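(* Let $M$ be a conformally flat manifold of dimension $n=p+q$ and $\lambda\in\mathbb{R}$. Let $\mathcal{Q}_{\lambda;\hbar}=\widetilde{\mathcal{Q}}_\lambda\circ\mathcal{I}_\hbar:\mathcal{S}\to\mathcal{D}_\lambda[i\hbar]$ be the conformally equivariant quantization map. The associative, conformally invariant operation $*_{\lambda;\hbar}:\mathcal{S}\otimes\mathcal{S}\to\mathcal{S}[[i\hbar]]$ defined by $$\mathcal{Q}_{\lambda;\hbar}(P*_{\lambda;\hbar}Q)=\mathcal{Q}_{\lambda;\hbar}(P)\circ\mathcal{Q}_{\lambda;\hbar}(Q)$$ is a star-product if and only if $\lambda=\tfrac12$.
   Context: Conformal algebra. Let $n=p+q$ and let $g=(g_{ij})$ be the constant flat metric of signature $(p,q)$ on $\mathbb{R}^n$, used to raise and lower indices ($x_i=g_{ij}x^j$); repeated indices are summed. $\mathfrak{so}(p+1,q+1)$ is realized as the Lie algebra of vector fields on $\mathbb{R}^n$ spanned by $X_i=\partial_i$, $X_{ij}=x_i\partial_j-x_j\partial_i$, $X_0=x^i\partial_i$, $\bar X_i=x_jx^j\partial_i-2x_ix^j\partial_j$. Manifold. $(M,\mathrm{g})$ is a smooth orientable conformally flat pseudo-Riemannian manifold of signature $(p,q)$. It carries an atlas of adapted charts in which $\mathrm{g}$ is conformal to the constant metric $g$ and whose coordinate changes are restrictions of conformal transformations given by elements of $SO(p+1,q+1)$; in each adapted chart, with coordinates $(x^1,\dots,x^n)$, $\mathfrak{so}(p+1,q+1)$ acts by the vector fields $X_i=\partial_i$,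 $X_{ij}=x_i\partial_j-x_j\partial_i$, $X_0=x^i\partial_i$, $\bar X_i=x_jx^j\partial_i-2x_ix^j\partial_j$. Modules. $\mathcal{F}_\lambda$ is the space of complex-valued smooth $\lambda$-densities with $L^\lambda_X(f)=X(f)+\lambda\,\mathrm{Div}(X)f$. $\mathcal{D}_\lambda$ is the space of linear differential operators $\mathcal{F}_\lambda\to\mathcal{F}_\lambda$ with action $\mathcal{L}^{\lambda,\lambda}_X(A)=L^\lambda_XA-AL^\lambda_X$. $\mathcal{S}$ is the space of smooth functions on $T^*M$ polynomial in the fibre coordinates $\xi_i$ (complex coefficients allowed), with the natural action $L_X$ given, for $X=X^i\xi_i$, by $L_X=\partial_{\xi_i}X\,\partial_i-\partial_iX\,\partial_{\xi_i}$; $\mathcal{S}^k$ is the subspace of degree $\le k$. The map $\widetilde{\mathcal{Q}}_\lambda:\mathcal{S}\to\mathcal{D}_\lambda$ is the unique isomorphism of $\mathfrak{so}(p+1,q+1)$-modules (i.e. globally defined, compatible with restriction to adapted chart domains, and intertwining the actions of $X_i,X_{ij},X_0,\bar X_i$ in each adapted chart) which preserves the principal symbol at each order; that is, $\widetilde{\mathcal{Q}}_\lambda=\mathrm{Id}+\mathcal{N}_\lambda$ with $\mathcal{N}_\lambda:\mathcal{S}^k\to\mathcal{S}^{k-1}$ under the normal-ordering identification $A^{i_1\dots i_k}\partial_{i_1}\cdots\partial_{i_k}\leftrightarrow A^{i_1\dots i_k}\xi_{i_1}\cdots\xi_{i_k}$ in adapted coordinates. (Its existence and uniqueness for every $\lambda$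 may be taken as given.) The map $\mathcal{I}_\hbar:\mathcal{S}\to\mathcal{S}[i\hbar]$ is $\mathcal{I}_\hbar(P)(\xi)=P(i\hbar\,\xi)$, with $\hbar$ a formal parameter; all maps are extended $\hbar$-linearly. Star-product. An associative operation $*_\hbar:\mathcal{S}\otimes\mathcal{S}\to\mathcal{S}[[i\hbar]]$ is called a star-product if $P*_\hbar Q=PQ+\frac{i\hbar}{2}\{P,Q\}+O(\hbar^2)$, where $\{P,Q\}=\partial_{\xi_j}P\,\partial_jQ-\partial_jP\,\partial_{\xi_j}Q$ is the Poisson bracket on $T^*M$, and it is given by bi-differential operators at each order in $\hbar$.
   Formalization: "Given by bi-differential operators at each order" is read degree by degree: the order is finite on symbols of degree at most k and l, but may grow with k, l; with one order for all degrees the product at λ=1/2 already fails for n=1. *)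

theory Defs
  imports "HOL-Analysis.Analysis"
begin

section \<open>Partial derivatives and smooth functions on open subsets of Euclidean space\<close>

definition pd :: "'n::finite \<Rightarrow> (real^'n \<Rightarrow> 'b::real_normed_vector) \<Rightarrow> real^'n \<Rightarrow> 'b" where
  "pd i u y = frechet_derivative u (at y) (axis i 1)"

text \<open>The list \<open>[i1, \<dots>, ik]\<close> stands for the iterated derivative in the directions
  \<open>i1, \<dots>, ik\<close>; the empty list gives the function itself.\<close>

definition pds :: "'n::finite list \<Rightarrow> (real^'n \<Rightarrow> 'b::real_normed_vector) \<Rightarrow> real^'n \<Rightarrow> 'b" where
  "pds I u = foldr pd I u"

text \<open>To be used for open sets only. Differentiability of all iterated partial derivatives
  entails their continuity.\<close>

definition smooth_on :: "(real^'n::finite) set \<Rightarrow> (real^'n \<Rightarrow> 'b::real_normed_vector) \<Rightarrow> bool" where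
  "smooth_on \<Omega> u \<longleftrightarrow> (\<forall>I. \<forall>y\<in>\<Omega>. pds I u differentiable (at y))"


section \<open>Signature, conformal vector fields and conformal transformations\<close>

definition flat_metric :: "nat \<Rightarrow> nat \<Rightarrow> real^'n^'n::finite \<Rightarrow> bool" where
  "flat_metric p q g \<longleftrightarrow>
     p + q = CARD('n) \<and>
     (\<forall>i j. i \<noteq> j \<longrightarrow> g $ i $ j = 0) \<and>
     card {i. g $ i $ i = 1} = p \<and> card {i. g $ i $ i = -1} = q"

text \<open>The lowered coordinates \<open>x\<^sub>i = g\<^sub>i\<^sub>j x\<^sup>j\<close> are \<^term>\<open>(g *v x) $ i\<close>. The generators are, in this order,
  \<open>\<partial>\<^sub>i\<close>, \<open>x\<^sub>i\<partial>\<^sub>j - x\<^sub>j\<partial>\<^sub>i\<close>, \<open>x\<^sup>i\<partial>\<^sub>i\<close> and \<open>x\<^sub>jx\<^sup>j\<partial>\<^sub>i - 2x\<^sub>ix\<^sup>j\<partial>\<^sub>j\<close>.\<close>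

definition conformal_generators :: "real^'n^'n::finite \<Rightarrow> (real^'n \<Rightarrow> real^'n) set" where
  "conformal_generators g =
     {(\<lambda>x. axis i 1) | i. True}
   \<union> {(\<lambda>x. (g *v x) $ i *\<^sub>R axis j 1 - (g *v x) $ j *\<^sub>R axis i 1) | i j. True}
   \<union> {(\<lambda>x. x)}
   \<union> {(\<lambda>x. ((g *v x) \<bullet> x) *\<^sub>R axis i 1 - (2 * (g *v x) $ i) *\<^sub>R x) | i. True}"

text \<open>\<open>\<real>\<^sup>n\<^sup>+\<^sup>2\<close> is indexed by \<^typ>\<open>'n + bool\<close>; the index \<open>Inr True\<close> carries the additional plus sign,
  \<open>Inr False\<close> the additional minus sign. \<open>\<real>\<^sup>n\<close> is embedded into the null cone, and \<open>SO(p+1,q+1)\<close> acts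
  (partially) on \<open>\<real>\<^sup>n\<close> by acting on null lines.\<close>

definition ambient_form :: "real^'n^'n::finite \<Rightarrow> real^('n + bool)^('n + bool)" where
  "ambient_form g = (\<chi> a b.
     case (a, b) of
       (Inl i, Inl j) \<Rightarrow> g $ i $ j
     | (Inr s, Inr t) \<Rightarrow> (if s = t then (if s then 1 else -1) else 0)
     | _ \<Rightarrow> 0)"

definition special_orthogonal :: "real^'n^'n::finite \<Rightarrow> (real^('n + bool)^('n + bool)) set" where
  "special_orthogonal g =
     {T. transpose T ** ambient_form g ** T = ambient_form g \<and> det T = 1}"

definition null_lift :: "real^'n^'n::finite \<Rightarrow> real^'n \<Rightarrow> real^('n + bool)" where
  "null_lift g x = (\<chi> a.
     case a of
       Inl i \<Rightarrow> x $ i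
     | Inr s \<Rightarrow> (if s then 1 - (g *v x) \<bullet> x else 1 + (g *v x) \<bullet> x) / 2)"

definition conformal_map_by ::
  "real^'n^'n::finite \<Rightarrow> real^('n + bool)^('n + bool) \<Rightarrow> real^'n \<Rightarrow> real^'n \<Rightarrow> bool" where
  "conformal_map_by g T x y \<longleftrightarrow> (\<exists>\<mu>. \<mu> \<noteq> 0 \<and> T *v null_lift g x = \<mu> *\<^sub>R null_lift g y)"


section \<open>Conformally flat manifolds\<close>

type_synonym ('m, 'n) chart = "'m set \<times> ('m \<Rightarrow> real^'n)"

text \<open>Coordinate domain of the part of a chart lying over \<open>W\<close>.\<close>

definition cdom :: "('m, 'n::finite) chart \<Rightarrow> 'm set \<Rightarrow> (real^'n) set" where
  "cdom c W = snd c ` (fst c \<inter> W)"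

definition transition :: "('m, 'n::finite) chart \<Rightarrow> ('m, 'n) chart \<Rightarrow> real^'n \<Rightarrow> real^'n" where
  "transition c c' = snd c' \<circ> inv_into (fst c) (snd c)"

definition jac :: "('m, 'n::finite) chart \<Rightarrow> ('m, 'n) chart \<Rightarrow> real^'n \<Rightarrow> real^'n^'n" where
  "jac c c' y = matrix (frechet_derivative (transition c c') (at y))"

text \<open>Restrictions of adapted charts to open subsets count as adapted charts.\<close>

definition conformal_atlas ::
  "real^'n^'n::finite \<Rightarrow> ('m::{t2_space, second_countable_topology}, 'n) chart set \<Rightarrow> bool" where
  "conformal_atlas g \<A> \<longleftrightarrow>
     (\<forall>(U, \<phi>)\<in>\<A>. open U \<and> open (\<phi> ` U) \<and> homeomorphism U (\<phi> ` U) \<phi> (inv_into U \<phi>)) \<and>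
     (\<Union>(U, \<phi>)\<in>\<A>. U) = UNIV \<and>
     (\<forall>(U, \<phi>)\<in>\<A>. \<forall>V. open V \<and> V \<subseteq> U \<longrightarrow> (V, \<phi>) \<in> \<A>) \<and>
     (\<forall>(U, \<phi>)\<in>\<A>. \<forall>(V, \<psi>)\<in>\<A>. \<exists>T\<in>special_orthogonal g.
        \<forall>x\<in>U \<inter> V. conformal_map_by g T (\<phi> x) (\<psi> x))"

text \<open>An orientation is given by recording, locally constantly, whether a chart preserves it.\<close>

definition orientable_atlas ::
  "('m::{t2_space, second_countable_topology}, 'n::finite) chart set \<Rightarrow> bool" where
  "orientable_atlas \<A> \<longleftrightarrow>
     (\<exists>\<sigma> :: ('m, 'n) chart \<Rightarrow> 'm \<Rightarrow> real.
        (\<forall>c\<in>\<A>. continuous_on (fst c) (\<sigma> c) \<and> \<sigma> c ` fst c \<subseteq> {-1, 1}) \<and>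
        (\<forall>c\<in>\<A>. \<forall>c'\<in>\<A>. \<forall>x\<in>fst c \<inter> fst c'.
           \<sigma> c x = sgn (det (jac c c' (snd c x))) * \<sigma> c' x))"

text \<open>The pseudo-Riemannian metric is given by its component matrices in the adapted charts.\<close>

definition conformally_flat_metric ::
  "real^'n^'n::finite \<Rightarrow> ('m, 'n) chart set \<Rightarrow> (('m, 'n) chart \<Rightarrow> real^'n \<Rightarrow> real^'n^'n) \<Rightarrow> bool" where
  "conformally_flat_metric g \<A> G \<longleftrightarrow>
     (\<forall>c\<in>\<A>. \<exists>F. smooth_on (cdom c UNIV) F \<and>
        (\<forall>y\<in>cdom c UNIV. F y > 0 \<and> G c y = F y *\<^sub>R g)) \<and>
     (\<forall>c\<in>\<A>. \<forall>c'\<in>\<A>. \<forall>x\<in>fst c \<inter> fst c'.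
        G c (snd c x) =
          transpose (jac c c' (snd c x)) ** G c' (snd c' x) ** jac c c' (snd c x))"

definition conformally_flat_manifold ::
  "nat \<Rightarrow> nat \<Rightarrow> real^'n^'n::finite
   \<Rightarrow> ('m::{t2_space, second_countable_topology}, 'n) chart set
   \<Rightarrow> (('m, 'n) chart \<Rightarrow> real^'n \<Rightarrow> real^'n^'n) \<Rightarrow> bool" where
  "conformally_flat_manifold p q g \<A> G \<longleftrightarrow>
     flat_metric p q g \<and> conformal_atlas g \<A> \<and> orientable_atlas \<A> \<and>
     conformally_flat_metric g \<A> G"


section \<open>Densities, symbols and differential operators\<close>

text \<open>Geometric objects over an open set \<open>W\<close> of the manifold are families of local expressions,
  one for each adapted chart \<open>c\<close> and defined on \<open>cdom c W\<close>, obeying the transformation law.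
  The value is 0 outside, so that equality of functions is equality of objects.\<close>

type_synonym ('m, 'n) density = "('m, 'n) chart \<Rightarrow> real^'n \<Rightarrow> complex"

definition densities :: "('m, 'n::finite) chart set \<Rightarrow> real \<Rightarrow> 'm set \<Rightarrow> ('m, 'n) density set" where
  "densities \<A> lam W = {f.
     (\<forall>c y. c \<notin> \<A> \<or> y \<notin> cdom c W \<longrightarrow> f c y = 0) \<and>
     (\<forall>c\<in>\<A>. smooth_on (cdom c W) (f c)) \<and>
     (\<forall>c\<in>\<A>. \<forall>c'\<in>\<A>. \<forall>x\<in>fst c \<inter> fst c' \<inter> W.
        f c (snd c x) =
          complex_of_real (\<bar>det (jac c c' (snd c x))\<bar> powr lam) * f c' (snd c' x))}"

text \<open>Local symbols are functions of the coordinates \<open>y\<close> and the fibre coordinates \<open>\<xi>\<close>.\<close>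

type_synonym 'n lsymbol = "real^'n \<Rightarrow> real^'n \<Rightarrow> complex"

definition monomial :: "'n::finite list \<Rightarrow> real^'n \<Rightarrow> complex" where
  "monomial I \<xi> = (\<Prod>i\<leftarrow>I. complex_of_real (\<xi> $ i))"

text \<open>In \<open>local_symbols L \<Omega>\<close> the finite set \<open>L\<close> restricts the admissible monomials.\<close>

definition local_symbols :: "'n::finite list set \<Rightarrow> (real^'n) set \<Rightarrow> 'n lsymbol set" where
  "local_symbols L \<Omega> = {p. \<exists>a. (\<forall>I. smooth_on \<Omega> (a I)) \<and>
     (\<forall>y\<in>\<Omega>. \<forall>\<xi>. p y \<xi> = (\<Sum>I\<in>L. a I y * monomial I \<xi>))}"

abbreviation deg_le :: "nat \<Rightarrow> 'n list set" where
  "deg_le k \<equiv> {I. length I \<le> k}"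

abbreviation deg_less :: "nat \<Rightarrow> 'n list set" where
  "deg_less k \<equiv> {I. length I < k}"

type_synonym ('m, 'n) symbol = "('m, 'n) chart \<Rightarrow> 'n lsymbol"

text \<open>Covectors transform by \<open>\<xi>\<^sub>i = \<xi>'\<^sub>j \<partial>y'\<^sup>j / \<partial>y\<^sup>i\<close>.\<close>

definition symbols_le ::
  "('m, 'n::finite) chart set \<Rightarrow> nat \<Rightarrow> 'm set \<Rightarrow> ('m, 'n) symbol set" where
  "symbols_le \<A> k W = {P.
     (\<forall>c y \<xi>. c \<notin> \<A> \<or> y \<notin> cdom c W \<longrightarrow> P c y \<xi> = 0) \<and>
     (\<forall>c\<in>\<A>. P c \<in> local_symbols (deg_le k) (cdom c W)) \<and>
     (\<forall>c\<in>\<A>. \<forall>c'\<in>\<A>. \<forall>x\<in>fst c \<inter> fst c' \<inter> W. \<forall>\<xi>.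
        P c (snd c x) (transpose (jac c c' (snd c x)) *v \<xi>) = P c' (snd c' x) \<xi>)}"

definition symbols :: "('m, 'n::finite) chart set \<Rightarrow> 'm set \<Rightarrow> ('m, 'n) symbol set" where
  "symbols \<A> W = (\<Union>k. symbols_le \<A> k W)"

text \<open>The symmetric coefficients \<open>A\<^sup>i\<^sup>1\<^sup>\<dots>\<^sup>i\<^sup>k\<close> of a fibrewise polynomial, as Taylor coefficients at
  \<open>\<xi> = 0\<close>.\<close>

definition fibre_coeff :: "'n::finite list \<Rightarrow> 'n lsymbol \<Rightarrow> real^'n \<Rightarrow> complex" where
  "fibre_coeff I p y = pds I (p y) 0 / fact (length I)"

definition hom_part :: "nat \<Rightarrow> 'n::finite lsymbol \<Rightarrow> 'n lsymbol" where
  "hom_part d p y \<xi> = (\<Sum>I | length I = d. fibre_coeff I p y * monomial I \<xi>)"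

text \<open>Normal ordering, for a symbol of degree at most \<open>k\<close>.\<close>

definition normal_order :: "nat \<Rightarrow> 'n::finite lsymbol \<Rightarrow> (real^'n \<Rightarrow> complex) \<Rightarrow> real^'n \<Rightarrow> complex" where
  "normal_order k p u y = (\<Sum>I\<in>deg_le k. fibre_coeff I p y * pds I u y)"

type_synonym ('m, 'n) oper = "('m, 'n) density \<Rightarrow> ('m, 'n) density"

text \<open>Operators are extended by 0 outside the space of densities.\<close>

definition diff_ops_le ::
  "('m, 'n::finite) chart set \<Rightarrow> real \<Rightarrow> nat \<Rightarrow> 'm set \<Rightarrow> ('m, 'n) oper set" where
  "diff_ops_le \<A> lam k W = {B.
     (\<forall>f. f \<notin> densities \<A> lam W \<longrightarrow> B f = (\<lambda>c y. 0)) \<and>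
     (\<forall>f\<in>densities \<A> lam W. B f \<in> densities \<A> lam W) \<and>
     (\<forall>c\<in>\<A>. \<exists>b\<in>local_symbols (deg_le k) (cdom c W). \<forall>f\<in>densities \<A> lam W.
        \<forall>y\<in>cdom c W. B f c y = normal_order k b (f c) y)}"

definition diff_ops :: "('m, 'n::finite) chart set \<Rightarrow> real \<Rightarrow> 'm set \<Rightarrow> ('m, 'n) oper set" where
  "diff_ops \<A> lam W = (\<Union>k. diff_ops_le \<A> lam k W)"

definition restrict_density ::
  "('m, 'n::finite) chart set \<Rightarrow> 'm set \<Rightarrow> ('m, 'n) density \<Rightarrow> ('m, 'n) density" where
  "restrict_density \<A> W f = (\<lambda>c y. if c \<in> \<A> \<and> y \<in> cdom c W then f c y else 0)"

definition restrict_symbol ::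
  "('m, 'n::finite) chart set \<Rightarrow> 'm set \<Rightarrow> ('m, 'n) symbol \<Rightarrow> ('m, 'n) symbol" where
  "restrict_symbol \<A> W P = (\<lambda>c y \<xi>. if c \<in> \<A> \<and> y \<in> cdom c W then P c y \<xi> else 0)"


section \<open>The action of the conformal algebra\<close>

definition lie_density ::
  "real \<Rightarrow> (real^'n::finite \<Rightarrow> real^'n) \<Rightarrow> (real^'n \<Rightarrow> complex) \<Rightarrow> real^'n \<Rightarrow> complex" where
  "lie_density lam X u y =
     (\<Sum>i\<in>UNIV. complex_of_real (X y $ i) * pd i u y) +
     complex_of_real (lam * (\<Sum>i\<in>UNIV. pd i X y $ i)) * u y"

definition lie_symbol :: "(real^'n::finite \<Rightarrow> real^'n) \<Rightarrow> 'n lsymbol \<Rightarrow> 'n lsymbol" where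
  "lie_symbol X p y \<xi> =
     (\<Sum>i\<in>UNIV. complex_of_real (X y $ i) * pd i (\<lambda>z. p z \<xi>) y) -
     (\<Sum>i\<in>UNIV. \<Sum>j\<in>UNIV. complex_of_real (pd i X y $ j * \<xi> $ j) * pd i (p y) \<xi>)"

text \<open>The unique density or symbol over the domain of the adapted chart \<open>c\<close> having the given
  expression in \<open>c\<close>.\<close>

definition density_from ::
  "('m, 'n::finite) chart set \<Rightarrow> real \<Rightarrow> ('m, 'n) chart \<Rightarrow> (real^'n \<Rightarrow> complex) \<Rightarrow> ('m, 'n) density" where
  "density_from \<A> lam c u = (\<lambda>c' z.
     if c' \<in> \<A> \<and> z \<in> cdom c' (fst c)
     then complex_of_real (\<bar>det (jac c' c z)\<bar> powr lam) * u (transition c' c z)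
     else 0)"

definition symbol_from ::
  "('m, 'n::finite) chart set \<Rightarrow> ('m, 'n) chart \<Rightarrow> 'n lsymbol \<Rightarrow> ('m, 'n) symbol" where
  "symbol_from \<A> c p = (\<lambda>c' z \<xi>.
     if c' \<in> \<A> \<and> z \<in> cdom c' (fst c)
     then p (transition c' c z) (transpose (jac c c' (transition c' c z)) *v \<xi>)
     else 0)"

text \<open>The vector field \<open>X\<close>, in the coordinates of \<open>c\<close>, acting on densities and symbols over the
  domain of \<open>c\<close>.\<close>

definition act_density ::
  "('m, 'n::finite) chart set \<Rightarrow> real \<Rightarrow> ('m, 'n) chart \<Rightarrow> (real^'n \<Rightarrow> real^'n)
   \<Rightarrow> ('m, 'n) density \<Rightarrow> ('m, 'n) density" where
  "act_density \<A> lam c X f = density_from \<A> lam c (lie_density lam X (f c))"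

definition act_symbol ::
  "('m, 'n::finite) chart set \<Rightarrow> ('m, 'n) chart \<Rightarrow> (real^'n \<Rightarrow> real^'n)
   \<Rightarrow> ('m, 'n) symbol \<Rightarrow> ('m, 'n) symbol" where
  "act_symbol \<A> c X P = symbol_from \<A> c (lie_symbol X (P c))"


section \<open>The conformally equivariant quantization map\<close>

text \<open>The map comes as a family indexed by \<^term>\<open>UNIV\<close> (the whole manifold) and by the domains of
  adapted charts.\<close>

definition adapted_domains :: "('m, 'n) chart set \<Rightarrow> 'm set set" where
  "adapted_domains \<A> = insert UNIV (fst ` \<A>)"

text \<open>\<open>conformal_quantization g \<A> lam Q\<close>: \<open>Q\<close> is an isomorphism of modules over the conformal algebra
  preserving the principal symbol. The third conjunct is \<open>Q = Id + N\<close> with \<open>N\<close> lowering the degree;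
  for \<open>k = 0\<close> it forces \<open>N = 0\<close>.\<close>

definition conformal_quantization ::
  "real^'n^'n::finite \<Rightarrow> ('m, 'n) chart set \<Rightarrow> real
   \<Rightarrow> ('m set \<Rightarrow> ('m, 'n) symbol \<Rightarrow> ('m, 'n) oper) \<Rightarrow> bool" where
  "conformal_quantization g \<A> lam Q \<longleftrightarrow>
     (\<forall>W\<in>adapted_domains \<A>. bij_betw (Q W) (symbols \<A> W) (diff_ops \<A> lam W)) \<and>
     (\<forall>W\<in>adapted_domains \<A>. \<forall>P\<in>symbols \<A> W. \<forall>R\<in>symbols \<A> W. \<forall>a b.
        \<forall>f\<in>densities \<A> lam W. \<forall>c y.
          Q W (\<lambda>c y \<xi>. a * P c y \<xi> + b * R c y \<xi>) f c y = a * Q W P f c y + b * Q W R f c y) \<and>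
     (\<forall>W\<in>adapted_domains \<A>. \<forall>k. \<forall>P\<in>symbols_le \<A> k W. \<forall>c\<in>\<A>.
        \<exists>N\<in>local_symbols (deg_less k) (cdom c W). \<forall>f\<in>densities \<A> lam W. \<forall>y\<in>cdom c W.
          Q W P f c y = normal_order k (\<lambda>y \<xi>. P c y \<xi> + N y \<xi>) (f c) y) \<and>
     (\<forall>W\<in>adapted_domains \<A>. \<forall>W'\<in>adapted_domains \<A>. W' \<subseteq> W \<longrightarrow>
        (\<forall>P\<in>symbols \<A> W. \<forall>f\<in>densities \<A> lam W.
          restrict_density \<A> W' (Q W P f) =
          Q W' (restrict_symbol \<A> W' P) (restrict_density \<A> W' f))) \<and>
     (\<forall>c\<in>\<A>. \<forall>X\<in>conformal_generators g. \<forall>P\<in>symbols \<A> (fst c).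
        \<forall>f\<in>densities \<A> lam (fst c). \<forall>c' y.
          Q (fst c) (act_symbol \<A> c X P) f c' y =
          act_density \<A> lam c X (Q (fst c) P f) c' y -
          Q (fst c) P (act_density \<A> lam c X f) c' y)"


section \<open>The formal parameter and the product of symbols\<close>

text \<open>A power series in \<open>\<hbar>\<close> is the sequence of its coefficients (of \<open>\<hbar>\<^sup>m\<close>, not of \<open>(i\<hbar>)\<^sup>m\<close>).\<close>

definition I_hbar :: "('m, 'n::finite) symbol \<Rightarrow> nat \<Rightarrow> ('m, 'n) symbol" where
  "I_hbar P m = (\<lambda>c y \<xi>. \<i> ^ m * hom_part m (P c) y \<xi>)"

definition quant_h ::
  "('m set \<Rightarrow> ('m, 'n::finite) symbol \<Rightarrow> ('m, 'n) oper) \<Rightarrow> 'm set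
   \<Rightarrow> ('m, 'n) symbol \<Rightarrow> nat \<Rightarrow> ('m, 'n) oper" where
  "quant_h Q W P m = Q W (I_hbar P m)"

text \<open>The \<open>\<hbar>\<close>-linear extension to power series of symbols.\<close>

definition quant_h_series ::
  "('m set \<Rightarrow> ('m, 'n::finite) symbol \<Rightarrow> ('m, 'n) oper) \<Rightarrow> 'm set
   \<Rightarrow> (nat \<Rightarrow> ('m, 'n) symbol) \<Rightarrow> nat \<Rightarrow> ('m, 'n) oper" where
  "quant_h_series Q W S m = (\<lambda>f c y. \<Sum>j\<le>m. quant_h Q W (S j) (m - j) f c y)"

definition quant_h_comp ::
  "('m set \<Rightarrow> ('m, 'n::finite) symbol \<Rightarrow> ('m, 'n) oper) \<Rightarrow> 'm set
   \<Rightarrow> ('m, 'n) symbol \<Rightarrow> ('m, 'n) symbol \<Rightarrow> nat \<Rightarrow> ('m, 'n) oper" where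
  "quant_h_comp Q W P R m =
     (\<lambda>f c y. \<Sum>j\<le>m. quant_h Q W P j (quant_h Q W R (m - j) f) c y)"

definition quant_product ::
  "('m, 'n::finite) chart set \<Rightarrow> real \<Rightarrow> ('m set \<Rightarrow> ('m, 'n) symbol \<Rightarrow> ('m, 'n) oper) \<Rightarrow> 'm set
   \<Rightarrow> ('m, 'n) symbol \<Rightarrow> ('m, 'n) symbol \<Rightarrow> nat \<Rightarrow> ('m, 'n) symbol" where
  "quant_product \<A> lam Q W P R = (THE S.
     (\<forall>m. S m \<in> symbols \<A> W) \<and>
     (\<forall>m. \<forall>f\<in>densities \<A> lam W. quant_h_series Q W S m f = quant_h_comp Q W P R m f))"

definition quantizes_product ::
  "('m, 'n::finite) chart set \<Rightarrow> real \<Rightarrow> ('m set \<Rightarrow> ('m, 'n) symbol \<Rightarrow> ('m, 'n) oper) \<Rightarrow> 'm set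
   \<Rightarrow> (('m, 'n) symbol \<Rightarrow> ('m, 'n) symbol \<Rightarrow> nat \<Rightarrow> ('m, 'n) symbol) \<Rightarrow> bool" where
  "quantizes_product \<A> lam Q W star \<longleftrightarrow>
     (\<forall>P\<in>symbols \<A> W. \<forall>R\<in>symbols \<A> W. \<forall>m.
        star P R m \<in> symbols \<A> W \<and>
        (\<forall>f\<in>densities \<A> lam W.
           quant_h_series Q W (star P R) m f = quant_h_comp Q W P R m f))"


section \<open>Star-products\<close>

type_synonym ('m, 'n) product_h = "('m, 'n) symbol \<Rightarrow> ('m, 'n) symbol \<Rightarrow> nat \<Rightarrow> ('m, 'n) symbol"

definition bilinear_product ::
  "('m, 'n::finite) chart set \<Rightarrow> 'm set \<Rightarrow> ('m, 'n) product_h \<Rightarrow> bool" where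
  "bilinear_product \<A> W star \<longleftrightarrow>
     (\<forall>P\<in>symbols \<A> W. \<forall>R\<in>symbols \<A> W. \<forall>m. star P R m \<in> symbols \<A> W) \<and>
     (\<forall>P\<in>symbols \<A> W. \<forall>R\<in>symbols \<A> W. \<forall>T\<in>symbols \<A> W. \<forall>a b m.
        star (\<lambda>c y \<xi>. a * P c y \<xi> + b * R c y \<xi>) T m =
          (\<lambda>c y \<xi>. a * star P T m c y \<xi> + b * star R T m c y \<xi>) \<and>
        star T (\<lambda>c y \<xi>. a * P c y \<xi> + b * R c y \<xi>) m =
          (\<lambda>c y \<xi>. a * star T P m c y \<xi> + b * star T R m c y \<xi>))"

definition associative_product ::
  "('m, 'n::finite) chart set \<Rightarrow> 'm set \<Rightarrow> ('m, 'n) product_h \<Rightarrow> bool" where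
  "associative_product \<A> W star \<longleftrightarrow>
     (\<forall>P\<in>symbols \<A> W. \<forall>R\<in>symbols \<A> W. \<forall>T\<in>symbols \<A> W. \<forall>m c y \<xi>.
        (\<Sum>j\<le>m. star (star P R j) T (m - j) c y \<xi>) =
        (\<Sum>j\<le>m. star P (star R T j) (m - j) c y \<xi>))"

definition poisson :: "'n::finite lsymbol \<Rightarrow> 'n lsymbol \<Rightarrow> 'n lsymbol" where
  "poisson p r y \<xi> = (\<Sum>j\<in>UNIV.
     pd j (p y) \<xi> * pd j (\<lambda>z. r z \<xi>) y - pd j (\<lambda>z. p z \<xi>) y * pd j (r y) \<xi>)"

text \<open>\<open>\<partial>\<^sub>y\<close> along \<open>I\<close> after \<open>\<partial>\<^sub>\<xi>\<close> along \<open>J\<close>.\<close>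

definition mixed :: "'n::finite list \<Rightarrow> 'n list \<Rightarrow> 'n lsymbol \<Rightarrow> 'n lsymbol" where
  "mixed I J p y \<xi> = pds I (\<lambda>z. pds J (p z) \<xi>) y"

text \<open>Bi-differential operators on symbols. As is usual for symbols (sections of the bundle of
  symmetric contravariant tensors, filtered by the degree), the order is required to be finite on
  arguments of bounded degree \<open>k\<close>, \<open>l\<close>; it may grow with \<open>k\<close> and \<open>l\<close>, since the coefficients of an
  operator on symbols may depend on the degree in a non-polynomial way. \<open>B\<close> is one coefficient of the
  product, a bilinear operation.\<close>

definition bidifferential ::
  "('m, 'n::finite) chart set \<Rightarrow> 'm set
   \<Rightarrow> (('m, 'n) symbol \<Rightarrow> ('m, 'n) symbol \<Rightarrow> ('m, 'n) symbol) \<Rightarrow> bool" where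
  "bidifferential \<A> W B \<longleftrightarrow>
     (\<forall>k l. \<exists>N. \<forall>c\<in>\<A>. \<exists>C.
        (\<forall>I J I' J'. \<exists>d. C I J I' J' \<in> local_symbols (deg_le d) (cdom c W)) \<and>
        (\<forall>P\<in>symbols_le \<A> k W. \<forall>R\<in>symbols_le \<A> l W. \<forall>y\<in>cdom c W. \<forall>\<xi>.
           B P R c y \<xi> =
             (\<Sum>I\<in>deg_le N. \<Sum>J\<in>deg_le N. \<Sum>I'\<in>deg_le N. \<Sum>J'\<in>deg_le N.
                C I J I' J' y \<xi> * mixed I J (P c) y \<xi> * mixed I' J' (R c) y \<xi>)))"

definition star_product ::
  "('m, 'n::finite) chart set \<Rightarrow> 'm set \<Rightarrow> ('m, 'n) product_h \<Rightarrow> bool" where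
  "star_product \<A> W star \<longleftrightarrow>
     bilinear_product \<A> W star \<and>
     associative_product \<A> W star \<and>
     (\<forall>P\<in>symbols \<A> W. \<forall>R\<in>symbols \<A> W. \<forall>c\<in>\<A>. \<forall>y\<in>cdom c W. \<forall>\<xi>.
        star P R 0 c y \<xi> = P c y \<xi> * R c y \<xi> \<and>
        star P R 1 c y \<xi> = \<i> / 2 * poisson (P c) (R c) y \<xi>) \<and>
     (\<forall>m. bidifferential \<A> W (\<lambda>P R. star P R m))"

text \<open>Since the conformal algebra acts on chart domains only, invariance of the product on the whole
  manifold means that it restricts to products on the domains of adapted charts for which the
  generators are derivations.\<close>

definition conformally_invariant ::
  "real^'n^'n::finite \<Rightarrow> ('m, 'n) chart set \<Rightarrow> ('m set \<Rightarrow> ('m, 'n) product_h) \<Rightarrow> bool" where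
  "conformally_invariant g \<A> star \<longleftrightarrow>
     (\<forall>c\<in>\<A>. \<forall>m.
        (\<forall>P\<in>symbols \<A> UNIV. \<forall>R\<in>symbols \<A> UNIV.
           restrict_symbol \<A> (fst c) (star UNIV P R m) =
           star (fst c) (restrict_symbol \<A> (fst c) P) (restrict_symbol \<A> (fst c) R) m) \<and>
        (\<forall>X\<in>conformal_generators g. \<forall>P\<in>symbols \<A> (fst c). \<forall>R\<in>symbols \<A> (fst c). \<forall>c' y \<xi>.
           act_symbol \<A> c X (star (fst c) P R m) c' y \<xi> =
           star (fst c) (act_symbol \<A> c X P) R m c' y \<xi> +
           star (fst c) P (act_symbol \<A> c X R) m c' y \<xi>))"

end

theory Submission
  imports Defs "HOL-Computational_Algebra.Polynomial"
begin

text \<open>The symbol of an operator is read off from its action on the functions \<open>exp \<langle>\<xi>, y\<rangle>\<close>. In a chart,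
  equivariance under the conformal fields centred at a point \<open>y0\<close> governs the degree \<open>l\<close> part at \<open>y0\<close> of
  the quantization of a homogeneous symbol \<open>p\<close> of degree \<open>k > l\<close>. The Euler field kills constant symbols, and
  since \<open>L - (k - l)\<close> (\<open>L\<close> the Euler operator) can be inverted on functions whose jet of order \<open>k - l\<close>
  vanishes at \<open>y0\<close>, the value at \<open>y0\<close> depends only on that jet; so the quantization is a differential operator
  on symbols. For \<open>l = k - 1\<close> it is a linear function of the first derivatives of \<open>p\<close>, which is determined by
  rotations and inversions: a Casimir argument leaves \<open>lam \<Sum> \<partial>\<^sub>\<xi>\<^sub>i \<partial>\<^sub>i\<close> when \<open>lam = 1/2\<close> or \<open>k = 1\<close>. Hence the
  first-order term of the product is \<open>\<i> ((1 - lam) \<partial>\<^sub>\<xi>P \<partial>R - lam \<partial>P \<partial>\<^sub>\<xi>R)\<close> in these cases: it is half the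
  Poisson bracket for \<open>lam = 1/2\<close>, and for no other \<open>lam\<close> when \<open>P\<close> has degree 1 and \<open>R\<close> degree 0.\<close>

text \<open>\<open>Q\<close> is only a linear bijection with compatibilities: there is no formula
  for it and no continuity, so even its locality must be extracted from the action of vector fields.
  The Euler field acts by \<open>-l\<close> on the degree \<open>l\<close> part of the quantization
  and by \<open>-k\<close> on constant symbols of degree \<open>k\<close>; the shift
  \<open>k - l\<close> bounds the derivatives that can enter. The inverse of \<open>Q\<close> is
  triangular in the degree and also loses finitely many derivatives, which is why the orders depend
  on the degrees of the arguments. The candidate \<open>lam * pd i\<close> satisfies the rotation
  equations for every \<open>lam\<close>, but misses the inversion equation by a multiple of
  \<open>(1 - 2 lam) (xi_m lap P - 2 (k - 1) g_mm pd m P)\<close>. This trace term vanishes in the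
  two cases treated; for other weights one product of degrees 1 and 0 refutes the bracket.
  Uniqueness of the candidate is algebraic and therefore independent of the signature: a difference
  of two solutions would give \<open>r2 o lap\<close> a negative eigenvalue on homogeneous
  polynomials, and it has none.\<close>

abbreviation (input) "LS \<equiv> local_symbols"
abbreviation (input) "cor \<equiv> complex_of_real"
abbreviation (input) "img c \<equiv> cdom c UNIV"

section \<open>Smooth functions\<close>

lemma pd_eqI: "(u has_derivative D) (at y) ==> pd i u y = D (axis i 1)"
 by (metis frechet_derivative_at pd_def)

lemma has_derivative_pd:
 fixes u :: "real^'n::finite => 'b::real_normed_vector"
 assumes "u differentiable (at y)"
 shows "(u has_derivative (%h. \<Sum>i\<in>UNIV. h $ i *\<^sub>R pd i u y)) (at y)"
proof -
 let ?D = "frechet_derivative u (at y)"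
 have D: "(u has_derivative ?D) (at y)" using assms by (simp add: frechet_derivative_works)
 then have lin: "linear ?D" by (rule has_derivative_linear)
 have "?D h = (\<Sum>i\<in>UNIV. h $ i *\<^sub>R pd i u y)" for h
 proof -
  have "h = (\<Sum>i\<in>UNIV. h $ i *\<^sub>R axis i 1)"
   by (simp add: vec_eq_iff axis_def if_distrib[of "%x. _ * x"] cong: if_cong)
  then have "?D h = ?D (\<Sum>i\<in>UNIV. h $ i *\<^sub>R axis i 1)" by simp
  also have "... = (\<Sum>i\<in>UNIV. h $ i *\<^sub>R pd i u y)"
   using lin by (simp add: linear_sum linear_scale pd_def)
  finally show ?thesis .
 qed
 then have "?D = (%h. \<Sum>i\<in>UNIV. h $ i *\<^sub>R pd i u y)" by blast
 with D show ?thesis by simp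
qed

lemma differentiable_cong_open:
 assumes "open S" "y \<in> S" "!!z. z \<in> S ==> u z = v z"
 shows "u differentiable (at y) \<longleftrightarrow> v differentiable (at y)"
 by (metis assms differentiable_def has_derivative_transform_within_open)

text \<open>Holds even where neither function is differentiable: \<open>frechet_derivative\<close>
  is a choice among all derivatives at \<open>y\<close>, and functions agreeing near
  \<open>y\<close> have the same derivatives there.\<close>

lemma pd_cong:
 assumes "open S" "y \<in> S" "!!z. z \<in> S ==> u z = v z"
 shows "pd i u y = pd i v y"
proof -
 have "(u has_derivative D) (at y) \<longleftrightarrow> (v has_derivative D) (at y)" for D
  by (metis assms has_derivative_transform_within_open)
 then show ?thesis unfolding pd_def frechet_derivative_def by simp
qed

lemma pd_const [simp]: "pd i (%_. c) y = 0"
 by (subst pd_eqI[OF has_derivative_const]) simp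

lemma pd_add:
 assumes "u differentiable (at y)" "v differentiable (at y)"
 shows "pd i (%z. u z + v z) y = pd i u y + pd i v y"
 using pd_eqI[OF has_derivative_add[OF assms[unfolded frechet_derivative_works]]] by (simp add: pd_def)

lemma pd_diff:
 assumes "u differentiable (at y)" "v differentiable (at y)"
 shows "pd i (%z. u z - v z) y = pd i u y - pd i v y"
 using pd_eqI[OF has_derivative_diff[OF assms[unfolded frechet_derivative_works]]] by (simp add: pd_def)

lemma pd_sum:
 assumes "!!a. a \<in> A ==> u a differentiable (at y)"
 shows "pd i (%z. \<Sum>a\<in>A. u a z) y = (\<Sum>a\<in>A. pd i (u a) y)"
 using pd_eqI[OF has_derivative_sum[of A u "%a. frechet_derivative (u a) (at y)" "at y"]] assms
 by (simp add: pd_def frechet_derivative_works)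

lemma pd_mult:
 fixes u v :: "real^'n::finite => 'b::real_normed_algebra"
 assumes "u differentiable (at y)" "v differentiable (at y)"
 shows "pd i (%z. u z * v z) y = pd i u y * v y + u y * pd i v y"
 using pd_eqI[OF has_derivative_mult[OF assms[unfolded frechet_derivative_works]]] by (simp add: pd_def)

lemma pd_bounded_linear:
 assumes "bounded_linear h" "u differentiable (at y)"
 shows "pd i (%z. h (u z)) y = h (pd i u y)"
 using pd_eqI[OF bounded_linear.has_derivative[OF assms(1) assms(2)[unfolded frechet_derivative_works]]]
 by (simp add: pd_def)

lemma pd_cmult:
 fixes u :: "real^'n::finite => 'b::real_normed_algebra"
 assumes "u differentiable (at y)"
 shows "pd i (%z. a * u z) y = a * pd i u y"
 by (rule pd_bounded_linear[OF bounded_linear_mult_right assms])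

lemma pd_coord [simp]: "pd i (%z. z $ j) y = (if i = j then 1 else 0)"
 using pd_eqI[OF bounded_linear.has_derivative[OF bounded_linear_vec_nth has_derivative_ident], of i j y]
 by (simp add: axis_def)

lemma pd_ident [simp]: "pd i (%z. z) y = axis i 1"
 by (subst pd_eqI[OF has_derivative_ident]) simp

lemma pd_vec_nth:
 assumes "u differentiable (at y)"
 shows "pd i u y $ j = pd i (%z. u z $ j) y"
 using pd_bounded_linear[OF bounded_linear_vec_nth assms] by simp

lemma pd_of_real:
 assumes "u differentiable (at y)"
 shows "pd i (%z. cor (u z)) y = cor (pd i u y)"
 by (rule pd_bounded_linear[OF bounded_linear_of_real assms])

lemma differentiable_mult':
 fixes u v :: "real^'n::finite => 'b::real_normed_algebra"
 shows "u differentiable (at y) ==> v differentiable (at y) ==> (%z. u z * v z) differentiable (at y)"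
 unfolding differentiable_def by (blast intro: has_derivative_mult)

lemma differentiable_bounded_linear:
 "bounded_linear h ==> u differentiable (at y) ==> (%z. h (u z)) differentiable (at y)"
 unfolding differentiable_def by (blast intro: bounded_linear.has_derivative)

lemma pds_Nil [simp]: "pds [] u = u" and pds_Cons: "pds (i # I) u = pd i (pds I u)"
 and pds_append: "pds (I @ J) u = pds I (pds J u)"
 by (simp_all add: pds_def)

lemma pds_cong:
 assumes "open S" "!!z. z \<in> S ==> u z = v z" "y \<in> S"
 shows "pds I u y = pds I v y"
 using assms(3)
proof (induction I arbitrary: y)
 case (Cons i I)
 then show ?case unfolding pds_Cons by (blast intro: pd_cong[OF assms(1)])
qed (simp add: assms)

lemma pds_const: "pds I (%_. c :: 'b::real_normed_vector) y = (if I = [] then c else 0)"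
proof (cases I rule: rev_cases)
 case (snoc J i)
 have *: "pds J (%_. 0 :: 'b) = (%_. 0)" by (induction J) (auto simp: pds_Cons)
 have "pd i (%_. c) = (%_. 0)" by auto
 then have "pds I (%_. c) = pds J (%_. 0)" using snoc by (simp add: pds_append pds_Cons)
 then show ?thesis using snoc * by simp
qed simp

text \<open>\<open>smooth_on\<close> speaks of all orders at once. Closure under products and
  composition needs an induction on the order, since a derivative of a product or composite is again
  built from such terms.\<close>

definition smooth_upto :: "nat => (real^'n::finite) set => (real^'n => 'b::real_normed_vector) => bool" where
 "smooth_upto k S u \<longleftrightarrow> (\<forall>I. length I <= k \<longrightarrow> (\<forall>y\<in>S. pds I u differentiable (at y)))"

lemma smooth_on_upto: "smooth_on S u \<longleftrightarrow> (\<forall>k. smooth_upto k S u)"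
 unfolding smooth_on_def smooth_upto_def by blast

lemma smooth_upto_0: "smooth_upto 0 S u \<longleftrightarrow> (\<forall>y\<in>S. u differentiable (at y))"
 by (auto simp: smooth_upto_def)

text \<open>The derivative split off is the one applied first, hence the last entry of the list;
  this explains the reverse case distinctions on \<open>I\<close>.\<close>

lemma smooth_upto_Suc:
 fixes u :: "real^'n::finite => 'b::real_normed_vector"
 shows "smooth_upto (Suc k) S u \<longleftrightarrow> (\<forall>y\<in>S. u differentiable (at y)) \<and> (\<forall>i. smooth_upto k S (pd i u))"
proof
 assume L: "smooth_upto (Suc k) S u"
 have "smooth_upto k S (pd i u)" for i
  unfolding smooth_upto_def
 proof (intro allI impI ballI)
  fix I :: "'n list" and y assume "length I <= k" "y \<in> S"
  with L[unfolded smooth_upto_def, rule_format, of "I @ [i]" y]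
  show "pds I (pd i u) differentiable (at y)" by (simp add: pds_append pds_Cons)
 qed
 with L[unfolded smooth_upto_def, rule_format, of "[]"]
 show "(\<forall>y\<in>S. u differentiable (at y)) \<and> (\<forall>i. smooth_upto k S (pd i u))" by simp
next
 assume R: "(\<forall>y\<in>S. u differentiable (at y)) \<and> (\<forall>i. smooth_upto k S (pd i u))"
 show "smooth_upto (Suc k) S u"
  unfolding smooth_upto_def
 proof (intro allI impI ballI)
  fix I :: "'n list" and y assume I: "length I <= Suc k" "y \<in> S"
  show "pds I u differentiable (at y)"
  proof (cases I rule: rev_cases)
   case (snoc J i)
   with R I show ?thesis by (simp add: pds_append pds_Cons smooth_upto_def)
  qed (use R I in simp)
 qed
qed

lemma smooth_on_unfold:
 "smooth_on S u \<longleftrightarrow> (\<forall>y\<in>S. u differentiable (at y)) \<and> (\<forall>i. smooth_on S (pd i u))"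
proof
 assume "smooth_on S u"
 then have "smooth_upto (Suc k) S u" for k by (simp add: smooth_on_upto)
 then show "(\<forall>y\<in>S. u differentiable (at y)) \<and> (\<forall>i. smooth_on S (pd i u))"
  by (simp add: smooth_on_upto smooth_upto_Suc)
next
 assume R: "(\<forall>y\<in>S. u differentiable (at y)) \<and> (\<forall>i. smooth_on S (pd i u))"
 have "smooth_upto k S u" for k
  by (cases k) (use R in \<open>simp_all add: smooth_on_upto smooth_upto_Suc smooth_upto_0\<close>)
 then show "smooth_on S u" by (simp add: smooth_on_upto)
qed

lemma smooth_on_differentiable: "smooth_on S u ==> y \<in> S ==> u differentiable (at y)"
 and smooth_on_pd: "smooth_on S u ==> smooth_on S (pd i u)"
 using smooth_on_unfold[of S u] by blast+

lemma smooth_on_pds: "smooth_on S u ==> smooth_on S (pds I u)"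
 by (induction I) (auto simp: pds_Cons intro: smooth_on_pd)

lemma smooth_on_subset: "smooth_on S u ==> T \<subseteq> S ==> smooth_on T u"
 unfolding smooth_on_def by blast

lemma smooth_upto_mono: "smooth_upto k S u ==> j <= k ==> smooth_upto j S u"
 unfolding smooth_upto_def by auto

lemma smooth_upto_cong:
 assumes "open S" "!!z. z \<in> S ==> u z = v z"
 shows "smooth_upto k S u \<longleftrightarrow> smooth_upto k S v"
proof -
 have "pds I u differentiable (at y) \<longleftrightarrow> pds I v differentiable (at y)" if "y \<in> S" for I y
  by (rule differentiable_cong_open[OF assms(1) that]) (rule pds_cong[OF assms(1) assms(2)])
 then show ?thesis by (simp add: smooth_upto_def)
qed

lemma smooth_on_cong:
 assumes "open S" "!!z. z \<in> S ==> u z = v z"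
 shows "smooth_on S u \<longleftrightarrow> smooth_on S v"
 unfolding smooth_on_upto using smooth_upto_cong[of S u v, OF assms] by simp

lemma smooth_on_local:
 assumes "!!y. y \<in> S ==> \<exists>T v. open T \<and> y \<in> T \<and> smooth_on T v \<and> (\<forall>z\<in>T. u z = v z)"
 shows "smooth_on S u"
 unfolding smooth_on_def
proof (intro allI ballI)
 fix I y assume "y \<in> S"
 from assms[OF this] obtain T v where T: "open T" "y \<in> T" "smooth_on T v" "\<forall>z\<in>T. u z = v z" by blast
 then have "smooth_on T u" using smooth_on_cong[of T u v] by simp
 with T(2) show "pds I u differentiable (at y)" unfolding smooth_on_def by blast
qed

lemma smooth_on_const [simp]: "smooth_on S (%_. c)"
proof -
 have "smooth_upto k S (%_. c)" for k
 proof (induction k arbitrary: c)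
  case (Suc k)
  have "pd i (%_. c) = (%_. 0)" for i :: 'a by auto
  with Suc show ?case by (simp add: smooth_upto_Suc)
 qed (simp add: smooth_upto_0)
 then show ?thesis by (simp add: smooth_on_upto)
qed

lemma smooth_upto_add:
 assumes "open S" "smooth_upto k S u" "smooth_upto k S v"
 shows "smooth_upto k S (%z. u z + v z)"
 using assms(2,3)
proof (induction k arbitrary: u v)
 case (Suc k)
 then have d: "\<forall>y\<in>S. u differentiable (at y) \<and> v differentiable (at y)" by (simp add: smooth_upto_Suc)
 have "smooth_upto k S (pd i (%z. u z + v z))" for i
  using smooth_upto_cong[OF assms(1), of "pd i (%z. u z + v z)" "%z. pd i u z + pd i v z" k]
   Suc d by (simp add: smooth_upto_Suc pd_add)
 with d show ?case by (auto simp: smooth_upto_Suc)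
qed (auto simp: smooth_upto_0)

lemma smooth_upto_linear:
 assumes "open S" "bounded_linear h" "smooth_upto k S u"
 shows "smooth_upto k S (%z. h (u z))"
 using assms(3)
proof (induction k arbitrary: u)
 case (Suc k)
 then have d: "\<forall>y\<in>S. u differentiable (at y)" by (simp add: smooth_upto_Suc)
 have "smooth_upto k S (pd i (%z. h (u z)))" for i
  using smooth_upto_cong[OF assms(1), of "pd i (%z. h (u z))" "%z. h (pd i u z)" k]
   Suc d by (simp add: smooth_upto_Suc pd_bounded_linear[OF assms(2)])
 with d show ?case by (auto simp: smooth_upto_Suc differentiable_bounded_linear[OF assms(2)])
qed (auto simp: smooth_upto_0 differentiable_bounded_linear[OF assms(2)])

lemma smooth_upto_mult:
 fixes u v :: "real^'n::finite => 'b::real_normed_algebra"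
 assumes "open S" "smooth_upto k S u" "smooth_upto k S v"
 shows "smooth_upto k S (%z. u z * v z)"
 using assms(2,3)
proof (induction k arbitrary: u v)
 case (Suc k)
 then have d: "\<forall>y\<in>S. u differentiable (at y) \<and> v differentiable (at y)" by (simp add: smooth_upto_Suc)
 have m: "smooth_upto k S u" "smooth_upto k S v" using Suc.prems smooth_upto_mono[of "Suc k" S _ k] by simp_all
 have "smooth_upto k S (%z. pd i u z * v z + u z * pd i v z)" for i
  using Suc m by (intro smooth_upto_add assms Suc.IH) (auto simp: smooth_upto_Suc)
 then have "smooth_upto k S (pd i (%z. u z * v z))" for i
  using smooth_upto_cong[OF assms(1), of "pd i (%z. u z * v z)" "%z. pd i u z * v z + u z * pd i v z" k] d
  by (simp add: pd_mult)
 with d show ?case by (auto simp: smooth_upto_Suc differentiable_mult')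
qed (auto simp: smooth_upto_0 differentiable_mult')

lemma smooth_on_add: "open S ==> smooth_on S u ==> smooth_on S v ==> smooth_on S (%z. u z + v z)"
 by (simp add: smooth_on_upto smooth_upto_add)

lemma smooth_on_linear:
 "open S ==> bounded_linear h ==> smooth_on S u ==> smooth_on S (%z. h (u z))"
 by (simp add: smooth_on_upto smooth_upto_linear)

lemma smooth_on_mult:
 fixes u v :: "real^'n::finite => 'b::real_normed_algebra"
 shows "open S ==> smooth_on S u ==> smooth_on S v ==> smooth_on S (%z. u z * v z)"
 by (simp add: smooth_on_upto smooth_upto_mult)

lemma smooth_on_cmult:
 fixes u :: "real^'n::finite => 'b::real_normed_algebra"
 shows "open S ==> smooth_on S u ==> smooth_on S (%z. a * u z)"
 by (rule smooth_on_linear[OF _ bounded_linear_mult_right])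

lemma smooth_on_of_real: "open S ==> smooth_on S u ==> smooth_on S (%z. cor (u z))"
 by (rule smooth_on_linear[OF _ bounded_linear_of_real])

lemma smooth_on_minus: "open S ==> smooth_on S u ==> smooth_on S (%z. - u z)"
 by (rule smooth_on_linear[OF _ bounded_linear_minus[OF bounded_linear_ident]])

lemma smooth_on_diff: "open S ==> smooth_on S u ==> smooth_on S v ==> smooth_on S (%z. u z - v z)"
 using smooth_on_add[of S u "%z. - v z"] smooth_on_minus[of S v] by simp

lemma smooth_on_sum:
 assumes "open S" "!!a. a \<in> A ==> smooth_on S (u a)"
 shows "smooth_on S (%z. \<Sum>a\<in>A. u a z)"
 using assms(2) by (induction A rule: infinite_finite_induct) (auto intro: smooth_on_add assms(1))

lemma smooth_on_prod:
 fixes u :: "'a => real^'n::finite => 'b::{comm_ring_1, real_normed_algebra_1}"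
 assumes "open S" "!!a. a \<in> A ==> smooth_on S (u a)"
 shows "smooth_on S (%z. \<Prod>a\<in>A. u a z)"
 using assms(2) by (induction A rule: infinite_finite_induct) (auto intro: smooth_on_mult assms(1))

lemma smooth_on_coord [simp]: "open S ==> smooth_on S (%z. z $ j)"
proof -
 have "pd i (%z. z $ j) = (%_. if i = j then 1 else 0)" for i by auto
 then show ?thesis by (subst smooth_on_unfold)
   (auto simp: bounded_linear_vec_nth[THEN bounded_linear_imp_differentiable])
qed

lemma pd_scaleR_fun:
 assumes "a differentiable (at y)" "b differentiable (at y)"
 shows "pd i (%y. a y *\<^sub>R b y) y = pd i a y *\<^sub>R b y + a y *\<^sub>R pd i b y"
  and "(%y. a y *\<^sub>R b y) differentiable (at y)"
 using pd_eqI[OF has_derivative_scaleR[OF assms[unfolded frechet_derivative_works]], of i]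
  has_derivative_scaleR[OF assms[unfolded frechet_derivative_works]]
 by (auto simp: differentiable_def pd_def)

lemma smooth_upto_scaleR:
 fixes u :: "real^'n::finite => real" and v :: "real^'n => 'b::real_normed_vector"
 assumes "open S" "smooth_upto k S u" "smooth_upto k S v"
 shows "smooth_upto k S (%z. u z *\<^sub>R v z)"
 using assms(2,3)
proof (induction k arbitrary: u v)
 case (Suc k)
 then have d: "\<forall>y\<in>S. u differentiable (at y) \<and> v differentiable (at y)" by (simp add: smooth_upto_Suc)
 have m: "smooth_upto k S u" "smooth_upto k S v" using Suc.prems smooth_upto_mono[of "Suc k" S _ k] by simp_all
 have "smooth_upto k S (%z. pd i u z *\<^sub>R v z + u z *\<^sub>R pd i v z)" for i
  using Suc m by (intro smooth_upto_add assms Suc.IH) (auto simp: smooth_upto_Suc)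
 then have "smooth_upto k S (pd i (%z. u z *\<^sub>R v z))" for i
  using smooth_upto_cong[OF assms(1), of "pd i (%z. u z *\<^sub>R v z)" "%z. pd i u z *\<^sub>R v z + u z *\<^sub>R pd i v z" k] d
  by (simp add: pd_scaleR_fun)
 with d show ?case by (auto simp: smooth_upto_Suc pd_scaleR_fun)
qed (auto simp: smooth_upto_0 pd_scaleR_fun)

lemma smooth_upto_sum:
 fixes u :: "'a => real^'n::finite => 'b::real_normed_vector"
 assumes "open S" "!!a. a \<in> A ==> smooth_upto k S (u a)"
 shows "smooth_upto k S (%z. \<Sum>a\<in>A. u a z)"
 using assms(2)
proof (induction A rule: infinite_finite_induct)
 case (insert a A)
 then show ?case by (simp add: smooth_upto_add[OF assms(1)])
qed (use smooth_on_const[of S "0::'b", unfolded smooth_on_upto] in simp_all)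

section \<open>The chain rule and smoothness of composites\<close>

lemma has_derivative_vec:
 fixes Phi :: "real^'n::finite => real^'m::finite"
 assumes "!!j. (%y. Phi y $ j) differentiable (at y)"
 shows "(Phi has_derivative (%h. \<chi> j. \<Sum>i\<in>UNIV. h $ i * pd i (%y. Phi y $ j) y)) (at y)"
proof -
 have "((%y. Phi y \<bullet> axis j 1) has_derivative
   (%h. (\<chi> j. \<Sum>i\<in>UNIV. h $ i * pd i (%y. Phi y $ j) y) \<bullet> axis j 1)) (at y)" for j
  using has_derivative_pd[OF assms] by (simp add: inner_axis)
 then show ?thesis
  by (subst has_derivative_componentwise_within) (auto simp: Basis_vec_def)
qed

lemma has_derivative_compose_pd:
 fixes v :: "real^'m::finite => 'b::real_normed_vector" and Phi :: "real^'n::finite => real^'m"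
 assumes "!!j. (%y. Phi y $ j) differentiable (at y)" "v differentiable (at (Phi y))"
 shows "((%y. v (Phi y)) has_derivative
   (%h. \<Sum>j\<in>UNIV. (\<Sum>i\<in>UNIV. h $ i * pd i (%y. Phi y $ j) y) *\<^sub>R pd j v (Phi y))) (at y)"
 using has_derivative_compose[OF has_derivative_vec[OF assms(1)] has_derivative_pd[OF assms(2)]] by simp

lemma pd_compose_at:
 fixes v :: "real^'m::finite => 'b::real_normed_vector" and Phi :: "real^'n::finite => real^'m"
 assumes "!!j. (%y. Phi y $ j) differentiable (at y)" "v differentiable (at (Phi y))"
 shows "pd i (%y. v (Phi y)) y = (\<Sum>j\<in>UNIV. pd i (%y. Phi y $ j) y *\<^sub>R pd j v (Phi y))"
proof -
 have "(\<Sum>l\<in>UNIV. axis i 1 $ l * pd l (%y. Phi y $ j) y) = pd i (%y. Phi y $ j) y" for j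
  by (subst sum.remove[of _ i]) (auto simp: axis_def)
 then show ?thesis by (subst pd_eqI[OF has_derivative_compose_pd[OF assms]]) simp_all
qed

text \<open>By the chain rule a derivative of the composite is a sum of smooth functions times
  composites of the functions \<open>pd j u\<close>, so the induction on the order has to range over
  all \<open>u\<close>.\<close>

lemma smooth_upto_compose:
 fixes u :: "real^'m::finite => 'b::real_normed_vector" and Phi :: "real^'n::finite => real^'m"
 assumes S: "open S" and T: "!!y. y \<in> S ==> Phi y \<in> T" and P: "!!j. smooth_on S (%y. Phi y $ j)"
  and u: "smooth_on T u"
 shows "smooth_upto k S (%y. u (Phi y))"
 using u
proof (induction k arbitrary: u)
 case 0
 show ?case unfolding smooth_upto_0
  using has_derivative_compose_pd[of Phi _ u] smooth_on_differentiable[OF P] smooth_on_differentiable[OF 0 T]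
  unfolding differentiable_def by blast
next
 case (Suc k)
 have d: "(%y. u (Phi y)) differentiable (at y)" if "y \<in> S" for y
  using has_derivative_compose_pd[of Phi y u] smooth_on_differentiable[OF P that] smooth_on_differentiable[OF Suc.prems T[OF that]]
  unfolding differentiable_def by blast
 have eq: "pd i (%y. u (Phi y)) y = (\<Sum>j\<in>UNIV. pd i (%y. Phi y $ j) y *\<^sub>R pd j u (Phi y))" if "y \<in> S" for i y
  by (rule pd_compose_at[OF smooth_on_differentiable[OF P that] smooth_on_differentiable[OF Suc.prems T[OF that]]])
 have "smooth_upto k S (%y. \<Sum>j\<in>UNIV. pd i (%y. Phi y $ j) y *\<^sub>R pd j u (Phi y))" for i
 proof (intro smooth_upto_sum smooth_upto_scaleR S)
  fix j
  show "smooth_upto k S (pd i (%y. Phi y $ j))" using smooth_on_pd[OF P] by (simp add: smooth_on_upto)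
  show "smooth_upto k S (%y. pd j u (Phi y))" by (rule Suc.IH) (rule smooth_on_pd[OF Suc.prems])
 qed
 then have "smooth_upto k S (pd i (%y. u (Phi y)))" for i
  using smooth_upto_cong[OF S, of "pd i (%y. u (Phi y))" "%y. \<Sum>j\<in>UNIV. pd i (%y. Phi y $ j) y *\<^sub>R pd j u (Phi y)" k] eq
  by simp
 with d show ?case by (simp add: smooth_upto_Suc)
qed

lemma smooth_on_compose:
 fixes u :: "real^'m::finite => 'b::real_normed_vector" and Phi :: "real^'n::finite => real^'m"
 assumes "open S" "!!y. y \<in> S ==> Phi y \<in> T" "!!j. smooth_on S (%y. Phi y $ j)" "smooth_on T u"
 shows "smooth_on S (%y. u (Phi y))"
 unfolding smooth_on_upto using smooth_upto_compose[of S Phi T u] assms by blast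

text \<open>The family \<open>F\<close> lists the successive derivatives of an outer function of one
  real variable; giving it explicitly replaces a notion of smoothness on the line. The induction
  treats all \<open>F k\<close> together.\<close>

lemma smooth_on_real_compose:
 fixes F :: "nat => real => real" and u :: "real^'n::finite => real"
 assumes S: "open S" and u: "smooth_on S u"
  and F: "!!k y. y \<in> S ==> (F k has_real_derivative F (Suc k) (u y)) (at (u y))"
 shows "smooth_on S (%y. F 0 (u y))"
proof -
 have du: "u differentiable (at y)" if "y \<in> S" for y using smooth_on_differentiable[OF u that] .
 have comp: "((%y. F k (u y)) has_derivative (%h. frechet_derivative u (at y) h * F (Suc k) (u y))) (at y)" if "y \<in> S" for y k
  using has_derivative_compose[OF du[OF that, unfolded frechet_derivative_works] F[OF that, unfolded has_field_derivative_def]]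
  by (simp add: mult.commute)
 have "smooth_upto m S (%y. F k (u y))" for m k
 proof (induction m arbitrary: k)
  case 0
  then show ?case using comp unfolding smooth_upto_0 differentiable_def by blast
 next
  case (Suc m)
  have eq: "pd i (%y. F k (u y)) y = pd i u y * F (Suc k) (u y)" if "y \<in> S" for i y
   using pd_eqI[OF comp[OF that]] by (simp add: pd_def)
  have "smooth_upto m S (pd i u)" for i using u smooth_on_pd smooth_on_upto by blast
  then have "smooth_upto m S (pd i (%y. F k (u y)))" for i
   using smooth_upto_cong[OF S, of "pd i (%y. F k (u y))" "%y. pd i u y * F (Suc k) (u y)" m] eq
    smooth_upto_mult[OF S _ Suc.IH] by simp
  moreover have "(%y. F k (u y)) differentiable (at y)" if "y \<in> S" for y
   using comp[OF that] unfolding differentiable_def by blast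
  ultimately show ?case by (simp add: smooth_upto_Suc)
 qed
 then show ?thesis by (simp add: smooth_on_upto)
qed

section \<open>Symmetry of second derivatives\<close>

lemma schwarz_aux:
 fixes f :: "real^'n::finite => real"
 assumes h: "h > 0" and cb: "!!s t. [|0 <= s; s <= h; 0 <= t; t <= h|] ==> y + s *\<^sub>R axis i 1 + t *\<^sub>R axis j 1 \<in> S"
  and S: "open S" "smooth_on S f"
 shows "\<exists>s t. 0 < s \<and> s < h \<and> 0 < t \<and> t < h \<and>
  f (y + h *\<^sub>R axis i 1 + h *\<^sub>R axis j 1) - f (y + h *\<^sub>R axis i 1) - f (y + h *\<^sub>R axis j 1) + f y
  = h * h * pd j (pd i f) (y + s *\<^sub>R axis i 1 + t *\<^sub>R axis j 1)"
proof -
 have D: "((%r. u (a + r *\<^sub>R axis l 1)) has_real_derivative pd l u (a + r *\<^sub>R axis l 1)) (at r)"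
  if "a + r *\<^sub>R axis l 1 \<in> S" "smooth_on S u" for u :: "real^'n => real" and a r l
 proof -
  have 1: "((%r. a + r *\<^sub>R axis l 1) has_derivative (%r. r *\<^sub>R axis l 1)) (at r)" by (auto intro!: derivative_eq_intros)
  have 2: "(u has_derivative frechet_derivative u (at (a + r *\<^sub>R axis l 1))) (at (a + r *\<^sub>R axis l 1))"
   using smooth_on_differentiable[OF that(2,1)] by (simp add: frechet_derivative_works)
  have "frechet_derivative u (at (a + r *\<^sub>R axis l 1)) (x *\<^sub>R axis l 1) = x * pd l u (a + r *\<^sub>R axis l 1)" for x
   using linear_scale[OF has_derivative_linear[OF 2]] by (simp add: pd_def)
  with has_derivative_compose[OF 1 2] show ?thesis
   by (simp add: has_field_derivative_def mult.commute[of _ "pd l u _"] fun_eq_iff)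
 qed
 \<comment> \<open>The second difference over a square of side \<open>h\<close> is an increment of
   \<open>?g\<close>. The mean value theorem in the direction \<open>i\<close>, and then in the
   direction \<open>j\<close>, turns it into a mixed derivative at an intermediate point.\<close>
 let ?g = "%s. f ((y + h *\<^sub>R axis j 1) + s *\<^sub>R axis i 1) - f (y + s *\<^sub>R axis i 1)"
 have "\<exists>s>0. s < h \<and> ?g h - ?g 0 = (h - 0) * (pd i f ((y + h *\<^sub>R axis j 1) + s *\<^sub>R axis i 1) - pd i f (y + s *\<^sub>R axis i 1))"
 proof (rule MVT2[OF h])
  fix s assume s: "0 <= s" "s <= h"
  have "y + h *\<^sub>R axis j 1 + s *\<^sub>R axis i 1 \<in> S" "y + s *\<^sub>R axis i 1 \<in> S"
   using cb[OF s, of h] cb[OF s, of 0] h by (auto simp: algebra_simps)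
  then show "(?g has_real_derivative (pd i f ((y + h *\<^sub>R axis j 1) + s *\<^sub>R axis i 1) - pd i f (y + s *\<^sub>R axis i 1))) (at s)"
   by (intro DERIV_diff D S)
 qed
 then obtain s where s: "0 < s" "s < h" and gs: "?g h - ?g 0 = h * (pd i f ((y + h *\<^sub>R axis j 1) + s *\<^sub>R axis i 1) - pd i f (y + s *\<^sub>R axis i 1))"
  by auto
 have "\<exists>t>0. t < h \<and> pd i f (y + s *\<^sub>R axis i 1 + h *\<^sub>R axis j 1) - pd i f (y + s *\<^sub>R axis i 1 + 0 *\<^sub>R axis j 1) =
  (h - 0) * pd j (pd i f) (y + s *\<^sub>R axis i 1 + t *\<^sub>R axis j 1)"
  using s by (intro MVT2[OF h]) (auto intro!: D cb smooth_on_pd[OF S(2)])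
 then obtain t where t: "0 < t" "t < h" "pd i f (y + s *\<^sub>R axis i 1 + h *\<^sub>R axis j 1) - pd i f (y + s *\<^sub>R axis i 1) =
  h * pd j (pd i f) (y + s *\<^sub>R axis i 1 + t *\<^sub>R axis j 1)" by auto
 have "y + h *\<^sub>R axis j 1 + s *\<^sub>R axis i 1 = y + s *\<^sub>R axis i 1 + h *\<^sub>R axis j 1" by (simp add: algebra_simps)
 with gs t(3) have "?g h - ?g 0 = h * h * pd j (pd i f) (y + s *\<^sub>R axis i 1 + t *\<^sub>R axis j 1)" by simp
 with s t show ?thesis by (intro exI[of _ s] exI[of _ t]) (simp add: algebra_simps)
qed

text \<open>The second difference does not depend on the order of the two directions, so mixed
  derivatives in both orders agree at points close to \<open>y\<close>; differentiability of the
  iterated derivatives makes them continuous, which would contradict a gap at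
  \<open>y\<close>.\<close>

lemma pd_commute_real:
 fixes f :: "real^'n::finite => real"
 assumes S: "open S" "smooth_on S f" and y: "y \<in> S"
 shows "pd i (pd j f) y = pd j (pd i f) y"
proof (rule ccontr)
 let ?a = "pd i (pd j f)" and ?b = "pd j (pd i f)"
 assume ne: "?a y \<noteq> ?b y"
 define e where "e = \<bar>?a y - ?b y\<bar> / 2"
 have e: "e > 0" using ne by (simp add: e_def)
 have "isCont ?a y" "isCont ?b y"
  by (auto intro!: differentiable_imp_continuous_within smooth_on_differentiable[OF _ y] smooth_on_pd S)
 then obtain d1 d2 where d: "d1 > 0" "!!z. dist z y < d1 ==> dist (?a z) (?a y) < e"
   "d2 > 0" "!!z. dist z y < d2 ==> dist (?b z) (?b y) < e"
  using e by (metis continuous_at_eps_delta)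
 obtain r where r: "r > 0" "ball y r \<subseteq> S" using S y openE by blast
 define h where "h = min (min d1 d2) r / 3"
 have h: "h > 0" "3 * h <= d1" "3 * h <= d2" "3 * h <= r" using d r by (auto simp: h_def)
 have near: "dist (y + s *\<^sub>R axis k 1 + t *\<^sub>R axis l 1) y < 3 * h" if "0 <= s" "s <= h" "0 <= t" "t <= h" for s t k l
 proof -
  have "norm (s *\<^sub>R axis k (1::real) + t *\<^sub>R axis l 1) <= norm (s *\<^sub>R axis k (1::real)) + norm (t *\<^sub>R axis l (1::real))"
   by (rule norm_triangle_ineq)
  also have "... <= 2 * h" using that by simp
  finally show ?thesis using h(1) by (simp add: dist_norm add.assoc)
 qed
 have inS: "y + s *\<^sub>R axis k 1 + t *\<^sub>R axis l 1 \<in> S" if "0 <= s" "s <= h" "0 <= t" "t <= h" for s t k l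
  using near[OF that, of k l] h(4) r(2) by (auto simp: mem_ball dist_commute subset_iff)
 obtain s t where st: "0 < s" "s < h" "0 < t" "t < h"
  "f (y + h *\<^sub>R axis i 1 + h *\<^sub>R axis j 1) - f (y + h *\<^sub>R axis i 1) - f (y + h *\<^sub>R axis j 1) + f y
  = h * h * ?b (y + s *\<^sub>R axis i 1 + t *\<^sub>R axis j 1)" using schwarz_aux[OF h(1) inS S] by blast
 obtain s' t' where st': "0 < s'" "s' < h" "0 < t'" "t' < h"
  "f (y + h *\<^sub>R axis j 1 + h *\<^sub>R axis i 1) - f (y + h *\<^sub>R axis j 1) - f (y + h *\<^sub>R axis i 1) + f y
  = h * h * ?a (y + s' *\<^sub>R axis j 1 + t' *\<^sub>R axis i 1)" using schwarz_aux[OF h(1) inS S] by blast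
 have "y + h *\<^sub>R axis j 1 + h *\<^sub>R axis i 1 = y + h *\<^sub>R axis i 1 + h *\<^sub>R axis j (1::real)" by simp
 then have "h * h * ?a (y + s' *\<^sub>R axis j 1 + t' *\<^sub>R axis i 1) = h * h * ?b (y + s *\<^sub>R axis i 1 + t *\<^sub>R axis j 1)"
  using st(5) st'(5) by (simp only:)
 then have eq: "?a (y + s' *\<^sub>R axis j 1 + t' *\<^sub>R axis i 1) = ?b (y + s *\<^sub>R axis i 1 + t *\<^sub>R axis j 1)"
  using h(1) by simp
 have "dist (?a (y + s' *\<^sub>R axis j 1 + t' *\<^sub>R axis i 1)) (?a y) < e"
  by (rule d(2)) (use near[of s' t' j i] st' h in linarith)
 moreover have "dist (?b (y + s *\<^sub>R axis i 1 + t *\<^sub>R axis j 1)) (?b y) < e"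
  by (rule d(4)) (use near[of s t i j] st h in linarith)
 ultimately show False using eq e by (auto simp: e_def dist_real_def abs_if field_simps split: if_splits)
qed

text \<open>The mean value theorem is real, so the claim is transferred to real and imaginary
  parts.\<close>

lemma pd_commute:
 fixes f :: "real^'n::finite => complex"
 assumes S: "open S" "smooth_on S f" and y: "y \<in> S"
 shows "pd i (pd j f) y = pd j (pd i f) y"
proof -
 have lin: "pd i (pd j (%z. h (f z))) y = h (pd i (pd j f) y)" if h: "bounded_linear h" for h :: "complex => real" and i j
 proof -
  have "pd i (pd j (%z. h (f z))) y = pd i (%z. h (pd j f z)) y"
   by (rule pd_cong[OF S(1) y]) (rule pd_bounded_linear[OF h smooth_on_differentiable[OF S(2)]])
  also have "... = h (pd i (pd j f) y)"
   by (rule pd_bounded_linear[OF h smooth_on_differentiable[OF smooth_on_pd[OF S(2)] y]])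
  finally show ?thesis .
 qed
 have "h (pd i (pd j f) y) = h (pd j (pd i f) y)" if h: "bounded_linear h" for h :: "complex => real"
  using pd_commute_real[OF S(1) smooth_on_linear[OF S(1) h S(2)] y, of i j] by (simp add: lin[OF h])
 from this[OF bounded_linear_Re] this[OF bounded_linear_Im] show ?thesis by (simp add: complex_eq_iff)
qed

lemma pds_perm:
 fixes f :: "real^'n::finite => complex"
 assumes S: "open S" "smooth_on S f" and IJ: "mset I = mset J" and y: "y \<in> S"
 shows "pds I f y = pds J f y"
 using IJ y
proof (induction I arbitrary: J y)
 case (Cons i I)
 \<comment> \<open>Any entry can be carried to the front by exchanging it with its left
   neighbours.\<close>
 have move: "pds (K @ i # L) f y = pds (i # K @ L) f y" if "y \<in> S" for K L y
  using that
 proof (induction K arbitrary: y)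
  case (Cons k K)
  have "pds ((k # K) @ i # L) f y = pd k (pds (i # K @ L) f) y"
   unfolding append_Cons pds_Cons[of k] by (rule pd_cong[OF S(1) Cons.prems]) (rule Cons.IH)
  also have "... = pd i (pd k (pds (K @ L) f)) y"
   unfolding pds_Cons by (rule pd_commute[OF S(1) smooth_on_pds[OF S(2)] Cons.prems])
  finally show ?case by (simp add: pds_Cons)
 qed simp
 have "i \<in> set J" using Cons.prems(1) by (metis list.set_intros(1) mset_eq_setD)
 then obtain K L where J: "J = K @ i # L" by (auto simp: in_set_conv_decomp)
 with Cons.prems(1) have m: "mset I = mset (K @ L)" by simp
 have "pds (i # I) f y = pds (i # K @ L) f y"
  unfolding pds_Cons by (rule pd_cong[OF S(1) Cons.prems(2)]) (rule Cons.IH[OF m])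
 with move[OF Cons.prems(2)] J show ?case by simp
qed simp

section \<open>Cut-off functions and the Euler equation\<close>

lemma poly_exp_tendsto_0: "((%t::real. poly p t * exp (- t)) \<longlongrightarrow> 0) at_top"
proof -
 have "((%t::real. \<Sum>i\<le>degree p. coeff p i * (t ^ i / exp t)) \<longlongrightarrow> (\<Sum>i\<le>degree p. coeff p i * 0)) at_top"
  by (intro tendsto_sum tendsto_mult tendsto_const tendsto_power_div_exp_0)
 then show ?thesis by (simp add: poly_altdef exp_minus field_simps sum_divide_distrib)
qed

text \<open>Differentiating \<open>p(1/x) exp(-1/x)\<close> gives
  \<open>(1/x)^2 (p - p')(1/x) exp(-1/x)\<close>; the factor \<open>[:0, 0, 1:]\<close> is the
  square of the variable \<open>1/x\<close>.\<close>

definition flat_poly :: "nat => real poly" where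
 "flat_poly k = ((%p. [:0, 0, 1:] * (p - pderiv p)) ^^ k) 1"

definition flat_fun :: "nat => real => real" where
 "flat_fun k x = (if x > 0 then poly (flat_poly k) (1 / x) * exp (- (1 / x)) else 0)"

lemma flat_fun_0: "flat_fun 0 x = (if x > 0 then exp (- (1 / x)) else 0)"
 by (simp add: flat_fun_def flat_poly_def)

lemma flat_fun_deriv: "(flat_fun k has_real_derivative flat_fun (Suc k) x) (at x)"
proof -
 consider "x > 0" | "x < 0" | "x = 0" by linarith
 then show ?thesis
 proof cases
  case 1
  have "((%x. poly (flat_poly k) (1 / x) * exp (- (1 / x))) has_real_derivative flat_fun (Suc k) x) (at x)"
   using 1 by (auto intro!: derivative_eq_intros DERIV_chain'[OF _ poly_DERIV]
     simp: flat_fun_def flat_poly_def field_simps power2_eq_square)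
  then show ?thesis
   by (rule has_field_derivative_transform_within_open[of _ _ _ "{0<..}"]) (use 1 in \<open>auto simp: flat_fun_def\<close>)
 next
  case 2
  have "((%_. 0) has_real_derivative 0) (at x)" by simp
  then have "(flat_fun k has_real_derivative 0) (at x)"
   by (rule has_field_derivative_transform_within_open[of _ _ _ "{..<0}"]) (use 2 in \<open>auto simp: flat_fun_def\<close>)
  then show ?thesis using 2 by (simp add: flat_fun_def)
 next
  case 3
  \<comment> \<open>\<open>pCons 0\<close> multiplies the polynomial by its variable
    \<open>1/x\<close>, so this is the right difference quotient of \<open>flat_fun k\<close> at
    0.\<close>
  have "((%x. poly (pCons 0 (flat_poly k)) (inverse x) * exp (- inverse x)) \<longlongrightarrow> 0) (at_right 0)"
   by (rule filterlim_compose[OF poly_exp_tendsto_0 filterlim_inverse_at_top_right])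
  moreover have "\<forall>\<^sub>F x in at_right 0. poly (pCons 0 (flat_poly k)) (inverse x) * exp (- inverse x) = flat_fun k x / x"
   unfolding eventually_at_right_field
   by (rule exI[of _ 1]) (auto simp: flat_fun_def field_simps)
  ultimately have r: "((%x. flat_fun k x / x) \<longlongrightarrow> 0) (at_right 0)"
   by (rule Lim_transform_eventually)
  have "((%_. 0) \<longlongrightarrow> (0::real)) (at_left 0)" by simp
  moreover have "\<forall>\<^sub>F x in at_left 0. 0 = flat_fun k x / x"
   unfolding eventually_at_left_field by (rule exI[of _ "-1"]) (auto simp: flat_fun_def)
  ultimately have l: "((%x. flat_fun k x / x) \<longlongrightarrow> 0) (at_left 0)"
   by (rule Lim_transform_eventually)
  have "((%x. flat_fun k x / x) \<longlongrightarrow> 0) (at 0)" using l r filterlim_split_at by blast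
  then show ?thesis using 3 by (simp add: has_field_derivative_iff flat_fun_def)
 qed
qed

lemma smooth_on_flat:
 "open S ==> smooth_on S u ==> smooth_on S (%y. flat_fun 0 (u y))"
 by (rule smooth_on_real_compose[of S u flat_fun]) (auto intro: flat_fun_deriv)

lemma smooth_on_inverse:
 fixes u :: "real^'n::finite => real"
 assumes S: "open S" "smooth_on S u" and nz: "!!y. y \<in> S ==> u y \<noteq> 0"
 shows "smooth_on S (%y. inverse (u y))"
proof -
 let ?F = "%k x::real. (-1) ^ k * fact k * inverse x ^ Suc k"
 have "(?F k has_real_derivative ?F (Suc k) (u y)) (at (u y))" if "y \<in> S" for k y
 proof -
  have "(inverse has_real_derivative - (inverse (u y) * 1 * inverse (u y))) (at (u y))"
   using DERIV_inverse[OF nz[OF that], of UNIV] by (simp add: power2_eq_square mult.assoc)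
  from DERIV_cmult[OF DERIV_power[OF this, of "Suc k"], of "(-1) ^ k * fact k"]
  show ?thesis by (simp add: algebra_simps)
 qed
 from smooth_on_real_compose[of S u ?F, OF S this] show ?thesis by simp
qed

lemma smooth_on_abs_powr:
 fixes u :: "real^'n::finite => real"
 assumes S: "open S" "smooth_on S u" and nz: "!!y. y \<in> S ==> u y \<noteq> 0"
 shows "smooth_on S (%y. \<bar>u y\<bar> powr a)"
proof -
 \<comment> \<open>The successive derivatives of \<open>|x|^a\<close> away from 0; each
   differentiation of \<open>|x|\<close> contributes a factor \<open>sgn x\<close>.\<close>
 let ?F = "%k x::real. (\<Prod>j<k. a - real j) * sgn x ^ k * \<bar>x\<bar> powr (a - real k)"
 have "(?F k has_real_derivative ?F (Suc k) x) (at x)" if "x \<noteq> 0" for k and x :: real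
 proof (cases "x > 0")
  case True
  have "((%x. (\<Prod>j<k. a - real j) * x powr (a - real k)) has_real_derivative ?F (Suc k) x) (at x)"
   using True by (auto intro!: derivative_eq_intros simp: algebra_simps)
  then show ?thesis
   by (rule has_field_derivative_transform_within_open[of _ _ _ "{0<..}"]) (use True in auto)
 next
  case False
  with that have neg: "x < 0" by simp
  have "((%x. (\<Prod>j<k. a - real j) * (-1) ^ k * (- x) powr (a - real k)) has_real_derivative ?F (Suc k) x) (at x)"
   using neg by (auto intro!: derivative_eq_intros simp: algebra_simps)
  then show ?thesis
   by (rule has_field_derivative_transform_within_open[of _ _ _ "{..<0}"]) (use neg in auto)
 qed
 from smooth_on_real_compose[of S u ?F, OF S this[OF nz]] show ?thesis by simp
qed

lemma smooth_on_exp: "open S ==> smooth_on S u ==> smooth_on S (%y. exp (u y) :: real)"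
 by (rule smooth_on_real_compose[of S u "%_. exp"]) auto

lemma smooth_on_inner: "open S ==> smooth_on S (%y. c \<bullet> (y - d))"
 unfolding inner_vec_def by (auto intro!: smooth_on_sum smooth_on_cmult smooth_on_diff)

lemma bump_exists:
 fixes y0 :: "real^'n::finite"
 assumes r: "r > 0"
 obtains \<beta> :: "real^'n => real" where "smooth_on UNIV \<beta>"
  "!!y. dist y y0 <= r / 2 ==> \<beta> y = 1" "!!y. dist y y0 \<ge> r ==> \<beta> y = 0"
proof -
 define s where "s y = (\<Sum>i\<in>UNIV. (y $ i - y0 $ i) * (y $ i - y0 $ i))" for y :: "real^'n"
 have s: "s y = (dist y y0)\<^sup>2" for y
  by (simp add: s_def dist_norm power2_norm_eq_inner inner_vec_def)
 have ss: "smooth_on UNIV s"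
  unfolding s_def by (intro smooth_on_sum smooth_on_mult smooth_on_diff) auto
 \<comment> \<open>\<open>a\<close> vanishes outside the ball of radius \<open>r\<close> and
   \<open>b\<close> inside the one of radius \<open>r / 2\<close>; at every point one of them is
   positive, so \<open>a / (a + b)\<close> is smooth and has the required values.\<close>
 define a b where "a y = flat_fun 0 (r\<^sup>2 - s y)" and "b y = flat_fun 0 (s y - r\<^sup>2 / 4)" for y
 have ab: "smooth_on UNIV a" "smooth_on UNIV b"
  unfolding a_def b_def by (intro smooth_on_flat smooth_on_diff ss open_UNIV smooth_on_const)+
 have nz: "a y + b y \<noteq> 0" for y
 proof -
  have "a y \<ge> 0" "b y \<ge> 0" by (auto simp: a_def b_def flat_fun_0)
  moreover have "r\<^sup>2 - s y > 0 \<or> s y - r\<^sup>2 / 4 > 0" using zero_less_power[OF r, of 2] by linarith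
  then have "a y > 0 \<or> b y > 0" by (auto simp: a_def b_def flat_fun_0)
  ultimately show ?thesis by linarith
 qed
 show ?thesis
 proof
  show "smooth_on UNIV (%y. a y * inverse (a y + b y))"
   by (intro smooth_on_mult smooth_on_inverse smooth_on_add ab open_UNIV nz)
  show "a y * inverse (a y + b y) = 1" if "dist y y0 <= r / 2" for y
  proof -
   have "s y <= (r / 2)\<^sup>2" unfolding s by (rule power_mono[OF that]) simp
   then have "b y = 0" by (simp add: b_def flat_fun_0 power_divide)
   with nz[of y] show ?thesis by simp
  qed
  show "a y * inverse (a y + b y) = 0" if "dist y y0 \<ge> r" for y
  proof -
   have "s y \<ge> r\<^sup>2" unfolding s by (rule power_mono[OF that]) (use r in simp)
   then show ?thesis by (simp add: a_def flat_fun_0)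
  qed
 qed
qed

section \<open>Radial averages, which invert the Euler operator centred at \<open>c\<close>\<close>

definition avg :: "real^'n::finite => nat => (real^'n => complex) => real^'n => complex" where
 "avg c s b x = integral (cbox 0 1) (%t::real. t ^ s *\<^sub>R b (c + t *\<^sub>R (x - c)))"

lemma segment_in_ball:
 fixes x c :: "'a::real_normed_vector"
 shows "x \<in> ball c r ==> t \<in> cbox 0 (1::real) ==> c + t *\<^sub>R (x - c) \<in> ball c r"
proof -
 assume x: "x \<in> ball c r" and t: "t \<in> cbox 0 1"
 have "dist c (c + t *\<^sub>R (x - c)) = \<bar>t\<bar> * norm (x - c)" by (simp add: dist_norm)
 also have "... <= 1 * norm (x - c)" using t by (intro mult_right_mono) auto
 finally show ?thesis using x by (simp add: dist_norm norm_minus_commute)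
qed

lemma smooth_on_continuous: "smooth_on S u ==> continuous_on S u"
 by (simp add: continuous_at_imp_continuous_on differentiable_imp_continuous_within smooth_on_differentiable)

lemma avg_has_derivative:
 fixes b :: "real^'n::finite => complex"
 assumes b: "smooth_on (ball c r) b" and x: "x \<in> ball c r"
 shows "(avg c s b has_derivative (%h. \<Sum>i\<in>UNIV. h $ i *\<^sub>R avg c (Suc s) (pd i b) x)) (at x)"
proof -
 \<comment> \<open>The derivative of the integrand, packed as a bounded linear map because the
   Leibniz rule for parameter integrals takes it in this form.\<close>
 define fx :: "real^'n => real => (real^'n) \<Rightarrow>\<^sub>L complex" where "fx x t = (\<Sum>i\<in>UNIV. blinfun_compose
   (blinfun_scaleR_left (t ^ Suc s *\<^sub>R pd i b (c + t *\<^sub>R (x - c)))) (blinfun_inner_left (axis i 1)))"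
  for x :: "real^'n" and t :: real
 have fx: "blinfun_apply (fx x t) h = (\<Sum>i\<in>UNIV. h $ i *\<^sub>R t ^ Suc s *\<^sub>R pd i b (c + t *\<^sub>R (x - c)))"
  for x h :: "real^'n" and t :: real
  by (simp add: fx_def blinfun.sum_left inner_axis inner_axis')
 have cont: "continuous_on (ball c r \<times> cbox 0 1) (%(x, t). u (c + t *\<^sub>R (x - c)))" if "smooth_on (ball c r) u"
  for u :: "real^'n => complex"
  unfolding case_prod_beta
 proof (rule continuous_on_compose2[OF smooth_on_continuous[OF that]])
  show "(%p. c + snd p *\<^sub>R (fst p - c)) ` (ball c r \<times> cbox 0 1) \<subseteq> ball c r"
   by (rule image_subsetI, rule segment_in_ball) (simp_all only: mem_Times_iff)
 qed (intro continuous_intros)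
 have int: "(%t. t ^ k *\<^sub>R u (c + t *\<^sub>R (x - c))) integrable_on cbox 0 1"
  if "smooth_on (ball c r) u" "x \<in> ball c r" for u :: "real^'n => complex" and x k
  by (intro integrable_continuous continuous_intros continuous_on_compose2[OF smooth_on_continuous[OF that(1)]])
    (use segment_in_ball[OF that(2)] in auto)
 have "((%x. integral (cbox 0 1) (%t::real. t ^ s *\<^sub>R b (c + t *\<^sub>R (x - c)))) has_derivative
   blinfun_apply (integral (cbox 0 1) (fx x))) (at x within ball c r)"
 proof (rule leibniz_rule)
  fix x :: "real^'n" and t :: real assume xt: "x \<in> ball c r" "t \<in> cbox 0 1"
  let ?p = "c + t *\<^sub>R (x - c)"
  have 1: "((%x. c + t *\<^sub>R (x - c)) has_derivative (%h. t *\<^sub>R h)) (at x)" by (auto intro!: derivative_eq_intros)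
  have 2: "(b has_derivative (%h. \<Sum>i\<in>UNIV. h $ i *\<^sub>R pd i b ?p)) (at ?p)"
   by (rule has_derivative_pd[OF smooth_on_differentiable[OF b segment_in_ball[OF xt]]])
  have "((%x. t ^ s *\<^sub>R b (c + t *\<^sub>R (x - c))) has_derivative
   (%h. t ^ s *\<^sub>R (\<Sum>i\<in>UNIV. (t *\<^sub>R h) $ i *\<^sub>R pd i b ?p))) (at x)"
   by (rule has_derivative_scaleR_right[OF has_derivative_compose[OF 1 2]])
  also have "(%h. t ^ s *\<^sub>R (\<Sum>i\<in>UNIV. (t *\<^sub>R h) $ i *\<^sub>R pd i b ?p)) = blinfun_apply (fx x t)"
   by (auto simp: fx scaleR_sum_right fun_eq_iff mult_ac intro!: sum.cong)
  finally show "((%x. t ^ s *\<^sub>R b (c + t *\<^sub>R (x - c))) has_derivative blinfun_apply (fx x t)) (at x within ball c r)"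
   by (rule has_derivative_at_withinI)
 next
  show "continuous_on (ball c r \<times> cbox 0 1) (%(x, t). fx x t)"
   unfolding fx_def case_prod_beta
   using cont[OF smooth_on_pd[OF b]] by (intro continuous_intros) (auto simp: case_prod_beta)
 qed (use x int[OF b] in auto)
 then have 3: "(avg c s b has_derivative blinfun_apply (integral (cbox 0 1) (fx x))) (at x)"
  using x by (simp add: avg_def[abs_def] at_within_open[of x "ball c r"])
 have "fx x integrable_on cbox 0 1"
  unfolding fx_def using x
  by (intro integrable_continuous continuous_intros continuous_on_compose2[OF smooth_on_continuous[OF smooth_on_pd[OF b]]])
    (use segment_in_ball[OF x] in auto)
 then have "blinfun_apply (integral (cbox 0 1) (fx x)) h = integral (cbox 0 1) (%t. blinfun_apply (fx x t) h)" for h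
  by (rule blinfun_apply_integral)
 moreover have "integral (cbox 0 1) (%t. blinfun_apply (fx x t) h) = (\<Sum>i\<in>UNIV. h $ i *\<^sub>R avg c (Suc s) (pd i b) x)" for h
  unfolding fx avg_def using int[OF smooth_on_pd[OF b] x]
  by (subst integral_sum) (auto intro!: integrable_cmul simp del: scaleR_scaleR power_Suc)
 ultimately have "blinfun_apply (integral (cbox 0 1) (fx x)) = (%h. \<Sum>i\<in>UNIV. h $ i *\<^sub>R avg c (Suc s) (pd i b) x)"
  by presburger
 with 3 show ?thesis by simp
qed

lemma pd_avg:
 assumes "smooth_on (ball c r) b" "x \<in> ball c r"
 shows "pd i (avg c s b) x = avg c (Suc s) (pd i b) x"
 using pd_eqI[OF avg_has_derivative[OF assms], of i s]
 by (simp add: axis_def if_distrib[of "%x. x *\<^sub>R _"] cong: if_cong)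

lemma smooth_on_avg:
 assumes "smooth_on (ball c r) b"
 shows "smooth_on (ball c r) (avg c s b)"
proof -
 have "smooth_upto k (ball c r) (avg c s b)" for k
  using assms
 proof (induction k arbitrary: b s)
  case 0
  then show ?case using avg_has_derivative[OF 0] unfolding smooth_upto_0 differentiable_def by blast
 next
  case (Suc k)
  have "smooth_upto k (ball c r) (pd i (avg c s b))" for i
   using smooth_upto_cong[of "ball c r" "pd i (avg c s b)" "avg c (Suc s) (pd i b)" k]
    pd_avg[OF Suc.prems] Suc.IH[OF smooth_on_pd[OF Suc.prems]] by simp
  then show ?case using avg_has_derivative[OF Suc.prems] unfolding smooth_upto_Suc differentiable_def by blast
 qed
 then show ?thesis by (simp add: smooth_on_upto)
qed

text \<open>Integrate the derivative of \<open>t^s b(c + t (x - c))\<close> over the unit interval.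
  By \<open>pd_avg\<close>, for \<open>s > 0\<close> this says that \<open>avg c (s - 1) b\<close>
  solves \<open>(E + s) u = b\<close> with \<open>E\<close> the Euler operator at \<open>c\<close>;
  for \<open>s = 0\<close> it is Hadamard's formula, as \<open>0 ^ 0 = 1\<close> produces the value
  at the centre.\<close>

lemma avg_euler:
 fixes b :: "real^'n::finite => complex"
 assumes b: "smooth_on (ball c r) b" and x: "x \<in> ball c r"
 shows "(\<Sum>i\<in>UNIV. (x - c) $ i *\<^sub>R avg c s (pd i b) x) + s *\<^sub>R avg c (s - 1) b x = b x - 0 ^ s * b c"
proof -
 let ?p = "%t. c + t *\<^sub>R (x - c)"
 let ?g = "%t. \<Sum>i\<in>UNIV. (x - c) $ i *\<^sub>R t ^ s *\<^sub>R pd i b (?p t)"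
 let ?h = "%t. s *\<^sub>R t ^ (s - 1) *\<^sub>R b (?p t)"
 have int: "(%t. t ^ k *\<^sub>R u (?p t)) integrable_on cbox 0 1"
  if "smooth_on (ball c r) u" for u :: "real^'n => complex" and k
  by (intro integrable_continuous continuous_intros continuous_on_compose2[OF smooth_on_continuous[OF that(1)]])
    (use segment_in_ball[OF x] in auto)
 have "((%t. t ^ s *\<^sub>R b (?p t)) has_vector_derivative ?g t + ?h t) (at t within {0..1})" if t: "t \<in> {0..1}" for t
 proof -
  have 1: "(?p has_derivative (%h. h *\<^sub>R (x - c))) (at t)" by (auto intro!: derivative_eq_intros)
  have 2: "(b has_derivative (%h. \<Sum>i\<in>UNIV. h $ i *\<^sub>R pd i b (?p t))) (at (?p t))"
   by (rule has_derivative_pd[OF smooth_on_differentiable[OF b segment_in_ball[OF x]]]) (use t in simp)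
  have 3: "((%t. b (?p t)) has_vector_derivative (\<Sum>i\<in>UNIV. (x - c) $ i *\<^sub>R pd i b (?p t))) (at t)"
   using has_derivative_compose[OF 1 2] by (simp add: has_vector_derivative_def scaleR_sum_right mult_ac)
  have 4: "((%t. t ^ s) has_field_derivative real s * t ^ (s - 1)) (at t)"
   by (auto intro!: derivative_eq_intros)
  have eq: "t ^ s *\<^sub>R (\<Sum>i\<in>UNIV. (x - c) $ i *\<^sub>R pd i b (?p t)) + (real s * t ^ (s - 1)) *\<^sub>R b (?p t) = ?g t + ?h t"
   by (simp add: scaleR_sum_right mult.commute)
  from has_vector_derivative_scaleR[OF 4 3] show ?thesis
   unfolding eq by (rule has_vector_derivative_at_within)
 qed
 then have "((%t. ?g t + ?h t) has_integral (1 ^ s *\<^sub>R b (?p 1) - 0 ^ s *\<^sub>R b (?p 0))) {0..1}"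
  by (intro fundamental_theorem_of_calculus) auto
 then have "integral {0..1} (%t. ?g t + ?h t) = b x - 0 ^ s * b c"
  by (auto dest!: integral_unique simp: scaleR_conv_of_real)
 moreover have "integral {0..1} (%t. ?g t + ?h t) = integral {0..1} ?g + integral {0..1} ?h"
  using int[OF smooth_on_pd[OF b]] int[OF b]
  by (intro integral_add integrable_sum integrable_cmul) auto
 moreover have "integral {0..1} ?g = (\<Sum>i\<in>UNIV. (x - c) $ i *\<^sub>R avg c s (pd i b) x)"
  unfolding avg_def using int[OF smooth_on_pd[OF b]]
  by (subst integral_sum) (auto intro!: integrable_cmul simp del: scaleR_scaleR)
 moreover have "integral {0..1} ?h = s *\<^sub>R avg c (s - 1) b x"
  unfolding avg_def by (simp del: scaleR_scaleR)
 ultimately show ?thesis by simp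
qed

text \<open>Averaging multiplies each Taylor coefficient at the centre by a nonzero number, so it
  preserves the vanishing of jets there.\<close>

lemma pds_avg_center:
 fixes b :: "real^'n::finite => complex"
 assumes b: "smooth_on (ball c r) b" and r: "r > 0"
 shows "pds I (avg c s b) c = pds I b c / of_nat (s + length I + 1)"
proof -
 have I: "pds I (avg c s b) x = avg c (s + length I) (pds I b) x" if "x \<in> ball c r" for I x
  using that
 proof (induction I arbitrary: x)
  case (Cons i I)
  have "pds (i # I) (avg c s b) x = pd i (avg c (s + length I) (pds I b)) x"
   unfolding pds_Cons by (rule pd_cong[OF open_ball Cons.prems]) (rule Cons.IH)
  also have "... = avg c (s + length (i # I)) (pds (i # I) b) x"
   using pd_avg[OF smooth_on_pds[OF b] Cons.prems] by (simp add: pds_Cons)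
  finally show ?case .
 qed simp
 have "avg c k u c = u c / of_nat (k + 1)" for k u
 proof -
  have "((%t::real. t ^ k) has_integral inverse (real (Suc k)) * 1 ^ Suc k - inverse (real (Suc k)) * 0 ^ Suc k) {0..1}"
  proof (rule fundamental_theorem_of_calculus)
   fix x :: real
   have "((%t. inverse (real (Suc k)) * t ^ Suc k) has_real_derivative inverse (real (Suc k)) * (real (Suc k) * (1 * x ^ k))) (at x within {0..1})"
    using DERIV_cmult[OF DERIV_power[OF DERIV_ident, of "Suc k"]] by simp
   then show "((%t. inverse (real (Suc k)) * t ^ Suc k) has_vector_derivative x ^ k) (at x within {0..1})"
    unfolding has_real_derivative_iff_has_vector_derivative by (simp add: field_simps del: of_nat_Suc power_Suc)
  qed simp
  then have "((%t::real. t ^ k *\<^sub>R u c) has_integral inverse (real (Suc k)) *\<^sub>R u c) {0..1}"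
   by (intro has_integral_scaleR_left) simp
  then show ?thesis by (auto simp: avg_def scaleR_conv_of_real field_simps dest!: integral_unique)
 qed
 with I[of c I] r show ?thesis by simp
qed

text \<open>For \<open>m = 0\<close> the operator is \<open>E + 1\<close>, inverted by
  \<open>avg c 0\<close>. For the step, \<open>a\<close> vanishes at \<open>c\<close>, so Hadamard's
  formula writes it as the sum of \<open>(x - c)_i a_i\<close> with
  \<open>a_i = avg c 0 (pd i a)\<close>, whose jets vanish to one order less. If \<open>h_i\<close>
  solves the equation for \<open>a_i\<close>, then \<open>(x - c)_i h_i\<close> solves the next one,
  because multiplication by a coordinate raises the degree for \<open>E\<close> by one.\<close>

lemma euler_solve:
 fixes a :: "real^'n::finite => complex"
 assumes a: "smooth_on (ball c r) a" and r: "r > 0"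
  and jet: "!!I. length I < m ==> pds I a c = 0"
 shows "\<exists>h. smooth_on (ball c r) h \<and>
  (\<forall>x\<in>ball c r. (\<Sum>i\<in>UNIV. (x - c) $ i *\<^sub>R pd i h x) - (of_nat m - 1) * h x = a x)"
 using a jet
proof (induction m arbitrary: a)
 case 0
 have "(\<Sum>i\<in>UNIV. (x - c) $ i *\<^sub>R pd i (avg c 0 a) x) - (of_nat 0 - 1) * avg c 0 a x = a x" if "x \<in> ball c r" for x
  using avg_euler[OF 0(1) that, of 1] pd_avg[OF 0(1) that, of _ 0] by simp
 with smooth_on_avg[OF 0(1)] show ?case by blast
next
 case (Suc m)
 let ?a = "%i. avg c 0 (pd i a)"
 have sm: "smooth_on (ball c r) (?a i)" for i by (rule smooth_on_avg[OF smooth_on_pd[OF Suc.prems(1)]])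
 have "pds I (?a i) c = 0" if "length I < m" for I i
  using pds_avg_center[OF smooth_on_pd[OF Suc.prems(1)] r, of I 0 i] Suc.prems(2)[of "I @ [i]"] that
  by (simp add: pds_append pds_Cons)
 have "\<exists>h. smooth_on (ball c r) h \<and>
  (\<forall>x\<in>ball c r. (\<Sum>j\<in>UNIV. (x - c) $ j *\<^sub>R pd j h x) - (of_nat m - 1) * h x = ?a i x)" for i
  by (rule Suc.IH[OF sm]) fact
 then obtain h where h': "\<forall>i. smooth_on (ball c r) (h i) \<and>
  (\<forall>x\<in>ball c r. (\<Sum>j\<in>UNIV. (x - c) $ j *\<^sub>R pd j (h i) x) - (of_nat m - 1) * h i x = ?a i x)"
  using choice[of "%i h. smooth_on (ball c r) h \<and>
  (\<forall>x\<in>ball c r. (\<Sum>j\<in>UNIV. (x - c) $ j *\<^sub>R pd j h x) - (of_nat m - 1) * h x = ?a i x)"] by blast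
 have h: "smooth_on (ball c r) (h i)" "x \<in> ball c r ==> (\<Sum>j\<in>UNIV. (x - c) $ j *\<^sub>R pd j (h i) x) - (of_nat m - 1) * h i x = ?a i x" for i x
  using h' by simp_all
 define H where "H x = (\<Sum>i\<in>UNIV. cor ((x - c) $ i) * h i x)" for x
 have co: "smooth_on (ball c r) (%x. cor ((x - c) $ i))" for i
  unfolding vector_minus_component by (intro smooth_on_of_real smooth_on_diff) auto
 have sH: "smooth_on (ball c r) H"
  unfolding H_def by (intro smooth_on_sum smooth_on_mult h co open_ball)
 have "(\<Sum>j\<in>UNIV. (x - c) $ j *\<^sub>R pd j H x) - (of_nat (Suc m) - 1) * H x = a x" if x: "x \<in> ball c r" for x
 proof -
  have d: "(%x. cor ((x - c) $ i)) differentiable (at x)" "h i differentiable (at x)" for i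
   using smooth_on_differentiable[OF co x] smooth_on_differentiable[OF h(1) x] by blast+
  have dd: "(%x. (x - c) $ i) differentiable (at x)" for i
   unfolding vector_minus_component by (intro derivative_intros bounded_linear_imp_differentiable bounded_linear_vec_nth)
  have pc: "pd j (%x. cor ((x - c) $ i)) x = (if j = i then 1 else 0)" for i j
   using pd_of_real[OF dd, of j i] pd_diff[of "%x. x $ i" x "%_. c $ i" j]
   by (simp add: bounded_linear_imp_differentiable bounded_linear_vec_nth)
  have pH: "pd j H x = (\<Sum>i\<in>UNIV. (if j = i then 1 else 0) * h i x + cor ((x - c) $ i) * pd j (h i) x)" for j
   unfolding H_def using d by (subst pd_sum) (auto simp: pd_mult pc intro!: differentiable_mult' simp del: vector_minus_component of_real_diff)
  have "(\<Sum>j\<in>UNIV. (x - c) $ j *\<^sub>R pd j H x) =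
   (\<Sum>j\<in>UNIV. (x - c) $ j *\<^sub>R h j x) + (\<Sum>j\<in>UNIV. \<Sum>i\<in>UNIV. (x - c) $ j *\<^sub>R (cor ((x - c) $ i) * pd j (h i) x))"
   unfolding pH by (simp add: sum.distrib scaleR_add_right scaleR_sum_right if_distrib[of "%x. x * _"] cong: if_cong)
  also have "(\<Sum>j\<in>UNIV. \<Sum>i\<in>UNIV. (x - c) $ j *\<^sub>R (cor ((x - c) $ i) * pd j (h i) x)) =
   (\<Sum>i\<in>UNIV. cor ((x - c) $ i) * (\<Sum>j\<in>UNIV. (x - c) $ j *\<^sub>R pd j (h i) x))"
   by (subst sum.swap) (simp add: sum_distrib_left)
  also have "... = (\<Sum>i\<in>UNIV. cor ((x - c) $ i) * (?a i x + (of_nat m - 1) * h i x))"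
  proof -
   have "(\<Sum>j\<in>UNIV. (x - c) $ j *\<^sub>R pd j (h i) x) = ?a i x + (of_nat m - 1) * h i x" for i
    using h(2)[OF x, of i] by (simp only: diff_eq_eq)
   then show ?thesis by (simp only:)
  qed
  also have "(\<Sum>j\<in>UNIV. (x - c) $ j *\<^sub>R h j x) + ... = (\<Sum>i\<in>UNIV. (x - c) $ i *\<^sub>R ?a i x) + of_nat m * H x"
   unfolding H_def sum_distrib_left sum.distrib[symmetric]
   by (rule sum.cong) (simp_all add: scaleR_conv_of_real algebra_simps)
  also have "(\<Sum>i\<in>UNIV. (x - c) $ i *\<^sub>R ?a i x) = a x"
   using avg_euler[OF Suc.prems(1) x, of 0] Suc.prems(2)[of "[]"] by simp
  finally show ?thesis by simp
 qed
 with sH show ?case by blast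
qed

section \<open>Local symbols\<close>

lemma pds_add:
 assumes S: "open S" and u: "smooth_on S u" "smooth_on S v" and y: "y \<in> S"
 shows "pds I (%z. u z + v z) y = pds I u y + pds I v y"
 using y
proof (induction I arbitrary: y)
 case (Cons i I)
 have "pds (i # I) (%z. u z + v z) y = pd i (%z. pds I u z + pds I v z) y"
  unfolding pds_Cons by (rule pd_cong[OF S Cons.prems]) (rule Cons.IH)
 also have "... = pds (i # I) u y + pds (i # I) v y"
  unfolding pds_Cons by (rule pd_add; rule smooth_on_differentiable[OF smooth_on_pds Cons.prems]; rule u)
 finally show ?case .
qed simp

lemma pds_linear:
 assumes S: "open S" and h: "bounded_linear h" and u: "smooth_on S u" and y: "y \<in> S"
 shows "pds I (%z. h (u z)) y = h (pds I u y)"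
 using y
proof (induction I arbitrary: y)
 case (Cons i I)
 have "pds (i # I) (%z. h (u z)) y = pd i (%z. h (pds I u z)) y"
  unfolding pds_Cons by (rule pd_cong[OF S Cons.prems]) (rule Cons.IH)
 also have "... = h (pds (i # I) u y)"
  unfolding pds_Cons by (rule pd_bounded_linear[OF h]; rule smooth_on_differentiable[OF smooth_on_pds Cons.prems]; rule u)
 finally show ?case .
qed simp

lemma pds_cmult:
 fixes u :: "real^'n::finite => complex"
 shows "open S ==> smooth_on S u ==> y \<in> S ==> pds I (%z. a * u z) y = a * pds I u y"
 by (rule pds_linear[OF _ bounded_linear_mult_right])

lemma pds_sum:
 assumes S: "open S" and u: "!!a. a \<in> A ==> smooth_on S (u a)" and y: "y \<in> S"
 shows "pds I (%z. \<Sum>a\<in>A. u a z) y = (\<Sum>a\<in>A. pds I (u a) y)"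
 using u
proof (induction A rule: infinite_finite_induct)
 case (insert a A)
 then show ?case using pds_add[OF S _ smooth_on_sum[OF S], of "u a" A u y I] y by simp
qed (auto simp: pds_const)

section \<open>Sums over lists of indices, and derivatives of monomials\<close>

lemma finite_length_eq [simp]: "finite {I :: 'n::finite list. length I = d}"
 and finite_length_le [simp]: "finite {I :: 'n::finite list. length I <= d}"
 using finite_lists_length_eq[of "UNIV :: 'n set" d] finite_lists_length_le[of "UNIV :: 'n set" d] by simp_all

lemma finite_length_less [simp]: "finite {I :: 'n::finite list. length I < d}"
 by (rule finite_subset[OF _ finite_length_le[of d]]) auto

lemma sum_length_Suc:
 "(\<Sum>I | length I = Suc d. F I) = (\<Sum>i\<in>UNIV. \<Sum>J | length J = d. F (J @ [i :: 'n::finite]))"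
proof -
 have "(\<Sum>I | length I = Suc d. F I) = (\<Sum>(i, J)\<in>UNIV \<times> {J. length J = d}. F (J @ [i]))"
  by (rule sum.reindex_bij_witness[where i="%(i, J). J @ [i]" and j="%I. (last I, butlast I)"])
   (auto simp: length_Suc_conv_rev)
 then show ?thesis by (simp add: sum.cartesian_product)
qed

lemma sum_deg_le:
 "(\<Sum>I\<in>deg_le k. F I) = (\<Sum>d\<le>k. \<Sum>I | length I = d. F (I :: 'n::finite list))"
proof -
 have "(\<Sum>I\<in>deg_le k. F I) = (\<Sum>d\<in>{..k}. \<Sum>I | I \<in> deg_le k \<and> length I = d. F I)"
  by (rule sum.group[symmetric]) auto
 also have "... = (\<Sum>d\<le>k. \<Sum>I | length I = d. F I)"
  by (intro sum.cong) auto
 finally show ?thesis .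
qed

lemma monomial_Nil [simp]: "monomial [] xi = 1"
 and monomial_Cons: "monomial (i # I) xi = cor (xi $ i) * monomial I xi"
 and monomial_append: "monomial (I @ J) xi = monomial I xi * monomial J xi"
 by (simp_all add: monomial_def)

lemma monomial_zero: "monomial I 0 = (if I = [] then 1 else 0)"
 by (cases I) (simp_all add: monomial_Cons)

lemma smooth_on_ccoord [simp]: "open S ==> smooth_on S (%z. cor (z $ i))"
 by (intro smooth_on_of_real) auto

lemma smooth_on_monomial [simp]: "open S ==> smooth_on S (monomial I)"
proof (induction I)
 case (Cons i I)
 have "monomial (i # I) = (%xi. cor (xi $ i) * monomial I xi)" by (auto simp: monomial_Cons)
 with Cons show ?case by (simp add: smooth_on_mult)
qed (simp add: monomial_def[abs_def])

lemmas monomial_differentiable [simp] = smooth_on_differentiable[OF smooth_on_monomial[OF open_UNIV] UNIV_I]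

lemma pd_ccoord [simp]: "pd i (%z. cor (z $ j)) y = (if i = j then 1 else 0)"
 using pd_of_real[of "%z. z $ j" y i] by (simp add: bounded_linear_imp_differentiable bounded_linear_vec_nth)

lemmas ccoord_differentiable [simp] = smooth_on_differentiable[OF smooth_on_ccoord[OF open_UNIV] UNIV_I]

lemma pd_monomial_Cons:
 "pd i (monomial (j # I)) xi = (if i = j then monomial I xi else 0) + cor (xi $ j) * pd i (monomial I) xi"
proof -
 have "monomial (j # I) = (%xi. cor (xi $ j) * monomial I xi)" by (auto simp: monomial_Cons)
 then show ?thesis by (simp add: pd_mult)
qed

definition del_nth :: "nat => 'a list => 'a list" where
 "del_nth t I = take t I @ drop (Suc t) I"

lemma length_del_nth: "t < length I ==> Suc (length (del_nth t I)) = length I"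
 by (simp add: del_nth_def)

lemma pd_monomial:
 "pd i (monomial I) xi = (\<Sum>t<length I. if I ! t = i then monomial (del_nth t I) xi else 0)"
proof (induction I)
 case (Cons j I)
 then show ?case
  unfolding length_Cons
  by (subst sum.lessThan_Suc_shift)
   (auto simp: pd_monomial_Cons del_nth_def monomial_Cons sum_distrib_left intro!: sum.cong)
qed (simp add: monomial_def)

text \<open>Each of the \<open>d!\<close> orders in which the factors of \<open>monomial I\<close>
  can be differentiated away contributes \<open>F I\<close>. This justifies the factorial in
  \<open>fibre_coeff\<close>: summing over all lists counts every ordering.\<close>

lemma pds_monomial_sum:
 fixes F :: "'n::finite list => complex"
 assumes "!!I J. mset I = mset J ==> F I = F J"
 shows "(\<Sum>J | length J = d. pds J (monomial I) 0 * F J) = (if length I = d then fact d * F I else 0)"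
 using assms
proof (induction d arbitrary: I F)
 case 0
 have "{J :: 'n list. length J = 0} = {[]}" by auto
 then show ?case by (simp add: monomial_zero)
next
 case (Suc d)
 have sm: "smooth_on UNIV (%z. if P then monomial J z else 0)" for P and J :: "'n list"
  by (cases P) auto
 have eq: "pds (J @ [i]) (monomial I) 0 = (\<Sum>t<length I. if I ! t = i then pds J (monomial (del_nth t I)) 0 else 0)" for i J
 proof -
  have "pds (J @ [i]) (monomial I) 0 = pds J (%xi. \<Sum>t<length I. if I ! t = i then monomial (del_nth t I) xi else 0) 0"
   by (simp add: pds_append pds_Cons pd_monomial[abs_def])
  also have "... = (\<Sum>t<length I. pds J (%xi. if I ! t = i then monomial (del_nth t I) xi else 0) 0)"
   by (rule pds_sum[OF open_UNIV sm]) simp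
  also have "... = (\<Sum>t<length I. if I ! t = i then pds J (monomial (del_nth t I)) 0 else 0)"
   by (intro sum.cong) (auto simp: pds_const)
  finally show ?thesis .
 qed
 have "(\<Sum>J | length J = Suc d. pds J (monomial I) 0 * F J) =
  (\<Sum>i\<in>UNIV. \<Sum>J | length J = d. \<Sum>t<length I. if I ! t = i then pds J (monomial (del_nth t I)) 0 * F (J @ [i]) else 0)"
  unfolding sum_length_Suc eq sum_distrib_right by (intro sum.cong) auto
 also have "... = (\<Sum>t<length I. \<Sum>J | length J = d. \<Sum>i\<in>UNIV. if I ! t = i then pds J (monomial (del_nth t I)) 0 * F (J @ [i]) else 0)"
  by (subst sum.swap, subst (2) sum.swap, rule sum.cong[OF refl], subst sum.swap) simp_all
 also have "... = (\<Sum>t<length I. \<Sum>J | length J = d. pds J (monomial (del_nth t I)) 0 * F (J @ [I ! t]))"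
  by simp
 also have "... = (\<Sum>t<length I. if length (del_nth t I) = d then fact d * F (del_nth t I @ [I ! t]) else 0)"
  by (intro sum.cong refl Suc.IH Suc.prems) simp
 also have "... = (\<Sum>t<length I. if length I = Suc d then fact d * F I else 0)"
 proof (intro sum.cong refl)
  fix t assume t: "t \<in> {..<length I}"
  have "I = take t I @ I ! t # drop (Suc t) I" using t by (simp add: id_take_nth_drop)
  then have "mset I = mset (take t I @ I ! t # drop (Suc t) I)" by (rule arg_cong)
  moreover have "mset (take t I @ I ! t # drop (Suc t) I) = mset (del_nth t I @ [I ! t])" by (simp add: del_nth_def)
  ultimately have "mset (del_nth t I @ [I ! t]) = mset I" by (simp only:)
  then have "F (del_nth t I @ [I ! t]) = F I" by (rule Suc.prems)
  moreover have "length (del_nth t I) = d \<longleftrightarrow> length I = Suc d" using t length_del_nth[of t I] by auto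
  ultimately show "(if length (del_nth t I) = d then fact d * F (del_nth t I @ [I ! t]) else 0) =
   (if length I = Suc d then fact d * F I else 0)" by simp
 qed
 also have "... = (if length I = Suc d then fact (Suc d) * F I else 0)"
  by (simp add: algebra_simps)
 finally show ?case .
qed

lemma mset_monomial: "mset I = mset J ==> monomial I xi = monomial J xi"
 unfolding monomial_def prod_mset_prod_list[symmetric] mset_map by simp

section \<open>Closure properties of local symbols\<close>

abbreviation deg_eq :: "nat => 'n list set" where "deg_eq d \<equiv> {I. length I = d}"

lemma local_symbolsE:
 assumes "p \<in> LS L Om"
 obtains a where "!!I. smooth_on Om (a I)" "!!y xi. y \<in> Om ==> p y xi = (\<Sum>I\<in>L. a I y * monomial I xi)"
 using assms unfolding local_symbols_def by blast

lemma local_symbolsI: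
 assumes "!!I. smooth_on Om (a I)" "!!y xi. y \<in> Om ==> p y xi = (\<Sum>I\<in>L. a I y * monomial I xi)"
 shows "p \<in> LS L Om"
 using assms unfolding local_symbols_def by blast

lemma LS_cong:
 assumes "!!y xi. y \<in> Om ==> p y xi = r y xi"
 shows "p \<in> LS L Om \<longleftrightarrow> r \<in> LS L Om"
 using assms unfolding local_symbols_def by simp

lemma LS_restrict:
 "p \<in> LS L Om ==> Om' \<subseteq> Om ==> p \<in> LS L Om'"
 unfolding local_symbols_def using smooth_on_subset[of Om _ Om'] by blast

lemma LS_zero [simp]: "(%_ _. 0) \<in> LS L Om"
 by (rule local_symbolsI[of _ "%_ _. 0"]) auto

lemma LS_add:
 assumes "open Om" "p \<in> LS L Om" "r \<in> LS L Om"
 shows "(%y xi. p y xi + r y xi) \<in> LS L Om"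
proof -
 obtain a where "!!I. smooth_on Om (a I)" "!!y xi. y \<in> Om ==> p y xi = (\<Sum>I\<in>L. a I y * monomial I xi)"
  using local_symbolsE[OF assms(2)] by blast
 moreover obtain b where "!!I. smooth_on Om (b I)" "!!y xi. y \<in> Om ==> r y xi = (\<Sum>I\<in>L. b I y * monomial I xi)"
  using local_symbolsE[OF assms(3)] by blast
 ultimately show ?thesis using assms(1)
  by (intro local_symbolsI[of _ "%I y. a I y + b I y"]) (auto simp: smooth_on_add sum.distrib algebra_simps)
qed

lemma LS_scale:
 assumes "open Om" "smooth_on Om c" "p \<in> LS L Om"
 shows "(%y xi. c y * p y xi) \<in> LS L Om"
proof -
 obtain a where "!!I. smooth_on Om (a I)" "!!y xi. y \<in> Om ==> p y xi = (\<Sum>I\<in>L. a I y * monomial I xi)"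
  using local_symbolsE[OF assms(3)] by blast
 then show ?thesis using assms(1,2)
  by (intro local_symbolsI[of _ "%I y. c y * a I y"]) (auto simp: smooth_on_mult sum_distrib_left algebra_simps)
qed

lemma LS_cscale:
 "open Om ==> p \<in> LS L Om ==> (%y xi. c * p y xi) \<in> LS L Om"
 by (rule LS_scale) auto

lemma LS_minus:
 "open Om ==> p \<in> LS L Om ==> (%y xi. - p y xi) \<in> LS L Om"
 using LS_cscale[of Om p L "-1"] by simp

lemma LS_diff:
 "open Om ==> p \<in> LS L Om ==> r \<in> LS L Om ==> (%y xi. p y xi - r y xi) \<in> LS L Om"
 using LS_add[of Om p L "%y xi. - r y xi"] LS_minus[of Om r L] by simp

lemma LS_sum:
 assumes "open Om" "!!s. s \<in> T ==> p s \<in> LS L Om"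
 shows "(%y xi. \<Sum>s\<in>T. p s y xi) \<in> LS L Om"
 using assms(2) by (induction T rule: infinite_finite_induct) (auto intro: LS_add[OF assms(1)])

lemma LS_monomial:
 assumes "finite L" "I \<in> L"
 shows "(%_. monomial I) \<in> LS L Om"
proof (rule local_symbolsI[of _ "%J _. if J = I then 1 else 0"])
 show "monomial I xi = (\<Sum>J\<in>L. (if J = I then 1 else 0) * monomial J xi)" for xi
  using assms by (simp add: if_distrib[of "%x. x * _"] cong: if_cong)
qed auto

lemma LS_fun:
 assumes "open Om" "finite L" "[] \<in> L" "smooth_on Om c"
 shows "(%y _. c y) \<in> LS L Om"
 using LS_scale[OF assms(1,4) LS_monomial[OF assms(2,3)]] by simp

lemma LS_mono:
 assumes "open Om" "finite L'" "L \<subseteq> L'" "p \<in> LS L Om"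
 shows "p \<in> LS L' Om"
proof -
 obtain a where a: "!!I. smooth_on Om (a I)" "!!y xi. y \<in> Om ==> p y xi = (\<Sum>I\<in>L. a I y * monomial I xi)"
  using local_symbolsE[OF assms(4)] by blast
 have "(%y xi. \<Sum>I\<in>L. a I y * monomial I xi) \<in> LS L' Om"
  using assms by (intro LS_sum LS_scale a LS_monomial) auto
 with a(2) show ?thesis using LS_cong[of Om p] by simp
qed

lemma LS_mult:
 assumes "open Om" "finite L''" "!!I J. I \<in> L ==> J \<in> L' ==> I @ J \<in> L''"
  and "p \<in> LS L Om" "r \<in> LS L' Om"
 shows "(%y xi. p y xi * r y xi) \<in> LS L'' Om"
proof -
 obtain a where a: "!!I. smooth_on Om (a I)" "!!y xi. y \<in> Om ==> p y xi = (\<Sum>I\<in>L. a I y * monomial I xi)"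
  using local_symbolsE[OF assms(4)] by blast
 obtain b where b: "!!I. smooth_on Om (b I)" "!!y xi. y \<in> Om ==> r y xi = (\<Sum>I\<in>L'. b I y * monomial I xi)"
  using local_symbolsE[OF assms(5)] by blast
 have "(%y xi. \<Sum>I\<in>L. \<Sum>J\<in>L'. (a I y * b J y) * monomial (I @ J) xi) \<in> LS L'' Om"
  by (intro LS_sum LS_scale smooth_on_mult a b LS_monomial assms(1-3)) auto
 moreover have "p y xi * r y xi = (\<Sum>I\<in>L. \<Sum>J\<in>L'. (a I y * b J y) * monomial (I @ J) xi)" if "y \<in> Om" for y xi
  using that by (simp add: a b monomial_append sum_product algebra_simps)
 ultimately show ?thesis
  using LS_cong[of Om "%y xi. p y xi * r y xi" "%y xi. \<Sum>I\<in>L. \<Sum>J\<in>L'. (a I y * b J y) * monomial (I @ J) xi"] by simp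
qed

lemma LS_pd:
 assumes "open Om" "p \<in> LS L Om"
 shows "(%y xi. pd i (%z. p z xi) y) \<in> LS L Om"
proof -
 obtain a where a: "!!I. smooth_on Om (a I)" "!!y xi. y \<in> Om ==> p y xi = (\<Sum>I\<in>L. a I y * monomial I xi)"
  using local_symbolsE[OF assms(2)] by blast
 have "pd i (%z. p z xi) y = (\<Sum>I\<in>L. pd i (a I) y * monomial I xi)" if y: "y \<in> Om" for y xi
 proof -
  have d: "a I differentiable (at y)" for I using smooth_on_differentiable[OF a(1) y] .
  have "pd i (%z. p z xi) y = pd i (%z. \<Sum>I\<in>L. a I z * monomial I xi) y"
   by (rule pd_cong[OF assms(1) y]) (rule a(2))
  also have "... = (\<Sum>I\<in>L. pd i (a I) y * monomial I xi)"
   using d by (subst pd_sum) (auto simp: pd_mult intro!: differentiable_mult')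
  finally show ?thesis .
 qed
 then show ?thesis by (intro local_symbolsI[of _ "%I. pd i (a I)"]) (auto intro: smooth_on_pd a)
qed

lemma LS_pd_fibre:
 assumes "open Om" "finite L'" "!!I t. I \<in> L ==> t < length I ==> del_nth t I \<in> L'" "p \<in> LS L Om"
 shows "(%y xi. pd i (p y) xi) \<in> LS L' Om"
proof -
 obtain a where a: "!!I. smooth_on Om (a I)" "!!y xi. y \<in> Om ==> p y xi = (\<Sum>I\<in>L. a I y * monomial I xi)"
  using local_symbolsE[OF assms(4)] by blast
 have "pd i (p y) xi = (\<Sum>I\<in>L. \<Sum>t<length I. (if I ! t = i then a I y * monomial (del_nth t I) xi else 0))" if y: "y \<in> Om" for y xi
 proof -
  have "p y = (%xi. \<Sum>I\<in>L. a I y * monomial I xi)" using a(2)[OF y] by auto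
  then have "pd i (p y) xi = (\<Sum>I\<in>L. a I y * pd i (monomial I) xi)"
   by (simp add: pd_sum pd_cmult differentiable_mult')
  then show ?thesis by (simp add: pd_monomial sum_distrib_left if_distrib[of "%x. _ * x"] cong: if_cong)
 qed
 moreover have "(%y xi. \<Sum>I\<in>L. \<Sum>t<length I. (if I ! t = i then a I y * monomial (del_nth t I) xi else 0)) \<in> LS L' Om"
 proof (intro LS_sum assms(1))
  fix I t assume "I \<in> L" "t \<in> {..<length I}"
  then show "(%y xi. if I ! t = i then a I y * monomial (del_nth t I) xi else 0) \<in> LS L' Om"
   using assms(1-3) a(1) by (cases "I ! t = i") (auto intro!: LS_scale LS_monomial)
 qed
 ultimately show ?thesis using LS_cong[of Om "%y xi. pd i (p y) xi"] by simp
qed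

lemma LS_smooth:
 assumes "open Om" "p \<in> LS L Om"
 shows "smooth_on Om (%y. p y xi)" "y \<in> Om ==> smooth_on UNIV (p y)"
proof -
 obtain a where a: "!!I. smooth_on Om (a I)" "!!y xi. y \<in> Om ==> p y xi = (\<Sum>I\<in>L. a I y * monomial I xi)"
  using local_symbolsE[OF assms(2)] by blast
 have "smooth_on Om (%y. \<Sum>I\<in>L. a I y * monomial I xi)"
  by (intro smooth_on_sum smooth_on_mult a assms(1) smooth_on_const)
 then show "smooth_on Om (%y. p y xi)" using smooth_on_cong[OF assms(1), of "%y. p y xi"] a(2) by simp
 assume "y \<in> Om"
 then have "p y = (%xi. \<Sum>I\<in>L. a I y * monomial I xi)" using a(2) by auto
 then show "smooth_on UNIV (p y)" by (auto intro!: smooth_on_sum smooth_on_cmult)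
qed

section \<open>Symmetric coefficients and homogeneous parts\<close>

lemma fibre_coeff_expand:
 assumes "!!xi. p y xi = (\<Sum>I\<in>L. a I y * monomial I xi)"
 shows "fibre_coeff J p y = (\<Sum>I\<in>L. a I y * (pds J (monomial I) 0 / fact (length J)))"
proof -
 have "p y = (%xi. \<Sum>I\<in>L. a I y * monomial I xi)" using assms by auto
 then have "pds J (p y) 0 = (\<Sum>I\<in>L. pds J (%xi. a I y * monomial I xi) 0)"
  using pds_sum[OF open_UNIV, of L "%I xi. a I y * monomial I xi" 0 J] by (simp add: smooth_on_cmult)
 then have "pds J (p y) 0 = (\<Sum>I\<in>L. a I y * pds J (monomial I) 0)"
  by (simp add: pds_cmult[OF open_UNIV])
 then show ?thesis by (simp add: fibre_coeff_def sum_divide_distrib)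
qed

text \<open>Permuted lists give the same monomial, so a polynomial has many expansions over lists.
  Paired with a symmetric \<open>F\<close>, all of them give the same value as the symmetric
  coefficients.\<close>

lemma fibre_coeff_sum:
 fixes F :: "'n::finite list => complex"
 assumes "!!xi. p y xi = (\<Sum>I\<in>L. a I y * monomial I xi)" "finite L" "!!I J. mset I = mset J ==> F I = F J"
 shows "(\<Sum>J | length J = d. fibre_coeff J p y * F J) = (\<Sum>I\<in>{I\<in>L. length I = d}. a I y * F I)"
proof -
 have "(\<Sum>J | length J = d. fibre_coeff J p y * F J) = (\<Sum>J | length J = d. \<Sum>I\<in>L. a I y / fact d * (pds J (monomial I) 0 * F J))"
  unfolding fibre_coeff_expand[of p y a L, OF assms(1)] by (simp add: sum_distrib_right sum_divide_distrib mult.assoc)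
 also have "... = (\<Sum>I\<in>L. a I y / fact d * (\<Sum>J | length J = d. pds J (monomial I) 0 * F J))"
  by (subst sum.swap) (simp add: sum_distrib_left)
 also have "... = (\<Sum>I\<in>L. if length I = d then a I y * F I else 0)"
  using pds_monomial_sum[of F, OF assms(3)] by (intro sum.cong) auto
 also have "... = (\<Sum>I\<in>{I\<in>L. length I = d}. a I y * F I)"
  using assms(2) by (simp add: sum.inter_filter)
 finally show ?thesis .
qed

lemma fibre_coeff_sum_le:
 fixes F :: "'n::finite list => complex"
 assumes "!!xi. p y xi = (\<Sum>I\<in>L. a I y * monomial I xi)" "finite L" "L \<subseteq> deg_le k" "!!I J. mset I = mset J ==> F I = F J"
 shows "(\<Sum>J\<in>deg_le k. fibre_coeff J p y * F J) = (\<Sum>I\<in>L. a I y * F I)"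
proof -
 have "(\<Sum>J\<in>deg_le k. fibre_coeff J p y * F J) = (\<Sum>d\<le>k. \<Sum>I\<in>{I\<in>L. length I = d}. a I y * F I)"
  unfolding sum_deg_le using fibre_coeff_sum[of p y a L F, OF assms(1,2,4)] by simp
 also have "... = (\<Sum>I\<in>L. a I y * F I)"
  using assms(2,3) by (intro sum.group) auto
 finally show ?thesis .
qed

lemma hom_part_expand:
 assumes "!!xi. p y xi = (\<Sum>I\<in>L. a I y * monomial I xi)" "finite L"
 shows "hom_part d p y xi = (\<Sum>I\<in>{I\<in>L. length I = d}. a I y * monomial I xi)"
 unfolding hom_part_def by (rule fibre_coeff_sum[of p y a L, OF assms mset_monomial])

lemma fibre_coeff_smooth:
 assumes "open Om" "p \<in> LS L Om"
 shows "smooth_on Om (fibre_coeff J p)"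
proof -
 obtain a where a: "!!I. smooth_on Om (a I)" "!!y xi. y \<in> Om ==> p y xi = (\<Sum>I\<in>L. a I y * monomial I xi)"
  using local_symbolsE[OF assms(2)] by blast
 have "smooth_on Om (%y. \<Sum>I\<in>L. a I y * (pds J (monomial I) 0 / fact (length J)))"
  by (intro smooth_on_sum smooth_on_mult a assms(1) smooth_on_const)
 then show ?thesis
  using smooth_on_cong[OF assms(1), of "fibre_coeff J p" "%y. \<Sum>I\<in>L. a I y * (pds J (monomial I) 0 / fact (length J))"]
   fibre_coeff_expand[of p _ a L, OF a(2)] by simp
qed

lemma symbol_fibre_coeff:
 assumes "p \<in> LS (deg_le k) Om" "y \<in> Om"
 shows "p y xi = (\<Sum>I\<in>deg_le k. fibre_coeff I p y * monomial I xi)"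
proof -
 obtain a where a': "!!I. smooth_on Om (a I)" and a: "!!y xi. y \<in> Om ==> p y xi = (\<Sum>I\<in>deg_le k. a I y * monomial I xi)"
  using local_symbolsE[OF assms(1)] by blast
 have "p y xi = (\<Sum>I\<in>deg_le k. a I y * monomial I xi)" by (rule a[OF assms(2)])
 also have "... = (\<Sum>I\<in>deg_le k. fibre_coeff I p y * monomial I xi)"
  by (rule fibre_coeff_sum_le[of p y a, symmetric, OF a[OF assms(2)]]) (auto intro: mset_monomial)
 finally show ?thesis .
qed

lemma LS_hom_part:
 assumes "open Om" "p \<in> LS L Om"
 shows "hom_part d p \<in> LS (deg_eq d) Om"
 by (rule local_symbolsI[of _ "%I. fibre_coeff I p"]) (auto simp: fibre_coeff_smooth[OF assms] hom_part_def)

lemma hom_part_sum: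
 assumes "p \<in> LS (deg_le k) Om" "y \<in> Om"
 shows "p y xi = (\<Sum>d\<le>k. hom_part d p y xi)"
 using symbol_fibre_coeff[OF assms, of xi] by (simp add: sum_deg_le hom_part_def)

lemma hom_part_eq_0:
 assumes "p \<in> LS L Om" "finite L" "y \<in> Om" "!!I. I \<in> L ==> length I \<noteq> d"
 shows "hom_part d p y xi = 0"
proof -
 obtain a where a': "!!I. smooth_on Om (a I)" and a: "!!y xi. y \<in> Om ==> p y xi = (\<Sum>I\<in>L. a I y * monomial I xi)"
  using local_symbolsE[OF assms(1)] by blast
 have e: "{I\<in>L. length I = d} = {}" using assms(4) by auto
 show ?thesis unfolding hom_part_expand[of p y a L d xi, OF a[OF assms(3)] assms(2)] e by simp
qed

lemma hom_part_hom:
 assumes "p \<in> LS (deg_eq d) Om" "y \<in> Om"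
 shows "hom_part d p y xi = p y xi"
proof -
 obtain a where a': "!!I. smooth_on Om (a I)" and a: "!!y xi. y \<in> Om ==> p y xi = (\<Sum>I\<in>deg_eq d. a I y * monomial I xi)"
  using local_symbolsE[OF assms(1)] by blast
 have "hom_part d p y xi = (\<Sum>I\<in>{I\<in>deg_eq d. length I = d}. a I y * monomial I xi)"
  by (rule hom_part_expand[of p y a, OF a[OF assms(2)]]) simp
 also have "... = p y xi" using a[OF assms(2), of xi] by simp
 finally show ?thesis .
qed

lemma hom_part_linear:
 assumes "open Om" "p \<in> LS L Om" "r \<in> LS L' Om" "y \<in> Om"
 shows "hom_part d (%y xi. a * p y xi + b * r y xi) y xi = a * hom_part d p y xi + b * hom_part d r y xi"
proof -
 note s = LS_smooth(2)[OF assms(1,2,4)] LS_smooth(2)[OF assms(1,3,4)]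
 have "fibre_coeff I (%y xi. a * p y xi + b * r y xi) y = a * fibre_coeff I p y + b * fibre_coeff I r y" for I
  unfolding fibre_coeff_def using s
  by (simp add: pds_add[OF open_UNIV] pds_cmult[OF open_UNIV] smooth_on_cmult add_divide_distrib)
 then show ?thesis unfolding hom_part_def
  by (simp add: sum.distrib sum_distrib_left algebra_simps)
qed

lemma hom_part_cong: "(!!xi. p y xi = r y xi) ==> hom_part d p y xi = hom_part d r y xi"
proof -
 assume "!!xi. p y xi = r y xi"
 then have "p y = r y" by auto
 then show ?thesis by (simp add: hom_part_def fibre_coeff_def)
qed

section \<open>Composition of normally ordered operators\<close>

definition ef :: "real^'n::finite => real^'n => complex" where
 "ef eta y = cor (exp (eta \<bullet> y))"

lemma ef_nonzero [simp]: "ef eta y \<noteq> 0" by (simp add: ef_def)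

lemma ef_minus: "ef (- eta) y * ef eta y = 1"
proof -
 have "exp (- (eta \<bullet> y)) * exp (eta \<bullet> y) = 1" by (simp add: exp_minus)
 then have "cor (exp (- (eta \<bullet> y)) * exp (eta \<bullet> y)) = 1" by simp
 then show ?thesis unfolding ef_def inner_minus_left of_real_mult .
qed

lemma smooth_on_ef [simp]: "open S ==> smooth_on S (ef eta)"
 unfolding ef_def[abs_def] using smooth_on_inner[of S eta 0]
 by (intro smooth_on_of_real smooth_on_exp) simp_all

lemma pd_ef: "pd i (ef eta) y = cor (eta $ i) * ef eta y"
proof -
 have "((%y. cor (exp (eta \<bullet> y))) has_derivative (%h. cor (exp (eta \<bullet> y) * (eta \<bullet> h)))) (at y)"
  by (rule bounded_linear.has_derivative[OF bounded_linear_of_real]) (auto intro!: derivative_eq_intros)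
 from pd_eqI[OF this, of i] show ?thesis by (simp add: ef_def[abs_def] inner_axis)
qed

text \<open>The conjugate of \<open>pd i\<close> by the exponential \<open>ef xi\<close>.
  Equivalently, it is the full symbol of \<open>pd i\<close> composed with the operator of symbol
  \<open>b\<close>.\<close>

definition tsym :: "'n::finite => 'n lsymbol => 'n lsymbol" where
 "tsym i b = (%y xi. pd i (%z. b z xi) y + cor (xi $ i) * b y xi)"

definition tsyms :: "'n::finite list => 'n lsymbol => 'n lsymbol" where
 "tsyms I b = foldr tsym I b"

lemma tsyms_Nil [simp]: "tsyms [] b = b"
 and tsyms_Cons: "tsyms (i # I) b = tsym i (tsyms I b)"
 by (simp_all add: tsyms_def)

lemma tsyms_cong:
 assumes "open S" "!!z. z \<in> S ==> b z xi = b' z xi" "y \<in> S"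
 shows "tsyms I b y xi = tsyms I b' y xi"
 using assms(3)
proof (induction I arbitrary: y)
 case (Cons i I)
 have "pd i (%z. tsyms I b z xi) y = pd i (%z. tsyms I b' z xi) y"
  by (rule pd_cong[OF assms(1) Cons.prems]) (rule Cons.IH)
 with Cons show ?case unfolding tsyms_Cons tsym_def by simp
qed (simp add: assms)

lemma smooth_on_tsyms:
 assumes "open Om" "smooth_on Om (%z. b z xi)"
 shows "smooth_on Om (%z. tsyms I b z xi)"
proof (induction I)
 case (Cons i I)
 then show ?case unfolding tsyms_Cons tsym_def
  by (intro smooth_on_add smooth_on_mult assms(1) smooth_on_const smooth_on_pd)
qed (simp add: assms)

lemma pds_ef:
 assumes "open Om" "smooth_on Om w" "y \<in> Om"
 shows "pds I (%z. w z * ef xi z) y = tsyms I (%z _. w z) y xi * ef xi y"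
 using assms(3)
proof (induction I arbitrary: y)
 case (Cons i I)
 let ?t = "%z. tsyms I (%z _. w z) z xi"
 have "pds (i # I) (%z. w z * ef xi z) y = pd i (%z. ?t z * ef xi z) y"
  unfolding pds_Cons by (rule pd_cong[OF assms(1) Cons.prems]) (rule Cons.IH)
 also have "... = pd i ?t y * ef xi y + ?t y * pd i (ef xi) y"
  by (intro pd_mult smooth_on_differentiable[OF smooth_on_tsyms[OF assms(1)] Cons.prems] assms(2)
    smooth_on_differentiable[OF smooth_on_ef[OF assms(1)] Cons.prems])
 finally show ?case by (simp add: tsyms_Cons tsym_def pd_ef algebra_simps)
qed simp

lemma LS_coord_mult:
 assumes "open Om" "finite L'" "!!I. I \<in> L ==> i # I \<in> L'" "b \<in> LS L Om"
 shows "(%y xi. cor (xi $ i) * b y xi) \<in> LS L' Om"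
 using LS_mult[OF assms(1,2), of "{[i]}" L "%_. monomial [i]" b] assms(3,4)
  LS_monomial[of "{[i]}" "[i]" Om] by (simp add: monomial_Cons)

lemma LS_tsym:
 assumes "open Om" "b \<in> LS (deg_le l) Om"
 shows "tsym i b \<in> LS (deg_le (Suc l)) Om"
 unfolding tsym_def
 by (intro LS_add LS_coord_mult[OF _ _ _ assms(2)] assms
   LS_mono[OF _ _ _ LS_pd[OF assms]]) auto

lemma LS_tsyms:
 assumes "open Om" "b \<in> LS (deg_le l) Om"
 shows "tsyms I b \<in> LS (deg_le (l + length I)) Om"
proof (induction I)
 case (Cons i I)
 from LS_tsym[OF assms(1) this, of i] show ?case by (simp add: tsyms_Cons)
qed (simp add: assms)

text \<open>Normal ordering is defined through the symmetric coefficients. As derivatives commute,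
  \<open>pds L u y\<close> is symmetric in \<open>L\<close>, so any other expansion of the symbol
  gives the same operator.\<close>

lemma normal_order_family:
 assumes S: "open Om" "smooth_on Om u" "y \<in> Om"
  and p: "!!xi. p y xi = (\<Sum>s\<in>T. c s * monomial (L s) xi)" and L: "!!s. s \<in> T ==> length (L s) <= k"
 shows "normal_order k p u y = (\<Sum>s\<in>T. c s * pds (L s) u y)"
proof -
 have py: "p y = (%xi. \<Sum>s\<in>T. c s * monomial (L s) xi)" using p by auto
 have "fibre_coeff J p y = (\<Sum>s\<in>T. c s * (pds J (monomial (L s)) 0 / fact (length J)))" for J
  unfolding fibre_coeff_def py
  by (simp add: pds_sum[OF open_UNIV] pds_cmult[OF open_UNIV] smooth_on_cmult sum_divide_distrib)
 then have "normal_order k p u y = (\<Sum>J\<in>deg_le k. \<Sum>s\<in>T. c s * (pds J (monomial (L s)) 0 / fact (length J) * pds J u y))"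
  by (simp add: normal_order_def sum_distrib_right mult.assoc)
 also have "... = (\<Sum>s\<in>T. c s * (\<Sum>J\<in>deg_le k. pds J (monomial (L s)) 0 / fact (length J) * pds J u y))"
  by (subst sum.swap) (simp add: sum_distrib_left)
 also have "... = (\<Sum>s\<in>T. c s * pds (L s) u y)"
 proof (intro sum.cong refl)
  fix s assume s: "s \<in> T"
  have "(\<Sum>J\<in>deg_le k. fibre_coeff J (%_. monomial (L s)) 0 * pds J u y) = (\<Sum>I\<in>{L s}. 1 * pds I u y)"
  proof (rule fibre_coeff_sum_le[of "%_. monomial (L s)" 0 "%_ _. 1" "{L s}" k "%J. pds J u y"])
   show "{L s} \<subseteq> deg_le k" using L[OF s] by simp
   show "pds I u y = pds J u y" if "mset I = mset J" for I J by (rule pds_perm[OF S(1,2) that S(3)])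
  qed simp_all
  then show "c s * (\<Sum>J\<in>deg_le k. pds J (monomial (L s)) 0 / fact (length J) * pds J u y) = c s * pds (L s) u y"
   by (simp add: fibre_coeff_def)
 qed
 finally show ?thesis .
qed

lemma normal_order_cong:
 "(!!xi. p y xi = r y xi) ==> normal_order k p u y = normal_order k r u y"
proof -
 assume "!!xi. p y xi = r y xi"
 then have "p y = r y" by auto
 then show ?thesis by (simp add: normal_order_def fibre_coeff_def)
qed

lemma normal_order_cong_fun:
 assumes "open S" "y \<in> S" "!!z. z \<in> S ==> u z = v z"
 shows "normal_order k p u y = normal_order k p v y"
 unfolding normal_order_def using pds_cong[OF assms(1,3,2)] by simp

lemma normal_order_raise:
 assumes "open Om" "smooth_on Om u" "y \<in> Om" "p \<in> LS (deg_le k) Om" "k <= k'"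
 shows "normal_order k' p u y = normal_order k p u y"
proof -
 have "normal_order k' p u y = (\<Sum>I\<in>deg_le k. fibre_coeff I p y * pds I u y)"
  by (rule normal_order_family[OF assms(1-3)]) (use symbol_fibre_coeff[OF assms(4,3)] assms(5) in auto)
 then show ?thesis by (simp add: normal_order_def)
qed

lemma normal_order_linear:
 assumes "open Om" "smooth_on Om u" "smooth_on Om v" "y \<in> Om"
 shows "normal_order k p (%z. a * u z + b * v z) y = a * normal_order k p u y + b * normal_order k p v y"
 unfolding normal_order_def using assms
 by (simp add: pds_add pds_cmult smooth_on_cmult sum.distrib sum_distrib_left algebra_simps)

lemma normal_order_add_symbol:
 assumes "open Om" "y \<in> Om" "p \<in> LS L Om" "r \<in> LS L' Om"
 shows "normal_order k (%y xi. a * p y xi + b * r y xi) u y = a * normal_order k p u y + b * normal_order k r u y"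
proof -
 note s = LS_smooth(2)[OF assms(1,3,2)] LS_smooth(2)[OF assms(1,4,2)]
 have "fibre_coeff I (%y xi. a * p y xi + b * r y xi) y = a * fibre_coeff I p y + b * fibre_coeff I r y" for I
  unfolding fibre_coeff_def using s
  by (simp add: pds_add[OF open_UNIV] pds_cmult[OF open_UNIV] smooth_on_cmult add_divide_distrib)
 then show ?thesis
  by (simp add: normal_order_def sum.distrib sum_distrib_left algebra_simps)
qed

lemma normal_order_ef:
 assumes "open Om" "smooth_on Om w" "y \<in> Om"
 shows "normal_order k b (%z. w z * ef xi z) y = (\<Sum>I\<in>deg_le k. fibre_coeff I b y * tsyms I (%z _. w z) y xi) * ef xi y"
 unfolding normal_order_def using pds_ef[OF assms] by (simp add: sum_distrib_right mult.assoc)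

lemma normal_order_ef_const:
 assumes "open Om" "b \<in> LS (deg_le k) Om" "y \<in> Om"
 shows "normal_order k b (ef xi) y = b y xi * ef xi y"
proof -
 have "tsyms I (%_ _. 1) z xi = monomial I xi" for I z
 proof (induction I arbitrary: z)
  case (Cons i I)
  then show ?case by (simp add: tsyms_Cons tsym_def monomial_Cons)
 qed simp
 with normal_order_ef[OF assms(1) smooth_on_const[of Om 1] assms(3), of k b xi] symbol_fibre_coeff[OF assms(2,3), of xi]
 show ?thesis by simp
qed

lemma pd_normal_order:
 assumes S: "open Om" "smooth_on Om u" "y \<in> Om" and b: "b \<in> LS (deg_le l) Om"
 shows "pd i (normal_order l b u) y = normal_order (Suc l) (tsym i b) u y"
proof -
 have c: "smooth_on Om (fibre_coeff I b)" for I by (rule fibre_coeff_smooth[OF S(1) b])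
 have d: "fibre_coeff I b differentiable (at y)" "pds I u differentiable (at y)" for I
  using smooth_on_differentiable[OF c S(3)] smooth_on_differentiable[OF smooth_on_pds[OF S(2)] S(3)] by auto
 have "normal_order l b u = (%y. \<Sum>I\<in>deg_le l. fibre_coeff I b y * pds I u y)"
  by (auto simp: normal_order_def)
 then have lhs: "pd i (normal_order l b u) y = (\<Sum>I\<in>deg_le l. pd i (fibre_coeff I b) y * pds I u y + fibre_coeff I b y * pds (i # I) u y)"
  using d by (simp add: pd_sum pd_mult differentiable_mult' pds_Cons)
 have sy: "b z xi = (\<Sum>I\<in>deg_le l. fibre_coeff I b z * monomial I xi)" if "z \<in> Om" for z xi
  by (rule symbol_fibre_coeff[OF b that])
 have "pd i (%z. b z xi) y = pd i (%z. \<Sum>I\<in>deg_le l. fibre_coeff I b z * monomial I xi) y" for xi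
  by (rule pd_cong[OF S(1,3)]) (rule sy)
 then have pb: "pd i (%z. b z xi) y = (\<Sum>I\<in>deg_le l. pd i (fibre_coeff I b) y * monomial I xi)" for xi
  using d by (simp add: pd_sum pd_mult differentiable_mult')
 have ts: "tsym i b = (%y xi. 1 * pd i (%z. b z xi) y + 1 * (cor (xi $ i) * b y xi))"
  by (simp add: tsym_def)
 have "normal_order (Suc l) (tsym i b) u y = normal_order (Suc l) (%y xi. pd i (%z. b z xi) y) u y
   + normal_order (Suc l) (%y xi. cor (xi $ i) * b y xi) u y"
  unfolding ts using normal_order_add_symbol[OF S(1,3) LS_pd[OF S(1) b]
    LS_coord_mult[OF S(1) finite_length_le[of "Suc l"] _ b], where a=1 and b=1] by simp
 also have "normal_order (Suc l) (%y xi. pd i (%z. b z xi) y) u y = (\<Sum>I\<in>deg_le l. pd i (fibre_coeff I b) y * pds I u y)"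
  by (rule normal_order_family[OF S]) (auto simp: pb)
 also have "normal_order (Suc l) (%y xi. cor (xi $ i) * b y xi) u y = (\<Sum>I\<in>deg_le l. fibre_coeff I b y * pds (i # I) u y)"
  by (rule normal_order_family[OF S]) (auto simp: sy[OF S(3)] monomial_Cons sum_distrib_left mult_ac)
 finally show ?thesis using lhs by (simp add: sum.distrib)
qed

lemma pds_normal_order:
 assumes S: "open Om" "smooth_on Om u" "y \<in> Om" and b: "b \<in> LS (deg_le l) Om"
 shows "pds I (normal_order l b u) y = normal_order (l + length I) (tsyms I b) u y"
 using S(3)
proof (induction I arbitrary: y)
 case (Cons i I)
 have "pds (i # I) (normal_order l b u) y = pd i (normal_order (l + length I) (tsyms I b) u) y"
  unfolding pds_Cons by (rule pd_cong[OF S(1) Cons.prems]) (rule Cons.IH)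
 also have "... = normal_order (Suc (l + length I)) (tsym i (tsyms I b)) u y"
  by (rule pd_normal_order[OF S(1,2) Cons.prems LS_tsyms[OF S(1) b]])
 finally show ?case by (simp add: tsyms_Cons)
qed simp

text \<open>The full symbol of a composition: the factor \<open>a\<close> enters through its
  coefficients, and each derivative in it acts on \<open>b\<close> by \<open>tsym\<close>. The
  number \<open>k\<close> has to bound the degree of \<open>a\<close>.\<close>

definition sharp :: "nat => 'n::finite lsymbol => 'n lsymbol => 'n lsymbol" where
 "sharp k a b y xi = (\<Sum>I\<in>deg_le k. fibre_coeff I a y * tsyms I b y xi)"

lemma LS_sharp:
 assumes "open Om" "a \<in> LS L Om" "b \<in> LS (deg_le l) Om"
 shows "sharp k a b \<in> LS (deg_le (k + l)) Om"
proof -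
 have "(%y xi. \<Sum>I\<in>deg_le k. fibre_coeff I a y * tsyms I b y xi) \<in> LS (deg_le (k + l)) Om"
  by (intro LS_sum LS_scale fibre_coeff_smooth[OF assms(1,2)]
    LS_mono[OF assms(1) _ _ LS_tsyms[OF assms(1,3)]] assms(1)) auto
 then show ?thesis by (simp add: sharp_def[abs_def])
qed

lemma normal_order_sum_symbol:
 assumes "open Om" "y \<in> Om" "finite T" "!!s. s \<in> T ==> p s \<in> LS L Om"
 shows "normal_order k (%y xi. \<Sum>s\<in>T. c s y * p s y xi) u y = (\<Sum>s\<in>T. c s y * normal_order k (p s) u y)"
proof -
 have "fibre_coeff I (%y xi. \<Sum>s\<in>T. c s y * p s y xi) y = (\<Sum>s\<in>T. c s y * fibre_coeff I (p s) y)" for I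
  unfolding fibre_coeff_def using LS_smooth(2)[OF assms(1,4,2)]
  by (simp add: pds_sum[OF open_UNIV] pds_cmult[OF open_UNIV] smooth_on_cmult sum_divide_distrib)
 then have "normal_order k (%y xi. \<Sum>s\<in>T. c s y * p s y xi) u y = (\<Sum>I\<in>deg_le k. \<Sum>s\<in>T. c s y * fibre_coeff I (p s) y * pds I u y)"
  by (simp add: normal_order_def sum_distrib_right)
 also have "... = (\<Sum>s\<in>T. c s y * normal_order k (p s) u y)"
  unfolding normal_order_def sum_distrib_left by (subst sum.swap) (simp add: mult.assoc)
 finally show ?thesis .
qed

lemma normal_order_compose:
 assumes S: "open Om" "smooth_on Om u" "y \<in> Om"
  and a: "a \<in> LS L Om" and b: "b \<in> LS (deg_le l) Om"
 shows "normal_order k a (normal_order l b u) y = normal_order (k + l) (sharp k a b) u y"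
proof -
 have "normal_order k a (normal_order l b u) y = (\<Sum>I\<in>deg_le k. fibre_coeff I a y * normal_order (l + length I) (tsyms I b) u y)"
  unfolding normal_order_def[of k] using pds_normal_order[OF S b] by simp
 also have "... = (\<Sum>I\<in>deg_le k. fibre_coeff I a y * normal_order (k + l) (tsyms I b) u y)"
  using normal_order_raise[OF S LS_tsyms[OF S(1) b], of _ "k + l"] by (intro sum.cong) auto
 also have "... = normal_order (k + l) (%y xi. \<Sum>I\<in>deg_le k. fibre_coeff I a y * tsyms I b y xi) u y"
  by (rule normal_order_sum_symbol[symmetric, OF S(1,3), where L="deg_le (k + l)"])
    (auto intro!: LS_mono[OF S(1) _ _ LS_tsyms[OF S(1) b]])
 finally show ?thesis by (simp add: sharp_def[abs_def])
qed

section \<open>The two leading terms of a composition\<close>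

definition gradprod :: "'n::finite lsymbol => 'n lsymbol => 'n lsymbol" where
 "gradprod a b y xi = (\<Sum>i\<in>UNIV. pd i (a y) xi * pd i (%z. b z xi) y)"

text \<open>Every derivative that falls on \<open>b\<close> replaces one factor \<open>xi\<close>,
  so terms with at least two of them lie two degrees below the top. If the total degree is less than
  2, the index set of the remainder is empty and the remainder is zero.\<close>

lemma tsyms_expand:
 assumes S: "open Om" and b: "b \<in> LS (deg_le l) Om"
 shows "\<exists>r\<in>LS {J. length J + 2 <= length I + l} Om. \<forall>y\<in>Om. \<forall>xi.
  tsyms I b y xi = monomial I xi * b y xi + gradprod (%_. monomial I) b y xi + r y xi"
proof (induction I)
 case Nil
 have "monomial [] = (%_ :: real^'a. 1)" by auto
 then show ?case by (intro bexI[of _ "%_ _. 0"]) (auto simp: gradprod_def)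
next
 case (Cons j I)
 then obtain r where r: "r \<in> LS {J. length J + 2 <= length I + l} Om"
  and eq: "!!y xi. y \<in> Om ==> tsyms I b y xi = monomial I xi * b y xi + gradprod (%_. monomial I) b y xi + r y xi" by blast
 \<comment> \<open>What one more \<open>tsym j\<close> adds to the remainder: \<open>pd j\<close>
   applied to the first-order term and to the old remainder, and \<open>xi_j\<close> times the old
   remainder.\<close>
 define r' where "r' y xi = (\<Sum>i\<in>UNIV. pd i (monomial I) xi * pd j (%z. pd i (%z. b z xi) z) y) + pd j (%z. r z xi) y
  + cor (xi $ j) * r y xi" for y xi
 have fin: "finite {J :: 'a list. length J + 2 <= m}" "finite {J :: 'a list. Suc (length J) <= m}" for m
  by (rule finite_subset[OF _ finite_length_le[of m]], auto)+
 have "(%y xi. pd i (monomial I) xi * pd j (%z. pd i (%z. b z xi) z) y) \<in> LS {J. length J + 2 <= length (j # I) + l} Om" for i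
 proof (rule LS_mult[OF S])
  show "(%y. pd i (monomial I)) \<in> LS {J. Suc (length J) = length I} Om"
   by (rule LS_pd_fibre[OF S _ _ LS_monomial[of "{I}" I]])
    (auto simp: length_del_nth intro: finite_subset[OF _ finite_length_le[of "length I"]])
  show "(%y xi. pd j (%z. pd i (%z. b z xi) z) y) \<in> LS (deg_le l) Om"
   by (intro LS_pd S b)
 qed (auto intro: fin)
 then have "r' \<in> LS {J. length J + 2 <= length (j # I) + l} Om"
  unfolding r'_def
  by (intro LS_add LS_sum S LS_mono[OF S _ _ LS_pd[OF S r]]
    LS_coord_mult[OF S _ _ r]) (auto intro: fin)
 moreover have "tsyms (j # I) b y xi = monomial (j # I) xi * b y xi + gradprod (%_. monomial (j # I)) b y xi + r' y xi" if y: "y \<in> Om" for y xi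
 proof -
  have sb: "smooth_on Om (%z. b z xi)" by (rule LS_smooth(1)[OF S b])
  have d: "(%z. b z xi) differentiable (at y)" "(%z. pd i (%z. b z xi) z) differentiable (at y)" "(%z. r z xi) differentiable (at y)" for i
   by (rule smooth_on_differentiable[OF _ y], simp add: sb smooth_on_pd LS_smooth(1)[OF S r])+
  have "pd j (%z. tsyms I b z xi) y = pd j (%z. monomial I xi * b z xi + gradprod (%_. monomial I) b z xi + r z xi) y"
   by (rule pd_cong[OF S y]) (rule eq)
  also have "... = monomial I xi * pd j (%z. b z xi) y + (\<Sum>i\<in>UNIV. pd i (monomial I) xi * pd j (%z. pd i (%z. b z xi) z) y) + pd j (%z. r z xi) y"
   unfolding gradprod_def using d by (simp add: pd_add pd_sum pd_cmult differentiable_mult')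
  finally have *: "pd j (%z. tsyms I b z xi) y = ..." .
  have "gradprod (%_. monomial (j # I)) b y xi = monomial I xi * pd j (%z. b z xi) y + cor (xi $ j) * gradprod (%_. monomial I) b y xi"
   by (simp add: gradprod_def pd_monomial_Cons algebra_simps sum.distrib sum_distrib_left if_distrib[of "%x. _ * x"] cong: if_cong)
  with * show ?thesis
   unfolding tsyms_Cons tsym_def eq[OF y] r'_def monomial_Cons by (simp add: algebra_simps)
 qed
 ultimately show ?case by blast
qed

lemma sharp_expand:
 assumes S: "open Om" and a: "a \<in> LS (deg_le k) Om" and b: "b \<in> LS (deg_le l) Om"
 shows "\<exists>r\<in>LS {J. length J + 2 <= k + l} Om. \<forall>y\<in>Om. \<forall>xi.
  sharp k a b y xi = a y xi * b y xi + gradprod a b y xi + r y xi"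
proof -
 have fin: "finite {J :: 'a list. length J + 2 <= m}" for m by (rule finite_subset[OF _ finite_length_le[of m]]) auto
 obtain r where r: "!!I. r I \<in> LS {J. length J + 2 <= length I + l} Om"
  and eq: "!!I y xi. y \<in> Om ==> tsyms I b y xi = monomial I xi * b y xi + gradprod (%_. monomial I) b y xi + r I y xi"
  using tsyms_expand[OF S b] by metis
 define R where "R y xi = (\<Sum>I\<in>deg_le k. fibre_coeff I a y * r I y xi)" for y xi
 have "R \<in> LS {J. length J + 2 <= k + l} Om"
  unfolding R_def
  by (intro LS_sum LS_scale fibre_coeff_smooth[OF S a] LS_mono[OF S fin _ r] S) auto
 moreover have "sharp k a b y xi = a y xi * b y xi + gradprod a b y xi + R y xi" if y: "y \<in> Om" for y xi
 proof -
  have ay: "a y = (%xi. \<Sum>I\<in>deg_le k. fibre_coeff I a y * monomial I xi)" using symbol_fibre_coeff[OF a y] by auto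
  have "pd i (a y) xi = (\<Sum>I\<in>deg_le k. fibre_coeff I a y * pd i (monomial I) xi)" for i
   by (subst ay) (simp add: pd_sum pd_cmult differentiable_mult')
  then have g: "gradprod a b y xi = (\<Sum>I\<in>deg_le k. fibre_coeff I a y * gradprod (%_. monomial I) b y xi)"
   unfolding gradprod_def sum_distrib_left by (subst sum.swap) (simp add: sum_distrib_right mult.assoc)
  show ?thesis
   unfolding sharp_def eq[OF y] R_def g symbol_fibre_coeff[OF a y, of xi]
   by (simp add: algebra_simps sum.distrib sum_distrib_left)
 qed
 ultimately show ?thesis by blast
qed

text \<open>The Leibniz formula stops at second order when the third derivatives of \<open>w\<close>
  vanish. Here \<open>w\<close> will be the symbol of a Lie derivative along a conformal field,
  which is at most quadratic in \<open>y\<close>.\<close>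

lemma tsyms_quadratic:
 assumes w: "smooth_on UNIV w" and w3: "!!i j l y. pd i (pd j (pd l w)) y = 0"
 shows "tsyms I (%z _. w z) y xi = w y * monomial I xi + (\<Sum>i\<in>UNIV. pd i w y * pd i (monomial I) xi)
  + (\<Sum>i\<in>UNIV. \<Sum>j\<in>UNIV. pd i (pd j w) y * pd i (pd j (monomial I)) xi) / 2"
proof (induction I arbitrary: y)
 case Nil
 have m: "monomial [] = (%_ :: real^'a. 1)" by auto
 have "pd j (%_ :: real^'a. 1 :: complex) = (%_. 0)" for j by auto
 then show ?case unfolding m by simp
next
 case (Cons l I)
 have d: "w differentiable (at y)" "pd i w differentiable (at y)" "pd i (pd j w) differentiable (at y)" for i j y
  by (rule smooth_on_differentiable[OF _ UNIV_I]; intro smooth_on_pd w)+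
 have IH: "(%z. tsyms I (%z _. w z) z xi) = (%y. w y * monomial I xi + (\<Sum>i\<in>UNIV. pd i w y * pd i (monomial I) xi)
  + (\<Sum>i\<in>UNIV. \<Sum>j\<in>UNIV. pd i (pd j w) y * pd i (pd j (monomial I)) xi) / 2)"
  using Cons.IH by auto
 have c: "pd l (%y. v y * c) y = pd l v y * c" if "v differentiable (at y)" for v :: "real^'a => complex" and c y
  using pd_bounded_linear[OF bounded_linear_mult_left that] .
 have dd: "(%y. v y * c) differentiable (at y)" if "v differentiable (at y)" for v :: "real^'a => complex" and c y
  by (rule differentiable_mult'[OF that]) simp
 have dq: "(%y. \<Sum>j\<in>UNIV. pd i (pd j w) y * c j) differentiable (at y)" for i c y
  by (intro differentiable_sum ballI dd d finite)
 have dQ: "(%y. \<Sum>i\<in>UNIV. \<Sum>j\<in>UNIV. pd i (pd j w) y * pd i (pd j (monomial I)) xi) differentiable (at y)" for y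
  by (intro differentiable_sum ballI dd d finite)
 have "pd l (%y. \<Sum>i\<in>UNIV. \<Sum>j\<in>UNIV. pd i (pd j w) y * pd i (pd j (monomial I)) xi) y =
   (\<Sum>i\<in>UNIV. \<Sum>j\<in>UNIV. pd l (%y. pd i (pd j w) y * pd i (pd j (monomial I)) xi) y)"
  by (subst pd_sum, rule dq) (intro sum.cong refl pd_sum dd d)
 also have "... = 0" unfolding c[OF d(3)] w3 by simp
 finally have half: "pd l (%y. (\<Sum>i\<in>UNIV. \<Sum>j\<in>UNIV. pd i (pd j w) y * pd i (pd j (monomial I)) xi) / 2) y = 0"
  unfolding divide_inverse c[OF dQ] by simp
 have p: "pd l (%z. tsyms I (%z _. w z) z xi) y = pd l w y * monomial I xi + (\<Sum>i\<in>UNIV. pd l (pd i w) y * pd i (monomial I) xi)"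
 proof -
  have 1: "(%y. (\<Sum>i\<in>UNIV. \<Sum>j\<in>UNIV. pd i (pd j w) y * pd i (pd j (monomial I)) xi) / 2) differentiable (at y)"
   unfolding divide_inverse by (rule dd[OF dQ])
  have 2: "(%y. \<Sum>i\<in>UNIV. pd i w y * pd i (monomial I) xi) differentiable (at y)" by (intro differentiable_sum ballI dd d finite)
  have 3: "(%y. w y * monomial I xi) differentiable (at y)" by (intro dd d)
  have 4: "pd l (%y. \<Sum>i\<in>UNIV. pd i w y * pd i (monomial I) xi) y = (\<Sum>i\<in>UNIV. pd l (pd i w) y * pd i (monomial I) xi)"
   by (subst pd_sum) (auto intro!: dd d simp: c d)
  show ?thesis unfolding IH
   by (simp add: pd_add 1 2 3 differentiable_add half 4 c d)
 qed
 have m1: "pd i (monomial (l # I)) = (%xi. (if i = l then monomial I xi else 0) + cor (xi $ l) * pd i (monomial I) xi)" for i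
  by (auto simp: pd_monomial_Cons)
 have dm: "pd i (monomial I) differentiable (at xi)" for i
  by (rule smooth_on_differentiable[OF smooth_on_pd[OF smooth_on_monomial[OF open_UNIV]] UNIV_I])
 have dif: "(%xi. if P then monomial I xi else 0) differentiable (at xi)" for P by (cases P) auto
 have pif: "pd i (%xi. if P then monomial I xi else 0) xi = (if P then pd i (monomial I) xi else 0)" for P i by (cases P) auto
 have m2: "pd i (pd j (monomial (l # I))) xi = (if j = l then pd i (monomial I) xi else 0) + (if i = l then pd j (monomial I) xi else 0)
  + cor (xi $ l) * pd i (pd j (monomial I)) xi" for i j
  unfolding m1 by (simp add: pd_add pd_mult dif pif dm differentiable_mult')
 \<comment> \<open>Symmetry of the second derivatives of \<open>w\<close> makes the two cross sums
   in \<open>r2\<close> equal, and together they cancel the factor 1/2.\<close>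
 have sym: "pd i (pd l w) y = pd l (pd i w) y" for i by (rule pd_commute[OF open_UNIV w UNIV_I])
 have r1: "(\<Sum>i\<in>UNIV. pd i w y * pd i (monomial (l # I)) xi) =
   pd l w y * monomial I xi + cor (xi $ l) * (\<Sum>i\<in>UNIV. pd i w y * pd i (monomial I) xi)"
  by (simp add: pd_monomial_Cons distrib_left sum.distrib sum_distrib_left mult.left_commute if_distrib[of "%x. _ * x"] cong: if_cong)
 have "(\<Sum>i\<in>UNIV. \<Sum>j\<in>UNIV. pd i (pd j w) y * pd i (pd j (monomial (l # I))) xi) =
   (\<Sum>i\<in>UNIV. \<Sum>j\<in>UNIV. if j = l then pd i (pd l w) y * pd i (monomial I) xi else 0) +
   (\<Sum>i\<in>UNIV. \<Sum>j\<in>UNIV. if i = l then pd l (pd j w) y * pd j (monomial I) xi else 0) +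
   cor (xi $ l) * (\<Sum>i\<in>UNIV. \<Sum>j\<in>UNIV. pd i (pd j w) y * pd i (pd j (monomial I)) xi)"
  unfolding m2 sum_distrib_left sum.distrib[symmetric]
  by (intro sum.cong refl) (simp add: algebra_simps)
 also have "(\<Sum>i\<in>UNIV. \<Sum>j\<in>UNIV. if j = l then pd i (pd l w) y * pd i (monomial I) xi else 0) =
   (\<Sum>i\<in>UNIV. pd l (pd i w) y * pd i (monomial I) xi)"
  by (simp add: sym)
 also have "(\<Sum>i\<in>UNIV. \<Sum>j\<in>UNIV. if i = l then pd l (pd j w) y * pd j (monomial I) xi else 0) =
   (\<Sum>j\<in>UNIV. pd l (pd j w) y * pd j (monomial I) xi)"
  by (subst sum.swap) simp
 finally have r2: "(\<Sum>i\<in>UNIV. \<Sum>j\<in>UNIV. pd i (pd j w) y * pd i (pd j (monomial (l # I))) xi) =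
   2 * (\<Sum>i\<in>UNIV. pd l (pd i w) y * pd i (monomial I) xi) +
   cor (xi $ l) * (\<Sum>i\<in>UNIV. \<Sum>j\<in>UNIV. pd i (pd j w) y * pd i (pd j (monomial I)) xi)" by simp
 have "tsyms (l # I) (%z _. w z) y xi = pd l (%z. tsyms I (%z _. w z) z xi) y + cor (xi $ l) * tsyms I (%z _. w z) y xi"
  by (simp only: tsyms_Cons tsym_def)
 then show ?case
  unfolding p unfolding r1 r2 unfolding Cons.IH[of y] monomial_Cons by (simp add: algebra_simps add_divide_distrib)
qed

lemma normal_order_quadratic:
 assumes S: "open Om" "y \<in> Om" "b \<in> LS (deg_le k) Om"
  and w: "smooth_on UNIV w" and w3: "!!i j l y. pd i (pd j (pd l w)) y = 0"
 shows "normal_order k b (%z. w z * ef xi z) y = (w y * b y xi + (\<Sum>i\<in>UNIV. pd i w y * pd i (b y) xi)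
  + (\<Sum>i\<in>UNIV. \<Sum>j\<in>UNIV. pd i (pd j w) y * pd i (pd j (b y)) xi) / 2) * ef xi y"
proof -
 let ?c = "%I. fibre_coeff I b y"
 have dm: "pd i (monomial I) differentiable (at xi)" for i I and xi :: "real^'a"
  by (rule smooth_on_differentiable[OF smooth_on_pd[OF smooth_on_monomial[OF open_UNIV]] UNIV_I])
 have by0: "b y = (%xi. \<Sum>I\<in>deg_le k. ?c I * monomial I xi)" using symbol_fibre_coeff[OF S(3,2)] by auto
 have b1: "pd i (b y) = (%xi. \<Sum>I\<in>deg_le k. ?c I * pd i (monomial I) xi)" for i
  by (subst by0) (auto simp: pd_sum pd_cmult differentiable_mult')
 have b2: "pd i (pd j (b y)) xi = (\<Sum>I\<in>deg_le k. ?c I * pd i (pd j (monomial I)) xi)" for i j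
  unfolding b1 by (simp add: pd_sum pd_cmult differentiable_mult' dm)
 have "(\<Sum>I\<in>deg_le k. ?c I * tsyms I (%z _. w z) y xi) = w y * b y xi + (\<Sum>i\<in>UNIV. pd i w y * pd i (b y) xi)
  + (\<Sum>i\<in>UNIV. \<Sum>j\<in>UNIV. pd i (pd j w) y * pd i (pd j (b y)) xi) / 2"
 proof -
  have 1: "(\<Sum>I\<in>deg_le k. ?c I * (w y * monomial I xi)) = w y * b y xi"
   by (simp add: by0 sum_distrib_left mult_ac)
  have 2: "(\<Sum>I\<in>deg_le k. ?c I * (\<Sum>i\<in>UNIV. pd i w y * pd i (monomial I) xi)) = (\<Sum>i\<in>UNIV. pd i w y * pd i (b y) xi)"
   unfolding b1 sum_distrib_left by (subst sum.swap) (simp add: mult_ac)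
  have 3: "(\<Sum>I\<in>deg_le k. ?c I * (\<Sum>i\<in>UNIV. \<Sum>j\<in>UNIV. pd i (pd j w) y * pd i (pd j (monomial I)) xi)) =
   (\<Sum>i\<in>UNIV. \<Sum>j\<in>UNIV. pd i (pd j w) y * pd i (pd j (b y)) xi)"
   unfolding b2 sum_distrib_left
   by (subst sum.swap, rule sum.cong[OF refl], subst sum.swap) (simp add: mult_ac)
  show ?thesis unfolding tsyms_quadratic[OF w w3] using 1 2 3
   by (simp add: distrib_left sum.distrib sum_divide_distrib[symmetric])
 qed
 with normal_order_ef[OF S(1) smooth_on_subset[OF w] S(2), of k b xi] show ?thesis by simp
qed

section \<open>Densities and symbols on a conformal atlas\<close>

text \<open>Expansions over lists are not unique, so local ones need not agree on overlaps. The
  symmetric coefficients are determined by \<open>p\<close> and therefore glue.\<close>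

lemma LS_local:
 assumes "!!y. y \<in> Om ==> \<exists>T. open T \<and> y \<in> T \<and> p \<in> LS (deg_le k) T"
 shows "p \<in> LS (deg_le k) Om"
proof (rule local_symbolsI[of _ "%I. fibre_coeff I p"])
 show "smooth_on Om (fibre_coeff I p)" for I
 proof (rule smooth_on_local)
  fix y assume "y \<in> Om"
  then obtain T where "open T" "y \<in> T" "p \<in> LS (deg_le k) T" using assms by blast
  then show "\<exists>T v. open T \<and> y \<in> T \<and> smooth_on T v \<and> (\<forall>z\<in>T. fibre_coeff I p z = v z)"
   using fibre_coeff_smooth[of T p] by blast
 qed
 fix y xi assume "y \<in> Om"
 then obtain T where "open T" "y \<in> T" "p \<in> LS (deg_le k) T" using assms by blast
 then show "p y xi = (\<Sum>I\<in>deg_le k. fibre_coeff I p y * monomial I xi)" using symbol_fibre_coeff by blast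
qed

lemma LS_monomial_linear:
 assumes S: "open Om" and M: "!!i j. smooth_on Om (%z. M z $ i $ j :: real)"
 shows "(%z xi. monomial I (M z *v xi)) \<in> LS (deg_eq (length I)) Om"
proof (induction I)
 case Nil
 have "monomial [] = (%_ :: real^'a. 1)" by auto
 then show ?case using LS_monomial[of "deg_eq 0" "[] :: 'a list" Om] by simp
next
 case (Cons i I)
 have 1: "(%z xi. cor ((M z *v xi) $ i)) \<in> LS (deg_eq 1) Om"
 proof -
  have "(%z xi. \<Sum>j\<in>UNIV. cor (M z $ i $ j) * monomial [j] xi) \<in> LS (deg_eq 1) Om"
   by (intro LS_sum LS_scale LS_monomial S smooth_on_of_real M) auto
  then show ?thesis by (simp add: matrix_vector_mult_def monomial_Cons)
 qed
 show ?case unfolding monomial_Cons by (rule LS_mult[OF S _ _ 1 Cons]) auto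
qed

lemma LS_compose:
 fixes Phi :: "real^'n::finite => real^'n"
 assumes S: "open Om'" and p: "p \<in> LS (deg_le k) Om" and Phi: "!!z. z \<in> Om' ==> Phi z \<in> Om"
  "!!j. smooth_on Om' (%z. Phi z $ j)" and M: "!!i j. smooth_on Om' (%z. M z $ i $ j)"
 shows "(%z xi. p (Phi z) (M z *v xi)) \<in> LS (deg_le k) Om'"
proof -
 obtain a where a: "!!I. smooth_on Om (a I)" "!!y xi. y \<in> Om ==> p y xi = (\<Sum>I\<in>deg_le k. a I y * monomial I xi)"
  using local_symbolsE[OF p] by blast
 have "(%z xi. \<Sum>I\<in>deg_le k. a I (Phi z) * monomial I (M z *v xi)) \<in> LS (deg_le k) Om'"
  by (intro LS_sum LS_scale S smooth_on_compose[OF S Phi a(1)]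
    LS_mono[OF S _ _ LS_monomial_linear[OF S M]]) auto
 then show ?thesis
  using LS_cong[of Om' "%z xi. p (Phi z) (M z *v xi)" "%z xi. \<Sum>I\<in>deg_le k. a I (Phi z) * monomial I (M z *v xi)"]
   a(2)[OF Phi(1)] by simp
qed

abbreviation smooth_field :: "(real^'n::finite => real^'n) => bool" where
 "smooth_field X \<equiv> \<forall>j. smooth_on UNIV (%x. X x $ j)"

lemma smooth_field_pd:
 assumes "smooth_field X"
 shows "pd i X y $ j = pd i (%x. X x $ j) y"
proof (rule pd_vec_nth)
 have "(%y. X y $ j) differentiable (at y)" for j
  using assms smooth_on_differentiable[OF _ UNIV_I] by blast
 from has_derivative_vec[OF this] show "X differentiable (at y)" unfolding differentiable_def by blast
qed

lemma smooth_on_lie_density: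
 assumes "open Om" "smooth_field X" "smooth_on Om u"
 shows "smooth_on Om (lie_density lam X u)"
proof -
 have X: "smooth_on Om (%x. X x $ j)" for j using assms(2) smooth_on_subset[of UNIV] by blast
 have "lie_density lam X u = (%y. (\<Sum>i\<in>UNIV. cor (X y $ i) * pd i u y) +
   cor (lam * (\<Sum>i\<in>UNIV. pd i (%x. X x $ i) y)) * u y)"
  by (simp add: lie_density_def[abs_def] smooth_field_pd[OF assms(2)])
 then show ?thesis
  by (auto intro!: smooth_on_add smooth_on_mult smooth_on_sum smooth_on_of_real smooth_on_pd assms(1,3) X
    simp del: of_real_sum of_real_mult)
qed

lemma LS_lie:
 assumes "open Om" "smooth_field X" "p \<in> LS (deg_le k) Om"
 shows "lie_symbol X p \<in> LS (deg_le k) Om"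
proof -
 have X: "smooth_on Om (%x. X x $ j)" for j using assms(2) smooth_on_subset[of UNIV] by blast
 have L: "(%y xi. cor (xi $ j) * pd i (p y) xi) \<in> LS (deg_le k) Om" for i j
 \<comment> \<open>Degree 0 is separate: the fibre derivative then has no terms at all, while
   \<open>deg_le (k - 1)\<close> would still admit constants, which become linear after
   multiplication by \<open>xi_j\<close>.\<close>
 proof (cases k)
  case 0
  have "(%y xi. pd i (p y) xi) \<in> LS {} Om"
   by (rule LS_pd_fibre[OF assms(1) _ _ assms(3)]) (use 0 in auto)
  from LS_coord_mult[OF assms(1) finite_length_le _ this, of j k] show ?thesis by simp
 next
  case (Suc m)
  have "(%y xi. pd i (p y) xi) \<in> LS (deg_le m) Om"
   by (rule LS_pd_fibre[OF assms(1) _ _ assms(3)]) (use Suc length_del_nth in fastforce)+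
  from LS_coord_mult[OF assms(1) finite_length_le _ this, of j k] Suc show ?thesis by simp
 qed
 have "lie_symbol X p = (%y xi. (\<Sum>i\<in>UNIV. cor (X y $ i) * pd i (%z. p z xi) y) -
   (\<Sum>i\<in>UNIV. \<Sum>j\<in>UNIV. cor (pd i (%x. X x $ j) y) * (cor (xi $ j) * pd i (p y) xi)))"
  by (auto simp: lie_symbol_def[abs_def] smooth_field_pd[OF assms(2)] mult.assoc)
 then show ?thesis
  by (simp add: LS_diff LS_sum LS_scale smooth_on_of_real X smooth_on_pd
    LS_pd assms(1,3) L)
qed

section \<open>Charts, transition maps and Jacobians\<close>

locale conf_atlas =
 fixes g :: "real^'n^'n::finite"
  and \<A> :: "('m::{t2_space, second_countable_topology}, 'n) chart set"
 assumes atlas: "conformal_atlas g \<A>"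
begin

abbreviation (input) "SL \<equiv> symbols_le \<A>"
abbreviation (input) "SY \<equiv> symbols \<A>"
abbreviation (input) "dens \<equiv> densities \<A>"

abbreviation pt :: "('m, 'n) chart => real^'n => 'm" where
 "pt c \<equiv> inv_into (fst c) (snd c)"

lemma chart_open: "c \<in> \<A> ==> open (fst c)"
 and chart_homeo: "c \<in> \<A> ==> homeomorphism (fst c) (snd c ` fst c) (snd c) (pt c)"
 and chart_image_open: "c \<in> \<A> ==> open (snd c ` fst c)"
 using atlas unfolding conformal_atlas_def by auto

lemma chart_restrict: "c \<in> \<A> ==> open V ==> V \<subseteq> fst c ==> (V, snd c) \<in> \<A>"
proof -
 assume c: "c \<in> \<A>" and V: "open V" "V \<subseteq> fst c"
 have "\<forall>c\<in>\<A>. \<forall>V. open V \<and> V \<subseteq> fst c \<longrightarrow> (V, snd c) \<in> \<A>"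
  using atlas by (simp add: conformal_atlas_def case_prod_beta)
 with c V show ?thesis by blast
qed

lemma chart_cover: obtains c where "c \<in> \<A>" "x \<in> fst c"
proof -
 have "(\<Union>c\<in>\<A>. fst c) = UNIV" using atlas by (simp add: conformal_atlas_def case_prod_beta)
 then have "x \<in> (\<Union>c\<in>\<A>. fst c)" by simp
 with that show thesis by blast
qed

lemma adapted_open: "W \<in> adapted_domains \<A> ==> open W"
 using chart_open by (auto simp: adapted_domains_def)

lemma pt_chart [simp]: "c \<in> \<A> ==> x \<in> fst c ==> pt c (snd c x) = x"
 using chart_homeo by (meson homeomorphism_apply1)

lemma mem_cdom: "y \<in> cdom c W \<longleftrightarrow> (\<exists>x. x \<in> fst c \<and> x \<in> W \<and> y = snd c x)"
 by (auto simp: cdom_def)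

lemma cdomE:
 assumes "c \<in> \<A>" "y \<in> cdom c W"
 obtains x where "x \<in> fst c" "x \<in> W" "y = snd c x" "pt c y = x"
 using assms by (auto simp: mem_cdom)

lemma cdom_induct:
 assumes "y \<in> cdom c W" "c \<in> \<A>" "!!x. x \<in> fst c ==> x \<in> W ==> Pr (snd c x)"
 shows "Pr y"
 using assms by (auto simp: mem_cdom)

lemma chart_mem_cdom [simp]: "c \<in> \<A> ==> x \<in> fst c ==> snd c x \<in> cdom c W \<longleftrightarrow> x \<in> W"
 unfolding mem_cdom by (metis pt_chart)

lemma cdom_mono: "W \<subseteq> W' ==> cdom c W \<subseteq> cdom c W'"
 by (auto simp: cdom_def)

lemma cdom_fst [simp]: "cdom c (fst c) = img c"
 by (simp add: cdom_def)

lemma open_cdom: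
 assumes "c \<in> \<A>" "open W"
 shows "open (cdom c W)"
proof -
 have h: "homeomorphism (fst c) (snd c ` fst c) (snd c) (pt c)" by (rule chart_homeo[OF assms(1)])
 have "openin (top_of_set (fst c)) (fst c \<inter> W)" using assms(2) by (simp add: openin_open_Int)
 then have "openin (top_of_set (snd c ` fst c)) (snd c ` (fst c \<inter> W))"
  using homeomorphism_imp_open_map[OF h] by blast
 then show ?thesis using chart_image_open[OF assms(1)] unfolding cdom_def by (simp add: openin_open_eq)
qed

lemma transition_chart [simp]: "c \<in> \<A> ==> x \<in> fst c ==> transition c c' (snd c x) = snd c' x"
 by (simp add: transition_def)

text \<open>The two extra coordinates of a null lift add up to 1. Hence the factor
  \<open>\<mu>\<close> is recovered as the sum of these coordinates of
  \<open>T *v null_lift g y\<close>, and the transition map is a quotient of polynomials with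
  nonvanishing denominator.\<close>

lemma transition_smooth:
 assumes c: "c \<in> \<A>" and c': "c' \<in> \<A>"
 shows "smooth_on (cdom c (fst c')) (%y. transition c c' y $ j)"
proof -
 let ?D = "cdom c (fst c')"
 have S: "open ?D" by (rule open_cdom[OF c chart_open[OF c']])
 have "\<forall>c\<in>\<A>. \<forall>c'\<in>\<A>. \<exists>T\<in>special_orthogonal g. \<forall>x\<in>fst c \<inter> fst c'. conformal_map_by g T (snd c x) (snd c' x)"
  using atlas by (simp add: conformal_atlas_def case_prod_beta)
 with c c' obtain T where T: "!!x. x \<in> fst c \<inter> fst c' ==> conformal_map_by g T (snd c x) (snd c' x)" by blast
 let ?N = "%y a. (T *v null_lift g y) $ a"
 let ?m = "%y. ?N y (Inr True) + ?N y (Inr False)"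
 have nl: "smooth_on ?D (%y. null_lift g y $ a)" for a
 proof -
  have q: "smooth_on ?D (%y. (g *v y) \<bullet> y)"
   unfolding inner_vec_def matrix_vector_mult_def
   by (simp add: smooth_on_sum smooth_on_mult S)
  show ?thesis
  proof (cases a)
   case (Inl i)
   then show ?thesis by (simp add: null_lift_def S)
  next
   case (Inr s)
   have "smooth_on ?D (%y. (if s then 1 - (g *v y) \<bullet> y else 1 + (g *v y) \<bullet> y) * (1 / 2))"
    by (rule smooth_on_mult[OF S]) (cases s, simp_all add: smooth_on_add smooth_on_diff S q)
   then show ?thesis using Inr by (simp add: null_lift_def)
  qed
 qed
 have N: "smooth_on ?D (%y. ?N y a)" for a
  unfolding matrix_vector_mult_def by (simp add: smooth_on_sum smooth_on_cmult S nl)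
 have eq: "?m y \<noteq> 0 \<and> transition c c' y $ j = ?N y (Inl j) * inverse (?m y)" if y: "y \<in> ?D" for y
 proof -
  obtain x where x: "x \<in> fst c" "x \<in> fst c'" "y = snd c x" using cdomE[OF c y] by blast
  obtain \<mu> where \<mu>: "\<mu> \<noteq> 0" "T *v null_lift g y = \<mu> *\<^sub>R null_lift g (snd c' x)"
   using T[of x] x unfolding conformal_map_by_def by auto
  have "?m y = \<mu>" unfolding \<mu>(2) by (simp add: null_lift_def field_simps)
  then show ?thesis using \<mu> x c by (simp add: null_lift_def)
 qed
 have "smooth_on ?D (%y. ?N y (Inl j) * inverse (?m y))"
  using eq by (intro smooth_on_mult smooth_on_inverse smooth_on_add N S) blast
 then show ?thesis
  using smooth_on_cong[OF S, of "%y. transition c c' y $ j" "%y. ?N y (Inl j) * inverse (?m y)"] eq by simp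
qed

lemma transition_differentiable:
 assumes "c \<in> \<A>" "c' \<in> \<A>" "y \<in> cdom c (fst c')"
 shows "transition c c' differentiable (at y)"
 using has_derivative_vec[of "transition c c'" y] smooth_on_differentiable[OF transition_smooth[OF assms(1,2)] assms(3)]
 unfolding differentiable_def by blast

lemma jac_entry:
 assumes "c \<in> \<A>" "c' \<in> \<A>" "y \<in> cdom c (fst c')"
 shows "jac c c' y $ i $ j = pd j (%y. transition c c' y $ i) y"
 using pd_vec_nth[OF transition_differentiable[OF assms], of j i]
 by (simp add: jac_def matrix_def pd_def)

lemma jac_smooth:
 assumes "c \<in> \<A>" "c' \<in> \<A>"
 shows "smooth_on (cdom c (fst c')) (%y. jac c c' y $ i $ j)"
 using smooth_on_cong[OF open_cdom[OF assms(1) chart_open[OF assms(2)]], of "%y. jac c c' y $ i $ j"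
   "pd j (%y. transition c c' y $ i)"] jac_entry[OF assms] smooth_on_pd[OF transition_smooth[OF assms]] by simp

lemma jac_chain:
 assumes c: "c \<in> \<A>" "c' \<in> \<A>" "c'' \<in> \<A>" and x: "x \<in> fst c" "x \<in> fst c'" "x \<in> fst c''"
 shows "jac c c'' (snd c x) = jac c' c'' (snd c' x) ** jac c c' (snd c x)"
proof -
 let ?y = "snd c x"
 have d: "transition c c' differentiable (at ?y)" "transition c' c'' differentiable (at (transition c c' ?y))"
  using x c by (auto intro!: transition_differentiable)
 have "frechet_derivative (transition c c'') (at ?y) = frechet_derivative (transition c' c'' \<circ> transition c c') (at ?y)"
 proof (rule frechet_derivative_transform_within_open)
  show "transition c c'' differentiable (at ?y)" using x c by (auto intro!: transition_differentiable)
  show "open (cdom c (fst c' \<inter> fst c''))" using open_cdom[OF c(1)] chart_open c by (simp add: open_Int)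
  show "?y \<in> cdom c (fst c' \<inter> fst c'')" using x c by simp
  show "transition c c'' z = (transition c' c'' \<circ> transition c c') z" if "z \<in> cdom c (fst c' \<inter> fst c'')" for z
   using that c(1) by (rule cdom_induct) (simp add: c)
 qed
 also have "... = frechet_derivative (transition c' c'') (at (transition c c' ?y)) \<circ> frechet_derivative (transition c c') (at ?y)"
  by (rule frechet_derivative_compose[OF d])
 finally show ?thesis
  unfolding jac_def using x c d
  by (simp add: matrix_compose linear_frechet_derivative)
qed

lemma jac_same:
 assumes "c \<in> \<A>" "c' \<in> \<A>" "snd c' = snd c" and x: "x \<in> fst c" "x \<in> fst c'"
 shows "jac c c' (snd c x) = mat 1"
proof -
 have "frechet_derivative (%z. z) (at (snd c x)) = frechet_derivative (transition c c') (at (snd c x))"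
 proof (rule frechet_derivative_transform_within_open)
  show "open (img c)" by (rule open_cdom[OF assms(1)]) simp
  show "snd c x \<in> img c" using x assms by simp
  show "z = transition c c' z" if "z \<in> img c" for z
   using that assms(1) by (rule cdom_induct) (simp add: assms)
 qed simp
 then have "frechet_derivative (transition c c') (at (snd c x)) = (%z. z)" by simp
 then show ?thesis unfolding jac_def by (simp add: matrix_id_mat_1[unfolded id_def])
qed

lemma jac_det_nonzero:
 assumes "c \<in> \<A>" "c' \<in> \<A>" "x \<in> fst c" "x \<in> fst c'"
 shows "det (jac c c' (snd c x)) \<noteq> 0"
proof -
 have "jac c' c (snd c' x) ** jac c c' (snd c x) = mat 1"
  using jac_chain[of c c' c x] jac_same[of c c x] assms by simp
 then have "det (jac c' c (snd c' x)) * det (jac c c' (snd c x)) = 1"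
  by (metis det_I det_mul)
 then show ?thesis by auto
qed

lemma smooth_on_det:
 assumes "open S" "!!i j. smooth_on S (%y. M y $ i $ j :: real)"
 shows "smooth_on S (%y. det (M y :: real^'n^'n))"
 unfolding det_def by (intro smooth_on_sum smooth_on_cmult smooth_on_prod assms)

lemma jac_weight_smooth:
 assumes "c \<in> \<A>" "c' \<in> \<A>"
 shows "smooth_on (cdom c (fst c')) (%y. \<bar>det (jac c c' y)\<bar> powr lam)"
proof (rule smooth_on_abs_powr)
 show S: "open (cdom c (fst c'))" by (rule open_cdom[OF assms(1) chart_open[OF assms(2)]])
 show "smooth_on (cdom c (fst c')) (%y. det (jac c c' y))" by (intro smooth_on_det S jac_smooth assms)
 show "det (jac c c' y) \<noteq> 0" if "y \<in> cdom c (fst c')" for y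
  using that assms(1) by (rule cdom_induct) (rule jac_det_nonzero[OF assms])
qed

lemma densitiesI:
 assumes "!!c y. c \<notin> \<A> \<or> y \<notin> cdom c W ==> f c y = 0" "!!c. c \<in> \<A> ==> smooth_on (cdom c W) (f c)"
  "!!c c' x. [|c \<in> \<A>; c' \<in> \<A>; x \<in> fst c; x \<in> fst c'; x \<in> W|] ==>
    f c (snd c x) = cor (\<bar>det (jac c c' (snd c x))\<bar> powr lam) * f c' (snd c' x)"
 shows "f \<in> dens lam W"
 unfolding densities_def using assms by blast

lemma
 assumes "f \<in> dens lam W"
 shows density_zero: "c \<notin> \<A> \<or> y \<notin> cdom c W ==> f c y = 0"
  and density_smooth: "c \<in> \<A> ==> smooth_on (cdom c W) (f c)"
  and density_law: "[|c \<in> \<A>; c' \<in> \<A>; x \<in> fst c; x \<in> fst c'; x \<in> W|] ==>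
    f c (snd c x) = cor (\<bar>det (jac c c' (snd c x))\<bar> powr lam) * f c' (snd c' x)"
 using assms unfolding densities_def by blast+

lemma symbols_leI:
 assumes "!!c y xi. c \<notin> \<A> \<or> y \<notin> cdom c W ==> P c y xi = 0" "!!c. c \<in> \<A> ==> P c \<in> LS (deg_le k) (cdom c W)"
  "!!c c' x xi. [|c \<in> \<A>; c' \<in> \<A>; x \<in> fst c; x \<in> fst c'; x \<in> W|] ==>
    P c (snd c x) (transpose (jac c c' (snd c x)) *v xi) = P c' (snd c' x) xi"
 shows "P \<in> SL k W"
 unfolding symbols_le_def using assms by blast

lemma
 assumes "P \<in> SL k W"
 shows symbol_zero: "c \<notin> \<A> \<or> y \<notin> cdom c W ==> P c y xi = 0"
  and symbol_local: "c \<in> \<A> ==> P c \<in> LS (deg_le k) (cdom c W)"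
  and symbol_law: "[|c \<in> \<A>; c' \<in> \<A>; x \<in> fst c; x \<in> fst c'; x \<in> W|] ==>
    P c (snd c x) (transpose (jac c c' (snd c x)) *v xi) = P c' (snd c' x) xi"
 using assms unfolding symbols_le_def by blast+

lemma symbolsE:
 assumes "P \<in> SY W"
 obtains k where "P \<in> SL k W"
 using assms by (auto simp: symbols_def)

section \<open>Densities and symbols prescribed in one chart\<close>

lemma density_from_chart:
 assumes "c \<in> \<A>" "y \<in> img c"
 shows "density_from \<A> lam c u c y = u y"
proof -
 obtain x where x: "x \<in> fst c" "y = snd c x" using cdomE[OF assms] by blast
 then show ?thesis using assms jac_same[of c c x] by (simp add: density_from_def)
qed

lemma density_from_law:
 assumes c: "c \<in> \<A>" "c' \<in> \<A>" "c'' \<in> \<A>" and x: "x \<in> fst c'" "x \<in> fst c''"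
 shows "density_from \<A> lam c u c' (snd c' x) =
  cor (\<bar>det (jac c' c'' (snd c' x))\<bar> powr lam) * density_from \<A> lam c u c'' (snd c'' x)"
proof (cases "x \<in> fst c")
 case True
 have "det (jac c' c (snd c' x)) = det (jac c'' c (snd c'' x)) * det (jac c' c'' (snd c' x))"
  using jac_chain[of c' c'' c x] c x True by (simp add: det_mul)
 then have "\<bar>det (jac c' c (snd c' x))\<bar> powr lam = \<bar>det (jac c' c'' (snd c' x))\<bar> powr lam * \<bar>det (jac c'' c (snd c'' x))\<bar> powr lam"
  by (simp add: abs_mult powr_mult mult.commute)
 then show ?thesis using c x True by (simp add: density_from_def)
next
 case False
 then show ?thesis using c x by (simp add: density_from_def)
qed

lemma density_from_smooth:
 assumes c: "c \<in> \<A>" "c' \<in> \<A>" and u: "smooth_on (img c) u"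
 shows "smooth_on (cdom c' (fst c)) (density_from \<A> lam c u c')"
proof -
 let ?D = "cdom c' (fst c)"
 have S: "open ?D" by (rule open_cdom[OF c(2) chart_open[OF c(1)]])
 have t: "transition c' c z \<in> img c" if "z \<in> ?D" for z
  using that c(2) by (rule cdom_induct) (simp add: c)
 have "smooth_on ?D (%z. cor (\<bar>det (jac c' c z)\<bar> powr lam) * u (transition c' c z))"
  by (intro smooth_on_mult S smooth_on_of_real jac_weight_smooth c smooth_on_compose[OF S t _ u] transition_smooth)
 then show ?thesis
  using smooth_on_cong[OF S, of "density_from \<A> lam c u c'"
   "%z. cor (\<bar>det (jac c' c z)\<bar> powr lam) * u (transition c' c z)"] c
  by (simp add: density_from_def)
qed

lemma symbol_from_chart:
 assumes "c \<in> \<A>" "y \<in> img c"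
 shows "symbol_from \<A> c p c y xi = p y xi"
proof -
 obtain x where x: "x \<in> fst c" "y = snd c x" using cdomE[OF assms] by blast
 then show ?thesis using assms jac_same[of c c x] by (simp add: symbol_from_def transpose_mat)
qed

lemma symbol_from_law:
 assumes c: "c \<in> \<A>" "c' \<in> \<A>" "c'' \<in> \<A>" and x: "x \<in> fst c'" "x \<in> fst c''"
 shows "symbol_from \<A> c p c' (snd c' x) (transpose (jac c' c'' (snd c' x)) *v xi) = symbol_from \<A> c p c'' (snd c'' x) xi"
proof (cases "x \<in> fst c")
 case True
 have "jac c c'' (snd c x) = jac c' c'' (snd c' x) ** jac c c' (snd c x)"
  using jac_chain[of c c' c'' x] c x True by simp
 then show ?thesis using c x True by (simp add: symbol_from_def matrix_transpose_mul matrix_vector_mul_assoc del: transpose_matrix_vector)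
next
 case False
 then show ?thesis using c x by (simp add: symbol_from_def)
qed

lemma symbol_from_local:
 assumes c: "c \<in> \<A>" "c' \<in> \<A>" and p: "p \<in> LS (deg_le k) (img c)"
 shows "symbol_from \<A> c p c' \<in> LS (deg_le k) (cdom c' (fst c))"
proof -
 let ?D = "cdom c' (fst c)"
 have S: "open ?D" by (rule open_cdom[OF c(2) chart_open[OF c(1)]])
 have t: "transition c' c z \<in> cdom c (fst c')" if "z \<in> ?D" for z
  using that c(2) by (rule cdom_induct) (simp add: c)
 have "(%z xi. p (transition c' c z) (transpose (jac c c' (transition c' c z)) *v xi)) \<in> LS (deg_le k) ?D"
 proof (rule LS_compose[OF S p])
  show "transition c' c z \<in> img c" if "z \<in> ?D" for z using t[OF that] cdom_mono[of "fst c'" UNIV c] by blast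
  show "smooth_on ?D (%z. transition c' c z $ j)" for j by (rule transition_smooth[OF c(2,1)])
  show "smooth_on ?D (%z. transpose (jac c c' (transition c' c z)) $ i $ j)" for i j
   unfolding transpose_def using smooth_on_compose[OF S t transition_smooth[OF c(2,1)] jac_smooth[OF c, of j i]] by simp
 qed
 then show ?thesis
  using LS_cong[of ?D "symbol_from \<A> c p c'"
    "%z xi. p (transition c' c z) (transpose (jac c c' (transition c' c z)) *v xi)"] c
  by (simp add: symbol_from_def)
qed

lemma density_from_mem:
 assumes c: "c \<in> \<A>" and u: "smooth_on (img c) u"
 shows "density_from \<A> lam c u \<in> dens lam (fst c)"
proof (rule densitiesI)
 show "density_from \<A> lam c u c' y = 0" if "c' \<notin> \<A> \<or> y \<notin> cdom c' (fst c)" for c' y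
  using that by (auto simp: density_from_def)
qed (rule density_from_smooth[OF c _ u] density_from_law[OF c]; assumption)+

lemma symbol_from_mem:
 assumes c: "c \<in> \<A>" and p: "p \<in> LS (deg_le k) (img c)"
 shows "symbol_from \<A> c p \<in> SL k (fst c)"
proof (rule symbols_leI)
 show "symbol_from \<A> c p c' y xi = 0" if "c' \<notin> \<A> \<or> y \<notin> cdom c' (fst c)" for c' y xi
  using that by (auto simp: symbol_from_def)
qed (rule symbol_from_local[OF c _ p] symbol_from_law[OF c]; assumption)+

lemma density_eqI:
 assumes "c \<in> \<A>" "f \<in> dens lam (fst c)" "h \<in> dens lam (fst c)"
  "!!y. y \<in> img c ==> f c y = h c y"
 shows "f = h"
proof (intro ext)
 fix c' z
 show "f c' z = h c' z"
 proof (cases "c' \<in> \<A> \<and> z \<in> cdom c' (fst c)")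
  case True
  then obtain x where x: "x \<in> fst c'" "x \<in> fst c" "z = snd c' x" using cdomE by blast
  then show ?thesis
   using density_law[OF assms(2), of c' c x] density_law[OF assms(3), of c' c x] True assms(1,4) by simp
 next
  case False
  then show ?thesis using density_zero[OF assms(2)] density_zero[OF assms(3)] by metis
 qed
qed

lemma symbol_eqI:
 assumes "c \<in> \<A>" "P \<in> SY (fst c)" "R \<in> SY (fst c)"
  "!!y xi. y \<in> img c ==> P c y xi = R c y xi"
 shows "P = R"
proof (intro ext)
 fix c' z xi
 show "P c' z xi = R c' z xi"
 proof (cases "c' \<in> \<A> \<and> z \<in> cdom c' (fst c)")
  case True
  then obtain x where x: "x \<in> fst c'" "x \<in> fst c" "z = snd c' x" using cdomE by blast
  have "v c' (snd c' x) xi = v c (snd c x) (transpose (jac c c' (snd c x)) *v xi)"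
   if v: "v \<in> SY (fst c)" for v
  proof -
   obtain k where "v \<in> SL k (fst c)" using symbolsE[OF v] by blast
   from symbol_law[OF this assms(1) _ x(2,1,2), of xi] show ?thesis using True by simp
  qed
  from this[OF assms(2)] this[OF assms(3)] show ?thesis using x assms(1,4) by simp
 next
  case False
  have z0: "v c' z xi = 0" if v: "v \<in> SY (fst c)" for v
  proof -
   obtain k where "v \<in> SL k (fst c)" using symbolsE[OF v] by blast
   from symbol_zero[OF this, of c' z xi] show ?thesis using False by blast
  qed
  show ?thesis using z0[OF assms(2)] z0[OF assms(3)] by simp
 qed
qed

text \<open>A bump in the chart extends by zero to a smooth function on the manifold: its support is
  the homeomorphic image of a compact ball, hence closed in a Hausdorff space, so the complement of
  \<open>K\<close> is an open set on which the extension is zero.\<close>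

lemma bump_function:
 assumes c: "c \<in> \<A>" and W: "open W" and y0: "y0 \<in> cdom c W"
 obtains \<beta> :: "'m => real" and K S where
  "!!c'. c' \<in> \<A> ==> smooth_on (img c') (%y. \<beta> (pt c' y))"
  "closed K" "K \<subseteq> fst c \<inter> W" "!!x. x \<notin> K ==> \<beta> x = 0"
  "open S" "y0 \<in> S" "S \<subseteq> cdom c W" "!!y. y \<in> S ==> \<beta> (pt c y) = 1"
proof -
 obtain r where r: "r > 0" "cball y0 r \<subseteq> cdom c W"
  using open_contains_cball[of "cdom c W"] open_cdom[OF c W] y0 by blast
 obtain b :: "real^'n => real" where b: "smooth_on UNIV b" "!!y. dist y y0 <= r / 2 ==> b y = 1" "!!y. dist y y0 \<ge> r ==> b y = 0"
  by (rule bump_exists[OF r(1), of y0]) blast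
 define \<beta> where "\<beta> x = (if x \<in> fst c then b (snd c x) else 0)" for x
 define K where "K = pt c ` cball y0 r"
 have sub: "cball y0 r \<subseteq> snd c ` fst c" using r(2) by (auto simp: cdom_def)
 have "continuous_on (cball y0 r) (pt c)"
  using chart_homeo[OF c] continuous_on_subset[OF _ sub] by (auto simp: homeomorphism_def)
 then have K1: "closed K" unfolding K_def by (intro compact_imp_closed compact_continuous_image compact_cball)
 have K2: "K \<subseteq> fst c \<inter> W"
 proof
  fix x assume "x \<in> K"
  then obtain y where "y \<in> cdom c W" "x = pt c y" using r(2) by (auto simp: K_def)
  then show "x \<in> fst c \<inter> W" using cdomE[OF c] by blast
 qed
 have K3: "\<beta> x = 0" if "x \<notin> K" for x
 proof (cases "x \<in> fst c")
  case True
  have "snd c x \<notin> cball y0 r" using that True pt_chart[OF c True] unfolding K_def by (metis imageI)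
  then have "b (snd c x) = 0" by (intro b(3)) (simp add: dist_commute)
  then show ?thesis by (simp add: \<beta>_def)
 qed (simp add: \<beta>_def)
 have sm: "smooth_on (img c') (%y. \<beta> (pt c' y))" if c': "c' \<in> \<A>" for c'
 proof (rule smooth_on_local)
  fix y assume "y \<in> img c'"
  then obtain x where x: "x \<in> fst c'" "y = snd c' x" using cdomE[OF c'] by blast
  show "\<exists>T v. open T \<and> y \<in> T \<and> smooth_on T v \<and> (\<forall>z\<in>T. \<beta> (pt c' z) = v z)"
  proof (cases "x \<in> fst c")
   case True
   let ?T = "cdom c' (fst c)"
   have T: "open ?T" by (rule open_cdom[OF c' chart_open[OF c]])
   have "smooth_on ?T (%z. b (transition c' c z))"
    by (rule smooth_on_compose[OF T _ _ b(1)]) (auto intro: transition_smooth c c')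
   moreover have "\<beta> (pt c' z) = b (transition c' c z)" if "z \<in> ?T" for z
    using that c' by (rule cdom_induct) (simp add: c' \<beta>_def)
   ultimately show ?thesis using T x True c' by (intro exI[of _ ?T] exI[of _ "%z. b (transition c' c z)"]) simp
  next
   case False
   let ?T = "cdom c' (- K)"
   have "open ?T" by (rule open_cdom[OF c' open_Compl[OF K1]])
   moreover have "\<beta> (pt c' z) = 0" if "z \<in> ?T" for z
    using that c' by (rule cdom_induct) (simp add: c' K3)
   moreover have "y \<in> ?T" using x False K2 c' by auto
   ultimately show ?thesis by (intro exI[of _ ?T] exI[of _ "%_. 0"]) simp
  qed
 qed
 show ?thesis
 proof (rule that[of \<beta> K "ball y0 (r / 2)", OF sm K1 K2 K3])
  show "ball y0 (r / 2) \<subseteq> cdom c W" using r by (auto simp: subset_iff)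
  show "\<beta> (pt c y) = 1" if "y \<in> ball y0 (r / 2)" for y
  proof -
   have "y \<in> cdom c W" using r that by (auto simp: subset_iff)
   then obtain x where "x \<in> fst c" "y = snd c x" "pt c y = x" using cdomE[OF c] by blast
   then show ?thesis using b(2)[of y] that by (simp add: \<beta>_def dist_commute)
  qed
 qed (use r in auto)
qed

text \<open>Provides densities over \<open>W\<close> with a prescribed germ at a point. An operator
  over the whole manifold can thus be probed with functions, such as exponentials, that are given in
  one chart only.\<close>

lemma density_extend:
 assumes c: "c \<in> \<A>" and W: "open W" and y0: "y0 \<in> cdom c W" and u: "smooth_on (img c) u"
 obtains f S where "f \<in> dens lam W" "open S" "y0 \<in> S" "S \<subseteq> cdom c W" "!!y. y \<in> S ==> f c y = u y"
proof -
 obtain \<beta> :: "'m => real" and K S where b: "!!c'. c' \<in> \<A> ==> smooth_on (img c') (%y. \<beta> (pt c' y))"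
  "closed K" "K \<subseteq> fst c \<inter> W" "!!x. x \<notin> K ==> \<beta> x = 0"
  "open S" "y0 \<in> S" "S \<subseteq> cdom c W" "!!y. y \<in> S ==> \<beta> (pt c y) = 1"
  by (rule bump_function[OF c W y0]) (rule that)
 define f where "f c' z = (if c' \<in> \<A> \<and> z \<in> cdom c' W then cor (\<beta> (pt c' z)) * density_from \<A> lam c u c' z else 0)" for c' z
 have sm: "smooth_on (cdom c' W) (f c')" if c': "c' \<in> \<A>" for c'
 proof (rule smooth_on_local)
  fix y assume y: "y \<in> cdom c' W"
  then obtain x where x: "x \<in> fst c'" "x \<in> W" "y = snd c' x" using cdomE[OF c'] by blast
  show "\<exists>T v. open T \<and> y \<in> T \<and> smooth_on T v \<and> (\<forall>z\<in>T. f c' z = v z)"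
  proof (cases "x \<in> fst c")
   case True
   let ?T = "cdom c' (fst c \<inter> W)" and ?v = "%z. cor (\<beta> (pt c' z)) * density_from \<A> lam c u c' z"
   have T: "open ?T" by (rule open_cdom[OF c']) (simp add: open_Int W chart_open[OF c])
   have "smooth_on ?T ?v"
    by (intro smooth_on_mult smooth_on_of_real T smooth_on_subset[OF b(1)[OF c']]
      smooth_on_subset[OF density_from_smooth[OF c c' u]] cdom_mono) auto
   moreover have "\<forall>z\<in>?T. f c' z = ?v z" using c' cdom_mono[of "fst c \<inter> W" W c'] by (auto simp: f_def)
   ultimately show ?thesis using T x True c' by (intro exI[of _ ?T] exI[of _ ?v]) simp
  next
   case False
   let ?T = "cdom c' (W - K)"
   have "open ?T" by (rule open_cdom[OF c' open_Diff[OF W b(2)]])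
   moreover have "f c' z = 0" if "z \<in> ?T" for z
    using that c' by (rule cdom_induct) (simp add: c' f_def b(4))
   moreover have "y \<in> ?T" using x False b(3) c' by auto
   ultimately show ?thesis by (intro exI[of _ ?T] exI[of _ "%_. 0"]) simp
  qed
 qed
 have "f \<in> dens lam W"
 proof (rule densitiesI)
  show "f c' (snd c' x) = cor (\<bar>det (jac c' c'' (snd c' x))\<bar> powr lam) * f c'' (snd c'' x)"
   if "c' \<in> \<A>" "c'' \<in> \<A>" "x \<in> fst c'" "x \<in> fst c''" "x \<in> W" for c' c'' x
   using density_from_law[OF c that(1-4), of lam u] that by (simp add: f_def)
  show "f c' y = 0" if "c' \<notin> \<A> \<or> y \<notin> cdom c' W" for c' y using that by (auto simp: f_def)
 qed (rule sm)
 moreover have "f c y = u y" if "y \<in> S" for y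
 proof -
  have "y \<in> cdom c W" "y \<in> img c" using that b(7) cdom_mono[of W UNIV c] by auto
  then show ?thesis using b(8)[OF that] density_from_chart[OF c, of y lam u] c by (simp add: f_def)
 qed
 ultimately show ?thesis using that b(5,6,7) by blast
qed

lemma symbol_extend:
 assumes c: "c \<in> \<A>" and W: "open W" and y0: "y0 \<in> cdom c W" and p: "p \<in> LS (deg_le k) (img c)"
 obtains P S where "P \<in> SL k W" "open S" "y0 \<in> S" "S \<subseteq> cdom c W" "!!y xi. y \<in> S ==> P c y xi = p y xi"
proof -
 obtain \<beta> :: "'m => real" and K S where b: "!!c'. c' \<in> \<A> ==> smooth_on (img c') (%y. \<beta> (pt c' y))"
  "closed K" "K \<subseteq> fst c \<inter> W" "!!x. x \<notin> K ==> \<beta> x = 0"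
  "open S" "y0 \<in> S" "S \<subseteq> cdom c W" "!!y. y \<in> S ==> \<beta> (pt c y) = 1"
  by (rule bump_function[OF c W y0]) (rule that)
 define P where "P c' z xi = (if c' \<in> \<A> \<and> z \<in> cdom c' W then cor (\<beta> (pt c' z)) * symbol_from \<A> c p c' z xi else 0)" for c' z xi
 have sm: "P c' \<in> LS (deg_le k) (cdom c' W)" if c': "c' \<in> \<A>" for c'
 proof (rule LS_local)
  fix y assume y: "y \<in> cdom c' W"
  then obtain x where x: "x \<in> fst c'" "x \<in> W" "y = snd c' x" using cdomE[OF c'] by blast
  show "\<exists>T. open T \<and> y \<in> T \<and> P c' \<in> LS (deg_le k) T"
  proof (cases "x \<in> fst c")
   case True
   let ?T = "cdom c' (fst c \<inter> W)" and ?v = "%z xi. cor (\<beta> (pt c' z)) * symbol_from \<A> c p c' z xi"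
   have T: "open ?T" by (rule open_cdom[OF c']) (simp add: open_Int W chart_open[OF c])
   have "?v \<in> LS (deg_le k) ?T"
    by (intro LS_scale smooth_on_of_real T smooth_on_subset[OF b(1)[OF c']]
      LS_restrict[OF symbol_from_local[OF c c' p]] cdom_mono) auto
   moreover have "\<forall>z\<in>?T. \<forall>xi. P c' z xi = ?v z xi" using c' cdom_mono[of "fst c \<inter> W" W c'] by (auto simp: P_def)
   ultimately have "P c' \<in> LS (deg_le k) ?T" using LS_cong[of ?T "P c'" ?v] by simp
   then show ?thesis using T x True c' by (intro exI[of _ ?T]) simp
  next
   case False
   let ?T = "cdom c' (W - K)"
   have "open ?T" by (rule open_cdom[OF c' open_Diff[OF W b(2)]])
   moreover have "P c' z xi = 0" if "z \<in> ?T" for z xi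
    using that c' by (rule cdom_induct) (simp add: c' P_def b(4))
   then have "P c' \<in> LS (deg_le k) ?T" using LS_cong[of ?T "P c'" "%_ _. 0"] by simp
   moreover have "y \<in> ?T" using x False b(3) c' by auto
   ultimately show ?thesis by blast
  qed
 qed
 have "P \<in> SL k W"
 proof (rule symbols_leI)
  show "P c' (snd c' x) (transpose (jac c' c'' (snd c' x)) *v xi) = P c'' (snd c'' x) xi"
   if "c' \<in> \<A>" "c'' \<in> \<A>" "x \<in> fst c'" "x \<in> fst c''" "x \<in> W" for c' c'' x xi
   using symbol_from_law[OF c that(1-4), of p xi] that by (simp add: P_def del: transpose_matrix_vector)
  show "P c' y xi = 0" if "c' \<notin> \<A> \<or> y \<notin> cdom c' W" for c' y xi using that by (auto simp: P_def)
 qed (rule sm)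
 moreover have "P c y xi = p y xi" if "y \<in> S" for y xi
 proof -
  have "y \<in> cdom c W" "y \<in> img c" using that b(7) cdom_mono[of W UNIV c] by auto
  then show ?thesis using b(8)[OF that] symbol_from_chart[OF c, of y p] c by (simp add: P_def)
 qed
 ultimately show ?thesis using that b(5,6,7) by blast
qed

end

section \<open>Full symbols of differential operators\<close>

lemma hom_part_setsum:
 assumes "open Om" "finite T" "!!s. s \<in> T ==> p s \<in> LS (L s) Om" "y \<in> Om"
 shows "hom_part d (%y xi. \<Sum>s\<in>T. p s y xi) y xi = (\<Sum>s\<in>T. hom_part d (p s) y xi)"
proof -
 have "fibre_coeff I (%y xi. \<Sum>s\<in>T. p s y xi) y = (\<Sum>s\<in>T. fibre_coeff I (p s) y)" for I
  unfolding fibre_coeff_def using LS_smooth(2)[OF assms(1,3,4)]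
  by (simp add: pds_sum[OF open_UNIV] sum_divide_distrib)
 then have "hom_part d (%y xi. \<Sum>s\<in>T. p s y xi) y xi = (\<Sum>I | length I = d. \<Sum>s\<in>T. fibre_coeff I (p s) y * monomial I xi)"
  by (simp add: hom_part_def sum_distrib_right)
 also have "... = (\<Sum>s\<in>T. hom_part d (p s) y xi)"
  unfolding hom_part_def by (rule sum.swap)
 finally show ?thesis .
qed

text \<open>A linear substitution maps homogeneous polynomials to homogeneous ones of the same
  degree. With the transposed Jacobian it makes homogeneous parts of a symbol independent of the
  chart.\<close>

lemma hom_part_subst:
 fixes M :: "real^'n::finite^'n"
 assumes S: "open Om" and p: "p \<in> LS (deg_le k) Om" "y \<in> Om"
  and r: "!!xi. p y (M *v xi) = r z xi"
 shows "hom_part d p y (M *v xi) = hom_part d r z xi"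
proof -
 let ?h = "%e (x :: real^'n) xi. hom_part e p y (M *v xi)"
 have h: "?h e \<in> LS (deg_eq e) UNIV" for e
  unfolding hom_part_def
 proof (intro LS_sum LS_cscale open_UNIV)
  fix I :: "'n list" assume "I \<in> deg_eq e"
  then show "(%x xi. monomial I (M *v xi)) \<in> LS (deg_eq e) UNIV"
   using LS_monomial_linear[of UNIV "%_. M" I] by simp
 qed
 have "hom_part d r z xi = hom_part d (%x xi. \<Sum>e\<le>k. ?h e x xi) z xi"
  by (rule hom_part_cong) (use r hom_part_sum[OF p] in simp)
 also have "... = (\<Sum>e\<le>k. hom_part d (?h e) z xi)"
  by (rule hom_part_setsum[OF open_UNIV _ h]) auto
 also have "... = (\<Sum>e\<le>k. if e = d then ?h e z xi else 0)"
 proof (intro sum.cong refl)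
  fix e
  show "hom_part d (?h e) z xi = (if e = d then ?h e z xi else 0)"
   using hom_part_hom[OF h UNIV_I, of d z xi] hom_part_eq_0[OF h finite_length_eq UNIV_I, of e d z xi]
   by (cases "e = d") simp_all
 qed
 also have "... = ?h d z xi"
 proof (cases "d <= k")
  case False
  then have "hom_part d p y xi = 0" for xi using hom_part_eq_0[OF p(1) finite_length_le p(2), of d xi] by auto
  then show ?thesis by simp
 qed simp
 finally show ?thesis by simp
qed

definition hom_sym :: "nat => ('m, 'n::finite) symbol => ('m, 'n) symbol" where
 "hom_sym d P c = hom_part d (P c)"

section \<open>Linear structure, homogeneous components and restriction; symbols of
  operators\<close>

context conf_atlas
begin

lemma symbols_le_linear:
 assumes "open W" "P \<in> SL k W" "R \<in> SL k W"
 shows "(%c y xi. a * P c y xi + b * R c y xi) \<in> SL k W"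
proof (rule symbols_leI)
 show "(%y xi. a * P c y xi + b * R c y xi) \<in> LS (deg_le k) (cdom c W)" if "c \<in> \<A>" for c
  using that open_cdom[OF that assms(1)]
  by (intro LS_add LS_cscale symbol_local[OF assms(2)] symbol_local[OF assms(3)])
next
 fix c y xi assume "c \<notin> \<A> \<or> y \<notin> cdom c W"
 then show "a * P c y xi + b * R c y xi = 0" using symbol_zero[OF assms(2)] symbol_zero[OF assms(3)] by simp
next
 fix c c' x xi assume "c \<in> \<A>" "c' \<in> \<A>" "x \<in> fst c" "x \<in> fst c'" "x \<in> W"
 from symbol_law[OF assms(2) this, of xi] symbol_law[OF assms(3) this, of xi]
 show "a * P c (snd c x) (transpose (jac c c' (snd c x)) *v xi) + b * R c (snd c x) (transpose (jac c c' (snd c x)) *v xi) =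
  a * P c' (snd c' x) xi + b * R c' (snd c' x) xi" by simp
qed

lemma symbols_le_mono:
 assumes "open W" "P \<in> SL k W" "k <= k'"
 shows "P \<in> SL k' W"
proof (rule symbols_leI)
 show "P c \<in> LS (deg_le k') (cdom c W)" if "c \<in> \<A>" for c
  by (rule LS_mono[OF open_cdom[OF that assms(1)] _ _ symbol_local[OF assms(2) that]]) (use assms(3) in auto)
qed (use symbol_zero[OF assms(2)] symbol_law[OF assms(2)] in blast)+

lemma symbols_common:
 assumes "open W" "P \<in> SY W" "R \<in> SY W"
 obtains k where "P \<in> SL k W" "R \<in> SL k W"
proof -
 obtain k l where kl: "P \<in> SL k W" "R \<in> SL l W" using assms(2,3) by (auto simp: symbols_def)
 show thesis
  by (rule that[of "max k l"]) (rule symbols_le_mono[OF assms(1)], rule kl, simp)+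
qed

lemma symbols_linear:
 assumes "open W" "P \<in> SY W" "R \<in> SY W"
 shows "(%c y xi. a * P c y xi + b * R c y xi) \<in> SY W"
proof -
 obtain k where "P \<in> SL k W" "R \<in> SL k W" using symbols_common[OF assms] by blast
 from symbols_le_linear[OF assms(1) this] show ?thesis by (auto simp: symbols_def)
qed

lemma symbols_le_zero: "(%c y xi. 0) \<in> SL k W"
 by (rule symbols_leI) auto

lemma symbols_le_sum:
 assumes "open W" "!!s. s \<in> T ==> P s \<in> SL k W"
 shows "(%c y xi. \<Sum>s\<in>T. a s * P s c y xi) \<in> SL k W"
 using assms(2)
proof (induction T rule: infinite_finite_induct)
 case (insert s T)
 then show ?case using symbols_le_linear[OF assms(1), of "P s" k "%c y xi. \<Sum>s\<in>T. a s * P s c y xi" "a s" 1] by simp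
qed (simp_all add: symbols_le_zero)

lemma symbols_sum:
 assumes "open W" "!!s. s \<in> T ==> P s \<in> SY W"
 shows "(%c y xi. \<Sum>s\<in>T. a s * P s c y xi) \<in> SY W"
 using assms(2)
proof (induction T rule: infinite_finite_induct)
 case (insert s T)
 then show ?case using symbols_linear[OF assms(1), of "P s" "%c y xi. \<Sum>s\<in>T. a s * P s c y xi" "a s" 1] by simp
qed (use symbols_le_zero[of 0 W] in \<open>auto simp: symbols_def\<close>)

lemma hom_sym_mem:
 assumes "open W" "P \<in> SL k W"
 shows "hom_sym d P \<in> SL d W"
proof (rule symbols_leI)
 fix c assume c: "c \<in> \<A>"
 show "hom_sym d P c \<in> LS (deg_le d) (cdom c W)"
  unfolding hom_sym_def
  by (rule LS_mono[OF open_cdom[OF c assms(1)] _ _ LS_hom_part[OF open_cdom[OF c assms(1)] symbol_local[OF assms(2) c]]]) auto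
next
 fix c y xi assume "c \<notin> \<A> \<or> y \<notin> cdom c W"
 from symbol_zero[OF assms(2) this] have "P c y = (%_. 0)" by (intro ext)
 then show "hom_sym d P c y xi = 0" by (simp add: hom_sym_def hom_part_def fibre_coeff_def pds_const)
next
 fix c c' x xi assume c: "c \<in> \<A>" "c' \<in> \<A>" "x \<in> fst c" "x \<in> fst c'" "x \<in> W"
 show "hom_sym d P c (snd c x) (transpose (jac c c' (snd c x)) *v xi) = hom_sym d P c' (snd c' x) xi"
  unfolding hom_sym_def
  by (rule hom_part_subst[OF open_cdom[OF c(1) assms(1)] symbol_local[OF assms(2) c(1)]])
   (use c symbol_law[OF assms(2) c] in auto)
qed

lemma hom_sym_sum:
 assumes "P \<in> SL k W"
 shows "P = (%c y xi. \<Sum>d\<le>k. hom_sym d P c y xi)"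
proof (intro ext)
 fix c y xi
 show "P c y xi = (\<Sum>d\<le>k. hom_sym d P c y xi)"
 proof (cases "c \<in> \<A> \<and> y \<in> cdom c W")
  case True
  then show ?thesis unfolding hom_sym_def using hom_part_sum[OF symbol_local[OF assms]] by blast
 next
  case False
  then have "c \<notin> \<A> \<or> y \<notin> cdom c W" by simp
  from symbol_zero[OF assms this] have z: "P c y = (%_. 0)" by (intro ext)
  then have "hom_sym d P c y xi = 0" for d by (simp add: hom_sym_def hom_part_def fibre_coeff_def pds_const)
  then show ?thesis using z by simp
 qed
qed

lemma restrict_symbol_mem:
 assumes "open W" "W' \<subseteq> W" "P \<in> SL k W"
 shows "restrict_symbol \<A> W' P \<in> SL k W'"
proof (rule symbols_leI)
 fix c assume c: "c \<in> \<A>"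
 have sub: "cdom c W' \<subseteq> cdom c W" by (rule cdom_mono[OF assms(2)])
 show "restrict_symbol \<A> W' P c \<in> LS (deg_le k) (cdom c W')"
  using LS_restrict[OF symbol_local[OF assms(3) c] sub] c
   LS_cong[of "cdom c W'" "restrict_symbol \<A> W' P c" "P c"] by (simp add: restrict_symbol_def)
next
 fix c c' x xi assume c: "c \<in> \<A>" "c' \<in> \<A>" "x \<in> fst c" "x \<in> fst c'" "x \<in> W'"
 then have "x \<in> W" using assms(2) by blast
 from symbol_law[OF assms(3) c(1-4) this, of xi] c
 show "restrict_symbol \<A> W' P c (snd c x) (transpose (jac c c' (snd c x)) *v xi) = restrict_symbol \<A> W' P c' (snd c' x) xi"
  by (simp add: restrict_symbol_def del: transpose_matrix_vector)
qed (auto simp: restrict_symbol_def)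

lemma restrict_density_mem:
 assumes "open W'" "W' \<subseteq> W" "f \<in> dens lam W"
 shows "restrict_density \<A> W' f \<in> dens lam W'"
proof (rule densitiesI)
 fix c y assume "c \<notin> \<A> \<or> y \<notin> cdom c W'"
 then show "restrict_density \<A> W' f c y = 0" by (auto simp: restrict_density_def)
next
 fix c assume c: "c \<in> \<A>"
 have sub: "cdom c W' \<subseteq> cdom c W" by (rule cdom_mono[OF assms(2)])
 show "smooth_on (cdom c W') (restrict_density \<A> W' f c)"
  using smooth_on_subset[OF density_smooth[OF assms(3) c] sub] c
   smooth_on_cong[OF open_cdom[OF c assms(1)], of "restrict_density \<A> W' f c" "f c"] by (simp add: restrict_density_def)
next
 fix c c' x assume c: "c \<in> \<A>" "c' \<in> \<A>" "x \<in> fst c" "x \<in> fst c'" "x \<in> W'"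
 then have "x \<in> W" using assms(2) by blast
 from density_law[OF assms(3) c(1-4) this] c
 show "restrict_density \<A> W' f c (snd c x) = cor (\<bar>det (jac c c' (snd c x))\<bar> powr lam) * restrict_density \<A> W' f c' (snd c' x)"
  by (simp add: restrict_density_def)
qed

lemma densities_linear:
 assumes "open W" "f \<in> dens lam W" "h \<in> dens lam W"
 shows "(%c y. a * f c y + b * h c y) \<in> dens lam W"
proof (rule densitiesI)
 fix c y assume "c \<notin> \<A> \<or> y \<notin> cdom c W"
 then show "a * f c y + b * h c y = 0" using density_zero[OF assms(2)] density_zero[OF assms(3)] by simp
next
 fix c assume c: "c \<in> \<A>"
 show "smooth_on (cdom c W) (%y. a * f c y + b * h c y)"
  by (intro smooth_on_add smooth_on_cmult open_cdom[OF c assms(1)] density_smooth[OF assms(2) c] density_smooth[OF assms(3) c])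
next
 fix c c' x assume c: "c \<in> \<A>" "c' \<in> \<A>" "x \<in> fst c" "x \<in> fst c'" "x \<in> W"
 show "a * f c (snd c x) + b * h c (snd c x) = cor (\<bar>det (jac c c' (snd c x))\<bar> powr lam) * (a * f c' (snd c' x) + b * h c' (snd c' x))"
  unfolding density_law[OF assms(2) c] density_law[OF assms(3) c] by (simp add: algebra_simps)
qed

lemma densities_zero: "(%c y. 0) \<in> dens lam W"
 by (rule densitiesI) auto

lemma densities_sum:
 assumes "open W" "!!s. s \<in> T ==> f s \<in> dens lam W"
 shows "(%c y. \<Sum>s\<in>T. f s c y) \<in> dens lam W"
 using assms(2)
proof (induction T rule: infinite_finite_induct)
 case (insert s T)
 then show ?case using densities_linear[OF assms(1), of "f s" lam "%c y. \<Sum>s\<in>T. f s c y" 1 1] by simp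
qed (simp_all add: densities_zero)

text \<open>The exponential need not extend to a density over \<open>W\<close>, so the operator is
  applied to an arbitrary density coinciding with it near \<open>y\<close>. For a differential
  operator the choice does not matter, by \<open>fsym_eq\<close>.\<close>

definition fsym :: "real => 'm set => ('m, 'n) oper => ('m, 'n) symbol" where
 "fsym lam W B c y xi = ef (- xi) y * B (SOME f. f \<in> dens lam W \<and>
   (\<exists>S. open S \<and> y \<in> S \<and> S \<subseteq> cdom c W \<and> (\<forall>z\<in>S. f c z = ef xi z))) c y"

lemma exp_density:
 assumes W: "open W" and c: "c \<in> \<A>" and y: "y \<in> cdom c W"
 obtains f S where "f \<in> dens lam W" "open S" "y \<in> S" "S \<subseteq> cdom c W" "!!z. z \<in> S ==> f c z = ef xi z"
proof -
 have "smooth_on (img c) (ef xi)" by (intro smooth_on_ef open_cdom[OF c]) simp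
 from density_extend[OF c W y this, of lam] that show ?thesis by blast
qed

lemma fsym_eq:
 assumes W: "open W" and c: "c \<in> \<A>" and b: "b \<in> LS (deg_le k) (cdom c W)"
  and B: "!!f y. f \<in> dens lam W ==> y \<in> cdom c W ==> B f c y = normal_order k b (f c) y"
  and y: "y \<in> cdom c W"
 shows "fsym lam W B c y xi = b y xi"
proof -
 let ?P = "%f. f \<in> dens lam W \<and> (\<exists>S. open S \<and> y \<in> S \<and> S \<subseteq> cdom c W \<and> (\<forall>z\<in>S. f c z = ef xi z))"
 obtain f S where "f \<in> dens lam W" "open S" "y \<in> S" "S \<subseteq> cdom c W" "!!z. z \<in> S ==> f c z = ef xi z"
  by (rule exp_density[OF W c y, of lam xi]) blast
 then have "\<exists>f. ?P f" by blast
 then have P: "?P (SOME f. ?P f)" by (rule someI_ex)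
 define f where "f = (SOME f. ?P f)"
 obtain S where S: "f \<in> dens lam W" "open S" "y \<in> S" "S \<subseteq> cdom c W" "!!z. z \<in> S ==> f c z = ef xi z"
  using P unfolding f_def[symmetric] by blast
 have "B f c y = normal_order k b (f c) y" by (rule B[OF S(1) y])
 also have "... = normal_order k b (ef xi) y" by (rule normal_order_cong_fun[OF S(2,3,5)])
 also have "... = b y xi * ef xi y" by (rule normal_order_ef_const[OF open_cdom[OF c W] b y])
 finally have "fsym lam W B c y xi = ef (- xi) y * (b y xi * ef xi y)"
  unfolding fsym_def f_def[symmetric] by simp
 then show ?thesis using ef_minus[of xi y] by (simp add: mult.left_commute)
qed

text \<open>The symbol that \<open>diff_ops_le\<close> merely asserts to exist becomes a function of
  the operator, with the same degree bound.\<close>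

lemma diff_op_local:
 assumes W: "open W" and B: "B \<in> diff_ops_le \<A> lam k W" and c: "c \<in> \<A>"
 shows "fsym lam W B c \<in> LS (deg_le k) (cdom c W)"
  and "f \<in> dens lam W ==> y \<in> cdom c W ==> B f c y = normal_order k (fsym lam W B c) (f c) y"
proof -
 obtain b where b: "b \<in> LS (deg_le k) (cdom c W)"
  "!!f y. f \<in> dens lam W ==> y \<in> cdom c W ==> B f c y = normal_order k b (f c) y"
  using B c unfolding diff_ops_le_def by blast
 have eq: "fsym lam W B c y xi = b y xi" if "y \<in> cdom c W" for y xi by (rule fsym_eq[where b=b and B=B, OF W c b that])
 then show "fsym lam W B c \<in> LS (deg_le k) (cdom c W)"
  using b(1) LS_cong[of "cdom c W" "fsym lam W B c" b] by simp
 show "B f c y = normal_order k (fsym lam W B c) (f c) y" if "f \<in> dens lam W" "y \<in> cdom c W" for f y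
  using b(2)[OF that] normal_order_cong[of "fsym lam W B c" y b k "f c"] eq[OF that(2)] by simp
qed

lemma diff_op_mem: "B \<in> diff_ops_le \<A> lam k W ==> f \<in> dens lam W ==> B f \<in> dens lam W"
 and diff_op_zero: "B \<in> diff_ops_le \<A> lam k W ==> f \<notin> dens lam W ==> B f = (%c y. 0)"
 unfolding diff_ops_le_def by blast+

lemma diff_op_value:
 assumes W: "open W" and B: "B \<in> diff_ops_le \<A> lam k W" and c: "c \<in> \<A>"
  and f: "f \<in> dens lam W" and S: "open S" "y \<in> S" "y \<in> cdom c W" "!!z. z \<in> S ==> f c z = ef xi z"
 shows "B f c y = fsym lam W B c y xi * ef xi y"
 using diff_op_local(2)[OF W B c f S(3)] normal_order_cong_fun[of S y "f c" "ef xi" k "fsym lam W B c", OF S(1,2,4)]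
  normal_order_ef_const[OF open_cdom[OF c W] diff_op_local(1)[OF W B c] S(3), of xi] by simp

lemma diff_ops_le_mono:
 assumes W: "open W" and B: "B \<in> diff_ops_le \<A> lam k W" and k: "k <= k'"
 shows "B \<in> diff_ops_le \<A> lam k' W"
proof -
 have "\<exists>b\<in>LS (deg_le k') (cdom c W). \<forall>f\<in>dens lam W. \<forall>y\<in>cdom c W. B f c y = normal_order k' b (f c) y"
  if c: "c \<in> \<A>" for c
 proof (intro bexI ballI)
  note loc = diff_op_local[OF W B c]
  show "fsym lam W B c \<in> LS (deg_le k') (cdom c W)"
   by (rule LS_mono[OF open_cdom[OF c W] _ _ loc(1)]) (use k in auto)
  show "B f c y = normal_order k' (fsym lam W B c) (f c) y" if "f \<in> dens lam W" "y \<in> cdom c W" for f y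
   using loc(2)[OF that] normal_order_raise[OF open_cdom[OF c W] density_smooth[OF that(1) c] that(2) loc(1) k] by simp
 qed
 then show ?thesis using diff_op_mem[OF B] diff_op_zero[OF B] unfolding diff_ops_le_def by blast
qed

lemma diff_ops_eqI:
 assumes W: "open W" and B: "B \<in> diff_ops \<A> lam W" "B' \<in> diff_ops \<A> lam W"
  and eq: "!!c y xi. c \<in> \<A> ==> y \<in> cdom c W ==> fsym lam W B c y xi = fsym lam W B' c y xi"
 shows "B = B'"
proof -
 obtain k l where kl: "B \<in> diff_ops_le \<A> lam k W" "B' \<in> diff_ops_le \<A> lam l W" using B by (auto simp: diff_ops_def)
 have m: "B \<in> diff_ops_le \<A> lam (max k l) W" "B' \<in> diff_ops_le \<A> lam (max k l) W"
  using diff_ops_le_mono[OF W kl(1)] diff_ops_le_mono[OF W kl(2)] by simp_all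
 show ?thesis
 proof (intro ext)
  fix f c y
  consider "f \<notin> dens lam W" | "f \<in> dens lam W" "c \<notin> \<A> \<or> y \<notin> cdom c W"
   | "f \<in> dens lam W" "c \<in> \<A>" "y \<in> cdom c W" by blast
  then show "B f c y = B' f c y"
  proof cases
   case 1
   then show ?thesis using diff_op_zero[OF m(1)] diff_op_zero[OF m(2)] by simp
  next
   case 2
   then show ?thesis using density_zero[OF diff_op_mem[OF m(1) 2(1)]] density_zero[OF diff_op_mem[OF m(2) 2(1)]] by simp
  next
   case 3
   then show ?thesis
    using diff_op_local(2)[OF W m(1) 3(2,1,3)] diff_op_local(2)[OF W m(2) 3(2,1,3)]
     normal_order_cong[of "fsym lam W B c" y "fsym lam W B' c" "max k l" "f c"] eq[OF 3(2,3)] by simp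
  qed
 qed
qed

lemma diff_op_linear:
 assumes W: "open W" and B: "B \<in> diff_ops_le \<A> lam k W" and f: "f \<in> dens lam W" "h \<in> dens lam W"
 shows "B (%c y. a * f c y + b * h c y) c y = a * B f c y + b * B h c y"
proof (cases "c \<in> \<A> \<and> y \<in> cdom c W")
 case True
 then have c: "c \<in> \<A>" and y: "y \<in> cdom c W" by auto
 show ?thesis
  unfolding diff_op_local(2)[OF W B c densities_linear[OF W f] y] diff_op_local(2)[OF W B c f(1) y] diff_op_local(2)[OF W B c f(2) y]
  by (rule normal_order_linear[OF open_cdom[OF c W] density_smooth[OF f(1) c] density_smooth[OF f(2) c] y])
next
 case False
 then show ?thesis
  using density_zero[OF diff_op_mem[OF B densities_linear[OF W f]]] density_zero[OF diff_op_mem[OF B f(1)]]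
   density_zero[OF diff_op_mem[OF B f(2)]] by simp
qed

lemma diff_op_sum:
 assumes W: "open W" and B: "B \<in> diff_ops_le \<A> lam k W" and f: "!!s. s \<in> T ==> f s \<in> dens lam W"
 shows "B (%c y. \<Sum>s\<in>T. f s c y) c y = (\<Sum>s\<in>T. B (f s) c y)"
proof -
 have z: "B (%c y. 0) c y = 0" using diff_op_linear[OF W B densities_zero densities_zero, of 0 0] by simp
 show ?thesis using f
 proof (induction T rule: infinite_finite_induct)
  case (insert s T)
  then have d: "f s \<in> dens lam W" "(%c y. \<Sum>s\<in>T. f s c y) \<in> dens lam W"
   by (simp_all add: densities_sum[OF W])
  show ?case using diff_op_linear[OF W B d, of 1 1] insert by simp
 qed (simp_all add: z)
qed

text \<open>Imposes the convention that operators are zero outside the space of densities, without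
  which equality of functions would not be equality of operators.\<close>

definition trunc_op :: "real => 'm set => ('m, 'n) oper => ('m, 'n) oper" where
 "trunc_op lam W F = (%f. if f \<in> dens lam W then F f else (%c y. 0))"

lemma trunc_op_mem:
 assumes W: "open W" and F: "!!f. f \<in> dens lam W ==> F f \<in> dens lam W"
  and b: "!!c. c \<in> \<A> ==> b c \<in> LS (deg_le k) (cdom c W)"
  and loc: "!!c f y. [|c \<in> \<A>; f \<in> dens lam W; y \<in> cdom c W|] ==> F f c y = normal_order k (b c) (f c) y"
 shows "trunc_op lam W F \<in> diff_ops_le \<A> lam k W"
  and "c \<in> \<A> ==> y \<in> cdom c W ==> fsym lam W (trunc_op lam W F) c y xi = b c y xi"
proof -
 have "\<exists>b\<in>LS (deg_le k) (cdom c W). \<forall>f\<in>dens lam W. \<forall>y\<in>cdom c W. trunc_op lam W F f c y = normal_order k b (f c) y"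
  if "c \<in> \<A>" for c
  by (rule bexI[OF _ b[OF that]]) (simp add: trunc_op_def loc that)
 then show "trunc_op lam W F \<in> diff_ops_le \<A> lam k W"
  unfolding diff_ops_le_def using F by (simp add: trunc_op_def)
 show "fsym lam W (trunc_op lam W F) c y xi = b c y xi" if "c \<in> \<A>" "y \<in> cdom c W" for c y
  by (rule fsym_eq[where b="b c", OF W that(1) b[OF that(1)] _ that(2)]) (simp add: trunc_op_def loc that(1))
qed

end

section \<open>The quantization map in a chart\<close>

text \<open>Polynomials of degree at most 2, described by vanishing third derivatives. Coefficients
  of conformal fields are of this kind, so commutators with them involve at most second fibre
  derivatives of a symbol.\<close>

definition quadr :: "(real^'n::finite => real) => bool" where
 "quadr f \<longleftrightarrow> smooth_on UNIV f \<and> (\<forall>i j l y. pd i (pd j (pd l f)) y = 0)"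

lemma pd_const_fun [simp]: "pd i (%_. c) = (%_. 0)"
 by auto

lemma pd_add_fun: "smooth_on UNIV u ==> smooth_on UNIV v ==> pd i (%z. u z + v z) = (%z. pd i u z + pd i v z)"
 by (rule ext, rule pd_add) (auto intro: smooth_on_differentiable)

lemma pd_cmult_fun:
 fixes u :: "real^'n::finite => 'b::real_normed_algebra"
 shows "smooth_on UNIV u ==> pd i (%z. a * u z) = (%z. a * pd i u z)"
 by (rule ext, rule pd_cmult) (auto intro: smooth_on_differentiable)

lemma pd_sum_fun: "(!!s. s \<in> T ==> smooth_on UNIV (u s)) ==> pd i (%z. \<Sum>s\<in>T. u s z) = (%z. \<Sum>s\<in>T. pd i (u s) z)"
 by (rule ext, rule pd_sum) (auto intro: smooth_on_differentiable)

lemma pd_of_real_fun: "smooth_on UNIV u ==> pd i (%z. cor (u z)) = (%z. cor (pd i u z))"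
 by (rule ext, rule pd_of_real) (auto intro: smooth_on_differentiable)

lemma quadr_add: "quadr u ==> quadr v ==> quadr (%z. u z + v z)"
 unfolding quadr_def by (simp add: smooth_on_add pd_add_fun smooth_on_pd)

lemma quadr_cmult: "quadr u ==> quadr (%z. a * u z)"
 unfolding quadr_def by (simp add: smooth_on_cmult pd_cmult_fun smooth_on_pd)

lemma quadr_const: "quadr (%_. a)"
 by (simp add: quadr_def)

lemma quadr_sum: "(!!s. s \<in> T ==> quadr (u s)) ==> quadr (%z. \<Sum>s\<in>T. u s z)"
 by (induction T rule: infinite_finite_induct) (auto intro: quadr_add quadr_const)

lemma quadr_coord: "quadr (%z. z $ a)"
proof -
 have "pd i (%z. z $ a) = (%_. if i = a then 1 else 0)" for i by auto
 then show ?thesis by (simp add: quadr_def)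
qed

lemma quadr_mult:
 fixes a b :: "'n::finite"
 shows "quadr (%z. z $ a * z $ b)"
proof -
 have c: "pd i (%z. z $ a) = (%_. if i = a then 1 else 0)" for i a by auto
 have d: "(%z. z $ a) differentiable (at y)" for a :: 'n and y :: "real^'n"
  by (rule smooth_on_differentiable[OF smooth_on_coord[OF open_UNIV] UNIV_I])
 have "pd i (%z. z $ a * z $ b) = (%z. (if i = a then 1 else 0) * z $ b + (if i = b then 1 else 0) * z $ a)" for i
  using d by (auto simp: pd_mult)
 then show ?thesis
  unfolding quadr_def by (simp add: smooth_on_mult pd_add_fun pd_cmult_fun smooth_on_cmult c)
qed

abbreviation quad_field :: "(real^'n::finite => real^'n) => bool" where
 "quad_field X \<equiv> \<forall>j. quadr (%x. X x $ j)"

lemma quad_field_smooth: "quad_field X ==> smooth_field X"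
 by (simp add: quadr_def)

lemma quad_field_linear: "quad_field X ==> quad_field Y ==> quad_field (%x. a *\<^sub>R X x + b *\<^sub>R Y x)"
 by (simp add: quadr_add quadr_cmult)

lemma quad_field_generator: "X \<in> conformal_generators g ==> quad_field X"
proof -
 have lin: "quadr (%x. (g *v x) $ i)" for i
  unfolding matrix_vector_mult_def by (auto intro!: quadr_sum quadr_cmult quadr_coord)
 have linc: "quadr (%x. (g *v x) $ i * x $ k)" for i k
  unfolding matrix_vector_mult_def by (auto simp: sum_distrib_right mult.assoc intro!: quadr_sum quadr_cmult quadr_mult)
 have diff: "quadr (%x. u x - v x)" if "quadr u" "quadr v" for u v
  using quadr_add[OF that(1) quadr_cmult[OF that(2), of "-1"]] by simp
 have mult: "quadr (%x. u x * a)" if "quadr u" for u a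
  using quadr_cmult[OF that, of a] by (simp add: mult.commute)
 have inn: "quadr (%x. (g *v x) \<bullet> x)"
  unfolding inner_vec_def by (auto intro!: quadr_sum linc)
 assume "X \<in> conformal_generators g"
 then consider i where "X = (%x. axis i 1)"
  | i j where "X = (%x. (g *v x) $ i *\<^sub>R axis j 1 - (g *v x) $ j *\<^sub>R axis i 1)"
  | "X = (%x. x)" | i where "X = (%x. ((g *v x) \<bullet> x) *\<^sub>R axis i 1 - (2 * (g *v x) $ i) *\<^sub>R x)"
  unfolding conformal_generators_def by blast
 then show ?thesis
 proof cases
  case 1 then show ?thesis by (simp add: quadr_const)
 next
  case 2 then show ?thesis by (simp add: diff mult lin)
 next
  case 3 then show ?thesis by (simp add: quadr_coord)
 next
  case 4 then show ?thesis by (simp add: diff mult inn mult.assoc quadr_cmult linc)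
 qed
qed

text \<open>\<open>fsym_field lam X\<close> is the symbol of the Lie derivative \<open>L\<^sub>X\<close> on densities, and \<open>commsym lam X b\<close>
 the symbol of its commutator with the operator of symbol \<open>b\<close>.\<close>

definition fsym_field :: "real => (real^'n::finite => real^'n) => real^'n => real^'n => complex" where
 "fsym_field lam X xi z = cor ((\<Sum>j\<in>UNIV. xi $ j * X z $ j) + lam * (\<Sum>i\<in>UNIV. pd i X z $ i))"

definition commsym :: "real => (real^'n::finite => real^'n) => 'n lsymbol => 'n lsymbol" where
 "commsym lam X b y xi = (\<Sum>i\<in>UNIV. cor (X y $ i) * pd i (%z. b z xi) y)
   - (\<Sum>i\<in>UNIV. pd i (fsym_field lam X xi) y * pd i (b y) xi)
   - (\<Sum>i\<in>UNIV. \<Sum>j\<in>UNIV. pd i (pd j (fsym_field lam X xi)) y * pd i (pd j (b y)) xi) / 2"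

lemma fsym_field_quadr:
 assumes X: "quad_field X"
 shows "smooth_on UNIV (fsym_field lam X xi)" "pd i (pd j (pd l (fsym_field lam X xi))) y = 0"
proof -
 let ?X = "%j x. X x $ j"
 let ?r = "%z. (\<Sum>j\<in>UNIV. xi $ j * ?X j z) + lam * (\<Sum>i\<in>UNIV. pd i (?X i) z)"
 have s: "smooth_on UNIV (?X j)" for j using X by (simp add: quadr_def)
 have z: "pd i (pd j (pd l (?X m))) = (%_. 0)" for i j l m using X by (auto simp: quadr_def)
 have w: "fsym_field lam X xi = (%z. cor (?r z))"
  by (auto simp: fsym_field_def smooth_field_pd[OF quad_field_smooth[OF X]])
 have sr: "smooth_on UNIV ?r" by (intro smooth_on_add smooth_on_cmult smooth_on_sum smooth_on_pd s open_UNIV)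
 show "smooth_on UNIV (fsym_field lam X xi)" unfolding w by (rule smooth_on_of_real[OF open_UNIV sr])
 have "pd i (pd j (pd l ?r)) = (%_. 0)"
  by (simp add: pd_add_fun pd_sum_fun pd_cmult_fun smooth_on_add smooth_on_cmult smooth_on_sum smooth_on_pd s z)
 then show "pd i (pd j (pd l (fsym_field lam X xi))) y = 0"
  unfolding w by (simp add: pd_of_real_fun sr smooth_on_pd del: of_real_sum of_real_add of_real_mult)
qed

text \<open>On exponentials the Lie derivative is multiplication by
  \<open>w = fsym_field lam X xi\<close>, which is at most quadratic, so
  \<open>normal_order_quadratic\<close> evaluates the second term. The products \<open>w b\<close>
  of the two terms cancel, leaving \<open>commsym\<close>.\<close>

lemma commsym_normal_order:
 assumes S: "open Om" "y \<in> Om" and b: "b \<in> LS (deg_le k) Om" and X: "quad_field X"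
 shows "lie_density lam X (%z. b z xi * ef xi z) y - normal_order k b (lie_density lam X (ef xi)) y = commsym lam X b y xi * ef xi y"
proof -
 let ?w = "fsym_field lam X xi"
 have "lie_density lam X (ef xi) = (%z. ?w z * ef xi z)"
  by (rule ext) (simp add: lie_density_def fsym_field_def pd_ef algebra_simps sum_distrib_left)
 then have 1: "normal_order k b (lie_density lam X (ef xi)) y = (?w y * b y xi + (\<Sum>i\<in>UNIV. pd i ?w y * pd i (b y) xi)
  + (\<Sum>i\<in>UNIV. \<Sum>j\<in>UNIV. pd i (pd j ?w) y * pd i (pd j (b y)) xi) / 2) * ef xi y"
  using normal_order_quadratic[OF S b fsym_field_quadr[OF X]] by simp
 have "(%z. b z xi) differentiable (at y)" "ef xi differentiable (at y)"
  using smooth_on_differentiable[OF LS_smooth(1)[OF S(1) b] S(2)]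
   smooth_on_differentiable[OF smooth_on_ef[OF S(1)] S(2)] by blast+
 then have "pd i (%z. b z xi * ef xi z) y = pd i (%z. b z xi) y * ef xi y + b y xi * (cor (xi $ i) * ef xi y)" for i
  by (simp add: pd_mult pd_ef)
 then have "lie_density lam X (%z. b z xi * ef xi z) y =
   ((\<Sum>i\<in>UNIV. cor (X y $ i) * pd i (%z. b z xi) y) + ?w y * b y xi) * ef xi y"
  by (simp add: lie_density_def fsym_field_def algebra_simps sum.distrib sum_distrib_left sum_distrib_right)
 with 1 show ?thesis by (simp add: commsym_def algebra_simps)
qed

lemma lie_symbol_linear:
 assumes "smooth_field X" "smooth_field Y"
 shows "lie_symbol (%x. a *\<^sub>R X x + b *\<^sub>R Y x) p y xi = cor a * lie_symbol X p y xi + cor b * lie_symbol Y p y xi"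
proof -
 have s: "smooth_field (%x. a *\<^sub>R X x + b *\<^sub>R Y x)" using assms by (simp add: smooth_on_add smooth_on_cmult)
 have "pd i (%x. a * X x $ j + b * Y x $ j) y = a * pd i (%x. X x $ j) y + b * pd i (%x. Y x $ j) y" for i j
  using assms by (simp add: pd_add_fun pd_cmult_fun smooth_on_cmult)
 then show ?thesis
  unfolding lie_symbol_def smooth_field_pd[OF s] smooth_field_pd[OF assms(1)] smooth_field_pd[OF assms(2)]
  by (simp add: sum.distrib sum_distrib_left algebra_simps)
qed

lemma fsym_field_linear:
 assumes "smooth_field X" "smooth_field Y"
 shows "fsym_field lam (%x. a *\<^sub>R X x + b *\<^sub>R Y x) xi = (%z. cor a * fsym_field lam X xi z + cor b * fsym_field lam Y xi z)"
proof
 fix z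
 have s: "smooth_field (%x. a *\<^sub>R X x + b *\<^sub>R Y x)" using assms by (simp add: smooth_on_add smooth_on_cmult)
 have "pd i (%x. a * X x $ j + b * Y x $ j) z = a * pd i (%x. X x $ j) z + b * pd i (%x. Y x $ j) z" for i j
  using assms by (simp add: pd_add_fun pd_cmult_fun smooth_on_cmult)
 then show "fsym_field lam (%x. a *\<^sub>R X x + b *\<^sub>R Y x) xi z = cor a * fsym_field lam X xi z + cor b * fsym_field lam Y xi z"
  unfolding fsym_field_def smooth_field_pd[OF s] smooth_field_pd[OF assms(1)] smooth_field_pd[OF assms(2)]
  by (simp add: sum.distrib sum_distrib_left algebra_simps)
qed

lemma commsym_linear:
 assumes X: "quad_field X" and Y: "quad_field Y"
 shows "commsym lam (%x. a *\<^sub>R X x + b *\<^sub>R Y x) p y xi = cor a * commsym lam X p y xi + cor b * commsym lam Y p y xi"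
proof -
 note s = fsym_field_quadr(1)[OF X] fsym_field_quadr(1)[OF Y]
 show ?thesis
  unfolding commsym_def fsym_field_linear[OF quad_field_smooth[OF X] quad_field_smooth[OF Y]]
  by (simp add: pd_add_fun pd_cmult_fun smooth_on_cmult smooth_on_pd s sum.distrib sum_distrib_left algebra_simps add_divide_distrib)
qed

section \<open>The quantization map and its full symbol\<close>

locale quantization = conf_atlas g \<A> for g :: "real^'n^'n::finite"
  and \<A> :: "('m::{t2_space, second_countable_topology}, 'n) chart set" +
 fixes np nq :: nat and lam :: real and Q :: "'m set => ('m, 'n) symbol => ('m, 'n) oper"
 assumes flat: "flat_metric np nq g"
  and quant: "conformal_quantization g \<A> lam Q"
begin

abbreviation AD where "AD \<equiv> adapted_domains \<A>"
abbreviation sig :: "'m set => ('m, 'n) symbol => ('m, 'n) symbol" where "sig W P \<equiv> fsym lam W (Q W P)"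

lemma fst_AD: "c \<in> \<A> ==> fst c \<in> AD" and UNIV_AD: "UNIV \<in> AD"
 by (auto simp: adapted_domains_def)

lemma Q_bij: "W \<in> AD ==> bij_betw (Q W) (SY W) (diff_ops \<A> lam W)"
 by (rule quant[unfolded conformal_quantization_def, THEN conjunct1, rule_format])

lemma Q_linear:
 "[|W \<in> AD; P \<in> SY W; R \<in> SY W; f \<in> dens lam W|] ==>
  Q W (%c y xi. a * P c y xi + b * R c y xi) f c y = a * Q W P f c y + b * Q W R f c y"
 by (rule quant[unfolded conformal_quantization_def, THEN conjunct2, THEN conjunct1, rule_format])

lemma Q_principal:
 "[|W \<in> AD; P \<in> SL k W; c \<in> \<A>|] ==>
  \<exists>N\<in>LS (deg_less k) (cdom c W). \<forall>f\<in>dens lam W. \<forall>y\<in>cdom c W.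
     Q W P f c y = normal_order k (%y xi. P c y xi + N y xi) (f c) y"
 by (rule quant[unfolded conformal_quantization_def, THEN conjunct2, THEN conjunct2, THEN conjunct1, rule_format])

lemma Q_restrict:
 "[|W \<in> AD; W' \<in> AD; W' \<subseteq> W; P \<in> SY W; f \<in> dens lam W|] ==>
  restrict_density \<A> W' (Q W P f) = Q W' (restrict_symbol \<A> W' P) (restrict_density \<A> W' f)"
 by (rule quant[unfolded conformal_quantization_def, THEN conjunct2, THEN conjunct2, THEN conjunct2, THEN conjunct1, rule_format])

lemma Q_equivariant:
 "[|c \<in> \<A>; X \<in> conformal_generators g; P \<in> SY (fst c); f \<in> dens lam (fst c)|] ==>
  Q (fst c) (act_symbol \<A> c X P) f c' y = act_density \<A> lam c X (Q (fst c) P f) c' y - Q (fst c) P (act_density \<A> lam c X f) c' y"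
 by (rule quant[unfolded conformal_quantization_def, THEN conjunct2, THEN conjunct2, THEN conjunct2, THEN conjunct2, rule_format])

lemma Q_mem: "W \<in> AD ==> P \<in> SY W ==> Q W P \<in> diff_ops \<A> lam W"
 using Q_bij bij_betwE by blast

text \<open>Bijectivity only places \<open>Q W P\<close> among operators of some order; the
  condition on the principal symbol improves this to the degree of \<open>P\<close>.\<close>

lemma Q_le:
 assumes W: "W \<in> AD" and P: "P \<in> SL k W"
 shows "Q W P \<in> diff_ops_le \<A> lam k W"
  and "c \<in> \<A> ==> (%y xi. sig W P c y xi - P c y xi) \<in> LS (deg_less k) (cdom c W)"
proof -
 have oW: "open W" by (rule adapted_open[OF W])
 have "P \<in> SY W" using P by (auto simp: symbols_def)
 from Q_mem[OF W this] obtain l where l: "Q W P \<in> diff_ops_le \<A> lam l W" by (auto simp: diff_ops_def)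
 have *: "\<exists>b\<in>LS (deg_le k) (cdom c W). (\<forall>f\<in>dens lam W. \<forall>y\<in>cdom c W. Q W P f c y = normal_order k b (f c) y)
   \<and> (%y xi. b y xi - P c y xi) \<in> LS (deg_less k) (cdom c W)" if c: "c \<in> \<A>" for c
 proof -
  obtain N where N: "N \<in> LS (deg_less k) (cdom c W)" "\<forall>f\<in>dens lam W. \<forall>y\<in>cdom c W.
     Q W P f c y = normal_order k (%y xi. P c y xi + N y xi) (f c) y" using Q_principal[OF W P c] by blast
  have "N \<in> LS (deg_le k) (cdom c W)"
   by (rule LS_mono[OF open_cdom[OF c oW] _ _ N(1)]) auto
  then have "(%y xi. P c y xi + N y xi) \<in> LS (deg_le k) (cdom c W)"
   by (intro LS_add open_cdom[OF c oW] symbol_local[OF P c])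
  then show ?thesis using N by (intro bexI[of _ "%y xi. P c y xi + N y xi"]) simp_all
 qed
 show "Q W P \<in> diff_ops_le \<A> lam k W"
  unfolding diff_ops_le_def using * diff_op_mem[OF l] diff_op_zero[OF l] by blast
 show "(%y xi. sig W P c y xi - P c y xi) \<in> LS (deg_less k) (cdom c W)" if c: "c \<in> \<A>"
 proof -
  obtain b where b: "b \<in> LS (deg_le k) (cdom c W)" "!!f y. f\<in>dens lam W ==> y\<in>cdom c W ==> Q W P f c y = normal_order k b (f c) y"
   "(%y xi. b y xi - P c y xi) \<in> LS (deg_less k) (cdom c W)" using *[OF c] by blast
  have "sig W P c y xi = b y xi" if "y \<in> cdom c W" for y xi
   by (rule fsym_eq[where b=b, OF oW c b(1) _ that]) (rule b(2))
  then show ?thesis using b(3) LS_cong[of "cdom c W" "%y xi. sig W P c y xi - P c y xi" "%y xi. b y xi - P c y xi"] by simp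
 qed
qed

lemma sig_local: "W \<in> AD ==> P \<in> SL k W ==> c \<in> \<A> ==> sig W P c \<in> LS (deg_le k) (cdom c W)"
 by (rule diff_op_local(1)[OF adapted_open Q_le(1)])

lemma sig_linear:
 assumes W: "W \<in> AD" and P: "P \<in> SY W" "R \<in> SY W" and c: "c \<in> \<A>" "y \<in> cdom c W"
 shows "sig W (%c y xi. a * P c y xi + b * R c y xi) c y xi = a * sig W P c y xi + b * sig W R c y xi"
proof -
 have oW: "open W" by (rule adapted_open[OF W])
 obtain k where k: "P \<in> SL k W" "R \<in> SL k W" using symbols_common[OF oW P] by blast
 obtain f S where f: "f \<in> dens lam W" "open S" "y \<in> S" "S \<subseteq> cdom c W" "!!z. z \<in> S ==> f c z = ef xi z"
  by (rule exp_density[OF oW c, of lam xi]) blast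
 have v: "Q W Z f c y = sig W Z c y xi * ef xi y" if "Z \<in> SL k W" for Z
  by (rule diff_op_value[OF oW Q_le(1)[OF W that] c(1) f(1,2,3) c(2) f(5)])
 have "sig W (%c y xi. a * P c y xi + b * R c y xi) c y xi * ef xi y = a * (sig W P c y xi * ef xi y) + b * (sig W R c y xi * ef xi y)"
  using Q_linear[OF W P f(1), of a b c y] v[OF symbols_le_linear[OF oW k, of a b]] v[OF k(1)] v[OF k(2)] by simp
 then have "sig W (%c y xi. a * P c y xi + b * R c y xi) c y xi * ef xi y = (a * sig W P c y xi + b * sig W R c y xi) * ef xi y"
  by (simp add: algebra_simps)
 then show ?thesis by simp
qed

lemma sig_sum:
 assumes W: "W \<in> AD" and P: "!!s. s \<in> T ==> P s \<in> SY W" and c: "c \<in> \<A>" "y \<in> cdom c W"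
 shows "sig W (%c y xi. \<Sum>s\<in>T. a s * P s c y xi) c y xi = (\<Sum>s\<in>T. a s * sig W (P s) c y xi)"
 using P
proof (induction T rule: infinite_finite_induct)
 case (insert s T)
 then have m: "P s \<in> SY W" "(%c y xi. \<Sum>s\<in>T. a s * P s c y xi) \<in> SY W"
  by (simp_all add: symbols_sum[OF adapted_open[OF W]])
 show ?case using sig_linear[OF W m c, of "a s" 1] insert by simp
next
 case empty
 have z: "(%c y xi. 0) \<in> SY W" using symbols_le_zero[of 0 W] by (auto simp: symbols_def)
 show ?case using sig_linear[OF W z z c, of 0 0] by simp
next
 case (infinite T)
 have z: "(%c y xi. 0) \<in> SY W" using symbols_le_zero[of 0 W] by (auto simp: symbols_def)
 show ?case using sig_linear[OF W z z c, of 0 0] infinite by simp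
qed

lemma sig_inject:
 assumes W: "W \<in> AD" and P: "P \<in> SY W" "R \<in> SY W"
  and eq: "!!c y xi. c \<in> \<A> ==> y \<in> cdom c W ==> sig W P c y xi = sig W R c y xi"
 shows "P = R"
proof -
 have "Q W P = Q W R" by (rule diff_ops_eqI[OF adapted_open[OF W] Q_mem[OF W P(1)] Q_mem[OF W P(2)] eq])
 then show ?thesis by (rule inj_onD[OF bij_betw_imp_inj_on[OF Q_bij[OF W]] _ P])
qed

text \<open>The top part of \<open>P\<close> is also the top part of its quantization, since the two
  differ in lower degree only. If the operator has order \<open>m\<close>, the part of degree
  \<open>Suc m\<close> must vanish.\<close>

lemma symbols_le_descend:
 assumes W: "W \<in> AD" and P: "P \<in> SL (Suc m) W"
  and s: "!!c. c \<in> \<A> ==> sig W P c \<in> LS (deg_le m) (cdom c W)"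
 shows "P \<in> SL m W"
proof (rule symbols_leI)
 have oW: "open W" by (rule adapted_open[OF W])
 fix c assume c: "c \<in> \<A>"
 have S: "open (cdom c W)" by (rule open_cdom[OF c oW])
 have top: "hom_part (Suc m) (P c) y xi = 0" if y: "y \<in> cdom c W" for y xi
 proof -
  have "P c = (%y xi. 1 * sig W P c y xi + (-1) * (sig W P c y xi - P c y xi))" by auto
  then have "hom_part (Suc m) (P c) y xi = 1 * hom_part (Suc m) (sig W P c) y xi + (-1) * hom_part (Suc m) (%y xi. sig W P c y xi - P c y xi) y xi"
   using hom_part_linear[OF S s[OF c] Q_le(2)[OF W P c] y, of "Suc m" 1 "-1" xi] by simp
  also have "... = 0"
   using hom_part_eq_0[OF s[OF c] finite_length_le y, of "Suc m"] hom_part_eq_0[OF Q_le(2)[OF W P c] finite_length_less y, of "Suc m"] by simp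
  finally show ?thesis .
 qed
 have "(%y xi. \<Sum>d\<le>m. hom_part d (P c) y xi) \<in> LS (deg_le m) (cdom c W)"
  by (intro LS_sum S LS_mono[OF S _ _ LS_hom_part[OF S symbol_local[OF P c]]]) auto
 moreover have "P c y xi = (\<Sum>d\<le>m. hom_part d (P c) y xi)" if "y \<in> cdom c W" for y xi
  using hom_part_sum[OF symbol_local[OF P c] that, of xi] top[OF that] by simp
 ultimately show "P c \<in> LS (deg_le m) (cdom c W)"
  using LS_cong[of "cdom c W" "P c" "%y xi. \<Sum>d\<le>m. hom_part d (P c) y xi"] by simp
qed (use symbol_zero[OF P] symbol_law[OF P] in blast)+

text \<open>Bijectivity gives a preimage of unknown degree. Its degree is lowered one at a time down
  to the order of \<open>B\<close>, so \<open>Q\<close> is bijective also between the filtration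
  steps.\<close>

lemma Q_surj:
 assumes W: "W \<in> AD" and B: "B \<in> diff_ops_le \<A> lam k W"
 obtains P where "P \<in> SL k W" "Q W P = B"
proof -
 have "B \<in> diff_ops \<A> lam W" using B by (auto simp: diff_ops_def)
 then have "B \<in> Q W ` SY W" by (simp add: bij_betw_imp_surj_on[OF Q_bij[OF W]])
 then obtain P where P: "P \<in> SY W" "Q W P = B" by auto
 then obtain l where "P \<in> SL l W" by (auto simp: symbols_def)
 then have l: "P \<in> SL (k + l) W" by (rule symbols_le_mono[OF adapted_open[OF W]]) simp
 have "P \<in> SL (k + l) W ==> P \<in> SL k W" for l
 proof (induction l)
  case (Suc l)
  have "P \<in> SL (k + l) W"
  proof (rule symbols_le_descend[OF W])
   show "P \<in> SL (Suc (k + l)) W" using Suc.prems by simp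
   show "sig W P c \<in> LS (deg_le (k + l)) (cdom c W)" if "c \<in> \<A>" for c
    unfolding P(2) by (rule diff_op_local(1)[OF adapted_open[OF W] diff_ops_le_mono[OF adapted_open[OF W] B] that]) simp
  qed
  then show ?case by (rule Suc.IH)
 qed simp
 from that[OF this[OF l] P(2)] show thesis .
qed

lemma sig_restrict:
 assumes W: "W \<in> AD" "W' \<in> AD" "W' \<subseteq> W" and P: "P \<in> SY W" and c: "c \<in> \<A>" "y \<in> cdom c W'"
 shows "sig W' (restrict_symbol \<A> W' P) c y xi = sig W P c y xi"
proof -
 have oW: "open W" "open W'" using adapted_open W by auto
 obtain k where k: "P \<in> SL k W" using P by (auto simp: symbols_def)
 have y: "y \<in> cdom c W" using c(2) cdom_mono[OF W(3)] by blast
 obtain f S where f: "f \<in> dens lam W" "open S" "y \<in> S" "S \<subseteq> cdom c W" "!!z. z \<in> S ==> f c z = ef xi z"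
  by (rule exp_density[OF oW(1) c(1) y, of lam xi]) blast
 have S': "open (S \<inter> cdom c W')" "y \<in> S \<inter> cdom c W'" using f(2,3) c open_cdom[OF c(1) oW(2)] by auto
 have "restrict_density \<A> W' f c z = ef xi z" if "z \<in> S \<inter> cdom c W'" for z
  using that f(5) c(1) by (simp add: restrict_density_def)
 from diff_op_value[OF oW(2) Q_le(1)[OF W(2) restrict_symbol_mem[OF oW(1) W(3) k]] c(1) restrict_density_mem[OF oW(2) W(3) f(1)] S' c(2) this]
 have "Q W' (restrict_symbol \<A> W' P) (restrict_density \<A> W' f) c y = sig W' (restrict_symbol \<A> W' P) c y xi * ef xi y" by simp
 moreover have "restrict_density \<A> W' (Q W P f) c y = sig W P c y xi * ef xi y"
  using diff_op_value[OF oW(1) Q_le(1)[OF W(1) k] c(1) f(1,2,3) y f(5)] c by (simp add: restrict_density_def)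
 ultimately show ?thesis using Q_restrict[OF W P f(1)] by simp
qed

text \<open>Charts with the same coordinate map have the identity as Jacobian on the overlap, so
  densities have equal expressions in both and so have operators.\<close>

lemma sig_same_chart:
 assumes W: "W \<in> AD" and P: "P \<in> SY W" and c: "c \<in> \<A>" "c' \<in> \<A>" "snd c' = snd c" "fst c' \<subseteq> fst c"
  and y: "y \<in> cdom c' W"
 shows "sig W P c' y xi = sig W P c y xi"
proof -
 have oW: "open W" by (rule adapted_open[OF W])
 obtain k where k: "P \<in> SL k W" using P by (auto simp: symbols_def)
 note op = Q_le(1)[OF W k]
 have sub: "cdom c' W \<subseteq> cdom c W" using c(3,4) by (auto simp: cdom_def)
 have same: "h c z = h c' z" if h: "h \<in> dens lam W" and z: "z \<in> cdom c' W" for h z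
  using z c(2)
 proof (rule cdom_induct)
  fix x assume "x \<in> fst c'" "x \<in> W"
  then show "h c (snd c' x) = h c' (snd c' x)"
   using density_law[OF h c(1,2), of x] jac_same[OF c(1,2,3), of x] c(3,4) by auto
 qed
 have yc: "y \<in> cdom c W" using y sub by blast
 obtain f S where f: "f \<in> dens lam W" "open S" "y \<in> S" "S \<subseteq> cdom c' W" "!!z. z \<in> S ==> f c' z = ef xi z"
  by (rule exp_density[OF oW c(2) y, of lam xi]) blast
 have fc: "f c z = ef xi z" if "z \<in> S" for z using f(4,5) same[OF f(1)] that by auto
 have "sig W P c' y xi * ef xi y = Q W P f c' y" by (rule diff_op_value[OF oW op c(2) f(1,2,3) y f(5), symmetric])
 also have "... = Q W P f c y" by (rule same[OF diff_op_mem[OF op f(1)] y, symmetric])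
 also have "... = sig W P c y xi * ef xi y" by (rule diff_op_value[OF oW op c(1) f(1,2,3) yc fc])
 finally show ?thesis by simp
qed

text \<open>Quantization over a chart domain as a map between functions on the chart image and the
  fibre: the symbol is carried to the manifold, quantized, and the full symbol of the result is read
  off in the same chart. Equivariance then becomes an identity on an open subset of the coordinate
  space.\<close>

definition lq :: "('m, 'n) chart => 'n lsymbol => 'n lsymbol" where
 "lq c p = sig (fst c) (symbol_from \<A> c p) c"

lemma sig_lq:
 assumes c: "c \<in> \<A>" and P: "P \<in> SY (fst c)"
 shows "sig (fst c) P c = lq c (P c)"
proof -
 obtain k where k: "P \<in> SL k (fst c)" using P by (auto simp: symbols_def)
 then have "P c \<in> LS (deg_le k) (img c)" using symbol_local[OF k c] by simp
 from symbol_from_mem[OF c this] have "symbol_from \<A> c (P c) \<in> SY (fst c)" by (auto simp: symbols_def)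
 then have "symbol_from \<A> c (P c) = P" by (rule symbol_eqI[OF c _ P]) (rule symbol_from_chart[OF c])
 then show ?thesis by (simp add: lq_def)
qed

lemma symbol_from_symbols:
 "c \<in> \<A> ==> p \<in> LS (deg_le k) (img c) ==> symbol_from \<A> c p \<in> SY (fst c)"
 by (drule (1) symbol_from_mem) (auto simp: symbols_def)

lemma symbol_from_cong:
 assumes c: "c \<in> \<A>" and eq: "!!y xi. y \<in> img c ==> p y xi = r y xi"
 shows "symbol_from \<A> c p = symbol_from \<A> c r"
proof (intro ext)
 fix c' z xi
 have "transition c' c z \<in> img c" if "c' \<in> \<A>" "z \<in> cdom c' (fst c)"
  using that(2,1) by (rule cdom_induct) (simp add: c that(1))
 then show "symbol_from \<A> c p c' z xi = symbol_from \<A> c r c' z xi"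
  using eq by (simp add: symbol_from_def del: transpose_matrix_vector)
qed

lemma lq_local:
 assumes c: "c \<in> \<A>" and p: "p \<in> LS (deg_le k) (img c)"
 shows "lq c p \<in> LS (deg_le k) (img c)"
  and "(%y xi. lq c p y xi - p y xi) \<in> LS (deg_less k) (img c)"
proof -
 note m = symbol_from_mem[OF c p]
 show "lq c p \<in> LS (deg_le k) (img c)"
  using sig_local[OF fst_AD[OF c] m c] by (simp add: lq_def)
 show "(%y xi. lq c p y xi - p y xi) \<in> LS (deg_less k) (img c)"
  using Q_le(2)[OF fst_AD[OF c] m c] symbol_from_chart[OF c, of _ p]
   LS_cong[of "img c" "%y xi. lq c p y xi - p y xi" "%y xi. lq c p y xi - symbol_from \<A> c p c y xi"]
  by (simp add: lq_def)
qed

lemma lq_cong: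
 assumes "c \<in> \<A>" "!!y xi. y \<in> img c ==> p y xi = r y xi"
 shows "lq c p = lq c r"
 unfolding lq_def using symbol_from_cong[OF assms] by simp

lemma lq_sum:
 assumes c: "c \<in> \<A>" "y \<in> img c" and p: "!!s. s \<in> T ==> p s \<in> LS (deg_le k) (img c)"
 shows "lq c (%y xi. \<Sum>s\<in>T. a s * p s y xi) y xi = (\<Sum>s\<in>T. a s * lq c (p s) y xi)"
proof -
 have "symbol_from \<A> c (%y xi. \<Sum>s\<in>T. a s * p s y xi) = (%c' y xi. \<Sum>s\<in>T. a s * symbol_from \<A> c (p s) c' y xi)"
  by (auto simp: symbol_from_def fun_eq_iff)
 then show ?thesis
  unfolding lq_def using sig_sum[OF fst_AD[OF c(1)] symbol_from_symbols[OF c(1) p] c(1)] c(2) by simp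
qed

lemma lq_linear:
 assumes c: "c \<in> \<A>" "y \<in> img c" and p: "p \<in> LS (deg_le k) (img c)" "r \<in> LS (deg_le k) (img c)"
 shows "lq c (%y xi. a * p y xi + b * r y xi) y xi = a * lq c p y xi + b * lq c r y xi"
 using lq_sum[OF c, of "{True, False}" "%s. if s then p else r" k "%s. if s then a else b" xi] p by simp

text \<open>Restricted charts are adapted, so compatibility of \<open>Q\<close> with restriction
  relates the domains, and \<open>sig_same_chart\<close> relates the charts. It allows passage to a
  ball around a given point.\<close>

lemma lq_restrict:
 assumes c: "c \<in> \<A>" and V: "open V" "V \<subseteq> fst c" and p: "p \<in> LS (deg_le k) (img c)"
  and y: "y \<in> cdom c V"
 shows "lq (V, snd c) p y xi = lq c p y xi"
proof -
 let ?c = "(V, snd c)"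
 have c': "?c \<in> \<A>" by (rule chart_restrict[OF c V])
 note oc = chart_open[OF c]
 have VA: "V \<in> AD" using fst_AD[OF c'] by simp
 let ?P = "symbol_from \<A> c p"
 have P: "?P \<in> SL k (fst c)" by (rule symbol_from_mem[OF c p])
 have cd: "cdom ?c V = cdom c V" using V by (auto simp: cdom_def)
 have cd': "cdom ?c UNIV = cdom c V" using V by (auto simp: cdom_def)
 have p': "p \<in> LS (deg_le k) (cdom ?c UNIV)"
  unfolding cd' by (rule LS_restrict[OF p cdom_mono]) simp
 have R: "restrict_symbol \<A> V ?P \<in> SL k V" by (rule restrict_symbol_mem[OF oc V(2) P])
 have "symbol_from \<A> ?c p = restrict_symbol \<A> V ?P"
 proof (rule symbol_eqI[OF c'])
  show "symbol_from \<A> ?c p \<in> SY (fst ?c)" by (rule symbol_from_symbols[OF c' p'])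
  show "restrict_symbol \<A> V ?P \<in> SY (fst ?c)" using R by (auto simp: symbols_def)
  show "symbol_from \<A> ?c p ?c y xi = restrict_symbol \<A> V ?P ?c y xi" if "y \<in> cdom ?c UNIV" for y xi
   using that c'
  proof (rule cdom_induct)
   fix x assume x: "x \<in> fst ?c"
   have "?P ?c (snd c x) xi = ?P c (snd c x) xi"
    using symbol_law[OF P c' c, of x xi] jac_same[OF c' c, of x] x V(2) by (auto simp: transpose_mat)
   also have "... = p (snd c x) xi" using symbol_from_chart[OF c, of "snd c x" p xi] x V(2) c by auto
   finally show "symbol_from \<A> ?c p ?c (snd ?c x) xi = restrict_symbol \<A> V ?P ?c (snd ?c x) xi"
    using symbol_from_chart[OF c', of "snd c x" p xi] x c' chart_mem_cdom[OF c', of x] by (simp add: restrict_symbol_def)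
  qed
 qed
 then have "lq ?c p y xi = sig V (restrict_symbol \<A> V ?P) ?c y xi" by (simp add: lq_def)
 also have "... = sig V (restrict_symbol \<A> V ?P) c y xi"
  by (rule sig_same_chart[OF VA _ c c']) (use R V y cd in \<open>auto simp: symbols_def\<close>)
 also have "... = sig (fst c) ?P c y xi"
  by (rule sig_restrict[OF fst_AD[OF c] VA V(2) _ c y]) (use P in \<open>auto simp: symbols_def\<close>)
 finally show ?thesis by (simp add: lq_def)
qed

lemma act_symbol_from:
 assumes c: "c \<in> \<A>" and p: "p \<in> LS (deg_le k) (img c)"
 shows "act_symbol \<A> c X (symbol_from \<A> c p) = symbol_from \<A> c (lie_symbol X p)"
 unfolding act_symbol_def
proof (rule symbol_from_cong[OF c])
 fix y xi assume y: "y \<in> img c"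
 have eq: "symbol_from \<A> c p c z = p z" if "z \<in> img c" for z
  using symbol_from_chart[OF c that, of p] by blast
 have S: "open (img c)" by (rule open_cdom[OF c]) simp
 have "pd i (%z. symbol_from \<A> c p c z xi) y = pd i (%z. p z xi) y" for i
  by (rule pd_cong[OF S y]) (simp add: eq)
 then show "lie_symbol X (symbol_from \<A> c p c) y xi = lie_symbol X p y xi"
  unfolding lie_symbol_def by (simp add: eq[OF y])
qed

lemma act_density_mem:
 assumes c: "c \<in> \<A>" and X: "smooth_field X" and f: "f \<in> dens lam (fst c)"
 shows "act_density \<A> lam c X f \<in> dens lam (fst c)"
  and "y \<in> img c ==> act_density \<A> lam c X f c y = lie_density lam X (f c) y"
proof -
 have S: "open (img c)" by (rule open_cdom[OF c]) simp
 have "smooth_on (img c) (f c)" using density_smooth[OF f c] by simp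
 then show "act_density \<A> lam c X f \<in> dens lam (fst c)"
  unfolding act_density_def by (intro density_from_mem[OF c] smooth_on_lie_density S X)
 show "y \<in> img c ==> act_density \<A> lam c X f c y = lie_density lam X (f c) y" for y
  unfolding act_density_def by (rule density_from_chart[OF c])
qed

lemma lie_density_cong:
 assumes "open S" "y \<in> S" "!!z. z \<in> S ==> u z = v z"
 shows "lie_density lam X u y = lie_density lam X v y"
 unfolding lie_density_def using pd_cong[OF assms] assms by simp

text \<open>Equivariance of \<open>Q\<close> is evaluated on a density that is an exponential on a
  neighbourhood \<open>T\<close> of \<open>y\<close>. A whole neighbourhood is required because the
  Lie derivatives differentiate the result.\<close>

lemma lq_equivariant:
 assumes c: "c \<in> \<A>" and X: "X \<in> conformal_generators g" and p: "p \<in> LS (deg_le k) (img c)"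
  and y: "y \<in> img c"
 shows "lq c (lie_symbol X p) y xi = commsym lam X (lq c p) y xi"
proof -
 let ?Om = "img c" and ?W = "fst c" and ?P = "symbol_from \<A> c p" and ?b = "lq c p"
 have W: "?W \<in> AD" and oW: "open ?W" using fst_AD[OF c] chart_open[OF c] by auto
 have S: "open ?Om" by (rule open_cdom[OF c]) simp
 have Xq: "quad_field X" by (rule quad_field_generator[OF X])
 have Xs: "smooth_field X" by (rule quad_field_smooth[OF Xq])
 have P: "?P \<in> SL k ?W" by (rule symbol_from_mem[OF c p])
 have Ps: "?P \<in> SY ?W" using P by (auto simp: symbols_def)
 have lp: "lie_symbol X p \<in> LS (deg_le k) ?Om" by (rule LS_lie[OF S Xs p])
 have b: "?b \<in> LS (deg_le k) ?Om" by (rule lq_local(1)[OF c p])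
 have bs: "fsym lam ?W (Q ?W ?P) c = ?b" by (simp add: lq_def)
 have y': "y \<in> cdom c ?W" using y by simp
 obtain f T where f: "f \<in> dens lam ?W" "open T" "y \<in> T" "T \<subseteq> cdom c ?W" "!!z. z \<in> T ==> f c z = ef xi z"
  by (rule exp_density[OF oW c y', of lam xi]) blast
 have val: "Q ?W ?P f c z = ?b z xi * ef xi z" if "z \<in> T" for z
  using diff_op_value[OF oW Q_le(1)[OF W P] c f(1,2) that _ f(5)] f(4) that by (auto simp: bs)
 have "lq c (lie_symbol X p) y xi * ef xi y = Q ?W (act_symbol \<A> c X ?P) f c y"
  unfolding act_symbol_from[OF c p] lq_def
  by (rule diff_op_value[OF oW Q_le(1)[OF W symbol_from_mem[OF c lp]] c f(1,2,3) y' f(5), symmetric])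
 also have "... = act_density \<A> lam c X (Q ?W ?P f) c y - Q ?W ?P (act_density \<A> lam c X f) c y"
  by (rule Q_equivariant[OF c X Ps f(1)])
 also have "act_density \<A> lam c X (Q ?W ?P f) c y = lie_density lam X (Q ?W ?P f c) y"
  by (rule act_density_mem(2)[OF c Xs diff_op_mem[OF Q_le(1)[OF W P] f(1)] y])
 also have "... = lie_density lam X (%z. ?b z xi * ef xi z) y"
  by (rule lie_density_cong[OF f(2,3) val])
 also have "Q ?W ?P (act_density \<A> lam c X f) c y = normal_order k ?b (act_density \<A> lam c X f c) y"
  using diff_op_local(2)[OF oW Q_le(1)[OF W P] c act_density_mem(1)[OF c Xs f(1)] y'] by (simp add: bs)
 also have "... = normal_order k ?b (lie_density lam X (ef xi)) y"
 proof (rule normal_order_cong_fun[OF f(2,3)])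
  fix z assume z: "z \<in> T"
  then have "z \<in> ?Om" using f(4) by auto
  then have "act_density \<A> lam c X f c z = lie_density lam X (f c) z" by (rule act_density_mem(2)[OF c Xs f(1)])
  also have "... = lie_density lam X (ef xi) z" by (rule lie_density_cong[OF f(2) z f(5)])
  finally show "act_density \<A> lam c X f c z = lie_density lam X (ef xi) z" .
 qed
 finally show ?thesis using commsym_normal_order[OF S y b Xq, of lam xi] by simp
qed

end

section \<open>Invariants of the orthogonal group\<close>

text \<open>Homogeneous polynomials on the fibre, encoded as local symbols constant in
  \<open>y\<close>, so that the closure properties of \<open>LS\<close> carry over.\<close>

definition homp :: "nat => (real^'n::finite => complex) set" where
 "homp d = {P. (%_ :: real^'n. P) \<in> LS (deg_eq d) UNIV}"

definition xm :: "'n::finite => (real^'n => complex) => real^'n => complex" where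
 "xm i P xi = cor (xi $ i) * P xi"

lemma homp_smooth: "P \<in> homp d ==> smooth_on UNIV P"
 unfolding homp_def using LS_smooth(2)[OF open_UNIV] by blast

lemma homp_sum: "(!!s. s \<in> T ==> P s \<in> homp d) ==> (%xi. \<Sum>s\<in>T. a s * P s xi) \<in> homp d"
 unfolding homp_def by (auto intro!: LS_sum LS_cscale)

lemma homp_add: "P \<in> homp d ==> R \<in> homp d ==> (%xi. P xi + R xi) \<in> homp d"
 unfolding homp_def by (auto intro!: LS_add)

lemma homp_cmult: "P \<in> homp d ==> (%xi. a * P xi) \<in> homp d"
 unfolding homp_def by (auto intro!: LS_cscale)

lemma homp_zero [simp]: "(%_. 0) \<in> homp d"
 by (simp add: homp_def)

lemma homp_xm: "P \<in> homp d ==> xm i P \<in> homp (Suc d)"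
 unfolding homp_def xm_def[abs_def] by (auto intro: LS_coord_mult[of UNIV "deg_eq (Suc d)" "deg_eq d"])

lemma homp_pd: "P \<in> homp (Suc d) ==> pd i P \<in> homp d"
proof -
 have "del_nth t I \<in> deg_eq d" if "I \<in> deg_eq (Suc d)" "t < length I" for t and I :: "'a list"
  using that length_del_nth[OF that(2)] by simp
 then show "P \<in> homp (Suc d) ==> pd i P \<in> homp d"
  unfolding homp_def using LS_pd_fibre[of UNIV "deg_eq d" "deg_eq (Suc d)" "%_. P" i] by simp
qed

lemma homp_pd_0: "P \<in> homp 0 ==> pd i P = (%_. 0)"
proof -
 assume "P \<in> homp 0"
 then have "(%_ :: real^'a. pd i P) \<in> LS {} UNIV"
  unfolding homp_def using LS_pd_fibre[of UNIV "{}" "deg_eq 0" "%_. P" i] by simp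
 then show ?thesis by (auto simp: local_symbols_def)
qed

lemma smooth_on_xm [simp]: "smooth_on UNIV P ==> smooth_on UNIV (xm i P)"
 unfolding xm_def[abs_def] by (simp add: smooth_on_mult)

lemma pd_xm: "smooth_on UNIV P ==> pd i (xm j P) = (%xi. (if i = j then P xi else 0) + xm j (pd i P) xi)"
proof -
 assume "smooth_on UNIV P"
 then have "P differentiable (at xi)" for xi using smooth_on_differentiable by blast
 then show ?thesis unfolding xm_def[abs_def] by (auto simp: pd_mult)
qed

lemma xm_sum: "xm i (%xi. \<Sum>s\<in>T. a s * P s xi) = (%xi. \<Sum>s\<in>T. a s * xm i (P s) xi)"
 by (auto simp: xm_def sum_distrib_left mult_ac)

lemma euler_monomial: "(\<Sum>i\<in>UNIV. xm i (pd i (monomial I)) xi) = of_nat (length I) * monomial I xi"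
proof (induction I)
 case Nil
 have "monomial [] = (%_ :: real^'a. 1)" by auto
 then show ?case by (simp add: xm_def)
next
 case (Cons j I)
 have "(\<Sum>i\<in>UNIV. xm i (pd i (monomial (j # I))) xi) = cor (xi $ j) * monomial I xi +
   cor (xi $ j) * (\<Sum>i\<in>UNIV. xm i (pd i (monomial I)) xi)"
  by (simp add: xm_def pd_monomial_Cons distrib_left sum.distrib sum_distrib_left mult.left_commute
    if_distrib[of "%x. _ * x"] cong: if_cong)
 then show ?case using Cons unfolding monomial_Cons[of j I xi] by (simp add: algebra_simps)
qed

lemma homp_euler:
 fixes P :: "real^'n::finite => complex"
 assumes "P \<in> homp d"
 shows "(\<Sum>i\<in>UNIV. xm i (pd i P) xi) = of_nat d * P xi"
proof -
 obtain a :: "'n list => real^'n => complex" where a: "!!y xi. P xi = (\<Sum>I\<in>deg_eq d. a I y * monomial I xi)"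
  using assms unfolding homp_def local_symbols_def by auto
 then have P: "P = (%xi. \<Sum>I\<in>deg_eq d. a I 0 * monomial I xi)" by auto
 have "pd i P = (%xi. \<Sum>I\<in>deg_eq d. a I 0 * pd i (monomial I) xi)" for i
  unfolding P by (simp add: pd_sum_fun pd_cmult_fun smooth_on_cmult)
 then have "(\<Sum>i\<in>UNIV. xm i (pd i P) xi) = (\<Sum>i\<in>UNIV. \<Sum>I\<in>deg_eq d. a I 0 * xm i (pd i (monomial I)) xi)"
  by (simp add: xm_sum)
 also have "... = (\<Sum>I\<in>deg_eq d. a I 0 * (of_nat d * monomial I xi))"
  by (subst sum.swap) (auto simp: sum_distrib_left[symmetric] euler_monomial intro!: sum.cong)
 also have "... = of_nat d * P xi" by (simp add: P sum_distrib_left mult_ac)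
 finally show ?thesis .
qed

lemma pd_commute_fun:
 fixes f :: "real^'n::finite => complex"
 shows "smooth_on UNIV f ==> pd i (pd j f) = pd j (pd i f)"
 by (rule ext) (rule pd_commute[OF open_UNIV _ UNIV_I])

lemma pd_diff_fun: "smooth_on UNIV u ==> smooth_on UNIV v ==> pd i (%z. u z - v z) = (%z. pd i u z - pd i v z)"
 by (rule ext, rule pd_diff) (auto intro: smooth_on_differentiable)

section \<open>Multiplication by the quadratic form and its Laplacian\<close>

locale quadratic_form =
 fixes \<gamma> :: "'n::finite => complex"
 assumes \<gamma>: "\<gamma> i * \<gamma> i = 1"
begin

lemma \<gamma>2 [simp]: "\<gamma> i * (\<gamma> i * z) = z"
 using \<gamma>[of i] by (metis mult.assoc mult_1)

definition r2 :: "(real^'n => complex) => real^'n => complex" where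
 "r2 P = (%xi. \<Sum>m\<in>UNIV. \<gamma> m * xm m (xm m P) xi)"

definition lap :: "(real^'n => complex) => real^'n => complex" where
 "lap P = (%xi. \<Sum>m\<in>UNIV. \<gamma> m * pd m (pd m P) xi)"

lemma homp_r2: "P \<in> homp d ==> r2 P \<in> homp (Suc (Suc d))"
 unfolding r2_def by (intro homp_sum homp_xm)

lemma homp_lap: "P \<in> homp (Suc (Suc d)) ==> lap P \<in> homp d"
 unfolding lap_def by (intro homp_sum homp_pd)

lemma homp_lap': "P \<in> homp d ==> lap P \<in> homp (d - 2)"
proof -
 assume P: "P \<in> homp d"
 consider "d = 0" | "d = 1" | e where "d = Suc (Suc e)" by (metis One_nat_def old.nat.exhaust)
 then show ?thesis
 proof cases
  case 1 then show ?thesis using P by (simp add: lap_def homp_pd_0)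
 next
  case 2
  then have "pd m P \<in> homp 0" for m using P by (intro homp_pd) simp
  then show ?thesis by (simp add: lap_def homp_pd_0)
 next
  case 3 then show ?thesis using P homp_lap by simp
 qed
qed

lemma lap_small: "P \<in> homp d ==> d < 2 ==> lap P = (%_. 0)"
proof -
 assume P: "P \<in> homp d" and "d < 2"
 then consider "d = 0" | "d = 1" by linarith
 then show ?thesis
 proof cases
  case 1 then show ?thesis using P by (simp add: lap_def homp_pd_0)
 next
  case 2
  then have "pd m P \<in> homp 0" for m using P by (intro homp_pd) simp
  then show ?thesis by (simp add: lap_def homp_pd_0)
 qed
qed

lemma pd_r2:
 assumes P: "smooth_on UNIV P"
 shows "pd m (r2 P) = (%xi. 2 * \<gamma> m * xm m P xi + r2 (pd m P) xi)"
proof -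
 have 1: "pd m (xm l (xm l P)) = (%xi. (if m = l then 2 * xm l P xi else 0) + xm l (xm l (pd m P)) xi)" for l
  using P by (auto simp: pd_xm xm_def fun_eq_iff algebra_simps)
 have "pd m (r2 P) = (%xi. \<Sum>l\<in>UNIV. \<gamma> l * pd m (xm l (xm l P)) xi)"
  unfolding r2_def using P by (simp add: pd_sum_fun pd_cmult_fun smooth_on_cmult)
 then show ?thesis
  unfolding 1 r2_def by (simp add: distrib_left sum.distrib if_distrib[of "%x. _ * x"] mult_ac cong: if_cong)
qed

lemma r2_add: "r2 (%xi. a * P xi + b * R xi) = (%xi. a * r2 P xi + b * r2 R xi)"
 by (auto simp: r2_def xm_def algebra_simps sum.distrib sum_distrib_left)

lemma lap_add: "smooth_on UNIV P ==> smooth_on UNIV R ==> lap (%xi. a * P xi + b * R xi) = (%xi. a * lap P xi + b * lap R xi)"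
 unfolding lap_def by (auto simp: pd_add_fun pd_cmult_fun smooth_on_cmult smooth_on_pd algebra_simps sum.distrib sum_distrib_left)

text \<open>The commutator of \<open>lap\<close> and \<open>r2\<close> is \<open>2 n\<close> plus
  four times the Euler operator, the relation by which these operators span a copy of sl(2).\<close>

lemma lap_r2:
 assumes P: "P \<in> homp e"
 shows "lap (r2 P) = (%xi. (2 * of_nat CARD('n) + 4 * of_nat e) * P xi + r2 (lap P) xi)"
proof -
 have s: "smooth_on UNIV P" by (rule homp_smooth[OF P])
 have sr: "smooth_on UNIV (r2 R)" if "smooth_on UNIV R" for R
  unfolding r2_def using that by (intro smooth_on_sum smooth_on_cmult) auto
 have "pd m (pd m (r2 P)) = (%xi. 2 * \<gamma> m * P xi + 4 * \<gamma> m * xm m (pd m P) xi + r2 (pd m (pd m P)) xi)" for m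
 proof -
  have "pd m (pd m (r2 P)) = (%xi. 2 * \<gamma> m * (P xi + xm m (pd m P) xi) + (2 * \<gamma> m * xm m (pd m P) xi + r2 (pd m (pd m P)) xi))"
   unfolding pd_r2[OF s] using s by (simp add: pd_add_fun pd_cmult_fun smooth_on_cmult sr smooth_on_pd pd_xm pd_r2)
  then show ?thesis by (auto simp: algebra_simps)
 qed
 moreover have g: "\<gamma> m * (2 * \<gamma> m * z) = 2 * z" "\<gamma> m * (4 * \<gamma> m * z) = 4 * z" for m z
  using \<gamma>[of m] by algebra+
 ultimately have 1: "lap (r2 P) xi = (\<Sum>m\<in>UNIV. 2 * P xi + 4 * xm m (pd m P) xi + \<gamma> m * r2 (pd m (pd m P)) xi)" for xi
  unfolding lap_def by (simp add: distrib_left g)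
 have 2: "(\<Sum>m\<in>UNIV. \<gamma> m * r2 (pd m (pd m P)) xi) = r2 (lap P) xi" for xi
  unfolding r2_def lap_def xm_sum sum_distrib_left by (subst sum.swap) (simp add: mult_ac)
 show ?thesis
  by (rule ext) (simp add: 1 2 sum.distrib sum_distrib_left[symmetric] homp_euler[OF P] algebra_simps)
qed

lemma lap_r2_pow:
 assumes P: "P \<in> homp e"
 shows "\<exists>b::nat. \<forall>xi. r2 (lap ((r2 ^^ s) P)) xi = of_nat b * (r2 ^^ s) P xi + (r2 ^^ Suc s) (lap P) xi"
proof (induction s)
 case 0
 show ?case by (intro exI[of _ 0]) simp
next
 case (Suc s)
 then obtain b where b: "r2 (lap ((r2 ^^ s) P)) = (%xi. of_nat b * (r2 ^^ s) P xi + 1 * (r2 ^^ Suc s) (lap P) xi)" by auto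
 have h: "(r2 ^^ s) P \<in> homp (e + 2 * s)" by (induction s) (use P homp_r2 in auto)
 have "lap ((r2 ^^ Suc s) P) = (%xi. (2 * of_nat CARD('n) + 4 * of_nat (e + 2 * s)) * (r2 ^^ s) P xi + r2 (lap ((r2 ^^ s) P)) xi)"
  using lap_r2[OF h] by simp
 also have "... = (%xi. of_nat (2 * CARD('n) + 4 * (e + 2 * s) + b) * (r2 ^^ s) P xi + 1 * (r2 ^^ Suc s) (lap P) xi)"
  unfolding b by (auto simp: algebra_simps)
 finally have "r2 (lap ((r2 ^^ Suc s) P)) = (%xi. of_nat (2 * CARD('n) + 4 * (e + 2 * s) + b) * r2 ((r2 ^^ s) P) xi + 1 * r2 ((r2 ^^ Suc s) (lap P)) xi)"
  by (simp only: r2_add)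
 then show ?case by (intro exI[of _ "2 * CARD('n) + 4 * (e + 2 * s) + b"]) simp
qed

text \<open>These operators replace the decomposition into harmonic components. By
  \<open>rlap_Suc\<close> the operator \<open>r2 o lap\<close> maps \<open>rlap s P\<close> to a
  natural multiple of itself plus \<open>rlap (Suc s) P\<close>, and the chain ends because
  \<open>rlap s\<close> vanishes once \<open>2 s\<close> exceeds the degree.\<close>

definition rlap :: "nat => (real^'n => complex) => real^'n => complex" where
 "rlap s P = (r2 ^^ s) ((lap ^^ s) P)"

lemma homp_lap_pow: "P \<in> homp d ==> (lap ^^ s) P \<in> homp (d - 2 * s)"
proof (induction s)
 case (Suc s)
 from homp_lap'[OF Suc.IH[OF Suc.prems]] show ?case by (simp add: algebra_simps)
qed simp

lemma homp_rlap: "P \<in> homp d ==> rlap s P \<in> homp d \<and> (2 * s > d \<longrightarrow> rlap s P = (%_. 0))"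
proof -
 assume P: "P \<in> homp d"
 have r0: "(r2 ^^ s) (%_. 0) = (%_. 0)" for s by (induction s) (auto simp: r2_def xm_def)
 have up: "(r2 ^^ s) R \<in> homp (e + 2 * s)" if "R \<in> homp e" for s e R
  using that by (induction s) (auto dest: homp_r2)
 show ?thesis
 proof (cases "2 * s <= d")
  case True
  then show ?thesis using up[OF homp_lap_pow[OF P, of s], of s] by (simp add: rlap_def)
 next
  case False
  then have "(lap ^^ s) P = (%_. 0)"
  proof (induction s)
   case (Suc s)
   show ?case
   proof (cases "2 * s > d")
    case True
    then show ?thesis using Suc.IH by (simp add: lap_def)
   next
    case False
    with Suc.prems have "d - 2 * s < 2" by auto
    from lap_small[OF homp_lap_pow[OF P, of s] this] show ?thesis by simp
   qed
  qed simp
  then show ?thesis by (simp add: rlap_def r0)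
 qed
qed

lemma rlap_Suc:
 assumes P: "P \<in> homp d"
 shows "\<exists>b::nat. \<forall>xi. r2 (lap (rlap s P)) xi = of_nat b * rlap s P xi + rlap (Suc s) P xi"
 using lap_r2_pow[OF homp_lap_pow[OF P, of s], of s] unfolding rlap_def by simp

text \<open>If \<open>P\<close> were an eigenvector for \<open>-c\<close>, each step of the chain
  would multiply it by \<open>-(c + b)\<close> with \<open>b\<close> natural, so every
  \<open>rlap s P\<close> would be a nonzero multiple of \<open>P\<close>; but
  \<open>rlap (Suc d) P = 0\<close>.\<close>

lemma eigen_zero:
 assumes P: "P \<in> homp d" and eq: "!!xi. r2 (lap P) xi = - of_nat c * P xi" and c: "c > 0"
 shows "P xi = 0"
proof -
 have "\<exists>z. z \<noteq> 0 \<and> rlap s P = (%xi. z * P xi + 0 * P xi)" for s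
 proof (induction s)
  case 0
  show ?case by (intro exI[of _ 1]) (simp add: rlap_def)
 next
  case (Suc s)
  then obtain z where z: "z \<noteq> 0" "rlap s P = (%xi. z * P xi + 0 * P xi)" by blast
  obtain b :: nat where b: "!!xi. r2 (lap (rlap s P)) xi = of_nat b * rlap s P xi + rlap (Suc s) P xi"
   using rlap_Suc[OF P] by blast
  have "r2 (lap (rlap s P)) = (%xi. z * r2 (lap P) xi + 0 * r2 (lap P) xi)"
   unfolding z(2) lap_add[OF homp_smooth[OF P] homp_smooth[OF P]] r2_add ..
  then have r: "z * r2 (lap P) xi + 0 * r2 (lap P) xi = of_nat b * (z * P xi + 0 * P xi) + rlap (Suc s) P xi" for xi
   using b[of xi] unfolding z(2) by simp
  have "rlap (Suc s) P xi = z * (- of_nat (c + b)) * P xi + 0 * P xi" for xi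
   using r[of xi] eq[of xi] unfolding of_nat_add by algebra
  moreover have "z * (- of_nat (c + b)) \<noteq> 0" using z(1) c by (simp only: mult_eq_0_iff neg_equal_0_iff_equal of_nat_eq_0_iff) simp
  ultimately show ?case by blast
 qed
 then obtain z where z: "z \<noteq> 0" "rlap (Suc d) P = (%xi. z * P xi + 0 * P xi)" by blast
 moreover have "rlap (Suc d) P = (%_. 0)" using homp_rlap[OF P, of "Suc d"] by simp
 ultimately have "z * P xi = 0" by (metis add_0_right mult_zero_left)
 then show ?thesis using z(1) by simp
qed

text \<open>The dual statement for a linear functional, by descent along the chain: from
  \<open>u (rlap (Suc t) P) = 0\<close> one gets \<open>(c + b) u (rlap t P) = 0\<close>, down to
  \<open>rlap 0 P = P\<close>.\<close>

lemma annihilator_zero: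
 assumes lin: "!!P R a b. P \<in> homp d ==> R \<in> homp d ==> u (%xi. a * P xi + b * R xi) = a * u P + b * u R"
  and eq: "!!P. P \<in> homp d ==> u (r2 (lap P)) = - of_nat c * u P" and c: "c > 0" and P: "P \<in> homp d"
 shows "u P = (0 :: complex)"
proof -
 have z: "u (%_. 0) = 0" using lin[of "%_. 0" "%_. 0" 0 0] by simp
 have "u (rlap (Suc d - s) P) = 0" if "s <= Suc d" for s
  using that
 proof (induction s)
  case 0
  then show ?case using homp_rlap[OF P, of "Suc d"] z by simp
 next
  case (Suc s)
  let ?t = "d - s"
  have t: "Suc d - s = Suc ?t" "Suc d - Suc s = ?t" using Suc.prems by auto
  obtain b :: nat where b: "!!xi. r2 (lap (rlap ?t P)) xi = of_nat b * rlap ?t P xi + rlap (Suc ?t) P xi"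
   using rlap_Suc[OF P] by blast
  then have bf: "r2 (lap (rlap ?t P)) = (%xi. of_nat b * rlap ?t P xi + 1 * rlap (Suc ?t) P xi)" by auto
  have h: "rlap ?t P \<in> homp d" "rlap (Suc ?t) P \<in> homp d" using homp_rlap[OF P] by blast+
  have "- of_nat c * u (rlap ?t P) = of_nat b * u (rlap ?t P) + 1 * u (rlap (Suc ?t) P)"
   using eq[OF h(1)] unfolding bf lin[OF h] by simp
  moreover have "u (rlap (Suc ?t) P) = 0" using Suc t by simp
  ultimately have "of_nat (c + b) * u (rlap ?t P) = 0" unfolding of_nat_add by algebra
  then show ?case using c t by (simp only: mult_eq_0_iff of_nat_eq_0_iff) simp
 qed
 from this[of "Suc d"] show ?thesis by (simp add: rlap_def)
qed

text \<open>\<open>rot a b\<close> generates the rotations fixing the form.\<close>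

definition rot :: "'n => 'n => (real^'n => complex) => real^'n => complex" where
 "rot a b P = (%xi. \<gamma> b * xm a (pd b P) xi - \<gamma> a * xm b (pd a P) xi)"

lemma homp_rot: "P \<in> homp d ==> rot a b P \<in> homp d"
proof (cases d)
 case 0
 assume "P \<in> homp d"
 then show ?thesis using 0 by (simp add: rot_def homp_pd_0 xm_def)
next
 case (Suc e)
 assume "P \<in> homp d"
 then have "(%xi. \<gamma> b * xm a (pd b P) xi + (- \<gamma> a) * xm b (pd a P) xi) \<in> homp d"
  unfolding Suc by (intro homp_add homp_cmult homp_xm homp_pd)
 then show ?thesis by (simp add: rot_def)
qed

section \<open>Rotations and the Casimir operator\<close>

lemma pd_rot:
 assumes "smooth_on UNIV P"
 shows "pd i (rot a b P) xi = rot a b (pd i P) xi + (if i = a then \<gamma> b * pd b P xi else 0) - (if i = b then \<gamma> a * pd a P xi else 0)"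
proof -
 have s: "smooth_on UNIV (pd j P)" for j using assms by (rule smooth_on_pd)
 have "pd i (rot a b P) xi = \<gamma> b * pd i (xm a (pd b P)) xi - \<gamma> a * pd i (xm b (pd a P)) xi"
  unfolding rot_def using s by (simp add: pd_diff_fun pd_cmult_fun smooth_on_cmult)
 then show ?thesis
  unfolding pd_xm[OF s] pd_commute_fun[OF assms, of i a] pd_commute_fun[OF assms, of i b] rot_def[of a b "pd i P"]
  by (cases "i = a"; cases "i = b") (simp_all add: algebra_simps)
qed

text \<open>The quadratic Casimir of the orthogonal algebra, expressed by \<open>r2 o lap\<close>
  and the degree. It converts commutation with rotations into an eigenvalue equation for
  \<open>r2 o lap\<close>.\<close>

lemma casimir:
 assumes P: "P \<in> homp d"
 shows "(\<Sum>a\<in>UNIV. \<Sum>b\<in>UNIV. \<gamma> a * \<gamma> b * rot a b (rot a b P) xi) =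
  2 * (r2 (lap P) xi - (of_nat d * of_nat d + (of_nat CARD('n) - 2) * of_nat d) * P xi)"
proof -
 have s: "smooth_on UNIV P" by (rule homp_smooth[OF P])
 let ?x = "%i. cor (xi $ i)" and ?d = "%i. pd i P xi" and ?dd = "%i j. pd i (pd j P) xi"
 have dd: "?dd i j = ?dd j i" for i j using pd_commute_fun[OF s, of i j] by simp
 \<comment> \<open>For \<open>a = b\<close> the rotation is zero while the generic terms add up to
   \<open>-2 xi_a pd a P\<close>; the conditional summand compensates this.\<close>
 have trm: "\<gamma> a * \<gamma> b * rot a b (rot a b P) xi =
   (\<gamma> a * (?x a * ?x a)) * (\<gamma> b * ?dd b b) + (\<gamma> b * (?x b * ?x b)) * (\<gamma> a * ?dd a a)
   - 2 * (?x a * (?x b * ?dd a b)) - ?x a * ?d a - ?x b * ?d b + (if a = b then 2 * (?x a * ?d a) else 0)" for a b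
 proof -
  have "rot a b (rot a b P) xi = \<gamma> b * (?x a * pd b (rot a b P) xi) - \<gamma> a * (?x b * pd a (rot a b P) xi)"
   by (simp add: rot_def[of a b "rot a b P"] xm_def)
  also have "... = \<gamma> b * (?x a * (\<gamma> b * (?x a * ?dd b b) - \<gamma> a * (?x b * ?dd a b) + (if b = a then \<gamma> b * ?d b else 0) - \<gamma> a * ?d a))
   - \<gamma> a * (?x b * (\<gamma> b * (?x a * ?dd b a) - \<gamma> a * (?x b * ?dd a a) + \<gamma> b * ?d b - (if a = b then \<gamma> a * ?d a else 0)))"
   unfolding pd_rot[OF s] unfolding rot_def xm_def by simp
  finally have *: "rot a b (rot a b P) xi = ..." .
  show ?thesis
  proof (cases "a = b")
   case True
   then show ?thesis unfolding * by (simp add: algebra_simps)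
  next
   case False
   have g: "\<gamma> a * (\<gamma> a * z) = z" "\<gamma> b * (\<gamma> b * z) = z" "\<gamma> a * (\<gamma> b * (\<gamma> a * z)) = \<gamma> b * z"
    "\<gamma> a * (\<gamma> b * (\<gamma> b * z)) = \<gamma> a * z" "\<gamma> b * (\<gamma> a * (\<gamma> b * z)) = \<gamma> a * z" "\<gamma> b * (\<gamma> a * (\<gamma> a * z)) = \<gamma> b * z" for z
    by (simp_all add: mult.left_commute)
   show ?thesis unfolding * using False by (simp add: algebra_simps g dd[of b a])
  qed
 qed
 have e1: "(\<Sum>a\<in>UNIV. ?x a * ?d a) = of_nat d * P xi" using homp_euler[OF P, of xi] by (simp add: xm_def)
 \<comment> \<open>Euler's relation is applied a second time, to the derivatives of
   \<open>P\<close>, which have degree \<open>d - 1\<close>.\<close>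
 have e2: "(\<Sum>a\<in>UNIV. \<Sum>b\<in>UNIV. ?x a * (?x b * ?dd a b)) = (of_nat d * of_nat d - of_nat d) * P xi"
 proof (cases d)
  case 0
  then have "pd b P = (%_. 0)" for b using P homp_pd_0 by blast
  then show ?thesis using 0 by simp
 next
  case (Suc e)
  have "(\<Sum>a\<in>UNIV. ?x a * ?dd a b) = of_nat e * ?d b" for b
   using homp_euler[OF homp_pd[OF P[unfolded Suc]], of b xi] by (simp add: xm_def)
  then have "(\<Sum>b\<in>UNIV. ?x b * (\<Sum>a\<in>UNIV. ?x a * ?dd a b)) = of_nat e * (\<Sum>b\<in>UNIV. ?x b * ?d b)"
   by (simp add: sum_distrib_left mult.left_commute)
  moreover have "(\<Sum>a\<in>UNIV. \<Sum>b\<in>UNIV. ?x a * (?x b * ?dd a b)) = (\<Sum>b\<in>UNIV. ?x b * (\<Sum>a\<in>UNIV. ?x a * ?dd a b))"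
   by (subst sum.swap) (simp add: sum_distrib_left mult.left_commute)
  ultimately show ?thesis using e1 Suc by (simp add: algebra_simps)
 qed
 have e3: "(\<Sum>a\<in>UNIV. \<gamma> a * (?x a * ?x a)) * (\<Sum>b\<in>UNIV. \<gamma> b * ?dd b b) = r2 (lap P) xi"
  by (simp add: r2_def xm_def lap_def sum_distrib_right mult.assoc)
 have "(\<Sum>a\<in>UNIV. \<Sum>b\<in>UNIV. \<gamma> a * \<gamma> b * rot a b (rot a b P) xi) =
   (\<Sum>a\<in>UNIV. \<Sum>b\<in>UNIV. (\<gamma> a * (?x a * ?x a)) * (\<gamma> b * ?dd b b)) + (\<Sum>a\<in>UNIV. \<Sum>b\<in>UNIV. (\<gamma> b * (?x b * ?x b)) * (\<gamma> a * ?dd a a))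
   - 2 * (\<Sum>a\<in>UNIV. \<Sum>b\<in>UNIV. ?x a * (?x b * ?dd a b)) - (\<Sum>a\<in>UNIV. \<Sum>b\<in>(UNIV::'n set). ?x a * ?d a)
   - (\<Sum>a\<in>(UNIV::'n set). \<Sum>b\<in>UNIV. ?x b * ?d b) + 2 * (\<Sum>a\<in>UNIV. ?x a * ?d a)"
  unfolding trm by (simp add: sum.distrib sum_subtractf sum_distrib_left)
 also have "(\<Sum>a\<in>UNIV. \<Sum>b\<in>UNIV. (\<gamma> a * (?x a * ?x a)) * (\<gamma> b * ?dd b b)) = r2 (lap P) xi"
  unfolding e3[symmetric] by (simp add: sum_product)
 also have "(\<Sum>a\<in>UNIV. \<Sum>b\<in>UNIV. (\<gamma> b * (?x b * ?x b)) * (\<gamma> a * ?dd a a)) = r2 (lap P) xi"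
  unfolding e3[symmetric] sum_product by (subst sum.swap) simp
 also have "(\<Sum>a\<in>UNIV. \<Sum>b\<in>(UNIV::'n set). ?x a * ?d a) = of_nat CARD('n) * (of_nat d * P xi)"
  by (simp add: e1[symmetric] sum_distrib_left)
 finally show ?thesis unfolding e2 e1 by (simp add: algebra_simps)
qed

text \<open>Uniqueness of the first correction: \<open>S\<close> stands for the difference of two
  solutions, \<open>roteq\<close> and \<open>xbar\<close> for the rotation and inversion equations.
  The contraction \<open>u\<close> of \<open>S\<close> with \<open>xi\<close> is killed by means of
  \<open>xbar\<close>; then \<open>S\<close> is recovered from \<open>v\<close>, which commutes with
  rotations and annihilates the image of \<open>r2\<close>. Comparing Casimir values in degrees
  \<open>Suc (Suc K)\<close> and \<open>K\<close> kills \<open>v\<close>.\<close>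

lemma no_invariant:
 assumes lin: "!!i T a F xi. [|finite T; !!s. s \<in> T ==> F s \<in> homp (Suc K)|] ==> S i (%xi. \<Sum>s\<in>(T::'n option set). a s * F s xi) xi = (\<Sum>s\<in>T. a s * S i (F s) xi)"
  and mem: "!!i P. P \<in> homp (Suc K) ==> S i P \<in> homp K"
  and roteq: "!!a b i P xi. P \<in> homp (Suc K) ==>
   S i (rot a b P) xi = rot a b (S i P) xi - (if i = b then \<gamma> a * S a P xi else 0) + (if i = a then \<gamma> b * S b P xi else 0)"
  and xbar: "!!m P xi. P \<in> homp (Suc K) ==>
   (\<Sum>i\<in>UNIV. \<gamma> i * S i (xm m (pd i P)) xi) - \<gamma> m * (\<Sum>i\<in>UNIV. S i (xm i (pd m P)) xi) = of_nat (Suc K) * \<gamma> m * S m P xi"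
  and P: "P \<in> homp (Suc K)"
 shows "S m P xi = 0"
proof -
 define u where "u R xi = (\<Sum>i\<in>UNIV. S i (xm i R) xi)" for R xi
 define v where "v W xi = (\<Sum>i\<in>UNIV. \<gamma> i * S i (pd i W) xi)" for W xi
 \<comment> \<open>The index type \<open>'n option\<close> lets the single hypothesis
   \<open>lin\<close> serve both for two summands, as here, and for sums over all coordinates, as in
   \<open>linU\<close>.\<close>
 have lin2: "S i (%xi. a * A xi + b * B xi) xi = a * S i A xi + b * S i B xi" if "A \<in> homp (Suc K)" "B \<in> homp (Suc K)" for i a b A B xi
  using lin[of "{None, Some undefined}" "%s. if s = None then A else B" i "%s. if s = None then a else b" xi] that by simp
 have linU: "S i (%xi. \<Sum>s\<in>UNIV. a s * F s xi) xi = (\<Sum>s\<in>UNIV. a s * S i (F s) xi)" if "!!s. F s \<in> homp (Suc K)" for i and a :: "'n => complex" and F xi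
  using lin[of "Some ` UNIV" "%s. F (the s)" i "%s. a (the s)" xi] that by (simp add: sum.reindex)
 have vlin: "v (%xi. \<Sum>s\<in>UNIV. a s * F s xi) xi = (\<Sum>s\<in>UNIV. a s * v (F s) xi)" if F: "!!s. F s \<in> homp (Suc (Suc K))" for a :: "'n => complex" and F xi
 proof -
  have "pd i (%xi. \<Sum>s\<in>UNIV. a s * F s xi) = (%xi. \<Sum>s\<in>UNIV. a s * pd i (F s) xi)" for i
   using homp_smooth[OF F] by (simp add: pd_sum_fun pd_cmult_fun smooth_on_cmult)
  then show ?thesis
   unfolding v_def using linU[OF homp_pd[OF F]] by (simp add: sum_distrib_left mult.left_commute) (subst sum.swap, simp)
 qed
 have ulin: "u (%xi. a * A xi + b * B xi) xi = a * u A xi + b * u B xi" if "A \<in> homp K" "B \<in> homp K" for a b A B xi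
 proof -
  have "xm i (%xi. a * A xi + b * B xi) = (%xi. a * xm i A xi + b * xm i B xi)" for i by (auto simp: xm_def algebra_simps)
  then show ?thesis unfolding u_def using lin2[OF homp_xm[OF that(1)] homp_xm[OF that(2)]] by (simp add: sum.distrib sum_distrib_left)
 qed
 have usum: "u (%xi. \<Sum>s\<in>UNIV. a s * F s xi) xi = (\<Sum>s\<in>UNIV. a s * u (F s) xi)" if F: "!!s. F s \<in> homp K" for a :: "'n => complex" and F xi
  unfolding u_def xm_sum using linU[OF homp_xm[OF F]] by (simp add: sum_distrib_left) (subst sum.swap, simp)
 \<comment> \<open>The inversion equation rewritten in \<open>u\<close> and \<open>v\<close>; the
   Leibniz term of \<open>xi_m P\<close> contributes one more copy of \<open>S m P\<close>, raising
   the factor from \<open>Suc K\<close> to \<open>Suc (Suc K)\<close>.\<close>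
 have key: "v (xm m P) xi = \<gamma> m * u (pd m P) xi + of_nat (Suc (Suc K)) * \<gamma> m * S m P xi" if P: "P \<in> homp (Suc K)" for m P xi
 proof -
  have "pd i (xm m P) = (%xi. (if i = m then 1 else 0) * P xi + 1 * xm m (pd i P) xi)" for i
   using homp_smooth[OF P] by (auto simp: pd_xm)
  then have "S i (pd i (xm m P)) xi = (if i = m then 1 else 0) * S i P xi + 1 * S i (xm m (pd i P)) xi" for i
   by (simp only: lin2[OF P homp_xm[OF homp_pd[OF P]]])
  then have "v (xm m P) xi = \<gamma> m * S m P xi + (\<Sum>i\<in>UNIV. \<gamma> i * S i (xm m (pd i P)) xi)"
   unfolding v_def by (simp add: distrib_left sum.distrib if_distrib[of "%x. x * _"] if_distrib[of "%x. _ * x"] cong: if_cong)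
  then show ?thesis using xbar[OF P, of m xi] unfolding u_def by (simp add: algebra_simps)
 qed
 \<comment> \<open>Sum \<open>key\<close> over \<open>m\<close> for the polynomials
   \<open>pd m W\<close>. By Euler's relation the left side is \<open>Suc (Suc K)\<close> times
   \<open>v W\<close>, which cancels against the same term on the right.\<close>
 have u_lap: "u (lap W) xi = 0" if W: "W \<in> homp (Suc (Suc K))" for W xi
 proof -
  have "(\<Sum>m\<in>UNIV. v (xm m (pd m W)) xi) = (\<Sum>m\<in>UNIV. \<gamma> m * u (pd m (pd m W)) xi) + of_nat (Suc (Suc K)) * v W xi"
   unfolding key[OF homp_pd[OF W]] by (simp add: v_def sum.distrib sum_distrib_left mult.assoc)
  moreover have "(\<Sum>m\<in>UNIV. \<gamma> m * u (pd m (pd m W)) xi) = u (lap W) xi"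
   unfolding lap_def by (rule usum[symmetric]) (intro homp_pd W)
  moreover have "(\<Sum>m\<in>UNIV. v (xm m (pd m W)) xi) = v (%xi. \<Sum>m\<in>UNIV. 1 * xm m (pd m W) xi) xi"
   using vlin[of "%m. xm m (pd m W)" "%_. 1" xi] homp_xm[OF homp_pd[OF W]] by simp
  moreover have "(%xi. \<Sum>m\<in>UNIV. 1 * xm m (pd m W) xi) = (%xi. of_nat (Suc (Suc K)) * W xi)" using homp_euler[OF W] by auto
  moreover have "v (%xi. of_nat (Suc (Suc K)) * W xi) xi = of_nat (Suc (Suc K)) * v W xi"
  proof -
   have "S i (%xi. a * pd i W xi + 0 * pd i W xi) xi = a * S i (pd i W) xi + 0 * S i (pd i W) xi" for a i
    by (rule lin2[OF homp_pd[OF W] homp_pd[OF W]])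
   then have S1: "S i (%xi. a * pd i W xi) xi = a * S i (pd i W) xi" for a i by simp
   show ?thesis unfolding v_def pd_cmult_fun[OF homp_smooth[OF W]] S1
    by (simp only: sum_distrib_left mult.left_commute)
  qed
  ultimately show ?thesis by simp
 qed
 \<comment> \<open>Applied to \<open>r2 P\<close>, \<open>u_lap\<close> and the commutator of
   \<open>lap\<close> with \<open>r2\<close> show that \<open>u o r2 o lap\<close> is
   \<open>-(2 n + 4 K) u\<close>.\<close>
 have u0: "u R xi = 0" if R: "R \<in> homp K" for R xi
 proof (rule annihilator_zero[where c="2 * CARD('n) + 4 * K" and d=K and u="%R. u R xi", OF _ _ _ R])
  show "u (r2 (lap P)) xi = - of_nat (2 * CARD('n) + 4 * K) * u P xi" if P: "P \<in> homp K" for P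
  proof -
   have rl: "r2 (lap P) \<in> homp K" using homp_rlap[OF P, of 1] by (simp add: rlap_def)
   have z: "u (lap (r2 P)) xi = 0" by (rule u_lap[OF homp_r2[OF P]])
   have l: "lap (r2 P) = (%xi. of_nat (2 * CARD('n) + 4 * K) * P xi + 1 * r2 (lap P) xi)" using lap_r2[OF P] by simp
   have "of_nat (2 * CARD('n) + 4 * K) * u P xi + 1 * u (r2 (lap P)) xi = 0" using z unfolding l ulin[OF P rl] .
   then show ?thesis by algebra
  qed
 qed (auto simp: ulin)
 have vx: "v (xm m P) xi = of_nat (Suc (Suc K)) * \<gamma> m * S m P xi" if P: "P \<in> homp (Suc K)" for m P xi
  using key[OF P] u0[OF homp_pd[OF P]] by simp
 \<comment> \<open>With \<open>u = 0\<close>, \<open>key\<close> expresses \<open>v (xi_m P)\<close>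
   through \<open>S m P\<close>; contracting once more returns a multiple of
   \<open>u\<close>.\<close>
 have v_r2: "v (r2 R) xi = 0" if R: "R \<in> homp K" for R xi
 proof -
  have "v (r2 R) xi = (\<Sum>m\<in>UNIV. \<gamma> m * v (xm m (xm m R)) xi)"
   unfolding r2_def by (rule vlin) (intro homp_xm R)
  also have "... = of_nat (Suc (Suc K)) * u R xi"
   unfolding vx[OF homp_xm[OF R]] u_def sum_distrib_left by (intro sum.cong refl) (simp add: mult.left_commute mult.assoc del: of_nat_Suc)
  finally show ?thesis using u0[OF R] by simp
 qed
 have vmem: "v W \<in> homp K" if W: "W \<in> homp (Suc (Suc K))" for W
  unfolding v_def[abs_def] by (intro homp_sum mem homp_pd W)
 have vrot: "v (rot a b W) = rot a b (v W)" if W: "W \<in> homp (Suc (Suc K))" for a b W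
 proof
  fix xi
  have sS: "smooth_on UNIV (S i (pd i W))" for i by (rule homp_smooth[OF mem[OF homp_pd[OF W]]])
  have "pd i (rot a b W) = (%xi. 1 * rot a b (pd i W) xi + 1 * ((if i = a then \<gamma> b else 0) * pd b W xi + (if i = b then - \<gamma> a else 0) * pd a W xi))" for i
   using pd_rot[OF homp_smooth[OF W]] by auto
  then have "S i (pd i (rot a b W)) xi = 1 * S i (rot a b (pd i W)) xi +
    1 * ((if i = a then \<gamma> b else 0) * S i (pd b W) xi + (if i = b then - \<gamma> a else 0) * S i (pd a W) xi)" for i
   by (simp only: lin2[OF homp_rot[OF homp_pd[OF W]] homp_add[OF homp_cmult homp_cmult, OF homp_pd[OF W] homp_pd[OF W]]]
     lin2[OF homp_pd[OF W] homp_pd[OF W]])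
  then have "v (rot a b W) xi = (\<Sum>i\<in>UNIV. \<gamma> i * rot a b (S i (pd i W)) xi) - \<gamma> b * (\<gamma> a * S a (pd b W) xi) + \<gamma> a * (\<gamma> b * S b (pd a W) xi)
    + \<gamma> a * (\<gamma> b * S a (pd b W) xi) - \<gamma> b * (\<gamma> a * S b (pd a W) xi)"
   unfolding v_def by (simp add: roteq[OF homp_pd[OF W]] distrib_left right_diff_distrib sum.distrib sum_subtractf
     if_distrib[of "%x. x * _"] if_distrib[of "%x. _ * x"] cong: if_cong)
  also have "... = (\<Sum>i\<in>UNIV. \<gamma> i * rot a b (S i (pd i W)) xi)" by (simp add: mult.left_commute)
  also have "... = rot a b (v W) xi"
  proof -
   have "pd j (v W) = (%xi. \<Sum>i\<in>UNIV. \<gamma> i * pd j (S i (pd i W)) xi)" for j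
    unfolding v_def[abs_def] using sS by (simp add: pd_sum_fun pd_cmult_fun smooth_on_cmult)
   then show ?thesis
    unfolding rot_def by (simp add: xm_sum right_diff_distrib sum_subtractf sum_distrib_left mult.left_commute)
  qed
  finally show "v (rot a b W) xi = rot a b (v W) xi" .
 qed
 \<comment> \<open>The Casimir of \<open>v W\<close> is computed in the target and, since
   \<open>v\<close> commutes with rotations, in the source, where the term with \<open>r2\<close>
   drops out. The difference of the two constants is \<open>-(2 n + 4 K)\<close>, a negative
   eigenvalue.\<close>
 have v0: "v W xi = 0" if W: "W \<in> homp (Suc (Suc K))" for W xi
 proof (rule eigen_zero[OF vmem[OF W], where c="2 * CARD('n) + 4 * K"])
  fix xi
  let ?n = "of_nat CARD('n) :: complex" and ?K = "of_nat K :: complex"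
  have "(\<Sum>a\<in>UNIV. \<Sum>b\<in>UNIV. \<gamma> a * \<gamma> b * rot a b (rot a b (v W)) xi) = (\<Sum>a\<in>UNIV. \<Sum>b\<in>UNIV. \<gamma> a * \<gamma> b * v (rot a b (rot a b W)) xi)"
   by (simp add: vrot W homp_rot)
  also have "... = (\<Sum>a\<in>UNIV. \<gamma> a * v (%xi. \<Sum>b\<in>UNIV. \<gamma> b * rot a b (rot a b W) xi) xi)"
   using vlin[OF homp_rot[OF homp_rot[OF W]]] by (simp add: sum_distrib_left mult.assoc)
  also have "... = v (%xi. \<Sum>a\<in>UNIV. \<gamma> a * (\<Sum>b\<in>UNIV. \<gamma> b * rot a b (rot a b W) xi)) xi"
   by (rule vlin[symmetric]) (intro homp_sum homp_rot W)
  also have "(%xi. \<Sum>a\<in>UNIV. \<gamma> a * (\<Sum>b\<in>UNIV. \<gamma> b * rot a b (rot a b W) xi)) =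
    (%xi. 2 * r2 (lap W) xi + (- 2 * (of_nat (Suc (Suc K)) * of_nat (Suc (Suc K)) + (?n - 2) * of_nat (Suc (Suc K)))) * W xi)"
   using casimir[OF W] by (auto simp: sum_distrib_left mult.assoc algebra_simps simp del: of_nat_Suc)
  also have "v ... xi = 2 * v (r2 (lap W)) xi + (- 2 * (of_nat (Suc (Suc K)) * of_nat (Suc (Suc K)) + (?n - 2) * of_nat (Suc (Suc K)))) * v W xi"
  proof -
   have rl: "r2 (lap W) \<in> homp (Suc (Suc K))" by (rule homp_r2[OF homp_lap[OF W]])
   have "v (%xi. a * A xi + b * B xi) xi = a * v A xi + b * v B xi" if A: "A \<in> homp (Suc (Suc K))" and B: "B \<in> homp (Suc (Suc K))" for a b A B
   proof -
    have "pd i (%xi. a * A xi + b * B xi) = (%xi. a * pd i A xi + b * pd i B xi)" for i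
     using homp_smooth[OF A] homp_smooth[OF B] by (simp add: pd_add_fun pd_cmult_fun smooth_on_cmult)
    then show ?thesis unfolding v_def using lin2[OF homp_pd[OF A] homp_pd[OF B]] by (simp add: algebra_simps sum.distrib sum_distrib_left)
   qed
   from this[OF rl W] show ?thesis .
  qed
  finally have "2 * (r2 (lap (v W)) xi - (?K * ?K + (?n - 2) * ?K) * v W xi) =
   (- 2 * (of_nat (Suc (Suc K)) * of_nat (Suc (Suc K)) + (?n - 2) * of_nat (Suc (Suc K)))) * v W xi"
   unfolding casimir[OF vmem[OF W]] v_r2[OF homp_lap[OF W]] by simp
  then have "2 * (r2 (lap (v W)) xi) = 2 * (- of_nat (2 * CARD('n) + 4 * K) * v W xi)"
   unfolding of_nat_Suc of_nat_add of_nat_mult of_nat_numeral by algebra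
  then show "r2 (lap (v W)) xi = - of_nat (2 * CARD('n) + 4 * K) * v W xi" by simp
 qed simp
 have "of_nat (Suc (Suc K)) * (\<gamma> m * S m P xi) = 0" using vx[OF P, of m xi] v0[OF homp_xm[OF P]] by (simp add: mult.assoc del: of_nat_Suc)
 then have "\<gamma> m * S m P xi = 0" by (simp only: mult_eq_0_iff of_nat_eq_0_iff) simp
 then show ?thesis using \<gamma>[of m] by auto
qed

end

section \<open>Conformal fields centred at a point\<close>

definition dsym :: "'n::finite list => 'n lsymbol => 'n lsymbol" where
 "dsym I p y xi = pds I (%z. p z xi) y"

lemma dsym_expand:
 assumes S: "open Om" and a: "!!J. smooth_on Om (a J)" "!!y xi. y \<in> Om ==> p y xi = (\<Sum>J\<in>L. a J y * monomial J xi)" and y: "y \<in> Om"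
 shows "dsym I p y xi = (\<Sum>J\<in>L. pds I (a J) y * monomial J xi)"
proof -
 have "dsym I p y xi = pds I (%z. \<Sum>J\<in>L. monomial J xi * a J z) y"
  unfolding dsym_def by (rule pds_cong[OF S _ y]) (simp add: a(2) mult.commute)
 also have "... = (\<Sum>J\<in>L. pds I (%z. monomial J xi * a J z) y)"
  by (rule pds_sum[OF S smooth_on_cmult[OF S a(1)] y])
 finally show ?thesis by (simp add: pds_cmult[OF S a(1) y] mult.commute)
qed

lemma dsym_local:
 assumes S: "open Om" and p: "p \<in> LS L Om"
 shows "dsym I p \<in> LS L Om"
proof -
 obtain a where a: "!!I. smooth_on Om (a I)" "!!y xi. y \<in> Om ==> p y xi = (\<Sum>I\<in>L. a I y * monomial I xi)"
  using local_symbolsE[OF p] by blast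
 show ?thesis
  by (rule local_symbolsI[of _ "%J. pds I (a J)"]) (auto intro: smooth_on_pds a(1) dsym_expand[OF S a])
qed

lemma pds_fibre_coeff:
 assumes S: "open Om" and p: "p \<in> LS L Om" and y: "y \<in> Om"
 shows "pds I (fibre_coeff J p) y = fibre_coeff J (dsym I p) y"
proof -
 obtain a where a: "!!I. smooth_on Om (a I)" "!!y xi. y \<in> Om ==> p y xi = (\<Sum>I\<in>L. a I y * monomial I xi)"
  using local_symbolsE[OF p] by blast
 let ?c = "%K. pds J (monomial K) 0 / fact (length J)"
 have "pds I (fibre_coeff J p) y = pds I (%z. \<Sum>K\<in>L. ?c K * a K z) y"
  by (rule pds_cong[OF S _ y]) (subst fibre_coeff_expand[of p _ a L, OF a(2)], auto simp: mult.commute)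
 also have "... = (\<Sum>K\<in>L. pds I (%z. ?c K * a K z) y)"
  by (rule pds_sum[OF S smooth_on_cmult[OF S a(1)] y])
 also have "... = (\<Sum>K\<in>L. pds I (a K) y * ?c K)" by (simp only: pds_cmult[OF S a(1) y]) (simp add: mult.commute)
 also have "... = fibre_coeff J (dsym I p) y"
  by (rule fibre_coeff_expand[of "dsym I p" y "%K. pds I (a K)" L, symmetric]) (rule dsym_expand[OF S a y])
 finally show ?thesis .
qed

lemma dsym_hom_part:
 assumes S: "open Om" and p: "p \<in> LS L Om" and y: "y \<in> Om"
 shows "dsym I (hom_part d p) y xi = hom_part d (dsym I p) y xi"
 unfolding hom_part_def
 by (subst dsym_expand[OF S fibre_coeff_smooth[OF S p] _ y, where L="deg_eq d"]) (auto simp: hom_part_def pds_fibre_coeff[OF S p y])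

lemma dsym_append: "dsym (I @ J) p = dsym I (dsym J p)"
 by (auto simp: dsym_def fun_eq_iff pds_append)

text \<open>Derivatives of order less than \<open>N\<close> are meant, so vanishing of the jet of
  order \<open>j\<close> is \<open>jet_zero (Suc j)\<close>. Only base derivatives count, but for
  all \<open>xi\<close> at once.\<close>

definition jet_zero :: "nat => 'n::finite lsymbol => real^'n => bool" where
 "jet_zero N p y \<longleftrightarrow> (\<forall>I xi. length I < N \<longrightarrow> dsym I p y xi = 0)"

lemma hom_part_zero: "(!!xi. p y xi = 0) ==> hom_part d p y xi = 0"
proof -
 assume "!!xi. p y xi = 0"
 then have "p y = (%_. 0)" by auto
 then show ?thesis by (simp add: hom_part_def fibre_coeff_def pds_const)
qed

lemma jet_zero_hom_part:
 assumes "open Om" "p \<in> LS L Om" "y \<in> Om" "jet_zero N p y"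
 shows "jet_zero N (hom_part d p) y"
 unfolding jet_zero_def
proof (intro allI impI)
 fix I :: "'a list" and xi assume "length I < N"
 then have z: "dsym I p y eta = 0" for eta using assms(4) by (simp add: jet_zero_def)
 show "dsym I (hom_part d p) y xi = 0"
  unfolding dsym_hom_part[OF assms(1-3)] by (rule hom_part_zero) (rule z)
qed

lemma homp_hom_part: "hom_part d b y \<in> homp d"
 unfolding homp_def hom_part_def[abs_def] by (auto intro!: LS_sum LS_cscale LS_monomial)

lemma homp_const_local: "P \<in> homp d ==> open Om ==> smooth_on Om u ==> (%y xi. u y * P xi) \<in> LS (deg_eq d) Om"
 unfolding homp_def using LS_scale[OF _ _ LS_restrict[of "%_. P" "deg_eq d" UNIV Om]] by simp

text \<open>Passes from an identity of full symbols at a point to homogeneous parts, for an operator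
  lowering the fibre degree by exactly \<open>s\<close>.\<close>

lemma hom_part_operator:
 fixes L :: "(real^'n::finite => complex) => real^'n => complex"
 assumes S: "open Om" and b: "b \<in> LS (deg_le k) Om" and y: "y \<in> Om"
  and lin: "!!F. (!!e. smooth_on UNIV (F e)) ==> L (%xi. \<Sum>e\<le>k. F e xi) = (%xi. \<Sum>e\<le>k. L (F e) xi)"
  and low: "!!e P. P \<in> homp e ==> e < s ==> L P = (%_. 0)" and mem: "!!e P. P \<in> homp (e + s) ==> L P \<in> homp e"
  and r: "!!xi. r z xi = L (b y) xi"
 shows "hom_part d r z xi = L (hom_part (d + s) b y) xi"
proof -
 let ?H = "%e. hom_part e b y"
 have by': "b y = (%xi. \<Sum>e\<le>k. ?H e xi)" using hom_part_sum[OF b y] by auto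
 \<comment> \<open>The sum in \<open>lin\<close> has a fixed length, so it does not give
   \<open>L 0 = 0\<close> directly. Instead \<open>L 0\<close> is homogeneous of degree 0 and of
   degree 1 at once.\<close>
 have L0: "L (%_. 0) = (%_. 0)"
 proof -
  have m0: "(%_ :: real^'n. L (%_. 0)) \<in> LS (deg_eq 0) UNIV" using mem[OF homp_zero, of 0] unfolding homp_def by simp
  have m1: "(%_ :: real^'n. L (%_. 0)) \<in> LS (deg_eq (Suc 0)) UNIV" using mem[OF homp_zero, of "Suc 0"] unfolding homp_def by simp
  have "L (%_. 0) xi = hom_part 0 (%_. L (%_. 0)) (0 :: real^'n) xi" for xi
   by (rule hom_part_hom[OF m0 UNIV_I, symmetric])
  also have "hom_part 0 (%_. L (%_. 0)) (0 :: real^'n) xi = 0" for xi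
   by (rule hom_part_eq_0[OF m1 finite_length_eq UNIV_I]) simp
  finally show ?thesis by (intro ext)
 qed
 have "L (b y) = (%xi. \<Sum>e\<le>k. L (?H e) xi)"
  by (subst by') (rule lin, rule homp_smooth[OF homp_hom_part])
 then have "hom_part d r z xi = hom_part d (%_ xi. \<Sum>e\<le>k. L (?H e) xi) z xi"
  by (intro hom_part_cong) (simp add: r)
 also have "... = (\<Sum>e\<le>k. hom_part d (%_. L (?H e)) z xi)"
 proof (rule hom_part_setsum[OF open_UNIV _ _ UNIV_I, where L="%e. deg_eq (e - s)"])
  show "(%_ :: real^'n. L (?H e)) \<in> LS (deg_eq (e - s)) UNIV" for e
   using low[OF homp_hom_part, of e b y] mem[of "?H e" "e - s"] homp_hom_part[of e b y]
   by (cases "e < s") (auto simp: homp_def)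
 qed simp
 also have "... = (\<Sum>e\<le>k. if e = d + s then L (?H e) xi else 0)"
 proof (intro sum.cong refl)
  fix e
  show "hom_part d (%_. L (?H e)) z xi = (if e = d + s then L (?H e) xi else 0)"
  proof (cases "e < s")
   case True
   then show ?thesis using low[OF homp_hom_part, of e b y] hom_part_zero[of "%_ _. 0" z d xi] by simp
  next
   case False
   then have m: "(%_ :: real^'n. L (?H e)) \<in> LS (deg_eq (e - s)) UNIV"
    using mem[of "?H e" "e - s"] homp_hom_part[of e b y] by (simp add: homp_def)
   show ?thesis
   proof (cases "e - s = d")
    case True
    then show ?thesis using hom_part_hom[OF m UNIV_I] False by auto
   next
    case ne: False
    have "hom_part d (%_. L (?H e)) z xi = 0" by (rule hom_part_eq_0[OF m finite_length_eq UNIV_I]) (use ne in auto)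
    then show ?thesis using ne False by auto
   qed
  qed
 qed
 also have "... = L (?H (d + s)) xi"
 proof (cases "d + s <= k")
  case False
  have "?H (d + s) = (%_. 0)" by (rule ext, rule hom_part_eq_0[OF b finite_length_le y]) (use False in auto)
  then show ?thesis using False L0 by simp
 qed simp
 finally show ?thesis .
qed

context quantization
begin

text \<open>The signature counts only the diagonal entries 1 and -1; as the counts add up to the
  dimension, every diagonal entry is one of them.\<close>

lemma g_diag: "i \<noteq> j ==> g $ i $ j = 0" and g_square: "g $ i $ i * g $ i $ i = 1"
proof -
 show "i \<noteq> j ==> g $ i $ j = 0" using flat by (simp add: flat_metric_def)
 let ?A = "{i. g $ i $ i = 1}" and ?B = "{i. g $ i $ i = - 1}"
 have "card (?A \<union> ?B) = card ?A + card ?B" by (rule card_Un_disjoint) auto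
 then have "card (?A \<union> ?B) = CARD('n)" using flat by (simp add: flat_metric_def)
 then have "?A \<union> ?B = UNIV" by (intro card_subset_eq) auto
 then have "i \<in> ?A \<union> ?B" by simp
 then show "g $ i $ i * g $ i $ i = 1" by auto
qed

lemma g_mult: "(g *v x) $ i = g $ i $ i * x $ i"
proof -
 have "(g *v x) $ i = (\<Sum>j\<in>UNIV. if j = i then g $ i $ i * x $ i else 0)"
  unfolding matrix_vector_mult_def vec_lambda_beta by (rule sum.cong[OF refl]) (use g_diag in auto)
 then show ?thesis by simp
qed

text \<open>Equivariance is linear in the field. Stating it for arbitrary quadratic fields lets it
  pass from the generators, which are centred at the origin, to their translates.\<close>

definition equiv :: "('m, 'n) chart => (real^'n => real^'n) => bool" where
 "equiv c X \<longleftrightarrow> quad_field X \<and> (\<forall>k. \<forall>p\<in>LS (deg_le k) (img c). \<forall>y\<in>img c. \<forall>xi.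
   lq c (lie_symbol X p) y xi = commsym lam X (lq c p) y xi)"

lemma equiv_quad: "equiv c X ==> quad_field X"
 by (simp add: equiv_def)

lemma open_image: "c \<in> \<A> ==> open (img c)"
 by (rule open_cdom) simp_all

lemma equiv_generator: "c \<in> \<A> ==> X \<in> conformal_generators g ==> equiv c X"
 unfolding equiv_def using quad_field_generator lq_equivariant by blast

lemma equiv_linear:
 assumes c: "c \<in> \<A>" and X: "equiv c X" and Y: "equiv c Y"
 shows "equiv c (%x. a *\<^sub>R X x + b *\<^sub>R Y x)"
proof -
 have q: "quad_field X" "quad_field Y" using X Y by (auto simp: equiv_def)
 note s = quad_field_smooth[OF q(1)] quad_field_smooth[OF q(2)]
 have "lq c (lie_symbol (%x. a *\<^sub>R X x + b *\<^sub>R Y x) p) y xi = commsym lam (%x. a *\<^sub>R X x + b *\<^sub>R Y x) (lq c p) y xi"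
  if p: "p \<in> LS (deg_le k) (img c)" and y: "y \<in> img c" for k p y xi
 proof -
  have "lie_symbol (%x. a *\<^sub>R X x + b *\<^sub>R Y x) p = (%y xi. cor a * lie_symbol X p y xi + cor b * lie_symbol Y p y xi)"
   by (intro ext) (rule lie_symbol_linear[OF s])
  then have "lq c (lie_symbol (%x. a *\<^sub>R X x + b *\<^sub>R Y x) p) y xi = cor a * lq c (lie_symbol X p) y xi + cor b * lq c (lie_symbol Y p) y xi"
   using lq_linear[OF c y LS_lie[OF open_image[OF c] s(1) p] LS_lie[OF open_image[OF c] s(2) p]] by simp
  also have "lq c (lie_symbol X p) y xi = commsym lam X (lq c p) y xi" using X p y unfolding equiv_def by blast
  also have "lq c (lie_symbol Y p) y xi = commsym lam Y (lq c p) y xi" using Y p y unfolding equiv_def by blast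
  finally show ?thesis unfolding commsym_linear[OF q] .
 qed
 then show ?thesis unfolding equiv_def using quad_field_linear[OF q] by blast
qed

lemma equiv_sum:
 assumes c: "c \<in> \<A>" and X: "!!s. s \<in> T ==> equiv c (X s)" and T: "finite T"
 shows "equiv c (%x. \<Sum>s\<in>T. a s *\<^sub>R X s x)"
 using T X
proof (induction T)
 case empty
 have "(%x. x) \<in> conformal_generators g" by (simp add: conformal_generators_def)
 from equiv_linear[OF c equiv_generator[OF c this] equiv_generator[OF c this], of 0 0] show ?case by simp
next
 case (insert s T)
 then show ?case using equiv_linear[OF c, of "X s" "%x. \<Sum>s\<in>T. a s *\<^sub>R X s x" "a s" 1] by simp
qed

lemma equiv_const: "c \<in> \<A> ==> equiv c (%_. v)"
proof -
 assume c: "c \<in> \<A>"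
 have "equiv c (%x. \<Sum>i\<in>UNIV. v $ i *\<^sub>R axis i 1)"
  by (rule equiv_sum[OF c equiv_generator[OF c]]) (auto simp: conformal_generators_def)
 also have "(%x :: real^'n. \<Sum>i\<in>UNIV. v $ i *\<^sub>R axis i 1) = (%_. v)"
  by (auto simp: vec_eq_iff axis_def if_distrib[of "%x. _ * x"] cong: if_cong)
 finally show ?thesis .
qed

section \<open>Conformal fields translated to a base point\<close>

definition eul :: "real^'n => real^'n => real^'n" where
 "eul y0 x = x - y0"

definition rotf :: "'n => 'n => real^'n => real^'n => real^'n" where
 "rotf a b y0 x = (g *v (x - y0)) $ a *\<^sub>R axis b 1 - (g *v (x - y0)) $ b *\<^sub>R axis a 1"

definition invf :: "'n => real^'n => real^'n => real^'n" where
 "invf m y0 x = ((g *v (x - y0)) \<bullet> (x - y0)) *\<^sub>R axis m 1 - (2 * (g *v (x - y0)) $ m) *\<^sub>R (x - y0)"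

lemma equiv_eul: "c \<in> \<A> ==> equiv c (eul y0)"
proof -
 assume c: "c \<in> \<A>"
 have "equiv c (%x. 1 *\<^sub>R x + (-1) *\<^sub>R y0)"
  by (rule equiv_linear[OF c equiv_generator[OF c] equiv_const[OF c]]) (simp add: conformal_generators_def)
 then show ?thesis by (simp add: eul_def[abs_def])
qed

lemma equiv_rotf: "c \<in> \<A> ==> equiv c (rotf a b y0)"
proof -
 assume c: "c \<in> \<A>"
 have "equiv c (%x. 1 *\<^sub>R ((g *v x) $ a *\<^sub>R axis b 1 - (g *v x) $ b *\<^sub>R axis a 1) + 1 *\<^sub>R (- rotf a b 0 y0))"
  by (rule equiv_linear[OF c equiv_generator[OF c] equiv_const[OF c]]) (auto simp: conformal_generators_def)
 also have "(%x. 1 *\<^sub>R ((g *v x) $ a *\<^sub>R axis b 1 - (g *v x) $ b *\<^sub>R axis a 1) + 1 *\<^sub>R (- rotf a b 0 y0)) = rotf a b y0"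
  by (auto simp: fun_eq_iff rotf_def g_mult algebra_simps)
 finally show ?thesis .
qed

text \<open>Expanding in \<open>x - y0\<close> shows that the translated quadratic field is the
  original one plus twice a combination of rotations with coefficients \<open>y0_j\<close>, a
  multiple of the Euler field, and a constant.\<close>

lemma equiv_inv: "c \<in> \<A> ==> equiv c (invf m y0)"
proof -
 assume c: "c \<in> \<A>"
 let ?R = "%j x. (g *v x) $ m *\<^sub>R axis j 1 - (g *v x) $ j *\<^sub>R axis m (1::real)"
 have 1: "equiv c (%x. \<Sum>j\<in>UNIV. y0 $ j *\<^sub>R ?R j x)"
  by (rule equiv_sum[OF c equiv_generator[OF c]]) (auto simp: conformal_generators_def)
 have 2: "equiv c (%x. (2 * (g *v y0) $ m) *\<^sub>R x + 1 *\<^sub>R invf m 0 y0)"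
  by (rule equiv_linear[OF c equiv_generator[OF c] equiv_const[OF c]]) (simp add: conformal_generators_def)
 have 3: "equiv c (invf m 0)"
  by (rule equiv_generator[OF c]) (auto simp: conformal_generators_def invf_def[abs_def])
 have 4: "equiv c (%x. 1 *\<^sub>R invf m 0 x + 1 *\<^sub>R (2 *\<^sub>R (\<Sum>j\<in>UNIV. y0 $ j *\<^sub>R ?R j x) + 1 *\<^sub>R ((2 * (g *v y0) $ m) *\<^sub>R x + 1 *\<^sub>R invf m 0 y0)))"
  by (intro equiv_linear[OF c] 1 2 3)
 have s: "(\<Sum>j\<in>UNIV. y0 $ j *\<^sub>R ?R j x) = (g *v x) $ m *\<^sub>R y0 - ((g *v x) \<bullet> y0) *\<^sub>R axis m 1" for x
 proof -
  have "(\<Sum>j\<in>UNIV. y0 $ j *\<^sub>R axis j (1::real)) = y0"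
   by (auto simp: vec_eq_iff axis_def if_distrib[of "%x. _ * x"] cong: if_cong)
  then have "(\<Sum>j\<in>UNIV. y0 $ j *\<^sub>R ((g *v x) $ m *\<^sub>R axis j (1::real))) = (g *v x) $ m *\<^sub>R y0"
   using scaleR_sum_right[of "(g *v x) $ m" "%j. y0 $ j *\<^sub>R axis j (1::real)" UNIV] by (simp add: mult.commute)
  then show ?thesis
   by (simp add: scaleR_diff_right sum_subtractf scaleR_sum_left[symmetric] inner_vec_def mult.commute)
 qed
 have sym: "(g *v x) \<bullet> y = (g *v y) \<bullet> x" for x y
  by (simp add: inner_vec_def g_mult mult_ac)
 have "(%x. 1 *\<^sub>R invf m 0 x + 1 *\<^sub>R (2 *\<^sub>R (\<Sum>j\<in>UNIV. y0 $ j *\<^sub>R ?R j x) + 1 *\<^sub>R ((2 * (g *v y0) $ m) *\<^sub>R x + 1 *\<^sub>R invf m 0 y0))) = invf m y0"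
 proof
  fix x
  have a: "(g *v (x - y0)) \<bullet> (x - y0) = (g *v x) \<bullet> x - 2 * ((g *v x) \<bullet> y0) + (g *v y0) \<bullet> y0"
   using sym[of y0 x] by (simp add: matrix_vector_mult_diff_distrib inner_diff_left inner_diff_right)
  have b: "(g *v (x - y0)) $ m = (g *v x) $ m - (g *v y0) $ m" by (simp add: matrix_vector_mult_diff_distrib)
  show "1 *\<^sub>R invf m 0 x + 1 *\<^sub>R (2 *\<^sub>R (\<Sum>j\<in>UNIV. y0 $ j *\<^sub>R ?R j x) + 1 *\<^sub>R ((2 * (g *v y0) $ m) *\<^sub>R x + 1 *\<^sub>R invf m 0 y0)) = invf m y0 x"
   unfolding s invf_def a b by (simp add: vec_eq_iff algebra_simps)
 qed
 with 4 show ?thesis by simp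
qed

end

lemma pd_mult_fun:
 fixes u v :: "real^'n::finite => 'b::real_normed_algebra"
 shows "smooth_on UNIV u ==> smooth_on UNIV v ==> pd i (%z. u z * v z) = (%z. pd i u z * v z + u z * pd i v z)"
 by (rule ext, rule pd_mult) (auto intro: smooth_on_differentiable)

lemma pd_shift_fun [simp]: "pd i (%z. z $ j - c) = (%_. if i = j then 1 else 0)"
proof
 fix z :: "real^'a"
 have "(%z. z $ j) differentiable (at z)"
  by (rule smooth_on_differentiable[OF smooth_on_coord[OF open_UNIV] UNIV_I])
 then show "pd i (%z. z $ j - c) z = (if i = j then 1 else 0)" by (simp add: pd_diff)
qed

lemma smooth_on_shift [simp]: "smooth_on UNIV (%z. z $ j - c)"
 by (intro smooth_on_diff) auto

lemma pd_minus_fun: "smooth_on UNIV u ==> pd i (%z. - u z) = (%z. - pd i u z)"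
 by (rule ext, rule pd_bounded_linear[OF bounded_linear_minus[OF bounded_linear_ident]]) (auto intro: smooth_on_differentiable)

lemma pd_lin2: "pd i (%x. \<alpha> * (x $ a - c) - \<beta> * (x $ b - d)) = (%_ :: real^'n::finite. \<alpha> * (if i = a then 1 else 0) - \<beta> * (if i = b then 1 else 0))"
 by (simp add: pd_diff_fun pd_cmult_fun smooth_on_cmult del: mult_zero_right mult_1_right)

context quantization
begin

sublocale quadratic_form "%i. cor (g $ i $ i)"
proof
 fix i
 have "cor (g $ i $ i) * cor (g $ i $ i) = cor (g $ i $ i * g $ i $ i)" by simp
 then show "cor (g $ i $ i) * cor (g $ i $ i) = 1" by (simp add: g_square)
qed

lemma smooth_field_centered: "smooth_field (eul y0)" "smooth_field (rotf a b y0)" "smooth_field (invf m y0)"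
proof -
 obtain c where c: "c \<in> \<A>" using chart_cover by blast
 show "smooth_field (eul y0)" "smooth_field (rotf a b y0)" "smooth_field (invf m y0)"
  by (rule quad_field_smooth[OF equiv_quad], rule equiv_eul[OF c] equiv_rotf[OF c] equiv_inv[OF c])+
qed

section \<open>The action of the centred fields at their centre\<close>

lemma pd_eul: "pd i (eul y0) z $ j = (if i = j then 1 else 0)"
 unfolding smooth_field_pd[OF smooth_field_centered(1)] by (simp add: eul_def)

lemma pd_rotf: "pd i (rotf a b y0) z $ j = (if i = a \<and> j = b then g $ a $ a else 0) - (if i = b \<and> j = a then g $ b $ b else 0)"
proof -
 have "(%x. rotf a b y0 x $ j) = (%x. (if j = b then g $ a $ a else 0) * (x $ a - y0 $ a) - (if j = a then g $ b $ b else 0) * (x $ b - y0 $ b))"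
  by (auto simp: rotf_def g_mult axis_def)
 then have "pd i (%x. rotf a b y0 x $ j) z = (if j = b then g $ a $ a else 0) * (if i = a then 1 else 0) - (if j = a then g $ b $ b else 0) * (if i = b then 1 else 0)"
  by (simp only: pd_lin2)
 moreover have "(if P then A else 0) * (if R then 1 else 0) = (if R \<and> P then A else (0::real))" for P R A by simp
 ultimately show ?thesis by (simp only: smooth_field_pd[OF smooth_field_centered(2)])
qed

lemma pd_inv: "pd i (invf m y0) z $ j = 2 * g $ i $ i * (z $ i - y0 $ i) * (if j = m then 1 else 0)
  - 2 * g $ m $ m * ((if i = m then 1 else 0) * (z $ j - y0 $ j) + (z $ m - y0 $ m) * (if i = j then 1 else 0))"
proof -
 have "(%x. invf m y0 x $ j) = (%x. (if j = m then 1 else 0) * (\<Sum>i\<in>UNIV. g $ i $ i * ((x $ i - y0 $ i) * (x $ i - y0 $ i))) -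
   (2 * g $ m $ m) * ((x $ m - y0 $ m) * (x $ j - y0 $ j)))"
  by (auto simp: invf_def g_mult axis_def inner_vec_def mult.assoc)
 then show ?thesis unfolding smooth_field_pd[OF smooth_field_centered(3)]
  by (simp add: pd_diff_fun pd_minus_fun pd_cmult_fun pd_sum_fun pd_mult_fun smooth_on_cmult smooth_on_mult smooth_on_sum if_distrib[of "%x. _ * x"] if_distrib[of "%x. x * _"] cong: if_cong)
qed

text \<open>The divergence of the Euler field is constant and the field vanishes at
  \<open>y0\<close>, so neither \<open>lam\<close> nor base derivatives of \<open>b\<close>
  survive.\<close>

lemma commsym_eul: "commsym lam (eul y0) b y0 xi = - (\<Sum>i\<in>UNIV. xm i (pd i (b y0)) xi)"
proof -
 have "fsym_field lam (eul y0) xi = (%z. cor ((\<Sum>j\<in>UNIV. xi $ j * (z $ j - y0 $ j)) + lam * CARD('n)))"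
  by (simp add: fsym_field_def[abs_def] pd_eul) (simp add: eul_def)
 then have "pd i (fsym_field lam (eul y0) xi) = (%_. cor (xi $ i))" for i
  by (simp add: pd_of_real_fun pd_add_fun pd_sum_fun pd_cmult_fun smooth_on_add smooth_on_sum smooth_on_cmult
    if_distrib[of "%x. _ * x"] del: of_real_sum of_real_add of_real_mult cong: if_cong)
 then show ?thesis by (simp add: commsym_def xm_def) (simp add: eul_def)
qed

lemma commsym_rotf: "commsym lam (rotf a b y0) p y0 xi = rot a b (p y0) xi"
proof -
 have "(\<Sum>i\<in>UNIV. pd i (rotf a b y0) z $ i) = 0" for z
  unfolding pd_rotf by (rule sum.neutral) auto
 then have "fsym_field lam (rotf a b y0) xi = (%z. cor ((xi $ b * g $ a $ a) * (z $ a - y0 $ a) - (xi $ a * g $ b $ b) * (z $ b - y0 $ b)))"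
  by (simp add: fsym_field_def[abs_def] rotf_def g_mult axis_def right_diff_distrib sum_subtractf mult.assoc
    if_distrib[of "%x. _ * x"] del: of_real_sum of_real_add of_real_mult of_real_diff cong: if_cong)
 then have "pd i (fsym_field lam (rotf a b y0) xi) = (%_. cor ((xi $ b * g $ a $ a) * (if i = a then 1 else 0) - (xi $ a * g $ b $ b) * (if i = b then 1 else 0)))" for i
  by (simp only: pd_of_real_fun[OF smooth_on_diff[OF open_UNIV smooth_on_cmult[OF open_UNIV smooth_on_shift] smooth_on_cmult[OF open_UNIV smooth_on_shift]]] pd_lin2)
 moreover have "rotf a b y0 y0 = 0" by (simp add: rotf_def)
 ultimately have "commsym lam (rotf a b y0) p y0 xi = - (\<Sum>i\<in>UNIV. pd i (p y0) xi * cor ((xi $ b * g $ a $ a) * (if i = a then 1 else 0) - (xi $ a * g $ b $ b) * (if i = b then 1 else 0)))"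
  by (simp only: commsym_def zero_index) (simp add: mult.commute)
 also have "(\<Sum>i\<in>UNIV. pd i (p y0) xi * cor ((xi $ b * g $ a $ a) * (if i = a then 1 else 0) - (xi $ a * g $ b $ b) * (if i = b then 1 else 0))) =
   (\<Sum>i\<in>UNIV. if i = a then cor (xi $ b * g $ a $ a) * pd a (p y0) xi else 0) - (\<Sum>i\<in>UNIV. if i = b then cor (xi $ a * g $ b $ b) * pd b (p y0) xi else 0)"
  unfolding sum_subtractf[symmetric] by (intro sum.cong refl) (auto simp: algebra_simps)
 finally show ?thesis by (simp add: rot_def xm_def mult_ac)
qed

text \<open>The weight enters through the divergence \<open>-2 n g_mm (x - y0)_m\<close>, whose
  derivative at \<open>y0\<close> is constant. The other two terms come from the second derivatives
  of the field; its value and its first derivatives vanish at \<open>y0\<close>.\<close>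

lemma commsym_inv:
 fixes p :: "'n lsymbol"
 assumes s: "smooth_on UNIV (p y0)"
 shows "commsym lam (invf m y0) p y0 xi = 2 * of_nat CARD('n) * lam * g $ m $ m * pd m (p y0) xi - xm m (lap (p y0)) xi
  + 2 * g $ m $ m * (\<Sum>j\<in>UNIV. xm j (pd j (pd m (p y0))) xi)"
proof -
 let ?G = "%i. g $ i $ i" and ?z = "%i z. z $ i - y0 $ i"
 have div: "(\<Sum>k\<in>UNIV. pd k (invf m y0) z $ k) = - 2 * CARD('n) * ?G m * ?z m z" for z
  unfolding pd_inv by (simp add: sum.distrib sum_subtractf sum_distrib_left[symmetric] algebra_simps
    if_distrib[of "%x. _ * x"] if_distrib[of "%x. x * _"] cong: if_cong)
 have X: "invf m y0 z $ j = (if j = m then (\<Sum>i\<in>UNIV. ?G i * (?z i z * ?z i z)) else 0) - 2 * ?G m * (?z m z * ?z j z)" for z j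
  by (auto simp: invf_def g_mult axis_def inner_vec_def mult.assoc)
 let ?F = "%z. xi $ m * (\<Sum>i\<in>UNIV. ?G i * (?z i z * ?z i z)) - 2 * ?G m * (?z m z * (\<Sum>j\<in>UNIV. xi $ j * ?z j z)) + (- 2 * lam * CARD('n) * ?G m) * ?z m z"
 have "fsym_field lam (invf m y0) xi z = cor (?F z)" for z
 proof -
  have "(\<Sum>j\<in>UNIV. xi $ j * invf m y0 z $ j) = xi $ m * (\<Sum>i\<in>UNIV. ?G i * (?z i z * ?z i z)) - 2 * ?G m * (?z m z * (\<Sum>j\<in>UNIV. xi $ j * ?z j z))"
   unfolding X by (simp add: right_diff_distrib sum_subtractf sum_distrib_left mult_ac if_distrib[of "%x. _ * x"] cong: if_cong)
  then show ?thesis unfolding fsym_field_def div by (simp del: of_real_sum of_real_add of_real_mult of_real_diff add: mult_ac)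
 qed
 then have f: "fsym_field lam (invf m y0) xi = (%z. cor (?F z))" by auto
 note sm = smooth_on_add smooth_on_diff smooth_on_sum smooth_on_cmult smooth_on_mult
 have sF: "smooth_on UNIV ?F" by (intro sm open_UNIV smooth_on_shift smooth_on_const)
 let ?F1 = "%i z. xi $ m * (2 * ?G i * ?z i z) - 2 * ?G m * ((if i = m then 1 else 0) * (\<Sum>j\<in>UNIV. xi $ j * ?z j z) + ?z m z * xi $ i)
   + (- 2 * lam * CARD('n) * ?G m) * (if i = m then 1 else 0)"
 have F1: "pd i ?F = ?F1 i" for i
  by (simp add: pd_add_fun pd_diff_fun pd_minus_fun pd_sum_fun pd_cmult_fun pd_mult_fun sm if_distrib[of "%x. _ * x"] if_distrib[of "%x. x * _"] cong: if_cong)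
   (auto simp: fun_eq_iff algebra_simps)
 have sF1: "smooth_on UNIV (?F1 i)" for i by (intro sm open_UNIV smooth_on_shift smooth_on_const)
 have F2: "pd j (?F1 i) = (%_. xi $ m * (2 * ?G i * (if j = i then 1 else 0)) - 2 * ?G m * ((if i = m then 1 else 0) * xi $ j + (if j = m then 1 else 0) * xi $ i))" for i j
  by (simp add: pd_add_fun pd_diff_fun pd_minus_fun pd_sum_fun pd_cmult_fun pd_mult_fun sm if_distrib[of "%x. _ * x"] cong: if_cong)
 have p1: "pd i (fsym_field lam (invf m y0) xi) y0 = cor (- 2 * lam * CARD('n) * ?G m * (if i = m then 1 else 0))" for i
  unfolding f pd_of_real_fun[OF sF] F1 by simp
 have p2: "pd j (pd i (fsym_field lam (invf m y0) xi)) y0 = cor (xi $ m * (2 * ?G i * (if j = i then 1 else 0)) - 2 * ?G m * ((if i = m then 1 else 0) * xi $ j + (if j = m then 1 else 0) * xi $ i))" for i j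
  unfolding f pd_of_real_fun[OF sF] F1 pd_of_real_fun[OF sF1] F2 by simp
 have z: "invf m y0 y0 = 0" by (simp add: invf_def)
 have com: "pd i (pd m (p y0)) = pd m (pd i (p y0))" for i by (rule pd_commute_fun[OF s])
 let ?g = "%i. cor (g $ i $ i)" and ?x = "%i. cor (xi $ i)" and ?D = "%i j. pd i (pd j (p y0)) xi"
 have A: "(\<Sum>i\<in>UNIV. pd i (fsym_field lam (invf m y0) xi) y0 * pd i (p y0) xi) = (\<Sum>i\<in>UNIV. if i = m then - 2 * cor lam * of_nat CARD('n) * ?g m * pd m (p y0) xi else 0)"
  unfolding p1 by (intro sum.cong refl) auto
 have "(\<Sum>i\<in>UNIV. \<Sum>j\<in>UNIV. pd i (pd j (fsym_field lam (invf m y0) xi)) y0 * ?D i j) =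
   (\<Sum>i\<in>UNIV. \<Sum>j\<in>UNIV. if j = i then 2 * ?x m * ?g i * ?D i i else 0) - (\<Sum>i\<in>UNIV. \<Sum>j\<in>UNIV. if j = m then 2 * ?g m * ?x i * ?D i m else 0)
   - (\<Sum>i\<in>UNIV. \<Sum>j\<in>UNIV. if i = m then 2 * ?g m * ?x j * ?D m j else 0)"
  unfolding p2 sum_subtractf[symmetric] by (intro sum.cong refl) (auto simp: algebra_simps)
 also have "(\<Sum>i\<in>UNIV. \<Sum>j\<in>UNIV. if i = m then 2 * ?g m * ?x j * ?D m j else 0) = (\<Sum>j\<in>UNIV. 2 * ?g m * ?x j * ?D j m)"
  by (subst sum.swap) (simp add: com[symmetric])
 finally have B: "(\<Sum>i\<in>UNIV. \<Sum>j\<in>UNIV. pd i (pd j (fsym_field lam (invf m y0) xi)) y0 * ?D i j) =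
   2 * (?x m * (\<Sum>i\<in>UNIV. ?g i * ?D i i) - 2 * ?g m * (\<Sum>i\<in>UNIV. ?x i * ?D i m))"
  by (simp add: sum_distrib_left right_diff_distrib mult_ac sum_negf)
 show ?thesis
  unfolding commsym_def z A B lap_def xm_def by (simp add: field_simps)
qed

lemma lie_eul: "lie_symbol (eul y0) p y xi = (\<Sum>i\<in>UNIV. cor (y $ i - y0 $ i) * pd i (%z. p z xi) y) - (\<Sum>i\<in>UNIV. xm i (pd i (p y)) xi)"
 unfolding lie_symbol_def pd_eul
 by (simp add: eul_def xm_def if_distrib[of "%x. x * _"] if_distrib[of cor] cong: if_cong)

lemma lie_rotf: "lie_symbol (rotf a b y0) p y xi = (\<Sum>i\<in>UNIV. cor (rotf a b y0 y $ i) * pd i (%z. p z xi) y) + rot a b (p y) xi"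
proof -
 have "(\<Sum>i\<in>UNIV. \<Sum>j\<in>UNIV. cor (pd i (rotf a b y0) y $ j * xi $ j) * pd i (p y) xi) =
  (\<Sum>i\<in>UNIV. \<Sum>j\<in>UNIV. if j = b then (if i = a then cor (g $ a $ a * xi $ b) * pd a (p y) xi else 0) else 0) -
  (\<Sum>i\<in>UNIV. \<Sum>j\<in>UNIV. if j = a then (if i = b then cor (g $ b $ b * xi $ a) * pd b (p y) xi else 0) else 0)"
  unfolding pd_rotf sum_subtractf[symmetric] by (intro sum.cong refl) (auto simp: algebra_simps)
 also have "... = - rot a b (p y) xi" by (simp add: rot_def xm_def mult_ac)
 finally show ?thesis unfolding lie_symbol_def by simp
qed

text \<open>On a symbol constant in \<open>y\<close> the result is linear in \<open>y - y0\<close>,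
  hence a combination of the symbols on which the first correction has to be found. This is the
  source of the inversion equation.\<close>

lemma lie_inv_const:
 "lie_symbol (invf m y0) (%_. P) y xi = (\<Sum>i\<in>UNIV. cor (y $ i - y0 $ i) *
   ((- 2 * g $ i $ i) * xm m (pd i P) xi + 2 * g $ m $ m * xm i (pd m P) xi))
  + 2 * g $ m $ m * cor (y $ m - y0 $ m) * (\<Sum>i\<in>UNIV. xm i (pd i P) xi)"
proof -
 let ?z = "%i. cor (y $ i - y0 $ i)" and ?G = "%i. cor (g $ i $ i)" and ?x = "%i. cor (xi $ i)"
 have "(\<Sum>i\<in>UNIV. \<Sum>j\<in>UNIV. cor (pd i (invf m y0) y $ j * xi $ j) * pd i P xi) =
  (\<Sum>i\<in>UNIV. \<Sum>j\<in>UNIV. (if j = m then 2 * ?G i * ?z i * ?x m * pd i P xi else 0)) -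
  (\<Sum>i\<in>UNIV. \<Sum>j\<in>UNIV. if i = m then 2 * ?G m * ?z j * ?x j * pd m P xi else 0) -
  (\<Sum>i\<in>UNIV. \<Sum>j\<in>UNIV. if i = j then 2 * ?G m * ?z m * ?x i * pd i P xi else 0)"
  unfolding pd_inv sum_subtractf[symmetric] by (intro sum.cong refl) (auto simp: algebra_simps)
 also have "(\<Sum>i\<in>UNIV. \<Sum>j\<in>UNIV. if i = m then 2 * ?G m * ?z j * ?x j * pd m P xi else 0) = (\<Sum>j\<in>UNIV. 2 * ?G m * ?z j * ?x j * pd m P xi)"
  by (subst sum.swap) simp
 finally have *: "(\<Sum>i\<in>UNIV. \<Sum>j\<in>UNIV. cor (pd i (invf m y0) y $ j * xi $ j) * pd i P xi) =
  (\<Sum>i\<in>UNIV. 2 * ?G i * ?z i * ?x m * pd i P xi) - (\<Sum>j\<in>UNIV. 2 * ?G m * ?z j * ?x j * pd m P xi) - (\<Sum>i\<in>UNIV. 2 * ?G m * ?z m * ?x i * pd i P xi)"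
  by simp
 show ?thesis
  unfolding lie_symbol_def * xm_def
  by (simp add: sum_distrib_left del: of_real_diff) (simp only: sum_subtractf[symmetric] sum.distrib[symmetric] sum_negf[symmetric], rule sum.cong[OF refl], simp add: algebra_simps)
qed

end

section \<open>The first correction to the principal symbol\<close>

lemma homp_local:
 assumes "p \<in> LS (deg_eq d) Om" "y \<in> Om"
 shows "p y \<in> homp d"
proof -
 have "p y = hom_part d p y" by (rule ext) (rule hom_part_hom[OF assms, symmetric])
 then show ?thesis using homp_hom_part[of d p y] by (simp only:)
qed

lemma hom_part_cmult:
 assumes "open Om" "p \<in> LS L Om" "y \<in> Om"
 shows "hom_part d (%y xi. a * p y xi) y xi = a * hom_part d p y xi"
 using hom_part_linear[OF assms(1,2,2,3), of d a 0 xi] by simp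

lemma xm_setsum: "xm i (%xi. \<Sum>s\<in>T. P s xi) = (%xi. \<Sum>s\<in>T. xm i (P s) xi)"
 by (auto simp: xm_def sum_distrib_left)

lemma deg_eq_le: "open Om ==> p \<in> LS (deg_eq d) Om ==> d <= k ==> p \<in> LS (deg_le k) Om"
 by (erule LS_mono[OF _ finite_length_le]) auto

lemma jet_zero_mono: "jet_zero N p y ==> N' <= N ==> jet_zero N' p y"
 unfolding jet_zero_def by auto

definition zeta :: "real^'n::finite => 'n => real^'n => complex" where
 "zeta y0 i y = cor (y $ i - y0 $ i)"

lemma zeta_at [simp]: "zeta y0 i y0 = 0"
 by (simp add: zeta_def)

lemma smooth_on_zeta [simp]: "open Om ==> smooth_on Om (zeta y0 i)"
 unfolding zeta_def[abs_def] by (intro smooth_on_of_real smooth_on_diff) auto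

lemma pd_zeta [simp]: "pd j (zeta y0 i) y = (if j = i then 1 else 0)"
 unfolding zeta_def[abs_def] pd_of_real_fun[OF smooth_on_shift] by simp

lemma pd_zeta_mult [simp]: "pd j (%z. zeta y0 i z * a) y = (if j = i then a else 0)"
proof -
 have "zeta y0 i differentiable (at y)" by (rule smooth_on_differentiable[OF smooth_on_zeta[OF open_UNIV] UNIV_I])
 then show ?thesis by (simp add: pd_mult)
qed

lemma zeta_local: "P \<in> homp d ==> open Om ==> (%y xi. zeta y0 i y * P xi) \<in> LS (deg_eq d) Om"
 by (intro homp_const_local smooth_on_zeta)

context quantization
begin

text \<open>One homogeneous component of the quantization at one point. Fields vanishing at
  \<open>y0\<close> act on it by fibre operators alone, with no derivative in \<open>y\<close> left
  over.\<close>

definition hq :: "('m, 'n) chart => real^'n => nat => 'n lsymbol => real^'n => complex" where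
 "hq c y0 d p = hom_part d (lq c p) y0"

lemma hq_homp: "hq c y0 d p \<in> homp d"
 by (simp add: hq_def homp_hom_part)

lemma rot_lin:
 assumes "smooth_on UNIV P" "smooth_on UNIV R"
 shows "rot a b (%xi. P xi - s * R xi) xi = rot a b P xi - s * rot a b R xi"
proof -
 have "pd i (%xi. P xi - s * R xi) = (%xi. pd i P xi - s * pd i R xi)" for i
  using assms by (simp add: pd_diff_fun pd_cmult_fun smooth_on_cmult)
 then show ?thesis unfolding rot_def xm_def by (simp add: algebra_simps)
qed

context
 fixes c y0
 assumes c: "c \<in> \<A>" and y0: "y0 \<in> img c"
begin

lemma hq_sum:
 assumes T: "finite T" and p: "!!s. s \<in> T ==> p s \<in> LS (deg_le k) (img c)"
 shows "hq c y0 d (%y xi. \<Sum>s\<in>T. a s * p s y xi) xi = (\<Sum>s\<in>T. a s * hq c y0 d (p s) xi)"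
proof -
 note o = open_image[OF c]
 have "hq c y0 d (%y xi. \<Sum>s\<in>T. a s * p s y xi) xi = hom_part d (%y xi. \<Sum>s\<in>T. a s * lq c (p s) y xi) y0 xi"
  unfolding hq_def by (rule hom_part_cong) (rule lq_sum[OF c y0 p])
 also have "... = (\<Sum>s\<in>T. hom_part d (%y xi. a s * lq c (p s) y xi) y0 xi)"
  by (rule hom_part_setsum[OF o T LS_cscale[OF o lq_local(1)[OF c p]] y0])
 also have "... = (\<Sum>s\<in>T. a s * hq c y0 d (p s) xi)"
  unfolding hq_def by (intro sum.cong refl hom_part_cmult[OF o lq_local(1)[OF c p] y0])
 finally show ?thesis .
qed

lemma hq_linear:
 assumes "p \<in> LS (deg_le k) (img c)" "r \<in> LS (deg_le k) (img c)"
 shows "hq c y0 d (%y xi. a * p y xi + b * r y xi) xi = a * hq c y0 d p xi + b * hq c y0 d r xi"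
 using hq_sum[of "{True, False}" "%s. if s then p else r" k d "%s. if s then a else b" xi] assms by simp

lemma hq_cong: "(!!y xi. y \<in> img c ==> p y xi = r y xi) ==> hq c y0 d p = hq c y0 d r"
 unfolding hq_def using lq_cong[OF c, of p r] by simp

lemma hq_top:
 assumes p: "p \<in> LS (deg_eq d) (img c)"
 shows "hq c y0 d p xi = p y0 xi"
proof -
 note o = open_image[OF c]
 have p': "p \<in> LS (deg_le d) (img c)" by (rule deg_eq_le[OF o p order_refl])
 note n = lq_local(2)[OF c p']
 have "hq c y0 d p xi = hom_part d (%y xi. 1 * p y xi + 1 * (lq c p y xi - p y xi)) y0 xi"
  unfolding hq_def by (rule hom_part_cong) simp
 also have "... = hom_part d p y0 xi + hom_part d (%y xi. lq c p y xi - p y xi) y0 xi"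
  using hom_part_linear[OF o p n y0, of d 1 1 xi] by simp
 also have "hom_part d (%y xi. lq c p y xi - p y xi) y0 xi = 0"
  by (rule hom_part_eq_0[OF n _ y0]) (auto intro: finite_subset[OF _ finite_length_le[of d]])
 finally show ?thesis using hom_part_hom[OF p y0] by simp
qed

lemma hq_eul:
 assumes p: "p \<in> LS (deg_le k) (img c)"
 shows "hq c y0 d (lie_symbol (eul y0) p) xi = - of_nat d * hq c y0 d p xi"
proof -
 let ?L = "%(P :: real^'n => complex) xi. - (\<Sum>i\<in>UNIV. xm i (pd i P) xi)"
 have "hom_part d (lq c (lie_symbol (eul y0) p)) y0 xi = ?L (hom_part (d + 0) (lq c p) y0) xi"
 proof (rule hom_part_operator[OF open_image[OF c] lq_local(1)[OF c p] y0])
  show "?L (%xi. \<Sum>e\<le>k. F e xi) = (%xi. \<Sum>e\<le>k. ?L (F e) xi)" if F: "!!e. smooth_on UNIV (F e)" for F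
  proof
   fix xi
   show "?L (%xi. \<Sum>e\<le>k. F e xi) xi = (\<Sum>e\<le>k. ?L (F e) xi)"
    unfolding pd_sum_fun[OF F] xm_setsum sum_negf by (subst sum.swap) simp
  qed
  show "?L P \<in> homp e" if P: "P \<in> homp (e + 0)" for e P
  proof -
   have "P \<in> homp e" using P by simp
   then have "?L P = (%xi. (- of_nat e) * P xi)" by (simp add: homp_euler)
   then show ?thesis using homp_cmult[OF \<open>P \<in> homp e\<close>, of "- of_nat e"] by simp
  qed
  show "lq c (lie_symbol (eul y0) p) y0 xi = ?L (lq c p y0) xi" for xi
   using equiv_eul[OF c, of y0] p y0 unfolding equiv_def by (simp add: commsym_eul)
 qed simp
 then show ?thesis unfolding hq_def by (simp add: homp_euler[OF homp_hom_part])
qed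

lemma hq_rot:
 assumes p: "p \<in> LS (deg_le k) (img c)"
 shows "hq c y0 d (lie_symbol (rotf a b y0) p) xi = rot a b (hq c y0 d p) xi"
proof -
 have "hom_part d (lq c (lie_symbol (rotf a b y0) p)) y0 xi = rot a b (hom_part (d + 0) (lq c p) y0) xi"
 proof (rule hom_part_operator[OF open_image[OF c] lq_local(1)[OF c p] y0])
  show "rot a b (%xi. \<Sum>e\<le>k. F e xi) = (%xi. \<Sum>e\<le>k. rot a b (F e) xi)" if F: "!!e. smooth_on UNIV (F e)" for F
   unfolding rot_def pd_sum_fun[OF F] xm_setsum by (simp add: sum_subtractf sum_distrib_left)
  show "rot a b P \<in> homp e" if P: "P \<in> homp (e + 0)" for e P
   using P homp_rot[of P e a b] by simp
  show "lq c (lie_symbol (rotf a b y0) p) y0 xi = rot a b (lq c p y0) xi" for xi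
   using equiv_rotf[OF c, of a b y0] p y0 unfolding equiv_def by (simp add: commsym_rotf)
 qed simp
 then show ?thesis unfolding hq_def by simp
qed

text \<open>The field centred at \<open>y0\<close> lowers the fibre degree by one there, so degree
  \<open>d\<close> of the left side is governed by the component \<open>H\<close> of degree
  \<open>Suc d\<close>.\<close>

lemma hq_inv:
 fixes H :: "real^'n => complex"
 assumes p: "p \<in> LS (deg_le k) (img c)"
  and H: "H = hq c y0 (Suc d) p"
 shows "hq c y0 d (lie_symbol (invf m y0) p) xi = 2 * of_nat CARD('n) * lam * g $ m $ m * pd m H xi - xm m (lap H) xi + 2 * g $ m $ m * (of_nat d * pd m H xi)"
proof -
 let ?A = "2 * of_nat CARD('n) * lam * g $ m $ m" and ?B = "2 * cor (g $ m $ m)"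
 let ?L = "%(P :: real^'n => complex) xi. ?A * pd m P xi - xm m (lap P) xi + ?B * (\<Sum>j\<in>UNIV. xm j (pd j (pd m P)) xi)"
 have "hom_part d (lq c (lie_symbol (invf m y0) p)) y0 xi = ?L (hom_part (d + 1) (lq c p) y0) xi"
 proof (rule hom_part_operator[OF open_image[OF c] lq_local(1)[OF c p] y0])
  show "?L (%xi. \<Sum>e\<le>k. F e xi) = (%xi. \<Sum>e\<le>k. ?L (F e) xi)" if F: "!!e. smooth_on UNIV (F e)" for F
  proof -
   have 2: "pd i (%xi. \<Sum>e\<le>k. pd j (F e) xi) = (%xi. \<Sum>e\<le>k. pd i (pd j (F e)) xi)" for i j
    by (rule pd_sum_fun) (rule smooth_on_pd[OF F])
   have l: "lap (%xi. \<Sum>e\<le>k. F e xi) = (%xi. \<Sum>e\<le>k. lap (F e) xi)"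
    unfolding lap_def pd_sum_fun[OF F] 2 sum_distrib_left by (rule ext) (rule sum.swap)
   have s: "(\<Sum>j\<in>UNIV. \<Sum>e\<le>k. xm j (pd j (pd m (F e))) xi) = (\<Sum>e\<le>k. \<Sum>j\<in>UNIV. xm j (pd j (pd m (F e))) xi)" for xi
    by (rule sum.swap)
   show ?thesis
    unfolding l pd_sum_fun[OF F] 2 xm_setsum s sum.distrib sum_subtractf sum_distrib_left ..
  qed
  show "?L P = (%_. 0)" if P: "P \<in> homp e" and e: "e < 1" for e P
  proof -
   have P0: "P \<in> homp 0" using P e by simp
   show ?thesis using homp_pd_0[OF P0] lap_small[OF P0] by (simp add: xm_def)
  qed
  show "?L P \<in> homp e" if P: "P \<in> homp (e + 1)" for e P
  proof -
   have P1: "P \<in> homp (Suc e)" using P by simp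
   note D = homp_pd[OF P1, of m]
   have "xm m (lap P) \<in> homp e"
   proof (cases e)
    case 0
    moreover have "xm m (%_. 0) = (%_ :: real^'n. 0)" by (auto simp: xm_def)
    ultimately show ?thesis using lap_small[OF P1] by simp
   next
    case (Suc f)
    then show ?thesis using homp_xm[OF homp_lap, of P f m] P1 by simp
   qed
   then have "(%xi. (?A * pd m P xi + (-1) * xm m (lap P) xi) + (?B * of_nat e) * pd m P xi) \<in> homp e"
    by (intro homp_add homp_cmult D)
   then show ?thesis by (simp add: homp_euler[OF D] mult.assoc)
  qed
  show "lq c (lie_symbol (invf m y0) p) y0 xi = ?L (lq c p y0) xi" for xi
  proof -
   have "lq c (lie_symbol (invf m y0) p) y0 xi = commsym lam (invf m y0) (lq c p) y0 xi"
    using equiv_inv[OF c, of m y0] p y0 unfolding equiv_def by blast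
   then show ?thesis
    using commsym_inv[of "lq c p" y0 m xi] LS_smooth(2)[OF open_image[OF c] lq_local(1)[OF c p] y0] by simp
  qed
 qed
 then show ?thesis
  unfolding H hq_def by (simp add: homp_euler[OF homp_pd[OF homp_hom_part]])
qed

text \<open>The Euler field multiplies a constant symbol by \<open>-k\<close>, and the degree
  \<open>d\<close> component of its quantization by \<open>-d\<close>; these differ.\<close>

lemma hq_const:
 assumes P: "P \<in> homp k" and d: "d \<noteq> k"
 shows "hq c y0 d (%_. P) xi = 0"
proof -
 note o = open_image[OF c]
 have p: "(%_. P) \<in> LS (deg_le k) (img c)"
  using deg_eq_le[OF o homp_const_local[OF P o smooth_on_const[of _ 1]]] by simp
 have "lie_symbol (eul y0) (%_. P) = (%y xi. (- of_nat k) * P xi + 0 * P xi)"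
  by (auto simp: fun_eq_iff lie_eul homp_euler[OF P])
 then have "- of_nat d * hq c y0 d (%_. P) xi = - of_nat k * hq c y0 d (%_. P) xi"
  using hq_eul[OF p, of d xi] hq_linear[OF p p, of d "- of_nat k" 0 xi] by simp
 then show ?thesis using d by simp
qed

text \<open>The Euler equation is solved along segments from the centre, so a chart whose image is a
  ball around \<open>y0\<close> is required.\<close>

lemma shrink_chart:
 obtains c' r where "r > 0" "c' \<in> \<A>" "img c' = ball y0 r" "ball y0 r \<subseteq> img c"
  "!!p k y xi. p \<in> LS (deg_le k) (img c) ==> y \<in> ball y0 r ==> lq c' p y xi = lq c p y xi"
proof -
 obtain r where r: "r > 0" "ball y0 r \<subseteq> img c"
  using open_image[OF c] y0 open_contains_ball by blast
 define V where "V = fst c \<inter> snd c -` ball y0 r"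
 have "open V"
  unfolding V_def using chart_homeo[OF c] chart_open[OF c]
  by (intro continuous_open_preimage) (auto simp: homeomorphism_def)
 moreover have V: "V \<subseteq> fst c" by (auto simp: V_def)
 moreover have b: "cdom c V = ball y0 r"
  using r(2) by (auto simp: V_def cdom_def)
 moreover have "cdom (V, snd c) UNIV = cdom c V" using V by (auto simp: cdom_def)
 ultimately show thesis
  using that[of r "(V, snd c)"] r chart_restrict[OF c] lq_restrict[OF c] by simp
qed

end

text \<open>Let \<open>H\<close> solve \<open>(E - (k - l)) H = p\<close> coefficientwise. On degree
  \<open>k\<close> the Euler field acts as \<open>E - k\<close>, so it maps \<open>H\<close> to
  \<open>p - l H\<close>. The degree \<open>l\<close> component of the quantized identity reads
  \<open>-l hq H = hq p - l hq H\<close>, whence \<open>hq p = 0\<close>.\<close>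

lemma hq_jet:
 assumes c: "c \<in> \<A>" and y0: "y0 \<in> img c" and p: "p \<in> LS (deg_eq k) (img c)"
  and l: "l < k" and jet: "jet_zero (Suc (k - l)) p y0"
 shows "hq c y0 l p xi = 0"
proof -
 obtain c' r where r: "r > 0" and c': "c' \<in> \<A>" and U: "img c' = ball y0 r" and sub: "ball y0 r \<subseteq> img c"
  and lq: "!!p k y xi. p \<in> LS (deg_le k) (img c) ==> y \<in> ball y0 r ==> lq c' p y xi = lq c p y xi"
  by (rule shrink_chart[OF c y0]) (rule that)
 have y0': "y0 \<in> img c'" using r U by simp
 note o = open_image[OF c'] and oc = open_image[OF c]
 have p': "p \<in> LS (deg_eq k) (img c')" using LS_restrict[OF p] sub U by simp
 have e: "hq c y0 l p xi = hq c' y0 l p xi"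
  unfolding hq_def by (rule hom_part_cong) (rule lq[OF deg_eq_le[OF oc p order_refl], symmetric], simp add: r)
 have "\<exists>h. smooth_on (ball y0 r) h \<and>
  (\<forall>x\<in>ball y0 r. (\<Sum>i\<in>UNIV. (x - y0) $ i *\<^sub>R pd i h x) - (of_nat (Suc (k - l)) - 1) * h x = fibre_coeff I p x)" for I
 \<comment> \<open>With \<open>m = Suc (k - l)\<close> the number \<open>m - 1\<close> subtracted in
   \<open>euler_solve\<close> is \<open>k - l\<close>, and the vanishing orders are those of
   \<open>jet_zero (Suc (k - l))\<close>.\<close>
 proof (rule euler_solve[OF _ r])
  show "smooth_on (ball y0 r) (fibre_coeff I p)" using fibre_coeff_smooth[OF o p'] U by simp
  fix J :: "'n list" assume "length J < Suc (k - l)"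
  then have "dsym J p y0 = (%_. 0)" using jet by (auto simp: jet_zero_def)
  then show "pds J (fibre_coeff I p) y0 = 0"
   using pds_fibre_coeff[OF oc p y0, of J I] by (simp add: fibre_coeff_def pds_const)
 qed
 then have "\<forall>I. \<exists>h. smooth_on (ball y0 r) h \<and>
  (\<forall>x\<in>ball y0 r. (\<Sum>i\<in>UNIV. (x - y0) $ i *\<^sub>R pd i h x) - (of_nat (Suc (k - l)) - 1) * h x = fibre_coeff I p x)" by (rule allI)
 from choice[OF this] obtain h where h0: "\<forall>I. smooth_on (ball y0 r) (h I) \<and>
  (\<forall>x\<in>ball y0 r. (\<Sum>i\<in>UNIV. (x - y0) $ i *\<^sub>R pd i (h I) x) - (of_nat (Suc (k - l)) - 1) * h I x = fibre_coeff I p x)" by (rule exE)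
 have h: "!!I. smooth_on (ball y0 r) (h I)"
  "!!I x. x \<in> ball y0 r ==> (\<Sum>i\<in>UNIV. (x - y0) $ i *\<^sub>R pd i (h I) x) - of_nat (k - l) * h I x = fibre_coeff I p x"
  using h0 by simp_all
 define H where "H y xi = (\<Sum>I\<in>deg_eq k. h I y * monomial I xi)" for y xi
 have HL: "H \<in> LS (deg_eq k) (img c')"
  by (rule local_symbolsI[of _ h]) (auto simp: H_def U h(1))
 note HL' = deg_eq_le[OF o HL order_refl]
 have lie: "lie_symbol (eul y0) H y eta = 1 * p y eta + (- of_nat l) * H y eta" if y: "y \<in> img c'" for y eta
 proof -
  have yb: "y \<in> ball y0 r" using y U by simp
  have d: "h I differentiable (at y)" for I by (rule smooth_on_differentiable[OF h(1) yb])
  have "pd i (%z. H z eta) y = (\<Sum>I\<in>deg_eq k. pd i (h I) y * monomial I eta)" for i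
   unfolding H_def using d by (subst pd_sum) (auto simp: pd_mult)
  then have "(\<Sum>i\<in>UNIV. cor (y $ i - y0 $ i) * pd i (%z. H z eta) y) =
   (\<Sum>I\<in>deg_eq k. (\<Sum>i\<in>UNIV. (y - y0) $ i *\<^sub>R pd i (h I) y) * monomial I eta)"
   by (simp only: sum_distrib_left sum_distrib_right vector_minus_component scaleR_conv_of_real mult.assoc) (rule sum.swap)
  also have "... = (\<Sum>I\<in>deg_eq k. (fibre_coeff I p y + of_nat (k - l) * h I y) * monomial I eta)"
  proof (intro sum.cong refl)
   fix I
   show "(\<Sum>i\<in>UNIV. (y - y0) $ i *\<^sub>R pd i (h I) y) * monomial I eta = (fibre_coeff I p y + of_nat (k - l) * h I y) * monomial I eta"
    using h(2)[OF yb, of I] by (simp add: algebra_simps)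
  qed
  also have "... = hom_part k p y eta + of_nat (k - l) * H y eta"
   by (simp add: hom_part_def H_def distrib_right sum.distrib sum_distrib_left mult.assoc)
  finally have "(\<Sum>i\<in>UNIV. cor (y $ i - y0 $ i) * pd i (%z. H z eta) y) = p y eta + of_nat (k - l) * H y eta"
   by (simp only: hom_part_hom[OF p' y])
  moreover have "(\<Sum>i\<in>UNIV. xm i (pd i (H y)) eta) = of_nat k * H y eta"
   by (rule homp_euler[OF homp_local[OF HL y]])
  ultimately show ?thesis unfolding lie_eul using l by (simp add: of_nat_diff algebra_simps)
 qed
 have "- of_nat l * hq c' y0 l H xi = hq c' y0 l (%y xi. 1 * p y xi + (- of_nat l) * H y xi) xi"
  using hq_eul[OF c' y0' HL', where d=l and xi=xi] hq_cong[OF c' y0' lie, where d=l] by simp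
 also have "... = hq c' y0 l p xi - of_nat l * hq c' y0 l H xi"
  using hq_linear[OF c' y0' deg_eq_le[OF o p' order_refl] HL', where d=l and a=1 and b="- of_nat l" and xi=xi] by simp
 finally show ?thesis unfolding e by simp
qed

text \<open>Expand \<open>p\<close> in \<open>y\<close> at \<open>y0\<close>: the remainder after
  the linear term has vanishing jet of order 1 and is killed by \<open>hq_jet\<close>, the constant
  term by \<open>hq_const\<close>.\<close>

lemma hq_taylor:
 assumes c: "c \<in> \<A>" and y0: "y0 \<in> img c" and p: "p \<in> LS (deg_eq (Suc K)) (img c)"
 shows "hq c y0 K p xi = (\<Sum>i\<in>UNIV. hq c y0 K (%y xi. zeta y0 i y * pd i (%z. p z xi) y0) xi)"
proof -
 note o = open_image[OF c]
 define P where "P i xi = pd i (%z. p z xi) y0" for i xi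
 have P: "P i \<in> homp (Suc K)" for i
  using homp_local[OF LS_pd[OF o p, of i] y0] by (simp add: P_def[abs_def])
 have p0: "p y0 \<in> homp (Suc K)" by (rule homp_local[OF p y0])
 define r where "r y xi = p y xi - p y0 xi - (\<Sum>i\<in>UNIV. zeta y0 i y * P i xi)" for y xi
 have c0: "(%_. p y0) \<in> LS (deg_eq (Suc K)) (img c)"
  using homp_const_local[OF p0 o smooth_on_const[of _ 1]] by simp
 have z: "(%y xi. zeta y0 i y * P i xi) \<in> LS (deg_eq (Suc K)) (img c)" for i
  by (rule zeta_local[OF P o])
 have r: "r \<in> LS (deg_eq (Suc K)) (img c)"
  unfolding r_def by (intro LS_diff LS_sum o p c0 z)
 have "jet_zero (Suc (Suc K - K)) r y0"
  unfolding jet_zero_def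
 proof (intro allI impI)
  fix I :: "'n list" and xi assume "length I < Suc (Suc K - K)"
  then consider "I = []" | j where "I = [j]" by (cases I) auto
  then show "dsym I r y0 xi = 0"
  proof cases
   case 1
   then show ?thesis by (simp add: dsym_def r_def)
  next
   case 2
   have d: "(%z. p z xi) differentiable (at y0)"
    by (rule smooth_on_differentiable[OF LS_smooth(1)[OF o p] y0])
   have d': "(%z. zeta y0 i z * a) differentiable (at y0)" for i a
    by (rule smooth_on_differentiable[OF smooth_on_mult[OF open_UNIV smooth_on_zeta[OF open_UNIV] smooth_on_const] UNIV_I])
   have "pd j (%z. r z xi) y0 = P j xi - (\<Sum>i\<in>UNIV. if j = i then P i xi else 0)"
    unfolding r_def using d d' by (subst pd_diff, simp, simp add: differentiable_sum, subst pd_diff, simp, simp, subst pd_sum, simp, simp add: P_def)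
   then show ?thesis using 2 by (simp add: dsym_def pds_Cons)
  qed
 qed
 then have r0: "hq c y0 K r xi = 0" by (intro hq_jet[OF c y0 r]) auto
 note le = deg_eq_le[OF o _ order_refl]
 have "hq c y0 K p xi = hq c y0 K (%y xi. 1 * (1 * r y xi + 1 * p y0 xi) + 1 * (\<Sum>i\<in>UNIV. 1 * (zeta y0 i y * P i xi))) xi"
  by (rule fun_cong[OF hq_cong[OF c y0]]) (simp add: r_def)
 also have "... = 1 * hq c y0 K (%y xi. 1 * r y xi + 1 * p y0 xi) xi + 1 * hq c y0 K (%y xi. \<Sum>i\<in>UNIV. 1 * (zeta y0 i y * P i xi)) xi"
  by (rule hq_linear[OF c y0, of _ "Suc K"]) (intro LS_add LS_cscale LS_sum o le r c0 z)+
 also have "hq c y0 K (%y xi. 1 * r y xi + 1 * p y0 xi) xi = 1 * hq c y0 K r xi + 1 * hq c y0 K (%_. p y0) xi"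
  by (rule hq_linear[OF c y0 le[OF r] le[OF c0]])
 also have "hq c y0 K (%y xi. \<Sum>i\<in>UNIV. 1 * (zeta y0 i y * P i xi)) xi = (\<Sum>i\<in>UNIV. 1 * hq c y0 K (%y xi. zeta y0 i y * P i xi) xi)"
  by (rule hq_sum[OF c y0 finite le[OF z]])
 finally have "hq c y0 K p xi = (\<Sum>i\<in>UNIV. hq c y0 K (%y xi. zeta y0 i y * P i xi) xi)"
  using r0 hq_const[OF c y0 p0, of K xi] by simp
 then show ?thesis unfolding P_def .
qed

text \<open>\<open>T i P\<close> is the correction on the symbol \<open>(y - y0)_i P\<close>, and
  \<open>S\<close> its difference from the candidate \<open>lam * pd i\<close>. The rotation and
  inversion equations are verified for \<open>S\<close>, and \<open>no_invariant\<close>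
  applies.\<close>

lemma hq_first_order:
 fixes p :: "'n lsymbol"
 assumes c: "c \<in> \<A>" and y0: "y0 \<in> img c" and p: "p \<in> LS (deg_eq (Suc K)) (img c)"
  and half: "lam = 1 / 2 \<or> K = 0"
 shows "hq c y0 K p xi = lam * (\<Sum>i\<in>UNIV. pd i (%xi. pd i (%z. p z xi) y0) xi)"
proof -
 note o = open_image[OF c]
 note le = deg_eq_le[OF o _ order_refl]
 let ?G = "%i. cor (g $ i $ i)"
 define T where "T i P = hq c y0 K (%y xi. zeta y0 i y * P xi)" for i :: 'n and P :: "real^'n => complex"
 define S where "S i P xi = T i P xi - lam * pd i P xi" for i :: 'n and P :: "real^'n => complex" and xi
 have T_mem: "T i P \<in> homp K" for i P by (simp add: T_def hq_homp)
 have z: "(%y xi. zeta y0 i y * P xi) \<in> LS (deg_le (Suc K)) (img c)" if "P \<in> homp (Suc K)" for i P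
  by (rule le[OF zeta_local[OF that o]])
 \<comment> \<open>A rotation acts on \<open>zeta y0 i y * P\<close> by rotating \<open>P\<close>
   and, through the coordinate factor, the index \<open>i\<close>; the latter gives the two
   conditional terms.\<close>
 have T_rot: "T i (rot a b P) eta = rot a b (T i P) eta - (if i = b then ?G a * T a P eta else 0) + (if i = a then ?G b * T b P eta else 0)"
  if P: "P \<in> homp (Suc K)" for i a b P eta
 proof -
  let ?\<alpha> = "if i = b then ?G a else 0" and ?\<beta> = "- (if i = a then ?G b else 0)"
  have R: "rot a b P \<in> homp (Suc K)" by (rule homp_rot[OF P])
  have m: "(%y xi. ?\<alpha> * (zeta y0 a y * P xi) + ?\<beta> * (zeta y0 b y * P xi)) \<in> LS (deg_le (Suc K)) (img c)"
   by (intro LS_add LS_cscale o z P)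
  have "lie_symbol (rotf a b y0) (%y xi. zeta y0 i y * P xi) y \<zeta> =
   1 * (zeta y0 i y * rot a b P \<zeta>) + 1 * (?\<alpha> * (zeta y0 a y * P \<zeta>) + ?\<beta> * (zeta y0 b y * P \<zeta>))" for y \<zeta>
  proof -
   have "(\<Sum>j\<in>UNIV. cor (rotf a b y0 y $ j) * pd j (%z. zeta y0 i z * P \<zeta>) y) = cor (rotf a b y0 y $ i) * P \<zeta>"
    by (simp add: if_distrib[of "%x. _ * x"] cong: if_cong)
   moreover have "rot a b (%xi. zeta y0 i y * P xi) \<zeta> = zeta y0 i y * rot a b P \<zeta>"
    unfolding rot_def xm_def pd_cmult_fun[OF homp_smooth[OF P]] by (simp add: algebra_simps)
   moreover have "cor (rotf a b y0 y $ i) = ?\<alpha> * zeta y0 a y + ?\<beta> * zeta y0 b y"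
    by (simp add: rotf_def g_mult axis_def zeta_def)
   ultimately show ?thesis unfolding lie_rotf by (simp only: distrib_right mult.assoc mult_1 add.commute)
  qed
  then have "rot a b (T i P) eta = hq c y0 K (%y xi. 1 * (zeta y0 i y * rot a b P xi) + 1 * (?\<alpha> * (zeta y0 a y * P xi) + ?\<beta> * (zeta y0 b y * P xi))) eta"
   unfolding T_def hq_rot[OF c y0 z[OF P], symmetric] by presburger
  also have "... = 1 * T i (rot a b P) eta + 1 * (?\<alpha> * T a P eta + ?\<beta> * T b P eta)"
   unfolding T_def hq_linear[OF c y0 z[OF R] m] hq_linear[OF c y0 z[OF P] z[OF P]] ..
  finally show ?thesis by (auto simp: algebra_simps)
 qed
 have S0: "S m P eta = 0" if "P \<in> homp (Suc K)" for m P eta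
 proof (rule no_invariant[of K S, OF _ _ _ _ that])
  fix i and I :: "'n option set" and a and F :: "'n option => real^'n => complex" and xi :: "real^'n" assume I: "finite I" and F: "!!s. s \<in> I ==> F s \<in> homp (Suc K)"
  have "T i (%xi. \<Sum>s\<in>I. a s * F s xi) xi = hq c y0 K (%y xi. \<Sum>s\<in>I. a s * (zeta y0 i y * F s xi)) xi"
   unfolding T_def by (rule arg_cong[of _ _ "%p. hq c y0 K p xi"]) (auto simp: fun_eq_iff sum_distrib_left mult.left_commute)
  also have "... = (\<Sum>s\<in>I. a s * T i (F s) xi)"
   unfolding T_def by (rule hq_sum[OF c y0 I z[OF F]])
  moreover have "pd i (%xi. \<Sum>s\<in>I. a s * F s xi) xi = (\<Sum>s\<in>I. a s * pd i (F s) xi)"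
   using homp_smooth[OF F] by (simp add: pd_sum_fun smooth_on_cmult pd_cmult_fun)
  ultimately show "S i (%xi. \<Sum>s\<in>I. a s * F s xi) xi = (\<Sum>s\<in>I. a s * S i (F s) xi)"
   by (simp add: S_def right_diff_distrib sum_subtractf sum_distrib_left mult.left_commute)
 next
  fix i :: 'n and P :: "real^'n => complex" assume P: "P \<in> homp (Suc K)"
  show "S i P \<in> homp K"
   using homp_add[OF T_mem homp_cmult[OF homp_pd[OF P], of "- cor lam" i], of i P] by (simp add: S_def[abs_def])
 next
  fix a b i :: 'n and P :: "real^'n => complex" and xi assume P: "P \<in> homp (Suc K)"
  show "S i (rot a b P) xi = rot a b (S i P) xi - (if i = b then ?G a * S a P xi else 0) + (if i = a then ?G b * S b P xi else 0)"
   unfolding S_def[abs_def] rot_lin[OF homp_smooth[OF T_mem] smooth_on_pd[OF homp_smooth[OF P]]] T_rot[OF P] pd_rot[OF homp_smooth[OF P]]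
   by (simp add: algebra_simps)
 next
  fix m :: 'n and P :: "real^'n => complex" and xi assume P: "P \<in> homp (Suc K)"
  have Pc: "(%_. P) \<in> LS (deg_eq (Suc K)) (img c)"
   using homp_const_local[OF P o smooth_on_const[of _ 1]] by simp
  have D: "xm j (pd i P) \<in> homp (Suc K)" for i j by (rule homp_xm[OF homp_pd[OF P]])
  define A where "A = (\<Sum>i\<in>UNIV. ?G i * T i (xm m (pd i P)) xi)"
  define B where "B = (\<Sum>i\<in>UNIV. T i (xm i (pd m P)) xi)"
  define X where "X = xm m (lap P) xi"
  let ?n = "of_nat CARD('n) :: complex" and ?D = "pd m P xi" and ?K = "of_nat K :: complex"
  \<comment> \<open>Applied to the constant symbol \<open>P\<close>, the inversion equation in
    degree \<open>K\<close> involves the component of degree \<open>Suc K\<close>, which is the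
    principal symbol \<open>P\<close> itself.\<close>
  have H: "hq c y0 (Suc K) (%_. P) = P" by (rule ext) (rule hq_top[OF c y0 Pc])
  let ?R = "%y xi. 1 * (\<Sum>i\<in>UNIV. (2 * ?G m) * (zeta y0 i y * xm i (pd m P) xi)) + (2 * ?G m * of_nat (Suc K)) * (zeta y0 m y * P xi)"
  have L: "lie_symbol (invf m y0) (%_. P) = (%y xi. 1 * (\<Sum>i\<in>UNIV. (- 2 * ?G i) * (zeta y0 i y * xm m (pd i P) xi)) + 1 * ?R y xi)"
   by (intro ext, simp add: lie_inv_const homp_euler[OF P] zeta_def[symmetric] distrib_left sum.distrib mult_ac del: of_nat_Suc of_real_diff)
    (simp only: sum.distrib[symmetric], rule sum.cong[OF refl], simp add: algebra_simps)
  have "2 * ?n * lam * ?G m * ?D - X + 2 * ?G m * (?K * ?D) = hq c y0 K (lie_symbol (invf m y0) (%_. P)) xi"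
   unfolding hq_inv[OF c y0 le[OF Pc] H[symmetric]] X_def by simp
  also have "... = 1 * hq c y0 K (%y xi. \<Sum>i\<in>UNIV. (- 2 * ?G i) * (zeta y0 i y * xm m (pd i P) xi)) xi + 1 * hq c y0 K ?R xi"
   unfolding L by (rule hq_linear[OF c y0, of _ "Suc K"]) (intro LS_add LS_cscale LS_sum o z D P)+
  also have "hq c y0 K (%y xi. \<Sum>i\<in>UNIV. (- 2 * ?G i) * (zeta y0 i y * xm m (pd i P) xi)) xi = (\<Sum>i\<in>UNIV. (- 2 * ?G i) * T i (xm m (pd i P)) xi)"
   unfolding T_def by (rule hq_sum[OF c y0 finite z[OF D]])
  also have "hq c y0 K ?R xi = 1 * hq c y0 K (%y xi. \<Sum>i\<in>UNIV. (2 * ?G m) * (zeta y0 i y * xm i (pd m P) xi)) xi + (2 * ?G m * of_nat (Suc K)) * T m P xi"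
   unfolding T_def by (rule hq_linear[OF c y0, of _ "Suc K"]) (intro LS_add LS_cscale LS_sum o z D P)+
  also have "hq c y0 K (%y xi. \<Sum>i\<in>UNIV. (2 * ?G m) * (zeta y0 i y * xm i (pd m P) xi)) xi = (\<Sum>i\<in>UNIV. (2 * ?G m) * T i (xm i (pd m P)) xi)"
   unfolding T_def by (rule hq_sum[OF c y0 finite z[OF D]])
  finally have E: "2 * ?n * lam * ?G m * ?D - X + 2 * ?G m * (?K * ?D) = - 2 * A + 2 * ?G m * B + 2 * ?G m * (?K + 1) * T m P xi"
   by (simp add: A_def B_def sum_distrib_left sum_negf mult.assoc del: mult_Suc_right)
  have s: "smooth_on UNIV (pd i P)" for i by (rule smooth_on_pd[OF homp_smooth[OF P]])
  have d1: "(\<Sum>i\<in>UNIV. ?G i * pd i (xm m (pd i P)) xi) = ?G m * ?D + X"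
   by (simp add: pd_xm[OF s] distrib_left sum.distrib X_def lap_def xm_def sum_distrib_left mult.left_commute if_distrib[of "%x. _ * x"] cong: if_cong)
  have d2: "(\<Sum>i\<in>UNIV. pd i (xm i (pd m P)) xi) = (?n + ?K) * ?D"
   by (simp add: pd_xm[OF s] sum.distrib homp_euler[OF homp_pd[OF P]] distrib_right)
  \<comment> \<open>Twice the amount by which \<open>lam * pd i\<close> fails the inversion
    equation. It vanishes for \<open>lam = 1 / 2\<close>; for \<open>K = 0\<close> the polynomial
    \<open>P\<close> is linear, so its Laplacian is zero as well.\<close>
  have h: "(1 - 2 * cor lam) * (X - 2 * ?K * (?G m * ?D)) = 0"
  proof (cases "K = 0")
   case True
   then show ?thesis using lap_small[OF P] by (simp add: X_def xm_def)
  next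
   case False
   then have l: "lam = 1 / 2" using half by simp
   show ?thesis unfolding l by simp
  qed
  have "(\<Sum>i\<in>UNIV. ?G i * S i (xm m (pd i P)) xi) = A - lam * (\<Sum>i\<in>UNIV. ?G i * pd i (xm m (pd i P)) xi)"
   by (simp add: S_def A_def right_diff_distrib sum_subtractf sum_distrib_left mult.left_commute)
  moreover have "(\<Sum>i\<in>UNIV. S i (xm i (pd m P)) xi) = B - lam * (\<Sum>i\<in>UNIV. pd i (xm i (pd m P)) xi)"
   by (simp add: S_def B_def sum_subtractf sum_distrib_left)
  moreover have "A - lam * (?G m * ?D + X) - ?G m * (B - lam * ((?n + ?K) * ?D)) = (?K + 1) * ?G m * (T m P xi - lam * ?D)"
  proof -
   have "2 * (A - lam * (?G m * ?D + X) - ?G m * (B - lam * ((?n + ?K) * ?D))) = 2 * ((?K + 1) * ?G m * (T m P xi - lam * ?D))"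
    using E h by algebra
   then show ?thesis by (rule mult_left_cancel[THEN iffD1, rotated]) simp
  qed
  ultimately show "(\<Sum>i\<in>UNIV. ?G i * S i (xm m (pd i P)) xi) - ?G m * (\<Sum>i\<in>UNIV. S i (xm i (pd m P)) xi) = of_nat (Suc K) * ?G m * S m P xi"
   unfolding d1 d2 S_def by (simp add: add.commute)
 qed
 have "hq c y0 K p xi = (\<Sum>i\<in>UNIV. T i (%xi. pd i (%z. p z xi) y0) xi)"
  unfolding T_def by (rule hq_taylor[OF c y0 p])
 also have "... = (\<Sum>i\<in>UNIV. lam * pd i (%xi. pd i (%z. p z xi) y0) xi)"
 proof (intro sum.cong refl)
  fix i
  have "(%xi. pd i (%z. p z xi) y0) \<in> homp (Suc K)"
   by (rule homp_local[OF LS_pd[OF o p, of i] y0])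
  from S0[OF this, of i xi] show "T i (%xi. pd i (%z. p z xi) y0) xi = lam * pd i (%xi. pd i (%z. p z xi) y0) xi"
   by (simp add: S_def)
 qed
 finally show ?thesis by (simp add: sum_distrib_left)
qed

text \<open>The largest difference \<open>d - l\<close> of degrees is \<open>k\<close>, so vanishing
  of the jet of order \<open>k\<close> suffices for all components together.\<close>

lemma lq_jet_at:
 assumes c: "c \<in> \<A>" and y0: "y0 \<in> img c" and p: "p \<in> LS (deg_le k) (img c)"
  and jet: "jet_zero (Suc k) p y0"
 shows "lq c p y0 xi = 0"
proof -
 note o = open_image[OF c]
 have h: "hom_part d p \<in> LS (deg_eq d) (img c)" for d by (rule LS_hom_part[OF o p])
 have h': "hom_part d p \<in> LS (deg_le k) (img c)" if "d \<in> {..k}" for d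
  using deg_eq_le[OF o h, of d k] that by simp
 have j: "jet_zero (Suc k) (hom_part d p) y0" for d by (rule jet_zero_hom_part[OF o p y0 jet])
 have "lq c p = lq c (%y xi. \<Sum>d\<in>{..k}. 1 * hom_part d p y xi)"
  by (rule lq_cong[OF c]) (simp add: hom_part_sum[OF p])
 then have "lq c p y0 xi = lq c (%y xi. \<Sum>d\<in>{..k}. 1 * hom_part d p y xi) y0 xi" by (rule fun_cong[OF fun_cong])
 also have "... = (\<Sum>d\<in>{..k}. 1 * lq c (hom_part d p) y0 xi)"
  by (rule lq_sum[OF c y0 h'])
 also have "... = 0"
 proof (rule sum.neutral, rule ballI)
  fix d assume d: "d \<in> {..k}"
  have "lq c (hom_part d p) y0 xi = (\<Sum>l\<le>d. hq c y0 l (hom_part d p) xi)"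
   unfolding hq_def by (rule hom_part_sum[OF lq_local(1)[OF c deg_eq_le[OF o h order_refl]] y0])
  also have "... = 0"
  proof (rule sum.neutral, rule ballI)
   fix l assume l: "l \<in> {..d}"
   show "hq c y0 l (hom_part d p) xi = 0"
   proof (cases "l = d")
    case True
    have "dsym [] (hom_part d p) y0 xi = 0" using j[of d] unfolding jet_zero_def by (metis list.size(3) zero_less_Suc)
    then show ?thesis using True hq_top[OF c y0 h, of d xi] by (simp add: dsym_def)
   next
    case False
    then show ?thesis using l d by (intro hq_jet[OF c y0 h] jet_zero_mono[OF j]) auto
   qed
  qed
  finally show "1 * lq c (hom_part d p) y0 xi = 0" by simp
 qed
 finally show ?thesis .
qed

text \<open>Constant fields act as partial derivatives on symbols, and their commutators with
  operators differentiate the full symbol. Equivariance under translations thus says that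
  \<open>lq\<close> has constant coefficients.\<close>

lemma lq_dsym:
 assumes c: "c \<in> \<A>" and y: "y \<in> img c" and p: "p \<in> LS (deg_le k) (img c)"
 shows "dsym I (lq c p) y xi = lq c (dsym I p) y xi"
 using y
proof (induction I arbitrary: y xi)
 case (Cons i I)
 note o = open_image[OF c]
 have X: "pd j (%_. axis i 1 :: real^'n) = (%_. 0)" for j by simp
 have lie: "lie_symbol (%_. axis i 1) r = (%y xi. pd i (%z. r z xi) y)" for r :: "'n lsymbol"
  by (auto simp: lie_symbol_def X axis_def fun_eq_iff if_distrib[of "%x. x * _"] if_distrib[of cor] cong: if_cong)
 have F: "fsym_field lam (%_. axis i 1) xi = (%_. cor (\<Sum>j\<in>UNIV. xi $ j * axis i 1 $ j))" for xi :: "real^'n"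
  by (auto simp: fsym_field_def X)
 have com: "commsym lam (%_. axis i 1) r y xi = pd i (%z. r z xi) y" for r :: "'n lsymbol"
  unfolding commsym_def F by (simp add: axis_def if_distrib[of "%x. x * _"] if_distrib[of cor] cong: if_cong)
 have "dsym (i # I) (lq c p) y xi = pd i (%z. dsym I (lq c p) z xi) y"
  by (simp add: dsym_def pds_Cons)
 also have "... = pd i (%z. lq c (dsym I p) z xi) y"
  by (rule pd_cong[OF o Cons.prems Cons.IH])
 also have "... = lq c (%y xi. pd i (%z. dsym I p z xi) y) y xi"
  using equiv_const[OF c, of "axis i 1"] dsym_local[OF o p, of I] Cons.prems unfolding equiv_def by (simp add: lie com)
 also have "(%y xi. pd i (%z. dsym I p z xi) y) = dsym (i # I) p"
  by (auto simp: fun_eq_iff dsym_def pds_Cons)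
 finally show ?case .
qed (simp add: dsym_def[abs_def])

lemma lq_jet:
 assumes c: "c \<in> \<A>" and y: "y \<in> img c" and p: "p \<in> LS (deg_le k) (img c)"
  and jet: "jet_zero (N + k) p y"
 shows "jet_zero N (lq c p) y"
 unfolding jet_zero_def
proof (intro allI impI)
 fix I :: "'n list" and xi assume I: "length I < N"
 have "jet_zero (Suc k) (dsym I p) y"
  unfolding jet_zero_def
 proof (intro allI impI)
  fix J :: "'n list" and eta assume J: "length J < Suc k"
  have "dsym (J @ I) p y eta = 0" using jet I J unfolding jet_zero_def by simp
  then show "dsym J (dsym I p) y eta = 0" by (simp add: dsym_append)
 qed
 then show "dsym I (lq c p) y xi = 0"
  unfolding lq_dsym[OF c y p] by (rule lq_jet_at[OF c y dsym_local[OF open_image[OF c] p]])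
qed

end

section \<open>The product of symbols\<close>

lemma sum_triangle: "(\<Sum>a\<le>m. \<Sum>j\<le>a. h j (a - j)) = (\<Sum>j\<le>m. \<Sum>b\<le>m - j. h j b)" for h :: "nat => nat => 'a::comm_monoid_add"
 unfolding sum.Sigma[OF finite_atMost, of m "%a. {..a}", simplified] sum.Sigma[OF finite_atMost, of m "%j. {..m - j}", simplified]
 by (rule sum.reindex_bij_witness[of _ "%(j, b). (j + b, j)" "%(a, j). (j, a - j)"]) auto

lemma sum_swap_triangle: "(\<Sum>j\<le>m. \<Sum>s\<le>m - j. h s j) = (\<Sum>s\<le>m. \<Sum>j\<le>m - s. h s j)" for h :: "nat => nat => 'a::comm_monoid_add"
 unfolding sum.Sigma[OF finite_atMost, of m "%j. {..m - j}", simplified]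
 by (rule sum.reindex_bij_witness[of _ "%(a, b). (b, a)" "%(a, b). (b, a)"]) auto

context conf_atlas
begin

section \<open>Homogeneous components and the formal parameter\<close>

lemma symbolsI: "P \<in> SL k W ==> P \<in> SY W"
 by (auto simp: symbols_def)

lemma symbol_outside: "P \<in> SY W ==> c \<notin> \<A> \<or> y \<notin> cdom c W ==> P c y xi = 0"
 by (erule symbolsE) (rule symbol_zero)

lemma hom_sym_symbols: "open W ==> P \<in> SY W ==> hom_sym d P \<in> SL d W"
 by (erule symbolsE) (rule hom_sym_mem)

lemma hom_sym_setsum:
 assumes W: "open W" and T: "finite T" and P: "!!s. s \<in> T ==> P s \<in> SY W"
 shows "hom_sym d (%c y xi. \<Sum>s\<in>T. a s * P s c y xi) = (%c y xi. \<Sum>s\<in>T. a s * hom_sym d (P s) c y xi)"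
proof (intro ext)
 fix c y xi
 show "hom_sym d (%c y xi. \<Sum>s\<in>T. a s * P s c y xi) c y xi = (\<Sum>s\<in>T. a s * hom_sym d (P s) c y xi)"
 proof (cases "c \<in> \<A> \<and> y \<in> cdom c W")
  case True
  then have c: "c \<in> \<A>" and y: "y \<in> cdom c W" by auto
  note o = open_cdom[OF c W]
  have "\<forall>s\<in>T. \<exists>k. P s \<in> SL k W" using P by (auto simp: symbols_def)
  from bchoice[OF this] obtain k where k: "\<forall>s\<in>T. P s \<in> SL (k s) W" by (rule exE)
  have L: "P s c \<in> LS (deg_le (k s)) (cdom c W)" if "s \<in> T" for s
   by (rule symbol_local[OF bspec[OF k that] c])
  have "hom_part d (%y xi. \<Sum>s\<in>T. a s * P s c y xi) y xi = (\<Sum>s\<in>T. hom_part d (%y xi. a s * P s c y xi) y xi)"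
   by (rule hom_part_setsum[OF o T LS_cscale[OF o L] y])
  also have "... = (\<Sum>s\<in>T. a s * hom_part d (P s c) y xi)"
   by (intro sum.cong refl hom_part_cmult[OF o L y])
  finally show ?thesis by (simp add: hom_sym_def)
 next
  case False
  then have o: "c \<notin> \<A> \<or> y \<notin> cdom c W" by simp
  have "P s c y eta = 0" if "s \<in> T" for s eta by (rule symbol_outside[OF P[OF that] o])
  then show ?thesis by (simp add: hom_sym_def hom_part_zero)
 qed
qed

lemma hom_sym_hom:
 assumes W: "open W" and P: "P \<in> SY W"
 shows "hom_sym d (hom_sym e P) c y xi = (if d = e then hom_sym e P c y xi else 0)"
proof (cases "c \<in> \<A> \<and> y \<in> cdom c W")
 case True
 then have c: "c \<in> \<A>" and y: "y \<in> cdom c W" by auto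
 obtain k where k: "P \<in> SL k W" using P by (rule symbolsE)
 have L: "hom_part e (P c) \<in> LS (deg_eq e) (cdom c W)"
  by (rule LS_hom_part[OF open_cdom[OF c W] symbol_local[OF k c]])
 show ?thesis
  unfolding hom_sym_def using hom_part_hom[OF L y, of xi] hom_part_eq_0[OF L finite_length_eq y, of d xi] by auto
next
 case False
 then have "c \<notin> \<A> \<or> y \<notin> cdom c W" by simp
 then have z: "P c y eta = 0" for eta by (rule symbol_outside[OF P])
 have z': "hom_part e (P c) y eta = 0" for eta by (rule hom_part_zero) (rule z)
 show ?thesis unfolding hom_sym_def using z' hom_part_zero[of "hom_part e (P c)" y d xi] by simp
qed

lemma hom_sym_high:
 assumes P: "P \<in> SL k W" and d: "d > k"
 shows "hom_sym d P = (%c y xi. 0)"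
proof (intro ext)
 fix c y xi
 show "hom_sym d P c y xi = 0"
 proof (cases "c \<in> \<A> \<and> y \<in> cdom c W")
  case True
  then have L: "P c \<in> LS (deg_le k) (cdom c W)" by (intro symbol_local[OF P]) simp
  show ?thesis unfolding hom_sym_def by (rule hom_part_eq_0[OF L finite_length_le]) (use True d in auto)
 next
  case False
  then have "c \<notin> \<A> \<or> y \<notin> cdom c W" by simp
  then have z: "P c y eta = 0" for eta by (rule symbol_zero[OF P])
  show ?thesis unfolding hom_sym_def by (rule hom_part_zero) (rule z)
 qed
qed

lemma symbol_eq_hom:
 assumes W: "open W" and P: "P \<in> SY W" "R \<in> SY W" and eq: "!!d. hom_sym d P = hom_sym d R"
 shows "P = R"
proof -
 obtain k where k: "P \<in> SL k W" "R \<in> SL k W" by (rule symbols_common[OF W P])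
 show ?thesis by (subst hom_sym_sum[OF k(1)], subst hom_sym_sum[OF k(2)]) (simp only: eq)
qed

lemma I_hbar_eq: "I_hbar P m = (%c y xi. \<i> ^ m * hom_sym m P c y xi)"
 by (simp add: I_hbar_def hom_sym_def)

lemma I_hbar_sum:
 assumes "open W" "finite T" "!!s. s \<in> T ==> P s \<in> SY W"
 shows "I_hbar (%c y xi. \<Sum>s\<in>T. a s * P s c y xi) m = (%c y xi. \<Sum>s\<in>T. a s * I_hbar (P s) m c y xi)"
proof -
 have h: "hom_sym m (%c y xi. \<Sum>s\<in>T. a s * P s c y xi) = (%c y xi. \<Sum>s\<in>T. a s * hom_sym m (P s) c y xi)"
  by (rule hom_sym_setsum[OF assms])
 show ?thesis unfolding I_hbar_eq h by (simp add: sum_distrib_left mult.left_commute)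
qed

lemma I_hbar_linear:
 assumes "open W" "P \<in> SY W" "R \<in> SY W"
 shows "I_hbar (%c y xi. a * P c y xi + b * R c y xi) m = (%c y xi. a * I_hbar P m c y xi + b * I_hbar R m c y xi)"
 using I_hbar_sum[OF assms(1), of "{True, False}" "%s. if s then P else R" "%s. if s then a else b" m] assms(2,3) by simp

lemma I_hbar_mem:
 assumes W: "open W" and P: "P \<in> SY W"
 shows "I_hbar P m \<in> SL m W"
 using symbols_le_sum[OF W, of "{()}" "%_. hom_sym m P" m "%_. \<i> ^ m"] hom_sym_symbols[OF W P] by (simp add: I_hbar_eq)

end

context quantization
begin

abbreviation star where "star W \<equiv> quant_product \<A> lam Q W"

lemma Q_sum:
 assumes W: "W \<in> AD" and P: "!!s. s \<in> T ==> P s \<in> SY W" and f: "f \<in> dens lam W"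
 shows "Q W (%c y xi. \<Sum>s\<in>T. a s * P s c y xi) f c y = (\<Sum>s\<in>T. a s * Q W (P s) f c y)"
 using P
proof (induction T rule: infinite_finite_induct)
 case (insert s T)
 then have m: "P s \<in> SY W" "(%c y xi. \<Sum>s\<in>T. a s * P s c y xi) \<in> SY W"
  by (simp_all add: symbols_sum[OF adapted_open[OF W]])
 show ?case using Q_linear[OF W m f, of "a s" 1] insert by simp
next
 case empty
 have z: "(%c y xi. 0) \<in> SY W" by (rule symbolsI[OF symbols_le_zero[of 0]])
 show ?case using Q_linear[OF W z z f, of 0 0] by simp
next
 case (infinite T)
 have z: "(%c y xi. 0) \<in> SY W" by (rule symbolsI[OF symbols_le_zero[of 0]])
 show ?case using Q_linear[OF W z z f, of 0 0] infinite by simp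
qed

lemma Q_dens: "W \<in> AD ==> P \<in> SY W ==> f \<in> dens lam W ==> Q W P f \<in> dens lam W"
 by (erule symbolsE) (rule diff_op_mem[OF Q_le(1)])

lemma Q_inj:
 assumes W: "W \<in> AD" and P: "P \<in> SY W" "R \<in> SY W" and eq: "!!f. f \<in> dens lam W ==> Q W P f = Q W R f"
 shows "P = R"
proof -
 have "Q W S f = (%c y. 0)" if "S \<in> SY W" "f \<notin> dens lam W" for S f
  using that(1) by (rule symbolsE) (rule diff_op_zero[OF Q_le(1)[OF W] that(2)])
 then have "Q W P = Q W R"
  using eq P by (intro ext, case_tac "x \<in> dens lam W") simp_all
 then show ?thesis by (rule inj_onD[OF bij_betw_imp_inj_on[OF Q_bij[OF W]] _ P])
qed

lemma Q_sum_arg: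
 assumes W: "W \<in> AD" and P: "P \<in> SY W" and f: "!!s. s \<in> T ==> f s \<in> dens lam W"
 shows "Q W P (%c y. \<Sum>s\<in>T. f s c y) c y = (\<Sum>s\<in>T. Q W P (f s) c y)"
 using P by (rule symbolsE) (rule diff_op_sum[OF adapted_open[OF W] Q_le(1)[OF W] f])

lemma Q_linear_arg:
 assumes W: "W \<in> AD" and P: "P \<in> SY W" and f: "f \<in> dens lam W" "h \<in> dens lam W"
 shows "Q W P (%c y. a * f c y + b * h c y) c y = a * Q W P f c y + b * Q W P h c y"
 using P by (rule symbolsE) (rule diff_op_linear[OF adapted_open[OF W] Q_le(1)[OF W] f])

text \<open>The product without formal parameter: composition of operators pulled back through
  \<open>Q\<close>. The formal product is assembled from it in \<open>star_sum\<close>.\<close>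

definition circ :: "'m set => ('m, 'n) symbol => ('m, 'n) symbol => ('m, 'n) symbol" where
 "circ W P R = inv_into (SY W) (Q W) (trunc_op lam W (%f. Q W P (Q W R f)))"

lemma circ:
 assumes W: "W \<in> AD" and P: "P \<in> SL k W" and R: "R \<in> SL l W"
 shows circ_mem: "circ W P R \<in> SL (k + l) W"
  and Q_circ: "f \<in> dens lam W ==> Q W (circ W P R) f = Q W P (Q W R f)"
  and sig_circ: "c \<in> \<A> ==> y \<in> cdom c W ==> sig W (circ W P R) c y xi = sharp k (sig W P c) (sig W R c) y xi"
proof -
 note oW = adapted_open[OF W]
 let ?F = "%f. Q W P (Q W R f)"
 note D = Q_dens[OF W symbolsI[OF P] Q_dens[OF W symbolsI[OF R]]]
 have sh: "sharp k (sig W P c) (sig W R c) \<in> LS (deg_le (k + l)) (cdom c W)" if c: "c \<in> \<A>" for c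
  by (rule LS_sharp[OF open_cdom[OF c oW] sig_local[OF W P c] sig_local[OF W R c]])
 have loc: "?F f c y = normal_order (k + l) (sharp k (sig W P c) (sig W R c)) (f c) y"
  if c: "c \<in> \<A>" and f: "f \<in> dens lam W" and y: "y \<in> cdom c W" for c f y
 proof -
  note o = open_cdom[OF c oW]
  have "?F f c y = normal_order k (sig W P c) (Q W R f c) y"
   by (rule diff_op_local(2)[OF oW Q_le(1)[OF W P] c Q_dens[OF W symbolsI[OF R] f] y])
  also have "... = normal_order k (sig W P c) (normal_order l (sig W R c) (f c)) y"
   by (rule normal_order_cong_fun[OF o y]) (rule diff_op_local(2)[OF oW Q_le(1)[OF W R] c f])
  also have "... = normal_order (k + l) (sharp k (sig W P c) (sig W R c)) (f c) y"
   by (rule normal_order_compose[OF o density_smooth[OF f c] y sig_local[OF W P c] sig_local[OF W R c]])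
  finally show ?thesis .
 qed
 note T = trunc_op_mem[OF oW D sh loc]
 obtain S where S: "S \<in> SL (k + l) W" "Q W S = trunc_op lam W ?F" by (rule Q_surj[OF W T(1)])
 have e: "circ W P R = S"
  unfolding circ_def S(2)[symmetric] by (rule inv_into_f_f[OF bij_betw_imp_inj_on[OF Q_bij[OF W]] symbolsI[OF S(1)]])
 show "circ W P R \<in> SL (k + l) W" unfolding e by (rule S(1))
 show "Q W (circ W P R) f = Q W P (Q W R f)" if "f \<in> dens lam W"
  unfolding e S(2) trunc_op_def using that by (simp only: if_True)
 show "sig W (circ W P R) c y xi = sharp k (sig W P c) (sig W R c) y xi" if "c \<in> \<A>" "y \<in> cdom c W"
  unfolding e S(2) by (rule T(2)) (assumption | rule that)+
qed

context
 fixes W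
 assumes W: "W \<in> AD"
begin

lemmas oW = adapted_open[OF W]

lemma series_mem: "(!!j. S j \<in> SY W) ==> (%c y xi. \<Sum>j\<le>m. 1 * I_hbar (S j) (m - j) c y xi) \<in> SY W"
 by (rule symbols_sum[OF oW symbolsI[OF I_hbar_mem[OF oW]]])

lemma series_Q:
 assumes S: "!!j. S j \<in> SY W" and f: "f \<in> dens lam W"
 shows "quant_h_series Q W S m f c y = Q W (%c y xi. \<Sum>j\<le>m. 1 * I_hbar (S j) (m - j) c y xi) f c y"
 unfolding quant_h_series_def quant_h_def by (subst Q_sum[OF W symbolsI[OF I_hbar_mem[OF oW S]] f]) simp

text \<open>\<open>I_hbar\<close> puts the degree \<open>d\<close> part of \<open>S j\<close> at
  order \<open>j + d\<close>. Hence the degree \<open>d\<close> part of the coefficient of order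
  \<open>j + d\<close> comes from \<open>S j\<close> alone, and injectivity of \<open>Q\<close>
  gives uniqueness of the formal product.\<close>

lemma series_inject:
 assumes S: "!!j. S j \<in> SY W" "!!j. S' j \<in> SY W"
  and eq: "!!m f c y. f \<in> dens lam W ==> quant_h_series Q W S m f c y = quant_h_series Q W S' m f c y"
 shows "S = S'"
proof
 fix j
 let ?U = "%S m. %c y xi. \<Sum>j\<le>m. 1 * I_hbar (S j) (m - j) c y xi"
 have U: "?U S m = ?U S' m" for m
  by (rule Q_inj[OF W series_mem[of S, OF S(1)] series_mem[of S', OF S(2)]]) (intro ext, subst (1 2) series_Q[symmetric], auto intro: S eq)
 have h: "hom_sym d (?U S (j + d)) c y xi = \<i> ^ d * hom_sym d (S j) c y xi" if S: "!!j. S j \<in> SY W" for S d c y xi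
 proof -
  have "hom_sym d (I_hbar (S i) e) c y xi = (if d = e then \<i> ^ d * hom_sym d (S i) c y xi else 0)" for i e
   using hom_sym_setsum[OF oW, of "{()}" "%_. hom_sym e (S i)" d "%_. \<i> ^ e"] symbolsI[OF hom_sym_symbols[OF oW S]] hom_sym_hom[OF oW S, of d e i c y xi]
   by (auto simp: I_hbar_eq)
  then have "hom_sym d (?U S (j + d)) c y xi = (\<Sum>i\<le>j + d. if i = j then \<i> ^ d * hom_sym d (S i) c y xi else 0)"
   unfolding hom_sym_setsum[OF oW finite_atMost symbolsI[OF I_hbar_mem[OF oW S]]] by (intro sum.cong refl) auto
  then show ?thesis by simp
 qed
 show "S j = S' j"
 proof (rule symbol_eq_hom[OF oW S])
  fix d
  show "hom_sym d (S j) = hom_sym d (S' j)"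
  proof (intro ext)
   fix c y xi
   have "\<i> ^ d * hom_sym d (S j) c y xi = \<i> ^ d * hom_sym d (S' j) c y xi"
    using h[of S, OF S(1), of d c y xi] h[of S', OF S(2), of d c y xi] U[of "j + d"] by simp
   then show "hom_sym d (S j) c y xi = hom_sym d (S' j) c y xi" by simp
  qed
 qed
qed

text \<open>Since \<open>I_hbar\<close> weights degree \<open>a\<close> by the power
  \<open>a\<close> of \<open>i hbar\<close>, the part of degree \<open>a + b - n\<close> in the
  product of components of degrees \<open>a\<close> and \<open>b\<close> must occur with the power
  \<open>n\<close>. The guard excludes \<open>n > a + b\<close>, where truncated subtraction would
  yield degree 0.\<close>

definition star_sum :: "nat => nat => ('m, 'n) symbol => ('m, 'n) symbol => nat => ('m, 'n) symbol" where
 "star_sum k l P R n = (%c y xi. \<Sum>s\<in>{..k} \<times> {..l}. (if n <= fst s + snd s then \<i> ^ n else 0) *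
   hom_sym (fst s + snd s - n) (circ W (hom_sym (fst s) P) (hom_sym (snd s) R)) c y xi)"

lemma Q_hbar:
 assumes P: "P \<in> SY W" and f: "f \<in> dens lam W"
 shows "Q W (I_hbar P m) f = (%c y. \<i> ^ m * Q W (hom_sym m P) f c y)"
 using Q_sum[OF W, of "{()}" "%_. hom_sym m P" f "%_. \<i> ^ m"] symbolsI[OF hom_sym_symbols[OF oW P]] f by (auto simp: I_hbar_eq fun_eq_iff)

lemma star_sum_solves:
 assumes P: "P \<in> SL k W" and R: "R \<in> SL l W"
 shows "star_sum k l P R n \<in> SY W"
  and "f \<in> dens lam W ==> quant_h_series Q W (star_sum k l P R) m f c y = quant_h_comp Q W P R m f c y"
proof -
 let ?T = "{..k} \<times> {..l}"
 define C where "C s = circ W (hom_sym (fst s) P) (hom_sym (snd s) R)" for s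
 have hP: "hom_sym a P \<in> SL a W" for a by (rule hom_sym_mem[OF oW P])
 have hR: "hom_sym a R \<in> SL a W" for a by (rule hom_sym_mem[OF oW R])
 have C: "C s \<in> SL (fst s + snd s) W" for s unfolding C_def by (rule circ_mem[OF W hP hR])
 have hC: "hom_sym d (C s) \<in> SY W" for d s by (rule symbolsI[OF hom_sym_mem[OF oW C]])
 have mem: "star_sum k l P R n \<in> SY W" for n
  unfolding star_sum_def C_def[symmetric] by (rule symbols_sum[OF oW hC])
 then show "star_sum k l P R n \<in> SY W" .
 assume f: "f \<in> dens lam W"
 \<comment> \<open>At total order \<open>m\<close> only pairs of degrees with sum \<open>m\<close>
   survive, and the two powers of \<open>i\<close> combine to \<open>i^m\<close> whatever
   \<open>n\<close> is.\<close>
 have I: "I_hbar (star_sum k l P R n) (m - n) c y xi = (\<Sum>s\<in>?T. (if fst s + snd s = m then \<i> ^ m else 0) * hom_sym (m - n) (C s) c y xi)" if n: "n <= m" for n c y xi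
 proof -
  have "I_hbar (star_sum k l P R n) (m - n) c y xi = (\<Sum>s\<in>?T. (if n <= fst s + snd s then \<i> ^ n else 0) * I_hbar (hom_sym (fst s + snd s - n) (C s)) (m - n) c y xi)"
   unfolding star_sum_def C_def[symmetric] by (subst I_hbar_sum[OF oW _ hC]) auto
  also have "... = (\<Sum>s\<in>?T. (if fst s + snd s = m then \<i> ^ m else 0) * hom_sym (m - n) (C s) c y xi)"
  proof (intro sum.cong refl)
   fix s
   have "\<i> ^ n * (\<i> ^ (m - n) * z) = \<i> ^ m * z" for z using n by (simp add: power_add[symmetric] mult.assoc[symmetric])
   then show "(if n <= fst s + snd s then \<i> ^ n else 0) * I_hbar (hom_sym (fst s + snd s - n) (C s)) (m - n) c y xi =
    (if fst s + snd s = m then \<i> ^ m else 0) * hom_sym (m - n) (C s) c y xi"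
    using n hom_sym_hom[OF oW symbolsI[OF C], of "m - n" "fst s + snd s - n" s c y xi] unfolding I_hbar_eq by auto
  qed
  finally show ?thesis .
 qed
 have rev: "(\<Sum>n\<le>m. hom_sym (m - n) (C s) c y xi) = C s c y xi" if s: "fst s + snd s = m" for s c y xi
 proof -
  have "(\<Sum>n\<le>m. hom_sym (m - n) (C s) c y xi) = (\<Sum>d\<le>m. hom_sym d (C s) c y xi)"
   by (rule sum.reindex_bij_witness[of _ "%n. m - n" "%n. m - n"]) auto
  then show ?thesis using fun_cong[OF fun_cong[OF fun_cong[OF hom_sym_sum[OF C[of s, unfolded s]]]], of c y xi] by simp
 qed
 have U: "(%c y xi. \<Sum>j\<le>m. 1 * I_hbar (star_sum k l P R j) (m - j) c y xi) = (%c y xi. \<Sum>s\<in>?T. (if fst s + snd s = m then \<i> ^ m else 0) * C s c y xi)"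
 proof (intro ext)
  fix c y xi
  have "(\<Sum>j\<le>m. 1 * I_hbar (star_sum k l P R j) (m - j) c y xi) = (\<Sum>j\<le>m. \<Sum>s\<in>?T. (if fst s + snd s = m then \<i> ^ m else 0) * hom_sym (m - j) (C s) c y xi)"
   by (intro sum.cong refl) (simp add: I)
  also have "... = (\<Sum>s\<in>?T. (if fst s + snd s = m then \<i> ^ m else 0) * (\<Sum>j\<le>m. hom_sym (m - j) (C s) c y xi))"
   by (subst sum.swap) (simp only: sum_distrib_left)
  also have "... = (\<Sum>s\<in>?T. (if fst s + snd s = m then \<i> ^ m else 0) * C s c y xi)"
   by (intro sum.cong refl) (use rev in auto)
  finally show "(\<Sum>j\<le>m. 1 * I_hbar (star_sum k l P R j) (m - j) c y xi) = (\<Sum>s\<in>?T. (if fst s + snd s = m then \<i> ^ m else 0) * C s c y xi)" .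
 qed
 define E where "E s = Q W (hom_sym (fst s) P) (Q W (hom_sym (snd s) R) f) c y" for s
 have Q0: "Q W (%c y xi. 0) h = (%c y. 0)" if "h \<in> dens lam W" for h
  using Q_sum[OF W, of "{}" "%_. P" h] that by (auto simp: fun_eq_iff)
 have dR: "Q W (hom_sym b R) f \<in> dens lam W" for b by (rule Q_dens[OF W symbolsI[OF hR] f])
 \<comment> \<open>Components beyond the degrees of \<open>P\<close> and \<open>R\<close> vanish, so
   the sum over the rectangle may be replaced by the sum over the whole antidiagonal.\<close>
 have E0: "E s = 0" if "s \<notin> ?T" for s
 proof (cases "fst s <= k")
  case False
  then show ?thesis using hom_sym_high[OF P, of "fst s"] Q0[OF dR] by (simp add: E_def)
 next
  case True
  then have "snd s > l" using that by (auto simp: mem_Times_iff)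
  then have "E s = Q W (hom_sym (fst s) P) (%c y. 0) c y" using hom_sym_high[OF R, of "snd s"] Q0[OF f] by (simp add: E_def)
  then show ?thesis using Q_sum_arg[OF W symbolsI[OF hP], of "{}" "%_. f"] by simp
 qed
 have "quant_h_series Q W (star_sum k l P R) m f c y = (\<Sum>s\<in>?T. (if fst s + snd s = m then \<i> ^ m else 0) * Q W (C s) f c y)"
  unfolding series_Q[of "star_sum k l P R", OF mem f] U by (rule Q_sum[OF W symbolsI[OF C] f])
 also have "... = (\<Sum>s\<in>?T. (if fst s + snd s = m then \<i> ^ m * E s else 0))"
  unfolding C_def Q_circ[OF W hP hR f] E_def by (intro sum.cong refl) simp
 also have "... = (\<Sum>s\<in>{s. fst s + snd s = m}. \<i> ^ m * E s)"
 proof -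
  have fin: "finite {s :: nat \<times> nat. fst s + snd s = m}" by (rule finite_subset[of _ "{..m} \<times> {..m}"]) auto
  have "(\<Sum>s\<in>?T. (if fst s + snd s = m then \<i> ^ m * E s else 0)) = (\<Sum>s\<in>?T \<inter> {s. fst s + snd s = m}. \<i> ^ m * E s)"
   by (subst sum.inter_restrict) auto
  also have "... = (\<Sum>s\<in>{s. fst s + snd s = m}. \<i> ^ m * E s)"
   by (rule sum.mono_neutral_left[OF fin]) (auto simp del: mem_Times_iff intro: E0)
  finally show ?thesis .
 qed
 also have "... = (\<Sum>j\<le>m. \<i> ^ m * E (j, m - j))"
  by (rule sum.reindex_bij_witness[of _ "%j. (j, m - j)" fst]) auto
 also have "... = quant_h_comp Q W P R m f c y"
  unfolding quant_h_comp_def quant_h_def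
 proof (intro sum.cong refl)
  fix j assume j: "j \<in> {..m}"
  have "Q W (I_hbar P j) (Q W (I_hbar R (m - j)) f) c y = \<i> ^ j * Q W (hom_sym j P) (Q W (I_hbar R (m - j)) f) c y"
   by (simp add: Q_hbar[OF symbolsI[OF P] Q_dens[OF W symbolsI[OF I_hbar_mem[OF oW symbolsI[OF R]]] f]])
  also have "Q W (hom_sym j P) (Q W (I_hbar R (m - j)) f) c y = \<i> ^ (m - j) * E (j, m - j)"
   unfolding Q_hbar[OF symbolsI[OF R] f] E_def using Q_linear_arg[OF W symbolsI[OF hP] dR dR, where a="\<i> ^ (m - j)" and b=0] by simp
  finally show "\<i> ^ m * E (j, m - j) = Q W (I_hbar P j) (Q W (I_hbar R (m - j)) f) c y"
   using j by (simp add: mult.assoc[symmetric] power_add[symmetric])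
 qed
 finally show "quant_h_series Q W (star_sum k l P R) m f c y = quant_h_comp Q W P R m f c y" .
qed

lemma star_eqI:
 assumes S: "!!m. S m \<in> SY W"
  and eq: "!!m f c y. f \<in> dens lam W ==> quant_h_series Q W S m f c y = quant_h_comp Q W P R m f c y"
 shows "star W P R = S"
 unfolding quant_product_def
proof (rule the_equality)
 show "(\<forall>m. S m \<in> SY W) \<and> (\<forall>m. \<forall>f\<in>dens lam W. quant_h_series Q W S m f = quant_h_comp Q W P R m f)"
  by (simp add: fun_eq_iff S eq)
 fix S' assume S': "(\<forall>m. S' m \<in> SY W) \<and> (\<forall>m. \<forall>f\<in>dens lam W. quant_h_series Q W S' m f = quant_h_comp Q W P R m f)"
 show "S' = S" by (rule series_inject) (use S S' eq in auto)
qed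

lemma star_formula: "P \<in> SL k W ==> R \<in> SL l W ==> star W P R = star_sum k l P R"
 by (rule star_eqI star_sum_solves | assumption)+

lemma star:
 assumes "P \<in> SY W" "R \<in> SY W"
 shows star_mem: "star W P R m \<in> SY W"
  and star_series: "f \<in> dens lam W ==> quant_h_series Q W (star W P R) m f c y = quant_h_comp Q W P R m f c y"
proof -
 obtain k where k: "P \<in> SL k W" using assms(1) by (rule symbolsE)
 obtain l where l: "R \<in> SL l W" using assms(2) by (rule symbolsE)
 note kl = k l
 show "star W P R m \<in> SY W" and "f \<in> dens lam W ==> quant_h_series Q W (star W P R) m f c y = quant_h_comp Q W P R m f c y"
  unfolding star_formula[OF kl] by (rule star_sum_solves[OF kl])+
qed

lemma series_sum:
 assumes T: "finite T" and S: "!!s j. s \<in> T ==> S s j \<in> SY W" and f: "f \<in> dens lam W"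
 shows "quant_h_series Q W (%j c y xi. \<Sum>s\<in>T. a s * S s j c y xi) m f c y = (\<Sum>s\<in>T. a s * quant_h_series Q W (S s) m f c y)"
proof -
 have "quant_h Q W (%c y xi. \<Sum>s\<in>T. a s * S s j c y xi) i f c y = (\<Sum>s\<in>T. a s * quant_h Q W (S s j) i f c y)" for j i
 proof -
  have h: "I_hbar (%c y xi. \<Sum>s\<in>T. a s * S s j c y xi) i = (%c y xi. \<Sum>s\<in>T. a s * I_hbar (S s j) i c y xi)"
   by (rule I_hbar_sum[OF oW T S])
  show ?thesis unfolding quant_h_def h by (rule Q_sum[OF W symbolsI[OF I_hbar_mem[OF oW S]] f])
 qed
 then show ?thesis
  unfolding quant_h_series_def sum_distrib_left by (subst sum.swap) simp
qed

lemma series_linear: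
 assumes "!!j. S j \<in> SY W" "!!j. S' j \<in> SY W" and f: "f \<in> dens lam W"
 shows "quant_h_series Q W (%j c y xi. a * S j c y xi + b * S' j c y xi) m f c y = a * quant_h_series Q W S m f c y + b * quant_h_series Q W S' m f c y"
 using series_sum[of "{True, False}" "%s. if s then S else S'" f "%s. if s then a else b" m c y] assms by simp

lemma quant_h_dens: "P \<in> SY W ==> f \<in> dens lam W ==> quant_h Q W P m f \<in> dens lam W"
 unfolding quant_h_def by (intro Q_dens[OF W] symbolsI[OF I_hbar_mem[OF oW]])

lemma quant_h_linear:
 assumes "P \<in> SY W" "R \<in> SY W" "f \<in> dens lam W"
 shows "quant_h Q W (%c y xi. a * P c y xi + b * R c y xi) m f = (%c y. a * quant_h Q W P m f c y + b * quant_h Q W R m f c y)"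
 unfolding quant_h_def I_hbar_linear[OF oW assms(1,2)]
 by (intro ext Q_linear[OF W] symbolsI[OF I_hbar_mem[OF oW]] assms)

lemma star_linear:
 assumes P: "P \<in> SY W" and R: "R \<in> SY W" and T: "T \<in> SY W"
 shows "star W (%c y xi. a * P c y xi + b * R c y xi) T = (%m c y xi. a * star W P T m c y xi + b * star W R T m c y xi)"
  and "star W T (%c y xi. a * P c y xi + b * R c y xi) = (%m c y xi. a * star W T P m c y xi + b * star W T R m c y xi)"
proof -
 note l = symbols_linear[OF oW]
 show "star W (%c y xi. a * P c y xi + b * R c y xi) T = (%m c y xi. a * star W P T m c y xi + b * star W R T m c y xi)"
 proof (rule star_eqI)
  show "(%c y xi. a * star W P T m c y xi + b * star W R T m c y xi) \<in> SY W" for m by (intro l star_mem P R T)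
  fix m f c y assume f: "f \<in> dens lam W"
  have "quant_h_comp Q W (%c y xi. a * P c y xi + b * R c y xi) T m f c y = a * quant_h_comp Q W P T m f c y + b * quant_h_comp Q W R T m f c y"
   unfolding quant_h_comp_def quant_h_linear[OF P R quant_h_dens[OF T f]] by (simp add: sum.distrib sum_distrib_left)
  then show "quant_h_series Q W (%m c y xi. a * star W P T m c y xi + b * star W R T m c y xi) m f c y =
   quant_h_comp Q W (%c y xi. a * P c y xi + b * R c y xi) T m f c y"
   using series_linear[of "star W P T" "star W R T" f a b m c y, OF star_mem[OF P T] star_mem[OF R T] f] star_series[OF P T f] star_series[OF R T f] by simp
 qed
 show "star W T (%c y xi. a * P c y xi + b * R c y xi) = (%m c y xi. a * star W T P m c y xi + b * star W T R m c y xi)"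
 proof (rule star_eqI)
  show "(%c y xi. a * star W T P m c y xi + b * star W T R m c y xi) \<in> SY W" for m by (intro l star_mem P R T)
  fix m f c y assume f: "f \<in> dens lam W"
  have "quant_h Q W T j (%c y. a * quant_h Q W P i f c y + b * quant_h Q W R i f c y) c y = a * quant_h Q W T j (quant_h Q W P i f) c y + b * quant_h Q W T j (quant_h Q W R i f) c y" for i j
   unfolding quant_h_def[of Q W T] by (intro Q_linear_arg[OF W] symbolsI[OF I_hbar_mem[OF oW T]] quant_h_dens P R f)
  then have "quant_h_comp Q W T (%c y xi. a * P c y xi + b * R c y xi) m f c y = a * quant_h_comp Q W T P m f c y + b * quant_h_comp Q W T R m f c y"
   unfolding quant_h_comp_def quant_h_linear[OF P R f] by (simp add: sum.distrib sum_distrib_left)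
  then show "quant_h_series Q W (%m c y xi. a * star W T P m c y xi + b * star W T R m c y xi) m f c y =
   quant_h_comp Q W T (%c y xi. a * P c y xi + b * R c y xi) m f c y"
   using series_linear[of "star W T P" "star W T R" f a b m c y, OF star_mem[OF T P] star_mem[OF T R] f] star_series[OF T P f] star_series[OF T R f] by simp
 qed
qed

text \<open>Both sides quantize to the triple composition of operators, whose contributions are
  \<open>H a b d\<close>; what remains is reindexing over exponents with sum \<open>m\<close>, and
  \<open>series_inject\<close> concludes.\<close>

lemma star_assoc:
 assumes P: "P \<in> SY W" and R: "R \<in> SY W" and T: "T \<in> SY W"
 shows "(\<Sum>j\<le>m. star W (star W P R j) T (m - j) c y xi) = (\<Sum>j\<le>m. star W P (star W R T j) (m - j) c y xi)"
proof -
 let ?F = "%m c y xi. \<Sum>j\<le>m. 1 * star W (star W P R j) T (m - j) c y xi"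
 let ?G = "%m c y xi. \<Sum>j\<le>m. 1 * star W P (star W R T j) (m - j) c y xi"
 have m1: "star W (star W P R j) T i \<in> SY W" for i j by (intro star_mem P R T)
 have m2: "star W P (star W R T j) i \<in> SY W" for i j by (intro star_mem P R T)
 have ser: "quant_h_series Q W (%m c y xi. \<Sum>j\<le>m. 1 * S j (m - j) c y xi) m f c y = (\<Sum>j\<le>m. quant_h_series Q W (S j) (m - j) f c y)"
  if S: "!!i j. S i j \<in> SY W" and f: "f \<in> dens lam W" for S m f c y
 proof -
  have "quant_h Q W (%c y xi. \<Sum>j\<le>a. 1 * S j (a - j) c y xi) (m - a) f c y = (\<Sum>j\<le>a. quant_h Q W (S j (a - j)) (m - j - (a - j)) f c y)" for a
  proof -
   have "quant_h Q W (%c y xi. \<Sum>j\<le>a. 1 * S j (a - j) c y xi) (m - a) f c y = (\<Sum>j\<le>a. 1 * quant_h Q W (S j (a - j)) (m - a) f c y)"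
    unfolding quant_h_def I_hbar_sum[OF oW finite_atMost S] by (rule Q_sum[OF W symbolsI[OF I_hbar_mem[OF oW S]] f])
   also have "... = (\<Sum>j\<le>a. quant_h Q W (S j (a - j)) (m - j - (a - j)) f c y)"
    by (intro sum.cong refl) simp
   finally show ?thesis .
  qed
  then show ?thesis
   unfolding quant_h_series_def using sum_triangle[of "%j b. quant_h Q W (S j b) (m - j - b) f c y" m] by simp
 qed
 have "?F = ?G"
 proof (rule series_inject)
  show "?F j \<in> SY W" for j by (rule symbols_sum[OF oW m1])
  show "?G j \<in> SY W" for j by (rule symbols_sum[OF oW m2])
  fix m f c y assume f: "f \<in> dens lam W"
  define H where "H a b d = quant_h Q W P a (quant_h Q W R b (quant_h Q W T d f)) c y" for a b d
  have fT: "quant_h Q W T d f \<in> dens lam W" for d by (rule quant_h_dens[OF T f])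
  have "quant_h_series Q W ?F m f c y = (\<Sum>j\<le>m. quant_h_comp Q W (star W P R j) T (m - j) f c y)"
   unfolding ser[of "%j i. star W (star W P R j) T i", OF m1 f] by (intro sum.cong refl star_series[OF star_mem[OF P R] T f])
  also have "... = (\<Sum>n\<le>m. \<Sum>j\<le>n. quant_h Q W (star W P R j) (n - j) (quant_h Q W T (m - j - (n - j)) f) c y)"
   unfolding quant_h_comp_def sum_triangle[of "%j s. quant_h Q W (star W P R j) s (quant_h Q W T (m - j - s) f) c y" m] ..
  also have "... = (\<Sum>n\<le>m. quant_h_series Q W (star W P R) n (quant_h Q W T (m - n) f) c y)"
   unfolding quant_h_series_def by (intro sum.cong refl) (simp add: le_diff_conv)
  also have "... = (\<Sum>n\<le>m. \<Sum>j\<le>n. H j (n - j) (m - n))"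
   by (intro sum.cong refl) (simp only: star_series[OF P R fT] quant_h_comp_def H_def)
  finally have A: "quant_h_series Q W ?F m f c y = (\<Sum>n\<le>m. \<Sum>j\<le>n. H j (n - j) (m - n))" .
  have "quant_h_series Q W ?G m f c y = (\<Sum>j\<le>m. quant_h_comp Q W P (star W R T j) (m - j) f c y)"
   unfolding ser[of "%j i. star W P (star W R T j) i", OF m2 f] by (intro sum.cong refl star_series[OF P star_mem[OF R T] f])
  also have "... = (\<Sum>j\<le>m. \<Sum>s\<le>m - j. quant_h Q W P s (quant_h Q W (star W R T j) (m - s - j) f) c y)"
   unfolding quant_h_comp_def by (intro sum.cong refl) (simp only: diff_commute)
  also have "... = (\<Sum>s\<le>m. \<Sum>j\<le>m - s. quant_h Q W P s (quant_h Q W (star W R T j) (m - s - j) f) c y)"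
   by (rule sum_swap_triangle[of "%s j. quant_h Q W P s (quant_h Q W (star W R T j) (m - s - j) f) c y" m])
  also have "... = (\<Sum>s\<le>m. \<Sum>t\<le>m - s. H s t (m - s - t))"
  proof (rule sum.cong[OF refl])
   fix s
   have "(%c y. \<Sum>j\<le>m - s. quant_h Q W (star W R T j) (m - s - j) f c y) = (%c y. \<Sum>t\<le>m - s. quant_h Q W R t (quant_h Q W T (m - s - t) f) c y)"
    using star_series[OF R T f, of "m - s"] unfolding quant_h_series_def quant_h_comp_def by (auto simp: fun_eq_iff)
   then have e: "quant_h Q W P s (%c y. \<Sum>j\<le>m - s. quant_h Q W (star W R T j) (m - s - j) f c y) c y = quant_h Q W P s (%c y. \<Sum>t\<le>m - s. quant_h Q W R t (quant_h Q W T (m - s - t) f) c y) c y"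
    by simp
   have l: "quant_h Q W P s (%c y. \<Sum>j\<le>m - s. h j c y) c y = (\<Sum>j\<le>m - s. quant_h Q W P s (h j) c y)" if "!!j. h j \<in> dens lam W" for h
    unfolding quant_h_def by (rule Q_sum_arg[OF W symbolsI[OF I_hbar_mem[OF oW P]] that])
   have "(\<Sum>j\<le>m - s. quant_h Q W P s (quant_h Q W (star W R T j) (m - s - j) f) c y) = quant_h Q W P s (%c y. \<Sum>j\<le>m - s. quant_h Q W (star W R T j) (m - s - j) f c y) c y"
    by (rule l[symmetric]) (rule quant_h_dens[OF star_mem[OF R T] f])
   also note e
   also have "quant_h Q W P s (%c y. \<Sum>t\<le>m - s. quant_h Q W R t (quant_h Q W T (m - s - t) f) c y) c y = (\<Sum>t\<le>m - s. quant_h Q W P s (quant_h Q W R t (quant_h Q W T (m - s - t) f)) c y)"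
    by (rule l) (rule quant_h_dens[OF R fT])
   finally show "(\<Sum>j\<le>m - s. quant_h Q W P s (quant_h Q W (star W R T j) (m - s - j) f) c y) = (\<Sum>t\<le>m - s. H s t (m - s - t))"
    unfolding H_def .
  qed
  also have "... = (\<Sum>n\<le>m. \<Sum>j\<le>n. H j (n - j) (m - j - (n - j)))"
   by (rule sum_triangle[of "%j s. H j s (m - j - s)" m, symmetric])
  also have "... = (\<Sum>n\<le>m. \<Sum>j\<le>n. H j (n - j) (m - n))"
   by (intro sum.cong refl) simp
  finally show "quant_h_series Q W ?F m f c y = quant_h_series Q W ?G m f c y" using A by simp
 qed
 from fun_cong[OF fun_cong[OF fun_cong[OF fun_cong[OF this]]], of m c y xi] show ?thesis by simp
qed

end

end

section \<open>Lowest orders of the product\<close>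

lemma sharp_cong:
 assumes S: "open S" "y \<in> S" and a: "!!xi. a y xi = a' y xi" and b: "!!z xi. z \<in> S ==> b z xi = b' z xi"
 shows "sharp k a b y xi = sharp k a' b' y xi"
proof -
 have "a y = a' y" by (rule ext) (rule a)
 then have "fibre_coeff I a y = fibre_coeff I a' y" for I by (simp add: fibre_coeff_def)
 moreover have "tsyms I b y xi = tsyms I b' y xi" for I by (rule tsyms_cong[OF S(1) _ S(2)]) (rule b)
 ultimately show ?thesis unfolding sharp_def by (simp only:)
qed

lemma LS_lie_eq:
 assumes S: "open Om" and X0: "smooth_field X" and p: "p \<in> LS (deg_eq k) Om"
 shows "lie_symbol X p \<in> LS (deg_eq k) Om"
proof -
 have X: "smooth_on Om (%x. X x $ j)" for j using X0 smooth_on_subset[of UNIV] by blast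
 let ?L = "{J :: 'a list. Suc (length J) = k}"
 have fin: "finite ?L" by (rule finite_subset[OF _ finite_length_le[of k]]) auto
 have L: "(%y xi. cor (xi $ j) * pd i (p y) xi) \<in> LS (deg_eq k) Om" for i j
 proof (rule LS_coord_mult[OF S finite_length_eq])
  show "(%y xi. pd i (p y) xi) \<in> LS ?L Om"
   by (rule LS_pd_fibre[OF S fin _ p]) (auto simp: length_del_nth)
 qed auto
 have "lie_symbol X p = (%y xi. (\<Sum>i\<in>UNIV. cor (X y $ i) * pd i (%z. p z xi) y) -
   (\<Sum>i\<in>UNIV. \<Sum>j\<in>UNIV. cor (pd i (%x. X x $ j) y) * (cor (xi $ j) * pd i (p y) xi)))"
  by (auto simp: lie_symbol_def[abs_def] smooth_field_pd[OF X0] mult.assoc)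
 then show ?thesis
  by (simp add: LS_diff LS_sum LS_scale smooth_on_of_real X smooth_on_pd
    LS_pd S p L)
qed

lemma hom_part_mult:
 assumes S: "open Om" and p: "p \<in> LS (deg_eq a) Om" and q: "q \<in> LS (deg_le m) Om" and y: "y \<in> Om"
 shows "hom_part (a + e) (%y xi. p y xi * q y xi) y xi = p y xi * hom_part e q y xi"
proof -
 have h: "(%y xi. p y xi * hom_part d q y xi) \<in> LS (deg_eq (a + d)) Om" for d
  by (rule LS_mult[OF S finite_length_eq _ p LS_hom_part[OF S q]]) auto
 have "hom_part (a + e) (%y xi. p y xi * q y xi) y xi = hom_part (a + e) (%y xi. \<Sum>d\<le>m. p y xi * hom_part d q y xi) y xi"
  by (rule hom_part_cong) (simp add: hom_part_sum[OF q y] sum_distrib_left)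
 also have "... = (\<Sum>d\<le>m. hom_part (a + e) (%y xi. p y xi * hom_part d q y xi) y xi)"
  by (rule hom_part_setsum[OF S finite_atMost h y])
 also have "... = (\<Sum>d\<le>m. if d = e then p y xi * hom_part d q y xi else 0)"
 proof (intro sum.cong refl)
  fix d
  show "hom_part (a + e) (%y xi. p y xi * hom_part d q y xi) y xi = (if d = e then p y xi * hom_part d q y xi else 0)"
  proof (cases "d = e")
   case True
   then show ?thesis using hom_part_hom[OF h[of e] y] by simp
  next
   case False
   then show ?thesis using hom_part_eq_0[OF h[of d] finite_length_eq y, of "a + e"] by auto
  qed
 qed
 also have "... = p y xi * hom_part e q y xi"
  using hom_part_eq_0[OF q finite_length_le y, of e] by (cases "e <= m") auto
 finally show ?thesis .
qed

definition div_grad :: "'n::finite lsymbol => 'n lsymbol" where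
 "div_grad p y xi = (\<Sum>i\<in>UNIV. pd i (%xi. pd i (%z. p z xi) y) xi)"

text \<open>\<open>div_grad\<close> takes one derivative in \<open>y\<close> and one in
  \<open>xi\<close>, so on a product it leaves two cross terms. These are the part of the bracket
  that carries the factor \<open>lam\<close>.\<close>

lemma div_grad_mult:
 assumes S: "open Om" "y \<in> Om" and p: "p \<in> LS L Om" and r: "r \<in> LS L' Om"
 shows "div_grad (%y xi. p y xi * r y xi) y xi = p y xi * div_grad r y xi + r y xi * div_grad p y xi + gradprod p r y xi + gradprod r p y xi"
proof -
 have d: "(%z. q z eta) differentiable (at y)" "q y differentiable (at eta)" if "q \<in> LS M Om" for q eta and M :: "'a list set"
  using smooth_on_differentiable[OF LS_smooth(1)[OF S(1) that] S(2)]
   smooth_on_differentiable[OF LS_smooth(2)[OF S(1) that S(2)] UNIV_I] by auto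
 note dp = d[OF p] d(2)[OF LS_pd[OF S(1) p]] and dr = d[OF r] d(2)[OF LS_pd[OF S(1) r]]
 have "pd i (%xi. pd i (%z. p z xi * r z xi) y) xi = (pd i (%xi. pd i (%z. p z xi) y) xi * r y xi + pd i (%z. p z xi) y * pd i (r y) xi)
   + (pd i (p y) xi * pd i (%z. r z xi) y + p y xi * pd i (%xi. pd i (%z. r z xi) y) xi)" for i
 proof -
  have "(%xi. pd i (%z. p z xi * r z xi) y) = (%xi. pd i (%z. p z xi) y * r y xi + p y xi * pd i (%z. r z xi) y)"
   using dp(1) dr(1) by (auto simp: pd_mult)
  then show ?thesis
   using dp(2,3) dr(2,3) by (simp only: pd_add[OF differentiable_mult[OF dp(3) dr(2)] differentiable_mult[OF dp(2) dr(3)]] pd_mult)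
 qed
 then show ?thesis
  unfolding div_grad_def gradprod_def by (simp add: sum.distrib sum_distrib_left algebra_simps)
qed

lemma LS_gradprod:
 assumes S: "open Om" and a: "a \<in> LS L Om" and b: "b \<in> LS L' Om" and fin: "finite L''" "finite L"
  and sub: "!!I J. I \<in> L ==> J \<in> L' ==> \<forall>K. Suc (length K) = length I + length J \<longrightarrow> K \<in> L''"
 shows "gradprod a b \<in> LS L'' Om"
proof -
 let ?D = "{K. \<exists>I\<in>L. \<exists>t<length I. K = del_nth t I}"
 have "?D \<subseteq> (\<Union>I\<in>L. (%t. del_nth t I) ` {..<length I})" by auto
 then have fD: "finite ?D" by (rule finite_subset) (use fin in auto)
 have "(%y xi. pd i (a y) xi) \<in> LS ?D Om" for i
  by (rule LS_pd_fibre[OF S fD _ a]) auto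
 then have "(%y xi. pd i (a y) xi * pd i (%z. b z xi) y) \<in> LS L'' Om" for i
 proof (rule LS_mult[OF S fin(1), rotated])
  show "(%y xi. pd i (%z. b z xi) y) \<in> LS L' Om" by (rule LS_pd[OF S b])
  fix I J assume "I \<in> ?D" "J \<in> L'"
  then obtain K t where K: "K \<in> L" "t < length K" "I = del_nth t K" by blast
  then have "Suc (length (I @ J)) = length K + length J" using length_del_nth[OF K(2)] by simp
  then show "I @ J \<in> L''" using sub[OF K(1) \<open>J \<in> L'\<close>] by blast
 qed
 then show ?thesis unfolding gradprod_def[abs_def] by (intro LS_sum S)
qed

lemma gradprod_sum:
 assumes "finite T" and "!!s. s \<in> T ==> p s y differentiable (at xi)" "!!s. s \<in> T ==> (%z. p s z xi) differentiable (at y)"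
 shows "gradprod (%y xi. \<Sum>s\<in>T. p s y xi) q y xi = (\<Sum>s\<in>T. gradprod (p s) q y xi)"
  and "gradprod q (%y xi. \<Sum>s\<in>T. p s y xi) y xi = (\<Sum>s\<in>T. gradprod q (p s) y xi)"
 unfolding gradprod_def using assms
 by (simp_all add: pd_sum sum_distrib_left sum_distrib_right) (rule sum.swap)+

context quantization
begin

text \<open>Compare homogeneous parts of both sides of \<open>eq\<close>. In degree \<open>K\<close>
  the left side is the part of \<open>t\<close> plus \<open>lam\<close> times
  \<open>div_grad\<close> of \<open>p r\<close>; the right side is \<open>gradprod p r\<close> plus
  the corrections of the factors. All terms with \<open>div_grad\<close> of a single factor
  cancel.\<close>

lemma quantum_product_parts:
 fixes p r t :: "'n lsymbol"
 assumes c: "c \<in> \<A>" and p: "p \<in> LS (deg_eq a) (img c)" and r: "r \<in> LS (deg_eq b) (img c)"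
  and t: "t \<in> LS (deg_le (a + b)) (img c)"
  and eq: "!!y xi. y \<in> img c ==> lq c t y xi = sharp a (lq c p) (lq c r) y xi"
  and y: "y \<in> img c"
 shows "hom_part (a + b) t y xi = p y xi * r y xi"
  and "a + b = Suc K ==> lam = 1 / 2 \<or> K = 0 ==> hom_part K t y xi = (1 - lam) * gradprod p r y xi - lam * gradprod r p y xi"
proof -
 let ?Om = "img c"
 note o = open_image[OF c]
 note p' = deg_eq_le[OF o p order_refl] and r' = deg_eq_le[OF o r order_refl]
 define A where "A y xi = lq c p y xi - p y xi" for y xi
 define B where "B y xi = lq c r y xi - r y xi" for y xi
 have A: "A \<in> LS (deg_less a) ?Om" using lq_local(2)[OF c p'] by (simp add: A_def[abs_def])
 have B: "B \<in> LS (deg_less b) ?Om" using lq_local(2)[OF c r'] by (simp add: B_def[abs_def])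
 have lA: "lq c p = (%y xi. p y xi + A y xi)" and lB: "lq c r = (%y xi. r y xi + B y xi)" by (auto simp: A_def B_def)
 obtain s where s: "s \<in> LS {J. length J + 2 <= a + b} ?Om"
  and sh: "!!y xi. y \<in> ?Om ==> sharp a (lq c p) (lq c r) y xi = lq c p y xi * lq c r y xi + gradprod (lq c p) (lq c r) y xi + s y xi"
  using sharp_expand[OF o lq_local(1)[OF c p'] lq_local(1)[OF c r']] by blast
 let ?R = "{J :: 'n list. length J + 2 <= a + b}"
 have fR: "finite ?R" by (rule finite_subset[OF _ finite_length_le[of "a + b"]]) auto
 have dif: "(%z. q z eta) differentiable (at z)" "q z differentiable (at eta)" if "q \<in> LS M ?Om" "z \<in> ?Om" for q eta z and M :: "'n list set"
  using smooth_on_differentiable[OF LS_smooth(1)[OF o that(1)] that(2)]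
   smooth_on_differentiable[OF LS_smooth(2)[OF o that] UNIV_I] by auto
 \<comment> \<open>Everything of degree at most \<open>a + b - 2\<close>: the corrections
   \<open>A\<close> and \<open>B\<close> lower the degree, and so does every
   \<open>gradprod\<close>.\<close>
 define \<rho> where "\<rho> y xi = A y xi * B y xi + gradprod p B y xi + gradprod A r y xi + gradprod A B y xi + s y xi" for y xi
 have \<rho>: "\<rho> \<in> LS ?R ?Om"
 proof -
  have 1: "(%y xi. A y xi * B y xi) \<in> LS ?R ?Om" by (rule LS_mult[OF o fR _ A B]) auto
  have 2: "gradprod p B \<in> LS ?R ?Om" by (rule LS_gradprod[OF o p B fR finite_length_eq]) auto
  have 3: "gradprod A r \<in> LS ?R ?Om" by (rule LS_gradprod[OF o A r fR finite_length_less]) auto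
  have 4: "gradprod A B \<in> LS ?R ?Om" by (rule LS_gradprod[OF o A B fR finite_length_less]) auto
  show ?thesis unfolding \<rho>_def by (intro LS_add o 1 2 3 4 s)
 qed
 let ?pr = "%y xi. p y xi * r y xi" and ?pB = "%y xi. p y xi * B y xi" and ?rA = "%y xi. r y xi * A y xi" and ?G = "gradprod p r"
 have lt: "lq c t y xi = ?pr y xi + ((?pB y xi + ?rA y xi) + (?G y xi + \<rho> y xi))" if y: "y \<in> ?Om" for y xi
 proof -
  have "gradprod (%y xi. p y xi + A y xi) (%y xi. r y xi + B y xi) y xi = gradprod p r y xi + gradprod p B y xi + gradprod A r y xi + gradprod A B y xi"
   unfolding gradprod_def using dif[OF p y] dif[OF A y] dif[OF r y] dif[OF B y]
   by (simp add: pd_add sum.distrib distrib_left distrib_right)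
  then show ?thesis unfolding eq[OF y] sh[OF y] unfolding lA lB \<rho>_def by (simp add: algebra_simps)
 qed
 have pr: "?pr \<in> LS (deg_eq (a + b)) ?Om" by (rule LS_mult[OF o finite_length_eq _ p r]) auto
 have pB: "?pB \<in> LS (deg_less (a + b)) ?Om" by (rule LS_mult[OF o finite_length_less _ p B]) auto
 have rA: "?rA \<in> LS (deg_less (a + b)) ?Om" by (rule LS_mult[OF o finite_length_less _ r A]) auto
 have G: "?G \<in> LS (deg_less (a + b)) ?Om" by (rule LS_gradprod[OF o p r finite_length_less finite_length_eq]) auto
 have \<rho>': "\<rho> \<in> LS (deg_less (a + b)) ?Om" by (rule LS_mono[OF o finite_length_less _ \<rho>]) auto
 have add: "hom_part d (%y xi. u y xi + v y xi) y xi = hom_part d u y xi + hom_part d v y xi"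
  if "u \<in> LS L ?Om" "v \<in> LS L' ?Om" "y \<in> ?Om" for u v d y xi and L L' :: "'n list set"
  using hom_part_linear[OF o that, of d 1 1 xi] by simp
 note D1 = LS_add[OF o pB rA] and D2 = LS_add[OF o G \<rho>']
 have hq_split: "hq c y d t xi = hom_part d ?pr y xi + ((hom_part d ?pB y xi + hom_part d ?rA y xi) + (hom_part d ?G y xi + hom_part d \<rho> y xi))" if y: "y \<in> ?Om" for d y xi
 proof -
  have "hq c y d t xi = hom_part d (%y xi. ?pr y xi + ((?pB y xi + ?rA y xi) + (?G y xi + \<rho> y xi))) y xi"
   unfolding hq_def by (rule hom_part_cong) (rule lt[OF y])
  also have "... = hom_part d ?pr y xi + ((hom_part d ?pB y xi + hom_part d ?rA y xi) + (hom_part d ?G y xi + hom_part d \<rho> y xi))"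
   by (simp only: add[OF pr LS_add[OF o D1 D2] y] add[OF D1 D2 y] add[OF pB rA y] add[OF G \<rho>' y])
  finally show ?thesis .
 qed
 have ht: "hom_part d t \<in> LS (deg_eq d) ?Om" for d by (rule LS_hom_part[OF o t])
 have ht': "hom_part d t \<in> LS (deg_le (a + b)) ?Om" if "d \<in> {..a + b}" for d by (rule deg_eq_le[OF o ht]) (use that in simp)
 have parts: "hq c y e t xi = (\<Sum>d\<le>a + b. hq c y e (hom_part d t) xi)" if y: "y \<in> ?Om" for e y xi
 proof -
  have "hq c y e t = hq c y e (%y xi. \<Sum>d\<in>{..a + b}. 1 * hom_part d t y xi)"
   by (rule hq_cong[OF c y]) (simp add: hom_part_sum[OF t])
  then have "hq c y e t xi = hq c y e (%y xi. \<Sum>d\<in>{..a + b}. 1 * hom_part d t y xi) xi" by (rule fun_cong)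
  also have "... = (\<Sum>d\<in>{..a + b}. 1 * hq c y e (hom_part d t) xi)"
   by (rule hq_sum[OF c y finite_atMost ht'])
  finally show ?thesis by simp
 qed
 have low: "hq c y e (hom_part d t) xi = 0" if "d < e" "y \<in> ?Om" for d e y xi
  unfolding hq_def by (rule hom_part_eq_0[OF lq_local(1)[OF c deg_eq_le[OF o ht order_refl]] finite_length_le that(2)]) (use that in auto)
 have top: "hom_part (a + b) t y xi = p y xi * r y xi" if y: "y \<in> ?Om" for y xi
 proof -
  have "hq c y (a + b) t xi = (\<Sum>d\<le>a + b. if d = a + b then hom_part (a + b) t y xi else 0)"
   unfolding parts[OF y] by (intro sum.cong refl) (auto simp: low y hq_top[OF c y ht])
  moreover have "hom_part (a + b) u y xi = 0" if "u \<in> LS (deg_less (a + b)) ?Om" for u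
   by (rule hom_part_eq_0[OF that finite_length_less y]) auto
  ultimately show ?thesis using hq_split[OF y, of "a + b" xi] pB rA G \<rho>' hom_part_hom[OF pr y, of xi] by simp
 qed
 then show "hom_part (a + b) t y xi = p y xi * r y xi" using y by simp
 assume K: "a + b = Suc K" and half: "lam = 1 / 2 \<or> K = 0"
 \<comment> \<open>For \<open>K = 0\<close> the bound \<open>e <= K\<close> leaves only
   \<open>e = 0\<close>, where \<open>hq_first_order\<close> holds for every weight.\<close>
 have dg: "hom_part e (%y xi. lq c q y xi - q y xi) y xi = lam * div_grad q y xi" if q: "q \<in> LS (deg_eq (Suc e)) ?Om" and e: "e <= K" for q e
 proof -
  note q' = deg_eq_le[OF o q order_refl]
  have "hom_part e (%y xi. lq c q y xi - q y xi) y xi = hom_part e (lq c q) y xi - hom_part e q y xi"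
   using hom_part_linear[OF o lq_local(1)[OF c q'] q y, of e 1 "-1" xi] by simp
  also have "hom_part e q y xi = 0" by (rule hom_part_eq_0[OF q finite_length_eq y]) auto
  also have "hom_part e (lq c q) y xi = lam * div_grad q y xi"
   using hq_first_order[OF c y q, of xi] half e unfolding hq_def div_grad_def by auto
  finally show ?thesis by simp
 qed
 have mixed_part: "hom_part K (%y xi. u y xi * (lq c v y xi - v y xi)) y xi = u y xi * (lam * div_grad v y xi)"
  if u: "u \<in> LS (deg_eq m) ?Om" and v: "v \<in> LS (deg_eq n) ?Om" and mn: "m + n = Suc K" for u v m n
 \<comment> \<open>A symbol of degree 0 is quantized without correction and both sides vanish.
   Otherwise the correction has top degree \<open>n - 1\<close>, which alone reaches degree
   \<open>K\<close> after multiplication by \<open>u\<close>.\<close>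
 proof (cases n)
  case 0
  have v0: "v \<in> LS (deg_eq 0) ?Om" using v 0 by simp
  have "(%y xi. lq c v y xi - v y xi) \<in> LS (deg_less 0) ?Om" by (rule lq_local(2)[OF c deg_eq_le[OF o v0 order_refl]])
  then have z: "lq c v y eta - v y eta = 0" for eta using y by (auto simp: local_symbols_def)
  have "(%xi. pd i (%z. v z xi) y) \<in> homp 0" for i by (rule homp_local[OF LS_pd[OF o v0] y])
  then have "div_grad v y xi = 0" unfolding div_grad_def by (simp add: homp_pd_0)
  moreover have "hom_part K (%y xi. u y xi * (lq c v y xi - v y xi)) y xi = 0" by (rule hom_part_zero) (simp only: z mult_zero_right)
  ultimately show ?thesis by simp
 next
  case (Suc e)
  have vS: "v \<in> LS (deg_eq (Suc e)) ?Om" using v Suc by simp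
  have e: "m + e = K" using mn Suc by simp
  have l: "(%y xi. lq c v y xi - v y xi) \<in> LS (deg_le (Suc e)) ?Om"
   by (rule LS_mono[OF o finite_length_le _ lq_local(2)[OF c deg_eq_le[OF o vS order_refl]]]) auto
  show ?thesis using hom_part_mult[OF o u l y, of e xi] dg[OF vS] e by simp
 qed
 have "hq c y K t xi = (\<Sum>d\<le>Suc K. hq c y K (hom_part d t) xi)" using parts[OF y, of K xi] K by simp
 also have "... = (\<Sum>d\<le>K. hq c y K (hom_part d t) xi) + hq c y K (hom_part (Suc K) t) xi" by simp
 also have "(\<Sum>d\<le>K. hq c y K (hom_part d t) xi) = (\<Sum>d\<le>K. if d = K then hom_part K t y xi else 0)"
  by (intro sum.cong refl) (auto simp: low y hq_top[OF c y ht])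
 also have "hq c y K (hom_part (Suc K) t) = hq c y K ?pr"
  by (rule hq_cong[OF c y]) (use top K in simp)
 also have "hq c y K ?pr xi = lam * div_grad ?pr y xi"
  using hq_first_order[OF c y pr[unfolded K] half, of xi] unfolding div_grad_def .
 finally have 1: "hq c y K t xi = hom_part K t y xi + lam * div_grad ?pr y xi" by simp
 have G': "?G \<in> LS (deg_eq K) ?Om" by (rule LS_gradprod[OF o p r finite_length_eq finite_length_eq]) (use K in auto)
 have "hom_part K ?pr y xi = 0" by (rule hom_part_eq_0[OF pr finite_length_eq y]) (use K in auto)
 moreover have "hom_part K \<rho> y xi = 0" by (rule hom_part_eq_0[OF \<rho> fR y]) (use K in auto)
 moreover have "hom_part K ?pB y xi = p y xi * (lam * div_grad r y xi)" unfolding B_def by (rule mixed_part[OF p r K])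
 moreover have "hom_part K ?rA y xi = r y xi * (lam * div_grad p y xi)" unfolding A_def by (rule mixed_part[OF r p]) (use K in simp)
 ultimately have "hq c y K t xi = p y xi * (lam * div_grad r y xi) + r y xi * (lam * div_grad p y xi) + gradprod p r y xi"
  using hq_split[OF y, of K xi] hom_part_hom[OF G' y, of xi] by simp
 with 1 show "hom_part K t y xi = (1 - lam) * gradprod p r y xi - lam * gradprod r p y xi"
  unfolding div_grad_mult[OF o y p r] by (simp add: algebra_simps)
qed

lemma sig_UNIV:
 assumes c: "c \<in> \<A>" and P: "P \<in> SY UNIV" and y: "y \<in> img c"
 shows "sig UNIV P c y xi = lq c (P c) y xi"
proof -
 let ?P = "restrict_symbol \<A> (fst c) P"
 obtain k where "P \<in> SL k UNIV" using P by (rule symbolsE)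
 then have m: "?P \<in> SY (fst c)" by (intro symbolsI[OF restrict_symbol_mem[OF open_UNIV subset_UNIV]])
 have "sig UNIV P c y xi = sig (fst c) ?P c y xi"
  by (rule sig_restrict[OF UNIV_AD fst_AD[OF c] subset_UNIV P c, symmetric]) (simp add: y)
 also have "... = lq c (?P c) y xi" by (simp only: sig_lq[OF c m])
 also have "lq c (?P c) = lq c (P c)" by (rule lq_cong[OF c]) (simp add: restrict_symbol_def c)
 finally show ?thesis .
qed

lemma star_low_order:
 assumes P: "P \<in> SL k UNIV" and R: "R \<in> SL l UNIV" and c: "c \<in> \<A>" and y: "y \<in> img c"
 shows "star UNIV P R 0 c y xi = P c y xi * R c y xi"
  and "lam = 1 / 2 \<or> k + l <= 1 ==> star UNIV P R 1 c y xi = \<i> * ((1 - lam) * gradprod (P c) (R c) y xi - lam * gradprod (R c) (P c) y xi)"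
proof -
 let ?Om = "img c" and ?T = "{..k} \<times> {..l}"
 note o = open_image[OF c]
 define C where "C s = circ UNIV (hom_sym (fst s) P) (hom_sym (snd s) R)" for s
 have hP: "hom_sym a P \<in> SL a UNIV" for a by (rule hom_sym_mem[OF open_UNIV P])
 have hR: "hom_sym a R \<in> SL a UNIV" for a by (rule hom_sym_mem[OF open_UNIV R])
 have C: "C s \<in> SL (fst s + snd s) UNIV" for s unfolding C_def by (rule circ_mem[OF UNIV_AD hP hR])
 have lP: "hom_sym a P c \<in> LS (deg_eq a) ?Om" for a unfolding hom_sym_def by (rule LS_hom_part[OF o symbol_local[OF P c]])
 have lR: "hom_sym a R c \<in> LS (deg_eq a) ?Om" for a unfolding hom_sym_def by (rule LS_hom_part[OF o symbol_local[OF R c]])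
 have eq: "lq c (C s c) z eta = sharp (fst s) (lq c (hom_sym (fst s) P c)) (lq c (hom_sym (snd s) R c)) z eta" if z: "z \<in> ?Om" for s z eta
 proof -
  have "lq c (C s c) z eta = sig UNIV (C s) c z eta" by (rule sig_UNIV[OF c symbolsI[OF C] z, symmetric])
  also have "... = sharp (fst s) (sig UNIV (hom_sym (fst s) P) c) (sig UNIV (hom_sym (snd s) R) c) z eta"
   unfolding C_def by (rule sig_circ[OF UNIV_AD hP hR c z])
  also have "... = sharp (fst s) (lq c (hom_sym (fst s) P c)) (lq c (hom_sym (snd s) R c)) z eta"
   by (rule sharp_cong[OF o z], rule sig_UNIV[OF c symbolsI[OF hP] z], rule sig_UNIV[OF c symbolsI[OF hR]])
  finally show ?thesis .
 qed
 note parts = quantum_product_parts[OF c lP lR symbol_local[OF C c] eq y]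
 have P_sum: "P c = (%z eta. \<Sum>a\<le>k. hom_sym a P c z eta)" using fun_cong[OF hom_sym_sum[OF P]] .
 have R_sum: "R c = (%z eta. \<Sum>a\<le>l. hom_sym a R c z eta)" using fun_cong[OF hom_sym_sum[OF R]] .
 have "star UNIV P R 0 c y xi = (\<Sum>s\<in>?T. hom_sym (fst s) P c y xi * hom_sym (snd s) R c y xi)"
  unfolding star_formula[OF UNIV_AD P R] star_sum_def[OF UNIV_AD] C_def[symmetric] by (simp add: hom_sym_def[of _ "C _"] parts(1))
 also have "... = (\<Sum>a\<le>k. \<Sum>b\<le>l. hom_sym a P c y xi * hom_sym b R c y xi)"
  by (simp add: sum.cartesian_product split_def)
 also have "... = P c y xi * R c y xi" unfolding fun_cong[OF fun_cong[OF P_sum]] fun_cong[OF fun_cong[OF R_sum]] sum_product ..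
 finally show "star UNIV P R 0 c y xi = P c y xi * R c y xi" .
 assume half: "lam = 1 / 2 \<or> k + l <= 1"
 let ?g = "%a b. gradprod (hom_sym a P c) (hom_sym b R c) y xi" and ?h = "%a b. gradprod (hom_sym b R c) (hom_sym a P c) y xi"
 have dif: "(%z. q z eta) differentiable (at y)" "q y differentiable (at eta)" if "q \<in> LS M ?Om" for q eta and M :: "'n list set"
  using smooth_on_differentiable[OF LS_smooth(1)[OF o that] y]
   smooth_on_differentiable[OF LS_smooth(2)[OF o that y] UNIV_I] by auto
 have "star UNIV P R 1 c y xi = (\<Sum>s\<in>?T. \<i> * ((1 - lam) * ?g (fst s) (snd s) - lam * ?h (fst s) (snd s)))"
  unfolding star_formula[OF UNIV_AD P R] star_sum_def[OF UNIV_AD] C_def[symmetric]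
 proof (intro sum.cong refl)
  fix s assume s: "s \<in> ?T"
  show "(if 1 <= fst s + snd s then \<i> ^ 1 else 0) * hom_sym (fst s + snd s - 1) (C s) c y xi = \<i> * ((1 - lam) * ?g (fst s) (snd s) - lam * ?h (fst s) (snd s))"
  proof (cases "fst s + snd s")
   \<comment> \<open>Two components of degree 0: the guard in \<open>star_sum\<close> removes the
     term, and the right side vanishes as nothing depends on \<open>xi\<close>.\<close>
   case 0
   have p0: "hom_sym (fst s) P c y \<in> homp 0" "hom_sym (snd s) R c y \<in> homp 0" using homp_local[OF lP y, of "fst s"] homp_local[OF lR y, of "snd s"] 0 by auto
   have "?g (fst s) (snd s) = 0" "?h (fst s) (snd s) = 0" unfolding gradprod_def using homp_pd_0[OF p0(1)] homp_pd_0[OF p0(2)] by auto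
   then show ?thesis using 0 by simp
  next
   case (Suc K)
   have h: "lam = 1 / 2 \<or> K = 0" using half s Suc by auto
   have "hom_part K (C s c) y xi = (1 - lam) * ?g (fst s) (snd s) - lam * ?h (fst s) (snd s)"
    by (rule parts(2)[OF _ Suc h])
   then show ?thesis using Suc by (simp add: hom_sym_def[of _ "C _"])
  qed
 qed
 also have "... = \<i> * ((1 - lam) * (\<Sum>s\<in>?T. ?g (fst s) (snd s)) - lam * (\<Sum>s\<in>?T. ?h (fst s) (snd s)))"
  by (simp only: sum_distrib_left[symmetric] sum_subtractf)
 also have "(\<Sum>s\<in>?T. ?g (fst s) (snd s)) = (\<Sum>a\<le>k. \<Sum>b\<le>l. ?g a b)" by (simp add: sum.cartesian_product split_def)
 also have "... = gradprod (P c) (R c) y xi"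
  unfolding P_sum R_sum gradprod_sum(1)[OF finite_atMost dif(2)[OF lP] dif(1)[OF lP]] gradprod_sum(2)[OF finite_atMost dif(2)[OF lR] dif(1)[OF lR]] ..
 also have "(\<Sum>s\<in>?T. ?h (fst s) (snd s)) = (\<Sum>a\<le>k. \<Sum>b\<le>l. ?h a b)" by (simp add: sum.cartesian_product split_def)
 also have "... = gradprod (R c) (P c) y xi"
  unfolding P_sum R_sum gradprod_sum(2)[OF finite_atMost dif(2)[OF lP] dif(1)[OF lP]] gradprod_sum(1)[OF finite_atMost dif(2)[OF lR] dif(1)[OF lR]] ..
 finally show "star UNIV P R 1 c y xi = \<i> * ((1 - lam) * gradprod (P c) (R c) y xi - lam * gradprod (R c) (P c) y xi)" .
qed

end

section \<open>Conformal invariance\<close>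

context quantization
begin

lemma restrict_hom_sym: "restrict_symbol \<A> W (hom_sym d P) = hom_sym d (restrict_symbol \<A> W P)"
proof (intro ext)
 fix c y xi
 show "restrict_symbol \<A> W (hom_sym d P) c y xi = hom_sym d (restrict_symbol \<A> W P) c y xi"
 proof (cases "c \<in> \<A> \<and> y \<in> cdom c W")
  case True
  then have "hom_part d (restrict_symbol \<A> W P c) y xi = hom_part d (P c) y xi"
   by (intro hom_part_cong) (simp add: restrict_symbol_def)
  then show ?thesis using True by (simp add: restrict_symbol_def hom_sym_def)
 next
  case False
  then have "hom_part d (restrict_symbol \<A> W P c) y xi = 0"
   by (intro hom_part_zero) (auto simp: restrict_symbol_def)
  then show ?thesis using False by (auto simp: restrict_symbol_def[of _ _ "hom_sym d P"] hom_sym_def)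
 qed
qed

text \<open>The full symbol of a composite is given by the local formula \<open>sharp\<close>, and
  full symbols determine symbols by injectivity of \<open>Q\<close>.\<close>

lemma restrict_circ:
 assumes W: "W \<in> AD" "W' \<in> AD" "W' \<subseteq> W" and P: "P \<in> SL k W" and R: "R \<in> SL l W"
 shows "restrict_symbol \<A> W' (circ W P R) = circ W' (restrict_symbol \<A> W' P) (restrict_symbol \<A> W' R)"
proof (rule sig_inject[OF W(2)])
 note r = restrict_symbol_mem[OF adapted_open[OF W(1)] W(3)]
 show "restrict_symbol \<A> W' (circ W P R) \<in> SY W'" by (rule symbolsI[OF r[OF circ_mem[OF W(1) P R]]])
 show "circ W' (restrict_symbol \<A> W' P) (restrict_symbol \<A> W' R) \<in> SY W'"
  by (rule symbolsI[OF circ_mem[OF W(2) r[OF P] r[OF R]]])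
 fix c y xi assume c: "c \<in> \<A>" and y: "y \<in> cdom c W'"
 have y': "y \<in> cdom c W" using cdom_mono[OF W(3)] y by blast
 have "sig W' (restrict_symbol \<A> W' (circ W P R)) c y xi = sig W (circ W P R) c y xi"
  by (rule sig_restrict[OF W symbolsI[OF circ_mem[OF W(1) P R]] c y])
 also have "... = sharp k (sig W P c) (sig W R c) y xi" by (rule sig_circ[OF W(1) P R c y'])
 also have "... = sharp k (sig W' (restrict_symbol \<A> W' P) c) (sig W' (restrict_symbol \<A> W' R) c) y xi"
  by (rule sharp_cong[OF open_cdom[OF c adapted_open[OF W(2)]] y], rule sig_restrict[OF W symbolsI[OF P] c y, symmetric], rule sig_restrict[OF W symbolsI[OF R] c, symmetric])
 also have "... = sig W' (circ W' (restrict_symbol \<A> W' P) (restrict_symbol \<A> W' R)) c y xi"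
  by (rule sig_circ[OF W(2) r[OF P] r[OF R] c y, symmetric])
 finally show "sig W' (restrict_symbol \<A> W' (circ W P R)) c y xi = sig W' (circ W' (restrict_symbol \<A> W' P) (restrict_symbol \<A> W' R)) c y xi" .
qed

lemma restrict_star:
 assumes W: "W \<in> AD" "W' \<in> AD" "W' \<subseteq> W" and P: "P \<in> SY W" and R: "R \<in> SY W"
 shows "restrict_symbol \<A> W' (star W P R m) = star W' (restrict_symbol \<A> W' P) (restrict_symbol \<A> W' R) m"
proof -
 note oW = adapted_open[OF W(1)]
 obtain k where k: "P \<in> SL k W" using P by (rule symbolsE)
 obtain l where l: "R \<in> SL l W" using R by (rule symbolsE)
 note r = restrict_symbol_mem[OF oW W(3)]
 have e: "hom_sym d (circ W' (hom_sym a (restrict_symbol \<A> W' P)) (hom_sym b (restrict_symbol \<A> W' R))) = restrict_symbol \<A> W' (hom_sym d (circ W (hom_sym a P) (hom_sym b R)))" for a b d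
  unfolding restrict_hom_sym[symmetric] restrict_circ[OF W hom_sym_mem[OF oW k] hom_sym_mem[OF oW l], symmetric] ..
 show ?thesis
  unfolding star_formula[OF W(1) k l] star_formula[OF W(2) r[OF k] r[OF l]] star_sum_def[OF W(1)] star_sum_def[OF W(2)] e
  by (auto simp: restrict_symbol_def fun_eq_iff)
qed

context
 fixes c X
 assumes c: "c \<in> \<A>" and X: "X \<in> conformal_generators g"
begin

lemma field: "smooth_field X"
 by (rule quad_field_smooth[OF quad_field_generator[OF X]])

lemma act_symbol_mem: "P \<in> SL k (fst c) ==> act_symbol \<A> c X P \<in> SL k (fst c)"
proof -
 assume P: "P \<in> SL k (fst c)"
 have "P c \<in> LS (deg_le k) (img c)" using symbol_local[OF P c] by simp
 then show ?thesis unfolding act_symbol_def by (intro symbol_from_mem[OF c] LS_lie[OF open_image[OF c] field])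
qed

lemma act_symbols: "P \<in> SY (fst c) ==> act_symbol \<A> c X P \<in> SY (fst c)"
 by (erule symbolsE) (rule symbolsI[OF act_symbol_mem])

lemma act_symbol_at: "y \<in> img c ==> act_symbol \<A> c X P c y xi = lie_symbol X (P c) y xi"
 unfolding act_symbol_def by (rule symbol_from_chart[OF c])

lemma act_symbol_sum:
 assumes T: "finite T" and P: "!!s. s \<in> T ==> P s \<in> SY (fst c)"
 shows "act_symbol \<A> c X (%c y xi. \<Sum>s\<in>T. a s * P s c y xi) = (%c' y xi. \<Sum>s\<in>T. a s * act_symbol \<A> c X (P s) c' y xi)"
proof (rule symbol_eqI[OF c])
 note oW = chart_open[OF c]
 show "act_symbol \<A> c X (%c y xi. \<Sum>s\<in>T. a s * P s c y xi) \<in> SY (fst c)"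
  by (rule act_symbols[OF symbols_sum[OF oW P]])
 show "(%c' y xi. \<Sum>s\<in>T. a s * act_symbol \<A> c X (P s) c' y xi) \<in> SY (fst c)"
  by (rule symbols_sum[OF oW act_symbols[OF P]])
 fix y xi assume y: "y \<in> img c"
 have d: "(%z. P s c z eta) differentiable (at y)" "P s c y differentiable (at eta)" if s: "s \<in> T" for s eta
 proof -
  obtain k where k: "P s \<in> SL k (fst c)" using P[OF s] by (rule symbolsE)
  have l: "P s c \<in> LS (deg_le k) (img c)" using symbol_local[OF k c] by simp
  show "(%z. P s c z eta) differentiable (at y)" by (rule smooth_on_differentiable[OF LS_smooth(1)[OF open_image[OF c] l] y])
  show "P s c y differentiable (at eta)" by (rule smooth_on_differentiable[OF LS_smooth(2)[OF open_image[OF c] l y] UNIV_I])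
 qed
 have 1: "pd i (%z. \<Sum>s\<in>T. a s * P s c z xi) y = (\<Sum>s\<in>T. a s * pd i (%z. P s c z xi) y)" for i
  using d by (simp add: pd_sum pd_cmult)
 have 2: "pd i (%xi. \<Sum>s\<in>T. a s * P s c y xi) xi = (\<Sum>s\<in>T. a s * pd i (P s c y) xi)" for i
  using d by (simp add: pd_sum pd_cmult)
 have 3: "(\<Sum>i\<in>UNIV. u i * (\<Sum>s\<in>T. a s * v s i)) = (\<Sum>s\<in>T. a s * (\<Sum>i\<in>UNIV. u i * v s i))" for u :: "'n => complex" and v
  unfolding sum_distrib_left by (subst sum.swap) (simp add: mult.left_commute)
 have 4: "(\<Sum>i\<in>UNIV. \<Sum>j\<in>UNIV. u i j * (\<Sum>s\<in>T. a s * v s i)) = (\<Sum>s\<in>T. a s * (\<Sum>i\<in>UNIV. \<Sum>j\<in>UNIV. u i j * v s i))" for u :: "'n => 'n => complex" and v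
  unfolding sum_distrib_right[symmetric] by (rule 3)
 show "act_symbol \<A> c X (%c y xi. \<Sum>s\<in>T. a s * P s c y xi) c y xi = (\<Sum>s\<in>T. a s * act_symbol \<A> c X (P s) c y xi)"
  unfolding act_symbol_at[OF y] lie_symbol_def 1 2
   3[of "%i. cor (X y $ i)" "%s i. pd i (%z. P s c z xi) y"]
   4[of "%i j. cor (pd i X y $ j * xi $ j)" "%s i. pd i (P s c y) xi"]
  by (simp only: right_diff_distrib sum_subtractf)
qed

lemma act_hom_sym:
 assumes P: "P \<in> SY (fst c)"
 shows "hom_sym d (act_symbol \<A> c X P) = act_symbol \<A> c X (hom_sym d P)"
proof -
 note oW = chart_open[OF c] and o = open_image[OF c]
 obtain k where k: "P \<in> SL k (fst c)" using P by (rule symbolsE)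
 have H: "hom_sym e P \<in> SY (fst c)" for e by (rule symbolsI[OF hom_sym_mem[OF oW k]])
 have z: "act_symbol \<A> c X (%c y xi. 0) = (%c y xi. 0)" using act_symbol_sum[of "{}" "%_. P"] by simp
 have one: "hom_sym d (act_symbol \<A> c X (hom_sym e P)) = (if e = d then act_symbol \<A> c X (hom_sym d P) else (%c y xi. 0))" for e
 proof (rule symbol_eqI[OF c])
  show "hom_sym d (act_symbol \<A> c X (hom_sym e P)) \<in> SY (fst c)" by (rule symbolsI[OF hom_sym_symbols[OF oW act_symbols[OF H]]])
  show "(if e = d then act_symbol \<A> c X (hom_sym d P) else (%c y xi. 0)) \<in> SY (fst c)"
   using act_symbols[OF H] symbolsI[OF symbols_le_zero[of 0 "fst c"]] by simp
  fix y xi assume y: "y \<in> img c"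
  have l0: "P c \<in> LS (deg_le k) (img c)" using symbol_local[OF k c] by simp
  have "hom_sym e P c \<in> LS (deg_eq e) (img c)"
   unfolding hom_sym_def by (rule LS_hom_part[OF o l0])
  note L = LS_lie_eq[OF o field this]
  have "hom_sym d (act_symbol \<A> c X (hom_sym e P)) c y xi = hom_part d (lie_symbol X (hom_sym e P c)) y xi"
   unfolding hom_sym_def[of d] by (rule hom_part_cong) (rule act_symbol_at[OF y])
  also have "... = (if e = d then lie_symbol X (hom_sym e P c) y xi else 0)"
  proof (cases "e = d")
   case True
   then show ?thesis using hom_part_hom[OF L y, of xi] by simp
  next
   case False
   then show ?thesis using hom_part_eq_0[OF L finite_length_eq y, of d xi] by simp
  qed
  finally show "hom_sym d (act_symbol \<A> c X (hom_sym e P)) c y xi = (if e = d then act_symbol \<A> c X (hom_sym d P) else (%c y xi. 0)) c y xi"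
   by (simp add: act_symbol_at[OF y])
 qed
 have "P = (%c y xi. \<Sum>e\<le>k. 1 * hom_sym e P c y xi)" using hom_sym_sum[OF k] by simp
 then have "act_symbol \<A> c X P = act_symbol \<A> c X (%c y xi. \<Sum>e\<le>k. 1 * hom_sym e P c y xi)" by (rule arg_cong)
 also have "... = (%c' y xi. \<Sum>e\<le>k. 1 * act_symbol \<A> c X (hom_sym e P) c' y xi)"
  by (rule act_symbol_sum[OF finite_atMost H])
 finally have "hom_sym d (act_symbol \<A> c X P) = hom_sym d (%c' y xi. \<Sum>e\<le>k. 1 * act_symbol \<A> c X (hom_sym e P) c' y xi)" by (rule arg_cong)
 also have "... = (%c' y xi. \<Sum>e\<le>k. 1 * hom_sym d (act_symbol \<A> c X (hom_sym e P)) c' y xi)"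
  by (rule hom_sym_setsum[OF oW finite_atMost act_symbols[OF H]])
 also have "... = (%c' y xi. \<Sum>e\<le>k. if e = d then act_symbol \<A> c X (hom_sym d P) c' y xi else 0)"
  unfolding one by (intro ext sum.cong refl) simp
 also have "... = act_symbol \<A> c X (hom_sym d P)"
  using hom_sym_high[OF k, of d] z by (cases "d <= k") auto
 finally show ?thesis .
qed

lemma act_I_hbar:
 assumes P: "P \<in> SY (fst c)"
 shows "I_hbar (act_symbol \<A> c X P) m = act_symbol \<A> c X (I_hbar P m)"
 using act_symbol_sum[of "{()}" "%_. hom_sym m P" "%_. \<i> ^ m"] symbolsI[OF hom_sym_symbols[OF chart_open[OF c] P]]
 by (simp add: I_hbar_eq act_hom_sym[OF P])

lemma act_density_sum:
 assumes T: "finite T" and h: "!!s. s \<in> T ==> h s \<in> dens lam (fst c)"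
 shows "act_density \<A> lam c X (%c y. \<Sum>s\<in>T. h s c y) = (%c' y. \<Sum>s\<in>T. act_density \<A> lam c X (h s) c' y)"
proof (rule density_eqI[OF c])
 note A = act_density_mem[OF c field]
 have m: "(%c y. \<Sum>s\<in>T. h s c y) \<in> dens lam (fst c)" by (rule densities_sum[OF chart_open[OF c] h])
 show "act_density \<A> lam c X (%c y. \<Sum>s\<in>T. h s c y) \<in> dens lam (fst c)" by (rule A(1)[OF m])
 show "(%c' y. \<Sum>s\<in>T. act_density \<A> lam c X (h s) c' y) \<in> dens lam (fst c)"
  by (rule densities_sum[OF chart_open[OF c] A(1)[OF h]])
 fix y assume y: "y \<in> img c"
 have "h s c differentiable (at y)" if "s \<in> T" for s
  using smooth_on_differentiable[OF density_smooth[OF h[OF that] c], of y] y by simp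
 then have "lie_density lam X (%y. \<Sum>s\<in>T. h s c y) y = (\<Sum>s\<in>T. lie_density lam X (h s c) y)"
  unfolding lie_density_def by (simp add: pd_sum sum.distrib sum_distrib_left) (rule sum.swap)
 then show "act_density \<A> lam c X (%c y. \<Sum>s\<in>T. h s c y) c y = (\<Sum>s\<in>T. act_density \<A> lam c X (h s) c y)"
  unfolding A(2)[OF m y] by (simp add: A(2)[OF h y])
qed

lemma quant_h_act:
 assumes P: "P \<in> SY (fst c)" and f: "f \<in> dens lam (fst c)"
 shows "quant_h Q (fst c) (act_symbol \<A> c X P) j f c' y =
  act_density \<A> lam c X (quant_h Q (fst c) P j f) c' y - quant_h Q (fst c) P j (act_density \<A> lam c X f) c' y"
 unfolding quant_h_def act_I_hbar[OF P]
 by (rule Q_equivariant[OF c X symbolsI[OF I_hbar_mem[OF chart_open[OF c] P]] f])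

text \<open>The commutator with a Lie derivative is a derivation of operator composition, and
  \<open>Q\<close> intertwines it with the action on symbols; uniqueness of the formal product
  transports the Leibniz rule.\<close>

lemma star_derivation:
 assumes P: "P \<in> SY (fst c)" and R: "R \<in> SY (fst c)"
 shows "act_symbol \<A> c X (star (fst c) P R m) c' y xi =
  star (fst c) (act_symbol \<A> c X P) R m c' y xi + star (fst c) P (act_symbol \<A> c X R) m c' y xi"
proof -
 note W = fst_AD[OF c] and oW = chart_open[OF c]
 let ?W = "fst c" and ?A = "act_symbol \<A> c X" and ?D = "act_density \<A> lam c X"
 note sm = star_mem[OF W]
 note qd = quant_h_dens[OF W]
 have fD: "?D f \<in> dens lam ?W" if "f \<in> dens lam ?W" for f by (rule act_density_mem(1)[OF c field that])
 have "star ?W (?A P) R = (%m c y xi. 1 * ?A (star ?W P R m) c y xi + (-1) * star ?W P (?A R) m c y xi)"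
 proof (rule star_eqI[OF W])
  show "(%c y xi. 1 * ?A (star ?W P R m) c y xi + (-1) * star ?W P (?A R) m c y xi) \<in> SY ?W" for m
   by (intro symbols_linear[OF oW] act_symbols sm P R)
  fix m f c' y assume f: "f \<in> dens lam ?W"
  let ?C = "%P R f. quant_h_comp Q ?W P R m f"
  have fun1: "quant_h_series Q ?W (star ?W P R) m f = ?C P R f" if "f \<in> dens lam ?W" for f
   by (intro ext star_series[OF W P R that])
  have s1: "quant_h_series Q ?W (%m. ?A (star ?W P R m)) m f c' y = ?D (?C P R f) c' y - ?C P R (?D f) c' y"
  proof -
   have sD: "?D (quant_h_series Q ?W (star ?W P R) m f) c' y = (\<Sum>j\<le>m. ?D (quant_h Q ?W (star ?W P R j) (m - j) f) c' y)"
    unfolding quant_h_series_def by (subst act_density_sum[OF finite_atMost qd[OF sm[OF P R] f]]) simp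
   have "quant_h_series Q ?W (%m. ?A (star ?W P R m)) m f c' y = ?D (quant_h_series Q ?W (star ?W P R) m f) c' y - quant_h_series Q ?W (star ?W P R) m (?D f) c' y"
    unfolding sD unfolding quant_h_series_def quant_h_act[OF sm[OF P R] f] sum_subtractf ..
   then show ?thesis unfolding fun1[OF f] fun1[OF fD[OF f]] .
  qed
  have s2: "quant_h_series Q ?W (star ?W P (?A R)) m f c' y = ?C P (?A R) f c' y"
   by (rule star_series[OF W P act_symbols[OF R] f])
  have cD: "?D (?C P R f) c' y = (\<Sum>j\<le>m. ?D (quant_h Q ?W P j (quant_h Q ?W R (m - j) f)) c' y)"
   unfolding quant_h_comp_def by (subst act_density_sum[OF finite_atMost qd[OF P qd[OF R f]]]) simp
  have "?C (?A P) R f c' y + ?C P (?A R) f c' y = ?D (?C P R f) c' y - ?C P R (?D f) c' y"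
   unfolding cD unfolding quant_h_comp_def sum.distrib[symmetric] sum_subtractf[symmetric]
  proof (intro sum.cong refl)
   fix j
   let ?q = "quant_h Q ?W R (m - j)"
   have e: "quant_h Q ?W (?A R) (m - j) f = (%c y. 1 * ?D (?q f) c y + (-1) * ?q (?D f) c y)"
    by (intro ext) (simp add: quant_h_act[OF R f])
   have "quant_h Q ?W P j (quant_h Q ?W (?A R) (m - j) f) c' y = 1 * quant_h Q ?W P j (?D (?q f)) c' y + (-1) * quant_h Q ?W P j (?q (?D f)) c' y"
    unfolding e unfolding quant_h_def[of Q ?W P]
    by (rule Q_linear_arg[OF W symbolsI[OF I_hbar_mem[OF oW P]] fD[OF qd[OF R f]] qd[OF R fD[OF f]]])
   then show "quant_h Q ?W (?A P) j (?q f) c' y + quant_h Q ?W P j (quant_h Q ?W (?A R) (m - j) f) c' y =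
    ?D (quant_h Q ?W P j (?q f)) c' y - quant_h Q ?W P j (?q (?D f)) c' y"
    using quant_h_act[OF P qd[OF R f], where j=j and c'=c' and y=y] by simp
  qed
  moreover have "quant_h_series Q ?W (%m c y xi. 1 * ?A (star ?W P R m) c y xi + (-1) * star ?W P (?A R) m c y xi) m f c' y =
   1 * quant_h_series Q ?W (%m. ?A (star ?W P R m)) m f c' y + (-1) * quant_h_series Q ?W (star ?W P (?A R)) m f c' y"
   by (rule series_linear[OF W act_symbols[OF sm[OF P R]] sm[OF P act_symbols[OF R]] f])
  ultimately show "quant_h_series Q ?W (%m c y xi. 1 * ?A (star ?W P R m) c y xi + (-1) * star ?W P (?A R) m c y xi) m f c' y = ?C (?A P) R f c' y"
   using s1 s2 by algebra
 qed
 then show ?thesis by simp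
qed

end

lemma star_invariant: "conformally_invariant g \<A> star"
 unfolding conformally_invariant_def
proof (intro ballI allI conjI)
 fix c m P R assume c: "c \<in> \<A>" and "P \<in> SY UNIV" "R \<in> SY UNIV"
 then show "restrict_symbol \<A> (fst c) (star UNIV P R m) = star (fst c) (restrict_symbol \<A> (fst c) P) (restrict_symbol \<A> (fst c) R) m"
  by (intro restrict_star UNIV_AD fst_AD) auto
qed (rule star_derivation)

end

section \<open>Locality of the product\<close>

definition flat_at :: "nat => (real^'n::finite => complex) => real^'n => bool" where
 "flat_at N u y \<longleftrightarrow> (\<forall>I. length I < N \<longrightarrow> pds I u y = 0)"

lemma jet_zero_flat: "jet_zero N p y \<longleftrightarrow> (\<forall>xi. flat_at N (%z. p z xi) y)"
 unfolding jet_zero_def flat_at_def dsym_def by blast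

lemma flat_at_Suc: "flat_at (Suc N) u y \<longleftrightarrow> u y = 0 \<and> (\<forall>i. flat_at N (pd i u) y)"
proof (intro iffI conjI allI)
 have p: "pds I (pd i u) = pds (I @ [i]) u" for I i by (simp add: pds_append pds_Cons)
 show "u y = 0" if "flat_at (Suc N) u y" using that[unfolded flat_at_def, rule_format, of "[]"] by simp
 show "flat_at N (pd i u) y" if "flat_at (Suc N) u y" for i
  using that unfolding flat_at_def p by simp
 assume a: "u y = 0 \<and> (\<forall>i. flat_at N (pd i u) y)"
 show "flat_at (Suc N) u y"
  unfolding flat_at_def
 proof (intro allI impI)
  fix I :: "'a list" assume "length I < Suc N"
  then show "pds I u y = 0"
   using a p unfolding flat_at_def by (cases I rule: rev_cases) auto
 qed
qed

lemma flat_at_mono: "flat_at N u y ==> M <= N ==> flat_at M u y"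
 unfolding flat_at_def by auto

lemma flat_at_cong: "open S ==> y \<in> S ==> (!!z. z \<in> S ==> u z = v z) ==> flat_at N u y \<longleftrightarrow> flat_at N v y"
 unfolding flat_at_def using pds_cong[of S u v y] by simp

lemma flat_at_sum:
 assumes "open S" "!!s. s \<in> T ==> smooth_on S (u s)" "y \<in> S" "!!s. s \<in> T ==> flat_at N (u s) y"
 shows "flat_at N (%z. \<Sum>s\<in>T. u s z) y"
 unfolding flat_at_def
proof (intro allI impI)
 fix I :: "'a list" assume I: "length I < N"
 have "pds I (%z. \<Sum>s\<in>T. u s z) y = (\<Sum>s\<in>T. pds I (u s) y)" by (rule pds_sum[OF assms(1,2,3)])
 also have "... = 0" by (rule sum.neutral) (use assms(4) I in \<open>auto simp: flat_at_def\<close>)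
 finally show "pds I (%z. \<Sum>s\<in>T. u s z) y = 0" .
qed

lemma flat_at_add:
 assumes "open S" "smooth_on S u" "smooth_on S v" "y \<in> S" "flat_at N u y" "flat_at N v y"
 shows "flat_at N (%z. u z + v z) y"
 using flat_at_sum[of S "{True, False}" "%s. if s then u else v" y N] assms by auto

lemma flat_at_mult:
 assumes S: "open S" "y \<in> S"
 shows "smooth_on S u ==> smooth_on S v ==> flat_at N u y ==> flat_at N (%z. u z * v z) y"
proof (induction N arbitrary: u v)
 case (Suc N)
 have "flat_at N (pd i (%z. u z * v z)) y" for i
 proof -
  have m: "smooth_on S (%z. pd i u z * v z)" "smooth_on S (%z. u z * pd i v z)"
   using Suc.prems by (auto intro!: smooth_on_mult S smooth_on_pd)
  have "flat_at N (%z. pd i u z * v z) y" "flat_at N (%z. u z * pd i v z) y"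
   using Suc.prems flat_at_Suc[of N u y] flat_at_mono[of "Suc N" u y N] by (auto intro!: Suc.IH smooth_on_pd)
  from flat_at_add[OF S(1) m S(2) this] have "flat_at N (%z. pd i u z * v z + u z * pd i v z) y" .
  then show ?thesis
   by (subst flat_at_cong[OF S, of _ "%z. pd i u z * v z + u z * pd i v z"])
    (auto intro!: pd_mult smooth_on_differentiable[OF Suc.prems(1)] smooth_on_differentiable[OF Suc.prems(2)])
 qed
 then show ?case using Suc.prems unfolding flat_at_Suc[of N "%z. u z * v z"] by (auto simp: flat_at_Suc)
qed (simp add: flat_at_def)

lemma jet_zero_cong: "open S ==> y \<in> S ==> (!!z xi. z \<in> S ==> p z xi = r z xi) ==> jet_zero N p y \<longleftrightarrow> jet_zero N r y"
proof -
 assume a: "open S" "y \<in> S" and e: "!!z xi. z \<in> S ==> p z xi = r z xi"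
 have "flat_at N (%z. p z xi) y \<longleftrightarrow> flat_at N (%z. r z xi) y" for xi by (rule flat_at_cong[OF a]) (rule e)
 then show ?thesis unfolding jet_zero_flat by (simp only:)
qed

lemma jet_zero_linear:
 assumes S: "open Om" "y \<in> Om" and p: "p \<in> LS L Om" "r \<in> LS L' Om" and j: "jet_zero N p y" "jet_zero N r y"
 shows "jet_zero N (%y xi. a * p y xi + b * r y xi) y"
 unfolding jet_zero_flat
proof
 fix xi
 note s = LS_smooth(1)[OF S(1) p(1), of xi] LS_smooth(1)[OF S(1) p(2), of xi]
 have "flat_at N (%z. p z xi * a) y" "flat_at N (%z. r z xi * b) y"
  using j unfolding jet_zero_flat by (auto intro!: flat_at_mult[OF S] s)
 then show "flat_at N (%z. a * p z xi + b * r z xi) y"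
  using flat_at_add[OF S(1) smooth_on_mult[OF S(1) s(1) smooth_on_const] smooth_on_mult[OF S(1) s(2) smooth_on_const] S(2)]
  by (simp add: mult.commute)
qed

lemma jet_zero_tsyms:
 assumes S: "open Om" "y \<in> Om" and b: "b \<in> LS (deg_le l) Om" and j: "jet_zero (N + length I) b y"
 shows "jet_zero N (tsyms I b) y"
 using j
proof (induction I arbitrary: N)
 case (Cons i I)
 have c: "jet_zero (Suc N) (tsyms I b) y" using Cons.IH[of "Suc N"] Cons.prems by simp
 show ?case
  unfolding jet_zero_flat
 proof
  fix xi
  let ?u = "%z. tsyms I b z xi"
  have s: "smooth_on Om ?u" by (rule smooth_on_tsyms[OF S(1) LS_smooth(1)[OF S(1) b]])
  have f: "flat_at (Suc N) ?u y" using c unfolding jet_zero_flat by blast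
  have "flat_at N (%z. ?u z * cor (xi $ i)) y"
   by (rule flat_at_mult[OF S s smooth_on_const flat_at_mono[OF f]]) simp
  moreover have "flat_at N (pd i ?u) y" using f unfolding flat_at_Suc by blast
  ultimately have "flat_at N (%z. pd i ?u z + ?u z * cor (xi $ i)) y"
   by (intro flat_at_add[OF S(1) smooth_on_pd[OF s] smooth_on_mult[OF S(1) s smooth_on_const] S(2)])
  then show "flat_at N (%z. tsyms (i # I) b z xi) y" by (simp add: tsyms_Cons tsym_def mult.commute)
 qed
qed simp

text \<open>Composition does not differentiate the coefficients of \<open>a\<close>, and
  differentiates those of \<open>b\<close> at most \<open>k\<close> times; this is the loss of
  order.\<close>

lemma jet_zero_sharp:
 assumes S: "open Om" "y \<in> Om" and a: "a \<in> LS L Om" and b: "b \<in> LS (deg_le l) Om"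
  and j: "jet_zero N a y \<or> jet_zero (N + k) b y"
 shows "jet_zero N (sharp k a b) y"
 unfolding jet_zero_flat sharp_def
proof
 fix xi
 note sb = smooth_on_tsyms[OF S(1) LS_smooth(1)[OF S(1) b]] and sa = fibre_coeff_smooth[OF S(1) a]
 show "flat_at N (%z. \<Sum>I\<in>deg_le k. fibre_coeff I a z * tsyms I b z xi) y"
 proof (rule flat_at_sum[OF S(1) smooth_on_mult[OF S(1) sa sb] S(2)])
  fix I :: "'a list" assume I: "I \<in> deg_le k"
  from j show "flat_at N (%z. fibre_coeff I a z * tsyms I b z xi) y"
  proof
   assume ja: "jet_zero N a y"
   have "flat_at N (fibre_coeff I a) y"
    unfolding flat_at_def
   proof (intro allI impI)
    fix J :: "'a list" assume "length J < N"
    then have "dsym J a y = (%_. 0)" using ja by (auto simp: jet_zero_def)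
    then show "pds J (fibre_coeff I a) y = 0" unfolding pds_fibre_coeff[OF S(1) a S(2)] by (simp add: fibre_coeff_def pds_const)
   qed
   then show ?thesis by (rule flat_at_mult[OF S sa sb])
  next
   assume "jet_zero (N + k) b y"
   then have "jet_zero (N + length I) b y" by (rule jet_zero_mono) (use I in simp)
   then have "flat_at N (%z. tsyms I b z xi) y" using jet_zero_tsyms[OF S b] unfolding jet_zero_flat by blast
   from flat_at_mult[OF S sb sa this] show ?thesis by (simp add: mult.commute)
  qed
 qed
qed

section \<open>Taylor expansion of symbols indexed by lists\<close>

lemma card_mset_class:
 fixes A :: "'n::finite list"
 shows "finite {J. mset J = mset A}" "of_nat (card {J. mset J = mset A}) \<noteq> (0 :: complex)"
proof -
 have "{J. mset J = mset A} \<subseteq> {J. length J = length A}" using mset_eq_length by blast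
 then show fin: "finite {J. mset J = mset A}" by (rule finite_subset) (rule finite_length_eq)
 have "A \<in> {J. mset J = mset A}" by (rule CollectI) (rule refl)
 then have "card {J. mset J = mset A} > 0" unfolding card_gt_0_iff using fin by blast
 then show "of_nat (card {J. mset J = mset A}) \<noteq> (0 :: complex)" by simp
qed

text \<open>The nonzero value is the product of the factorials of the multiplicities in
  \<open>A\<close>, written as \<open>length A\<close> factorial over the number of rearrangements.
  It follows from \<open>pds_monomial_sum\<close> for the indicator of the rearrangements, as all of
  these give the same derivative.\<close>

lemma pds_monomial_zero:
 "pds A (monomial I) (0 :: real^'n::finite) = (if mset I = mset A then fact (length A) / of_nat (card {J. mset J = mset A}) else 0)"
proof -
 define S where "S = {J. mset J = mset A}"
 define z where "z = pds A (monomial I) (0 :: real^'n)"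
 let ?F = "%J :: 'n list. if mset J = mset A then 1 else 0 :: complex"
 have "(\<Sum>J | length J = length A. pds J (monomial I) (0 :: real^'n) * ?F J) = (\<Sum>J\<in>S. z)"
 proof (rule sum.mono_neutral_cong_right[OF finite_length_eq])
  show "S \<subseteq> {J. length J = length A}" unfolding S_def using mset_eq_length by blast
  show "\<forall>J\<in>{J. length J = length A} - S. pds J (monomial I) (0 :: real^'n) * ?F J = 0" by (simp add: S_def)
  fix J assume "J \<in> S"
  then have J: "mset J = mset A" by (simp add: S_def)
  have "pds J (monomial I) (0 :: real^'n) = z"
   unfolding z_def by (rule pds_perm[OF open_UNIV smooth_on_monomial[OF open_UNIV] J UNIV_I])
  then show "pds J (monomial I) (0 :: real^'n) * ?F J = z" using J by simp
 qed
 also have "(\<Sum>J | length J = length A. pds J (monomial I) (0 :: real^'n) * ?F J) = (if length I = length A then fact (length A) * ?F I else 0)"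
  by (rule pds_monomial_sum[where F="?F"]) simp
 also have "(\<Sum>J\<in>S. z) = of_nat (card S) * z" by (rule sum_constant)
 finally have E: "(if length I = length A then fact (length A) * ?F I else 0) = of_nat (card S) * z" .
 have n: "of_nat (card S) \<noteq> (0 :: complex)" unfolding S_def by (rule card_mset_class(2))
 show ?thesis
 proof (cases "mset I = mset A")
  case True
  have "length I = length A" by (rule mset_eq_length[OF True])
  then have "of_nat (card S) * z = fact (length A)" using E True by simp
  then have "z = fact (length A) / of_nat (card S)" using n by (simp add: nonzero_eq_divide_eq mult.commute)
  then show ?thesis using True by (simp only: z_def S_def simp_thms if_True)
 next
  case False
  then have "of_nat (card S) * z = 0" using E by (simp split: if_splits)
  then have "z = 0" using n by (simp only: mult_eq_0_iff) simp
  then show ?thesis using False by (simp only: z_def if_False)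
 qed
qed

text \<open>A sum over lists meets each Taylor monomial once per rearrangement; dividing by
  \<open>length I\<close> factorial compensates this exactly.\<close>

lemma taylor_symmetric:
 assumes F: "!!I J. mset I = mset J ==> F I = F J" and A: "length A <= N"
 shows "(\<Sum>I\<in>deg_le N. pds A (monomial I) (0 :: real^'n::finite) / fact (length I) * F I) = (F A :: complex)"
proof -
 define S where "S = {J :: 'n list. mset J = mset A}"
 have n: "of_nat (card S) \<noteq> (0 :: complex)" unfolding S_def by (rule card_mset_class(2))
 have "(\<Sum>I\<in>deg_le N. pds A (monomial I) (0 :: real^'n) / fact (length I) * F I) = (\<Sum>I\<in>S. F A / of_nat (card S))"
 proof (rule sum.mono_neutral_cong_right[OF finite_length_le])
  show "S \<subseteq> deg_le N" unfolding S_def using A by (auto dest!: mset_eq_length)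
  show "\<forall>I\<in>deg_le N - S. pds A (monomial I) (0 :: real^'n) / fact (length I) * F I = 0"
   unfolding pds_monomial_zero by (simp add: S_def)
  fix I assume "I \<in> S"
  then have I: "mset I = mset A" by (simp add: S_def)
  show "pds A (monomial I) (0 :: real^'n) / fact (length I) * F I = F A / of_nat (card S)"
   unfolding pds_monomial_zero F[OF I] mset_eq_length[OF I] S_def[symmetric] using I by simp
 qed
 also have "... = of_nat (card S) * (F A / of_nat (card S))" by (rule sum_constant)
 also have "... = F A" using n by simp
 finally show ?thesis .
qed

lemma pd_shift_arg:
 assumes "u differentiable (at (y + v))"
 shows "pd i (%z. u (z + v)) y = pd i u (y + v)"
proof -
 have hd: "(u has_derivative frechet_derivative u (at (y + v))) (at (y + v))" using assms frechet_derivative_works by blast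
 have d: "((%z. z + v) has_derivative (%h. h)) (at y)" by (auto intro!: derivative_eq_intros)
 have "((%z. u (z + v)) has_derivative (%h. frechet_derivative u (at (y + v)) h)) (at y)"
  by (rule has_derivative_compose[OF d hd])
 from pd_eqI[OF this] show ?thesis by (simp add: pd_def)
qed

lemma pds_shift_arg:
 assumes u: "smooth_on UNIV u"
 shows "pds I (%z. u (z + v)) = (%z. pds I u (z + v))"
proof (induction I)
 case (Cons i I)
 show ?case unfolding pds_Cons Cons
  by (rule ext) (rule pd_shift_arg[OF smooth_on_differentiable[OF smooth_on_pds[OF u] UNIV_I]])
qed simp

lemma monomial_shift_local: "(%_. %xi. monomial I (xi + v)) \<in> LS (deg_le (length I)) (UNIV :: (real^'n::finite) set)"
proof (induction I)
 case Nil
 have "(%_. monomial []) \<in> LS (deg_le (length ([] :: 'n list))) (UNIV :: (real^'n) set)" by (rule LS_monomial) auto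
 moreover have "monomial [] = (%_ :: real^'n. 1)" by (rule ext) simp
 ultimately show ?case by simp
next
 case (Cons i I)
 let ?m = "%(_ :: real^'n) xi. monomial I (xi + v)"
 have 1: "(%y xi. cor (xi $ i) * ?m y xi) \<in> LS (deg_le (Suc (length I))) UNIV"
  by (rule LS_coord_mult[OF open_UNIV finite_length_le _ Cons]) auto
 have 2: "(%y xi. cor (v $ i) * ?m y xi) \<in> LS (deg_le (Suc (length I))) UNIV"
  by (rule LS_mono[OF open_UNIV finite_length_le _ LS_cscale[OF open_UNIV Cons]]) auto
 have "(%_. %xi. monomial (i # I) (xi + v)) = (%y xi. cor (xi $ i) * ?m y xi + cor (v $ i) * ?m y xi)"
  by (auto simp: monomial_Cons fun_eq_iff distrib_right)
 then show ?case using LS_add[OF open_UNIV 1 2] by simp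
qed

lemma poly_taylor:
 assumes f: "f = (%xi. \<Sum>I\<in>deg_le N. a I * monomial I xi)"
 shows "f xi = (\<Sum>L\<in>deg_le N. pds L f xi0 / fact (length L) * monomial L (xi - xi0 :: real^'n::finite))"
proof -
 let ?g = "%(_ :: real^'n) eta. f (eta + xi0)"
 have m: "(%_ eta. monomial I (eta + xi0)) \<in> LS (deg_le N) (UNIV :: (real^'n) set)" if "I \<in> deg_le N" for I
  by (rule LS_mono[OF open_UNIV finite_length_le _ monomial_shift_local]) (use that in auto)
 have g: "?g \<in> LS (deg_le N) UNIV"
  unfolding f by (intro LS_sum LS_cscale open_UNIV m)
 have s: "smooth_on UNIV f" unfolding f by (intro smooth_on_sum smooth_on_cmult open_UNIV smooth_on_monomial)
 have "f xi = ?g 0 (xi - xi0)" by simp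
 also have "... = (\<Sum>L\<in>deg_le N. fibre_coeff L ?g 0 * monomial L (xi - xi0))" by (rule symbol_fibre_coeff[OF g UNIV_I])
 finally show ?thesis by (simp add: fibre_coeff_def pds_shift_arg[OF s])
qed

text \<open>The guard keeps the symbol of degree at most \<open>k\<close>, while the lists in the
  sums may be as long as the order \<open>N\<close> of the expansion in \<open>y\<close>.\<close>

definition taylor_term :: "nat => 'n::finite list => 'n list => real^'n => real^'n => 'n lsymbol" where
 "taylor_term k I L y0 xi0 y xi =
   (if length L <= k then monomial I (y - y0) / fact (length I) * (monomial L (xi - xi0) / fact (length L)) else 0)"

lemma smooth_on_monomial_shift: "smooth_on Om (%y. monomial I (y - y0))" if "open Om" for Om :: "(real^'n::finite) set"
proof (induction I)
 case (Cons i I)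
 then show ?case
  by (simp add: monomial_Cons smooth_on_mult[OF that] smooth_on_of_real[OF that] smooth_on_diff[OF that] smooth_on_coord[OF that] del: of_real_diff)
qed simp

lemma taylor_term_local:
 assumes S: "open Om"
 shows "taylor_term k I L y0 xi0 \<in> LS (deg_le k) Om"
proof (cases "length L <= k")
 case True
 have "(%_ xi. monomial L (xi + (- xi0))) \<in> LS (deg_le (length L)) Om"
  by (rule LS_restrict[OF monomial_shift_local]) simp
 then have m: "(%_ xi. monomial L (xi - xi0)) \<in> LS (deg_le (length L)) Om" by simp
 have "smooth_on Om (%y. (1 / (fact (length I) * fact (length L))) * monomial I (y - y0))"
  by (rule smooth_on_cmult[OF S smooth_on_monomial_shift[OF S]])
 from LS_scale[OF S this m]
 have "taylor_term k I L y0 xi0 \<in> LS (deg_le (length L)) Om" using True by (simp add: taylor_term_def[abs_def])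
 then show ?thesis by (rule LS_mono[OF S finite_length_le, rotated]) (use True in auto)
qed (simp add: taylor_term_def[abs_def])

lemma mixed_expand:
 assumes S: "open Om" and a: "!!J. smooth_on Om (a J)" "!!y xi. y \<in> Om ==> p y xi = (\<Sum>J\<in>M. a J y * monomial J xi)" and y: "y \<in> Om"
 shows "mixed I L p y xi = (\<Sum>J\<in>M. pds I (a J) y * pds L (monomial J) xi)"
  and "pds L (dsym I p y) xi = (\<Sum>J\<in>M. pds I (a J) y * pds L (monomial J) xi)"
proof -
 have lin: "pds L (%xi. \<Sum>J\<in>M. b J * monomial J xi) xi = (\<Sum>J\<in>M. b J * pds L (monomial J) xi)" for b
  by (subst pds_sum[OF open_UNIV smooth_on_cmult[OF open_UNIV smooth_on_monomial[OF open_UNIV]] UNIV_I])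
   (simp add: pds_cmult[OF open_UNIV smooth_on_monomial[OF open_UNIV] UNIV_I])
 have step: "pds L (p z) xi = (\<Sum>J\<in>M. pds L (monomial J) xi * a J z)" if "z \<in> Om" for z
 proof -
  have e: "p z = (%xi. \<Sum>J\<in>M. a J z * monomial J xi)" using a(2)[OF that] by auto
  show ?thesis unfolding e lin by (rule sum.cong[OF refl]) (rule mult.commute)
 qed
 have "mixed I L p y xi = pds I (%z. \<Sum>J\<in>M. pds L (monomial J) xi * a J z) y"
  unfolding mixed_def by (rule pds_cong[OF S _ y]) (rule step)
 also have "... = (\<Sum>J\<in>M. pds I (%z. pds L (monomial J) xi * a J z) y)"
  by (rule pds_sum[OF S smooth_on_cmult[OF S a(1)] y])
 also have "... = (\<Sum>J\<in>M. pds L (monomial J) xi * pds I (a J) y)"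
  by (intro sum.cong refl pds_cmult[OF S a(1) y])
 also have "... = (\<Sum>J\<in>M. pds I (a J) y * pds L (monomial J) xi)"
  by (intro sum.cong refl mult.commute)
 finally show "mixed I L p y xi = (\<Sum>J\<in>M. pds I (a J) y * pds L (monomial J) xi)" .
 have "dsym I p y = (%xi. \<Sum>J\<in>M. pds I (a J) y * monomial J xi)" using dsym_expand[OF S a y] by auto
 then show "pds L (dsym I p y) xi = (\<Sum>J\<in>M. pds I (a J) y * pds L (monomial J) xi)" by (simp only: lin)
qed

text \<open>In the fibre the expansion at \<open>xi0\<close> is exact, \<open>p\<close> being a
  polynomial of degree at most \<open>k <= N\<close>. Hence the remainder vanishes to order
  \<open>N\<close> in \<open>y\<close> for every \<open>xi\<close>, not only at
  \<open>xi0\<close>.\<close>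

lemma taylor_remainder:
 assumes S: "open Om" and p: "p \<in> LS (deg_le k) Om" and k: "k <= N" and y0: "y0 \<in> Om"
 shows "jet_zero (Suc N) (%y xi. p y xi - (\<Sum>I\<in>deg_le N. \<Sum>L\<in>deg_le N. mixed I L p y0 xi0 * taylor_term k I L y0 xi0 y xi)) y0"
 unfolding jet_zero_def
proof (intro allI impI)
 fix A :: "'a list" and xi assume A: "length A < Suc N"
 obtain a where a: "!!I. smooth_on Om (a I)" "!!y xi. y \<in> Om ==> p y xi = (\<Sum>I\<in>deg_le k. a I y * monomial I xi)"
  using local_symbolsE[OF p] by blast
 define F where "F I = (\<Sum>L\<in>deg_le k. mixed I L p y0 xi0 / fact (length L) * monomial L (xi - xi0))" for I
 have F_eq: "F I = dsym I p y0 xi" for I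
 proof -
  have "dsym I p y0 = (%xi. \<Sum>J\<in>deg_le k. pds I (a J) y0 * monomial J xi)" using dsym_expand[OF S a y0] by auto
  from poly_taylor[OF this, of xi xi0]
  have pt: "dsym I p y0 xi = (\<Sum>L\<in>deg_le k. pds L (dsym I p y0) xi0 / fact (length L) * monomial L (xi - xi0))" .
  have me: "mixed I L p y0 xi0 = pds L (dsym I p y0) xi0" for L
   by (simp only: mixed_expand(1)[OF S a y0] mixed_expand(2)[OF S a y0])
  show ?thesis unfolding F_def me by (rule pt[symmetric])
 qed
 have sym: "F I = F J" if "mset I = mset J" for I J
  unfolding F_eq dsym_def by (rule pds_perm[OF S LS_smooth(1)[OF S p] that y0])
 have sh: "pds A (%y. monomial I (y - y0)) y0 = pds A (monomial I) 0" for I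
  using fun_cong[OF pds_shift_arg[OF smooth_on_monomial[OF open_UNIV], of A I "- y0"], of y0] by simp
 let ?t = "%y. \<Sum>I\<in>deg_le N. (F I / fact (length I)) * monomial I (y - y0)"
 have st: "smooth_on Om (%y. c * monomial I (y - y0))" for c :: complex and I
  by (rule smooth_on_cmult[OF S smooth_on_monomial_shift[OF S]])
 have inner: "(\<Sum>L\<in>deg_le N. mixed I L p y0 xi0 * taylor_term k I L y0 xi0 y xi) = (F I / fact (length I)) * monomial I (y - y0)" for I y
 proof -
  have "(\<Sum>L\<in>deg_le N. mixed I L p y0 xi0 * taylor_term k I L y0 xi0 y xi) =
   (\<Sum>L\<in>deg_le k. mixed I L p y0 xi0 * (monomial I (y - y0) / fact (length I) * (monomial L (xi - xi0) / fact (length L))))"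
   by (rule sum.mono_neutral_cong_right[OF finite_length_le]) (use k in \<open>auto simp: taylor_term_def\<close>)
  also have "... = (F I / fact (length I)) * monomial I (y - y0)"
   unfolding F_def sum_divide_distrib sum_distrib_right by (intro sum.cong refl) (simp add: mult_ac)
  finally show ?thesis .
 qed
 have "(%y. p y xi - (\<Sum>I\<in>deg_le N. \<Sum>L\<in>deg_le N. mixed I L p y0 xi0 * taylor_term k I L y0 xi0 y xi)) = (%y. p y xi - ?t y)"
  unfolding inner ..
 then have "dsym A (%y xi. p y xi - (\<Sum>I\<in>deg_le N. \<Sum>L\<in>deg_le N. mixed I L p y0 xi0 * taylor_term k I L y0 xi0 y xi)) y0 xi = pds A (%y. p y xi - ?t y) y0"
  unfolding dsym_def by simp
 also have "... = pds A (%y. \<Sum>s\<in>{True, False}. if s then p y xi else (-1) * ?t y) y0" by simp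
 also have "... = (\<Sum>s\<in>{True, False}. pds A (%y. if s then p y xi else (-1) * ?t y) y0)"
 proof (rule pds_sum[OF S _ y0])
  show "smooth_on Om (%y. if s then p y xi else (-1) * ?t y)" for s
  proof (cases s)
   case True
   then show ?thesis using LS_smooth(1)[OF S p, of xi] by simp
  next
   case False
   have "smooth_on Om (%y. (-1) * ?t y)" by (rule smooth_on_cmult[OF S smooth_on_sum[OF S st]])
   then show ?thesis using False by (simp only: if_False)
  qed
 qed
 also have "... = pds A (%y. p y xi) y0 + pds A (%y. (-1) * ?t y) y0" by simp
 also have "pds A (%y. (-1) * ?t y) y0 = (-1) * pds A ?t y0"
  by (rule pds_cmult[OF S smooth_on_sum[OF S st] y0])
 also have "pds A ?t y0 = (\<Sum>I\<in>deg_le N. pds A (%y. (F I / fact (length I)) * monomial I (y - y0)) y0)"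
  by (rule pds_sum[OF S st y0])
 also have "... = (\<Sum>I\<in>deg_le N. pds A (monomial I) 0 / fact (length I) * F I)"
 proof (rule sum.cong[OF refl])
  fix I
  have "pds A (%y. (F I / fact (length I)) * monomial I (y - y0)) y0 = (F I / fact (length I)) * pds A (monomial I) 0"
   unfolding sh[symmetric] by (rule pds_cmult[OF S smooth_on_monomial_shift[OF S] y0])
  also have "... = pds A (monomial I) 0 / fact (length I) * F I" by simp
  finally show "pds A (%y. (F I / fact (length I)) * monomial I (y - y0)) y0 = pds A (monomial I) 0 / fact (length I) * F I" .
 qed
 also have "... = F A" by (rule taylor_symmetric[OF sym]) (use A in auto)
 finally show "dsym A (%y xi. p y xi - (\<Sum>I\<in>deg_le N. \<Sum>L\<in>deg_le N. mixed I L p y0 xi0 * taylor_term k I L y0 xi0 y xi)) y0 xi = 0"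
  by (simp add: F_eq dsym_def)
qed

text \<open>Families of symbols, parametrized by a point of the cotangent bundle, that are finite sums of
 products of a function of the parameter with a fixed symbol.\<close>

inductive separated :: "(real^'n::finite) set => (real^'n => real^'n => 'n lsymbol) => bool" for Om where
 tensor: "a \<in> LS (deg_le d) Om ==> b \<in> LS (deg_le k) Om ==> separated Om (%y0 xi0 y xi. a y0 xi0 * b y xi)"
| plus: "separated Om e ==> separated Om e' ==> separated Om (%y0 xi0 y xi. e y0 xi0 y xi + e' y0 xi0 y xi)"

lemma separated_mult:
 assumes S: "open Om" and e: "separated Om e" and a: "a \<in> LS (deg_le d) Om" and b: "b \<in> LS (deg_le k) Om"
 shows "separated Om (%y0 xi0 y xi. a y0 xi0 * b y xi * e y0 xi0 y xi)"
 using e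
proof induction
 case (tensor a' d' b' k')
 have "separated Om (%y0 xi0 y xi. (a y0 xi0 * a' y0 xi0) * (b y xi * b' y xi))"
  by (rule separated.tensor[where d="d + d'" and k="k + k'"])
   (rule LS_mult[OF S finite_length_le _ a tensor(1)] LS_mult[OF S finite_length_le _ b tensor(2)], simp)+
 then show ?case by (simp add: mult_ac)
next
 case (plus e e')
 from separated.plus[OF plus.IH] show ?case by (simp add: distrib_left)
qed

lemma separated_one: "open Om ==> separated Om (%y0 xi0 y xi. c)"
 using separated.tensor[of "%_ _. c" 0 Om "%_ _. 1" 0] by (simp add: LS_fun)

lemma separated_diff:
 assumes S: "open Om" and e: "separated Om e" and a: "u \<in> LS (deg_le d) Om"
 shows "separated Om (%y0 xi0 y xi. (u y xi - u y0 xi0) * e y0 xi0 y xi)"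
proof -
 have 1: "(%_ _. c) \<in> LS (deg_le 0) Om" for c :: complex by (rule LS_fun[OF S]) auto
 from separated.plus[OF separated_mult[OF S e 1[of 1] a] separated_mult[OF S e a 1[of "-1"]]]
 show ?thesis by (simp add: algebra_simps)
qed

text \<open>Each linear factor is a difference of a coordinate at the running point and at the
  parameter, so multiplying by it keeps a finite sum of products.\<close>

lemma separated_taylor:
 assumes S: "open Om"
 shows "separated Om (taylor_term k I L)"
proof (cases "length L <= k")
 case True
 have y: "(%y _. cor (y $ i)) \<in> LS (deg_le 0) Om" for i
  by (rule LS_fun[OF S]) (auto intro: smooth_on_of_real[OF S] smooth_on_coord[OF S])
 have x: "(%_ xi. cor (xi $ i)) \<in> LS (deg_le 1) Om" for i
  using LS_monomial[OF finite_length_le[of 1], of "[i]" Om] by (simp add: monomial_Cons[abs_def])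
 have X: "separated Om (%y0 xi0 y xi. monomial L (xi - xi0) * c)" for c
 proof (induction L)
  case (Cons i L)
  from separated_diff[OF S Cons x[of i]] show ?case by (simp add: monomial_Cons mult.assoc)
 qed (use separated_one[OF S] in simp)
 have "separated Om (%y0 xi0 y xi. monomial I (y - y0) * (monomial L (xi - xi0) * c))" for c
 proof (induction I)
  case (Cons i I)
  from separated_diff[OF S Cons y[of i]] show ?case by (simp add: monomial_Cons mult.assoc)
 qed (use X in simp)
 moreover have "taylor_term k I L = (%y0 xi0 y xi. monomial I (y - y0) * (monomial L (xi - xi0) * (1 / (fact (length I) * fact (length L)))))"
  using True by (auto simp: taylor_term_def fun_eq_iff)
 ultimately show ?thesis by (simp only:)
next
 case False
 then have "taylor_term k I L = (%y0 xi0 y xi. 0)" by (auto simp: taylor_term_def fun_eq_iff)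
 then show ?thesis using separated_one[OF S, of 0] by simp
qed

lemma separated_local:
 assumes S: "open Om" and e: "separated Om e"
 shows "\<exists>K. \<forall>y0 xi0. e y0 xi0 \<in> LS (deg_le K) Om"
 using e
proof induction
 case (tensor a d b k)
 then show ?case using LS_cscale[OF S] by blast
next
 case (plus e e')
 obtain K where K: "!!y0 xi0. e y0 xi0 \<in> LS (deg_le K) Om" using plus.IH(1) by blast
 obtain K' where K': "!!y0 xi0. e' y0 xi0 \<in> LS (deg_le K') Om" using plus.IH(2) by blast
 have "(%y xi. e y0 xi0 y xi + e' y0 xi0 y xi) \<in> LS (deg_le (K + K')) Om" for y0 xi0
  by (intro LS_add[OF S] LS_mono[OF S finite_length_le _ K] LS_mono[OF S finite_length_le _ K']) auto
 then show ?case by blast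
qed

section \<open>The product is of finite order, and the equivalence with the weight 1/2\<close>

context quantization
begin

text \<open>The top part \<open>h\<close> of \<open>t\<close> is the top part of
  \<open>lq c t\<close>, so its jets vanish; \<open>lq c h\<close> loses at most
  \<open>Suc k\<close> orders, and \<open>lq c (t - h)\<close> is treated by induction. The number
  \<open>k (k + 1)\<close> bounds the accumulated loss.\<close>

lemma lq_jet_inv:
 fixes t :: "'n lsymbol"
 assumes c: "c \<in> \<A>" and y: "y \<in> img c"
 shows "t \<in> LS (deg_le k) (img c) ==> jet_zero (N + k * (k + 1)) (lq c t) y ==> jet_zero N t y"
proof (induction k arbitrary: t)
 case 0
 have "(%y xi. lq c t y xi - t y xi) \<in> LS (deg_less 0) (img c)" by (rule lq_local(2)[OF c 0(1)])
 then have "lq c t z xi = t z xi" if "z \<in> img c" for z xi using that by (auto simp: local_symbols_def)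
 from jet_zero_cong[OF open_image[OF c] y this] 0(2) show ?case by simp
next
 case (Suc k)
 let ?Om = "img c"
 note o = open_image[OF c] and t = Suc.prems(1)
 define h where "h = hom_part (Suc k) t"
 define t' where "t' y xi = (\<Sum>d\<le>k. hom_part d t y xi)" for y xi
 have heq: "h \<in> LS (deg_eq (Suc k)) ?Om" unfolding h_def by (rule LS_hom_part[OF o t])
 note h = deg_eq_le[OF o heq order_refl]
 have t'k: "t' \<in> LS (deg_le k) ?Om"
  unfolding t'_def by (rule LS_sum[OF o]) (rule deg_eq_le[OF o LS_hom_part[OF o t]], simp)
 have t'S: "t' \<in> LS (deg_le (Suc k)) ?Om" by (rule LS_mono[OF o finite_length_le _ t'k]) auto
 have split: "t z xi = t' z xi + h z xi" if "z \<in> ?Om" for z xi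
  using hom_part_sum[OF t that, of xi] by (simp add: t'_def h_def)
 let ?M = "N + Suc k * (Suc k + 1)"
 have h_top: "hom_part (Suc k) (lq c t) z xi = h z xi" if z: "z \<in> ?Om" for z xi
 proof -
  note n = lq_local(2)[OF c t]
  have "hom_part (Suc k) (lq c t) z xi = hom_part (Suc k) (%y xi. 1 * t y xi + 1 * (lq c t y xi - t y xi)) z xi"
   by (rule hom_part_cong) simp
  also have "... = 1 * hom_part (Suc k) t z xi + 1 * hom_part (Suc k) (%y xi. lq c t y xi - t y xi) z xi"
   by (rule hom_part_linear[OF o t n z])
  also have "hom_part (Suc k) (%y xi. lq c t y xi - t y xi) z xi = 0"
   by (rule hom_part_eq_0[OF n finite_length_less z]) auto
  finally show ?thesis by (simp add: h_def)
 qed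
 have jh: "jet_zero ?M h y"
  using jet_zero_hom_part[OF o lq_local(1)[OF c t] y Suc.prems(2), where d="Suc k"] jet_zero_cong[OF o y h_top, where N="?M"] by simp
 have jlh: "jet_zero (N + k * (k + 1)) (lq c h) y"
  by (rule lq_jet[OF c y h]) (rule jet_zero_mono[OF jh], simp)
 have "lq c t' z xi = 1 * lq c t z xi + (-1) * lq c h z xi" if z: "z \<in> ?Om" for z xi
 proof -
  have "lq c t' = lq c (%y xi. 1 * t y xi + (-1) * h y xi)" by (rule lq_cong[OF c]) (simp add: split)
  then show ?thesis using lq_linear[OF c z t h, where a=1 and b="-1" and xi=xi] by simp
 qed
 note ct' = jet_zero_cong[OF o y this]
 have "jet_zero (N + k * (k + 1)) (%y xi. 1 * lq c t y xi + (-1) * lq c h y xi) y"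
  by (rule jet_zero_linear[OF o y lq_local(1)[OF c t] lq_local(1)[OF c h] jet_zero_mono[OF Suc.prems(2)] jlh]) simp
 then have "jet_zero (N + k * (k + 1)) (lq c t') y" by (simp only: ct')
 from Suc.IH[OF t'k this] have jt': "jet_zero N t' y" .
 have "jet_zero N (%y xi. 1 * t' y xi + 1 * h y xi) y"
  by (rule jet_zero_linear[OF o y t'k h jt' jet_zero_mono[OF jh]]) simp
 moreover have "1 * t' z xi + 1 * h z xi = t z xi" if "z \<in> ?Om" for z xi using split[OF that, of xi] by simp
 note jet_zero_cong[OF o y this]
 ultimately show ?case by (simp only:)
qed

text \<open>Three losses add up: \<open>a\<close> or \<open>b\<close> for quantizing the factor, up
  to \<open>a\<close> for \<open>sharp\<close>, and \<open>(a + b) (a + b + 1)\<close> for returning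
  from the full symbol to the symbol.\<close>

lemma circ_jet:
 assumes c: "c \<in> \<A>" and y: "y \<in> img c" and P: "P \<in> SL a (fst c)" and R: "R \<in> SL b (fst c)"
  and j: "jet_zero (N + (a + b) * (a + b + 1) + a + b) (P c) y \<or> jet_zero (N + (a + b) * (a + b + 1) + a + b) (R c) y"
 shows "jet_zero N (circ (fst c) P R c) y"
proof -
 let ?Om = "img c" and ?M = "N + (a + b) * (a + b + 1)"
 note o = open_image[OF c] and W = fst_AD[OF c]
 note m = circ_mem[OF W P R]
 have p: "P c \<in> LS (deg_le a) ?Om" using symbol_local[OF P c] by simp
 have r: "R c \<in> LS (deg_le b) ?Om" using symbol_local[OF R c] by simp
 have t: "circ (fst c) P R c \<in> LS (deg_le (a + b)) ?Om" using symbol_local[OF m c] by simp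
 have eq: "lq c (circ (fst c) P R c) z xi = sharp a (lq c (P c)) (lq c (R c)) z xi" if z: "z \<in> ?Om" for z xi
  using sig_circ[OF W P R c, where y=z and xi=xi] z by (simp add: sig_lq[OF c symbolsI[OF m]] sig_lq[OF c symbolsI[OF P]] sig_lq[OF c symbolsI[OF R]])
 have "jet_zero ?M (lq c (P c)) y \<or> jet_zero (?M + a) (lq c (R c)) y"
  using j
 proof
  assume "jet_zero (N + (a + b) * (a + b + 1) + a + b) (P c) y"
  then have "jet_zero (?M + a) (P c) y" by (rule jet_zero_mono) simp
  from lq_jet[OF c y p this] show ?thesis ..
 next
  assume "jet_zero (N + (a + b) * (a + b + 1) + a + b) (R c) y"
  from lq_jet[OF c y r this] show ?thesis ..
 qed
 from jet_zero_sharp[OF o y lq_local(1)[OF c p] lq_local(1)[OF c r] this]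
 have "jet_zero ?M (lq c (circ (fst c) P R c)) y" using jet_zero_cong[OF o y eq, where N="?M"] by simp
 then show ?thesis by (rule lq_jet_inv[OF c y t])
qed

text \<open>The order in \<open>circ_jet\<close> for \<open>N = 1\<close>, which is vanishing of the
  value at the point.\<close>

definition star_order :: "nat => nat => nat" where
 "star_order k l = 1 + (k + l) * (k + l + 1) + k + l"

lemma star_jet:
 assumes c: "c \<in> \<A>" and y: "y \<in> img c" and P: "P \<in> SL k (fst c)" and R: "R \<in> SL l (fst c)"
  and j: "jet_zero (star_order k l) (P c) y \<or> jet_zero (star_order k l) (R c) y"
 shows "star (fst c) P R m c y xi = 0"
proof -
 note o = open_image[OF c] and W = fst_AD[OF c] and oW = chart_open[OF c]
 have p: "P c \<in> LS (deg_le k) (img c)" using symbol_local[OF P c] by simp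
 have r: "R c \<in> LS (deg_le l) (img c)" using symbol_local[OF R c] by simp
 have "hom_sym d (circ (fst c) (hom_sym a P) (hom_sym b R)) c y xi = 0" if a: "a <= k" and b: "b <= l" for a b d
 proof -
  have "(a + b) * (a + b + 1) <= (k + l) * (k + l + 1)" by (rule mult_le_mono) (use a b in auto)
  then have le: "1 + (a + b) * (a + b + 1) + a + b <= star_order k l" using a b by (simp add: star_order_def)
  have "jet_zero 1 (circ (fst c) (hom_sym a P) (hom_sym b R) c) y"
  proof (rule circ_jet[OF c y hom_sym_mem[OF oW P] hom_sym_mem[OF oW R]])
   show "jet_zero (1 + (a + b) * (a + b + 1) + a + b) (hom_sym a P c) y \<or> jet_zero (1 + (a + b) * (a + b + 1) + a + b) (hom_sym b R c) y"
    using j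
   proof
    assume "jet_zero (star_order k l) (P c) y"
    from jet_zero_mono[OF jet_zero_hom_part[OF o p y this, where d=a] le] show ?thesis unfolding hom_sym_def ..
   next
    assume "jet_zero (star_order k l) (R c) y"
    from jet_zero_mono[OF jet_zero_hom_part[OF o r y this, where d=b] le] show ?thesis unfolding hom_sym_def ..
   qed
  qed
  then have "dsym [] (circ (fst c) (hom_sym a P) (hom_sym b R) c) y eta = 0" for eta
   unfolding jet_zero_def by simp
  then have z: "circ (fst c) (hom_sym a P) (hom_sym b R) c y eta = 0" for eta by (simp add: dsym_def)
  show ?thesis unfolding hom_sym_def[of d] by (rule hom_part_zero) (rule z)
 qed
 then show ?thesis
  unfolding star_formula[OF W P R] star_sum_def[OF W] by (intro sum.neutral ballI) auto
qed

lemma star_setsum: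
 assumes W: "W \<in> AD" and R: "R \<in> SY W" and T: "finite T" and P: "!!s. s \<in> T ==> P s \<in> SY W"
 shows "star W (%c y xi. \<Sum>s\<in>T. a s * P s c y xi) R m c y xi = (\<Sum>s\<in>T. a s * star W (P s) R m c y xi)"
  and "star W R (%c y xi. \<Sum>s\<in>T. a s * P s c y xi) m c y xi = (\<Sum>s\<in>T. a s * star W R (P s) m c y xi)"
proof -
 note oW = adapted_open[OF W]
 have "star W (%c y xi. \<Sum>s\<in>T. a s * P s c y xi) R m c y xi = (\<Sum>s\<in>T. a s * star W (P s) R m c y xi) \<and>
  star W R (%c y xi. \<Sum>s\<in>T. a s * P s c y xi) m c y xi = (\<Sum>s\<in>T. a s * star W R (P s) m c y xi)"
  using T P
 proof (induction T)
  case empty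
  have z: "(%c y xi. 0) \<in> SY W" by (rule symbolsI[OF symbols_le_zero[of 0]])
  from fun_cong[OF fun_cong[OF fun_cong[OF fun_cong[OF star_linear(1)[OF W z z R, of 0 0]]]], of m c y xi]
   fun_cong[OF fun_cong[OF fun_cong[OF fun_cong[OF star_linear(2)[OF W z z R, of 0 0]]]], of m c y xi]
  show ?case by simp
 next
  case (insert s T)
  have m: "(%c y xi. \<Sum>s\<in>T. a s * P s c y xi) \<in> SY W" by (rule symbols_sum[OF oW]) (simp add: insert.prems)
  have p: "P s \<in> SY W" by (simp add: insert.prems)
  from fun_cong[OF fun_cong[OF fun_cong[OF fun_cong[OF star_linear(1)[OF W p m R, of "a s" 1]]]], of m c y xi]
   fun_cong[OF fun_cong[OF fun_cong[OF fun_cong[OF star_linear(2)[OF W p m R, of "a s" 1]]]], of m c y xi]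
  show ?case using insert by simp
 qed
 then show "star W (%c y xi. \<Sum>s\<in>T. a s * P s c y xi) R m c y xi = (\<Sum>s\<in>T. a s * star W (P s) R m c y xi)"
  and "star W R (%c y xi. \<Sum>s\<in>T. a s * P s c y xi) m c y xi = (\<Sum>s\<in>T. a s * star W R (P s) m c y xi)" by auto
qed

text \<open>The product on local symbols of one chart. Taylor terms are given by formulas in
  coordinates and are not symbols on the whole manifold.\<close>

definition lstar :: "('m, 'n) chart => nat => 'n lsymbol => 'n lsymbol => 'n lsymbol" where
 "lstar c m p r = star (fst c) (symbol_from \<A> c p) (symbol_from \<A> c r) m c"

context
 fixes c :: "('m, 'n) chart" and m :: nat
 assumes c: "c \<in> \<A>"
begin

lemma lstar_sum:
 assumes T: "finite T" and p: "!!s. s \<in> T ==> p s \<in> LS (deg_le k) (img c)" and r: "r \<in> LS (deg_le l) (img c)"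
 shows "lstar c m (%y xi. \<Sum>s\<in>T. a s * p s y xi) r y xi = (\<Sum>s\<in>T. a s * lstar c m (p s) r y xi)"
  and "lstar c m r (%y xi. \<Sum>s\<in>T. a s * p s y xi) y xi = (\<Sum>s\<in>T. a s * lstar c m r (p s) y xi)"
proof -
 have e: "symbol_from \<A> c (%y xi. \<Sum>s\<in>T. a s * p s y xi) = (%c' y xi. \<Sum>s\<in>T. a s * symbol_from \<A> c (p s) c' y xi)"
  by (auto simp: symbol_from_def fun_eq_iff)
 show "lstar c m (%y xi. \<Sum>s\<in>T. a s * p s y xi) r y xi = (\<Sum>s\<in>T. a s * lstar c m (p s) r y xi)"
  unfolding lstar_def e by (rule star_setsum(1)[OF fst_AD[OF c] symbol_from_symbols[OF c r] T symbol_from_symbols[OF c p]])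
 show "lstar c m r (%y xi. \<Sum>s\<in>T. a s * p s y xi) y xi = (\<Sum>s\<in>T. a s * lstar c m r (p s) y xi)"
  unfolding lstar_def e by (rule star_setsum(2)[OF fst_AD[OF c] symbol_from_symbols[OF c r] T symbol_from_symbols[OF c p]])
qed

lemma lstar_linear:
 assumes p: "p \<in> LS (deg_le k) (img c)" "p' \<in> LS (deg_le k) (img c)" and r: "r \<in> LS (deg_le l) (img c)"
 shows "lstar c m (%y xi. a * p y xi + b * p' y xi) r y xi = a * lstar c m p r y xi + b * lstar c m p' r y xi"
  and "lstar c m r (%y xi. a * p y xi + b * p' y xi) y xi = a * lstar c m r p y xi + b * lstar c m r p' y xi"
 using lstar_sum[of "{True, False}" "%s. if s then p else p'" k r l "%s. if s then a else b" y xi] assms by auto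

lemma lstar_jet:
 assumes y: "y \<in> img c" and p: "p \<in> LS (deg_le k) (img c)" and r: "r \<in> LS (deg_le l) (img c)"
  and j: "jet_zero (star_order k l) p y \<or> jet_zero (star_order k l) r y"
 shows "lstar c m p r y xi = 0"
proof -
 have "symbol_from \<A> c q c z xi = q z xi" if "z \<in> img c" for q z xi by (rule symbol_from_chart[OF c that])
 from jet_zero_cong[OF open_image[OF c] y this]
 have "jet_zero (star_order k l) (symbol_from \<A> c p c) y \<or> jet_zero (star_order k l) (symbol_from \<A> c r c) y" using j by simp
 then show ?thesis unfolding lstar_def by (rule star_jet[OF c y symbol_from_mem[OF c p] symbol_from_mem[OF c r]])
qed

lemma lstar_local:
 assumes p: "p \<in> LS (deg_le k) (img c)" and r: "r \<in> LS (deg_le l) (img c)"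
 shows "\<exists>d. lstar c m p r \<in> LS (deg_le d) (img c)"
proof -
 have "star (fst c) (symbol_from \<A> c p) (symbol_from \<A> c r) m \<in> SY (fst c)"
  by (rule star_mem[OF fst_AD[OF c] symbol_from_symbols[OF c p] symbol_from_symbols[OF c r]])
 then obtain d where "star (fst c) (symbol_from \<A> c p) (symbol_from \<A> c r) m \<in> SL d (fst c)" by (rule symbolsE)
 from symbol_local[OF this c] show ?thesis unfolding lstar_def by auto
qed

text \<open>The arguments depend on the point at which the product is evaluated, so smoothness in
  that point is not immediate. For finite sums of products, bilinearity moves the functions of the
  parameter outside, and products of fixed symbols remain.\<close>

lemma lstar_separated:
 assumes e: "separated (img c) e" and e': "separated (img c) e'"
 shows "\<exists>d. (%y xi. lstar c m (e y xi) (e' y xi) y xi) \<in> LS (deg_le d) (img c)"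
proof -
 let ?Om = "img c"
 note o = open_image[OF c]
 have add: "\<exists>d. (%y xi. u y xi + v y xi) \<in> LS (deg_le d) ?Om"
  if u: "\<exists>d. u \<in> LS (deg_le d) ?Om" and v: "\<exists>d. v \<in> LS (deg_le d) ?Om" for u v
 proof -
  obtain d where d: "u \<in> LS (deg_le d) ?Om" using u by blast
  obtain d' where d': "v \<in> LS (deg_le d') ?Om" using v by blast
  have "(%y xi. u y xi + v y xi) \<in> LS (deg_le (d + d')) ?Om"
   by (intro LS_add[OF o] LS_mono[OF o finite_length_le _ d] LS_mono[OF o finite_length_le _ d']) auto
  then show ?thesis by blast
 qed
 have mult: "\<exists>d. (%y xi. u y xi * v y xi) \<in> LS (deg_le d) ?Om"
  if u: "u \<in> LS (deg_le k) ?Om" and v: "\<exists>d. v \<in> LS (deg_le d) ?Om" for u v k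
 proof -
  obtain d where d: "v \<in> LS (deg_le d) ?Om" using v by blast
  have "(%y xi. u y xi * v y xi) \<in> LS (deg_le (k + d)) ?Om"
   by (rule LS_mult[OF o finite_length_le _ u d]) auto
  then show ?thesis by blast
 qed
 have one: "\<exists>d. (%y xi. lstar c m b (e' y xi) y xi) \<in> LS (deg_le d) ?Om" if b: "b \<in> LS (deg_le k) ?Om" for b k
  using e'
 proof induction
  case (tensor a' d' b' k')
  have "lstar c m b (%z eta. a' y xi * b' z eta) y xi = a' y xi * lstar c m b b' y xi" for y xi
   using lstar_linear(2)[OF tensor(2,2) b, where a="a' y xi" and b=0 and y=y and xi=xi] by simp
  then show ?case using mult[OF tensor(1) lstar_local[OF b tensor(2)]] by simp
 next
  case (plus f f')
  obtain K where K: "!!y0 xi0. f y0 xi0 \<in> LS (deg_le K) ?Om" using separated_local[OF o plus(1)] by blast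
  obtain K' where K': "!!y0 xi0. f' y0 xi0 \<in> LS (deg_le K') ?Om" using separated_local[OF o plus(2)] by blast
  have f: "f y0 xi0 \<in> LS (deg_le (K + K')) ?Om" "f' y0 xi0 \<in> LS (deg_le (K + K')) ?Om" for y0 xi0
   by (rule LS_mono[OF o finite_length_le _ K] LS_mono[OF o finite_length_le _ K'], auto)+
  have "lstar c m b (%z eta. f y xi z eta + f' y xi z eta) y xi = lstar c m b (f y xi) y xi + lstar c m b (f' y xi) y xi" for y xi
   using lstar_linear(2)[OF f[of y xi] b, where a=1 and b=1 and y=y and xi=xi] by simp
  then show ?case using add[OF plus.IH] by simp
 qed
 obtain L where L: "!!y0 xi0. e' y0 xi0 \<in> LS (deg_le L) ?Om" using separated_local[OF o e'] by blast
 show ?thesis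
  using e
 proof induction
  case (tensor a d b k)
  have "lstar c m (%z eta. a y xi * b z eta) (e' y xi) y xi = a y xi * lstar c m b (e' y xi) y xi" for y xi
   using lstar_linear(1)[OF tensor(2,2) L[of y xi], where a="a y xi" and b=0 and y=y and xi=xi] by simp
  then show ?case using mult[OF tensor(1) one[OF tensor(2)]] by simp
 next
  case (plus f f')
  obtain K where K: "!!y0 xi0. f y0 xi0 \<in> LS (deg_le K) ?Om" using separated_local[OF o plus(1)] by blast
  obtain K' where K': "!!y0 xi0. f' y0 xi0 \<in> LS (deg_le K') ?Om" using separated_local[OF o plus(2)] by blast
  have f: "f y0 xi0 \<in> LS (deg_le (K + K')) ?Om" "f' y0 xi0 \<in> LS (deg_le (K + K')) ?Om" for y0 xi0
   by (rule LS_mono[OF o finite_length_le _ K] LS_mono[OF o finite_length_le _ K'], auto)+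
  have "lstar c m (%z eta. f y xi z eta + f' y xi z eta) (e' y xi) y xi = lstar c m (f y xi) (e' y xi) y xi + lstar c m (f' y xi) (e' y xi) y xi" for y xi
   using lstar_linear(1)[OF f[of y xi] L[of y xi], where a=1 and b=1 and y=y and xi=xi] by simp
  then show ?case using add[OF plus.IH] by simp
 qed
qed

text \<open>The Taylor remainder at the evaluation point has vanishing jets of high order, so
  \<open>lstar_jet\<close> removes it; in the remaining finite sum the derivatives of
  \<open>p\<close> appear as scalars.\<close>

lemma lstar_taylor:
 assumes y: "y \<in> img c" and p: "p \<in> LS (deg_le k) (img c)" and r: "r \<in> LS (deg_le l) (img c)"
  and N: "star_order k l <= N" "star_order l k <= N"
 defines "D \<equiv> deg_le N \<times> deg_le N :: ('n list \<times> 'n list) set"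
 shows "lstar c m p r y xi = (\<Sum>s\<in>D. mixed (fst s) (snd s) p y xi * lstar c m (taylor_term k (fst s) (snd s) y xi) r y xi)"
  and "lstar c m r p y xi = (\<Sum>s\<in>D. mixed (fst s) (snd s) p y xi * lstar c m r (taylor_term k (fst s) (snd s) y xi) y xi)"
proof -
 let ?Om = "img c"
 note o = open_image[OF c]
 have kN: "k <= N" using N by (simp add: star_order_def)
 have fin: "finite D" by (simp add: D_def)
 define q where "q z eta = (\<Sum>s\<in>D. mixed (fst s) (snd s) p y xi * taylor_term k (fst s) (snd s) y xi z eta)" for z eta
 define w where "w z eta = p z eta - q z eta" for z eta
 have t: "taylor_term k (fst s) (snd s) y xi \<in> LS (deg_le k) ?Om" for s :: "'n list \<times> 'n list" by (rule taylor_term_local[OF o])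
 have q: "q \<in> LS (deg_le k) ?Om" unfolding q_def by (intro LS_sum LS_cscale o t)
 have w: "w \<in> LS (deg_le k) ?Om" unfolding w_def by (rule LS_diff[OF o p q])
 have "w = (%z eta. p z eta - (\<Sum>I\<in>deg_le N. \<Sum>L\<in>deg_le N. mixed I L p y xi * taylor_term k I L y xi z eta))"
  by (simp add: w_def[abs_def] q_def D_def sum.cartesian_product split_def)
 then have jw: "jet_zero (Suc N) w y" using taylor_remainder[OF o p kN y, of xi] by simp
 have p_eq: "p = (%z eta. 1 * w z eta + 1 * q z eta)" by (auto simp: w_def)
 have q_eq: "q = (%z eta. \<Sum>s\<in>D. mixed (fst s) (snd s) p y xi * taylor_term k (fst s) (snd s) y xi z eta)" by (intro ext) (rule q_def)
 have "lstar c m p r y xi = 1 * lstar c m w r y xi + 1 * lstar c m q r y xi"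
  by (subst p_eq) (rule lstar_linear(1)[OF w q r])
 also have "lstar c m w r y xi = 0"
  by (rule lstar_jet[OF y w r]) (rule disjI1, rule jet_zero_mono[OF jw], use N in simp)
 also have "lstar c m q r y xi = (\<Sum>s\<in>D. mixed (fst s) (snd s) p y xi * lstar c m (taylor_term k (fst s) (snd s) y xi) r y xi)"
  by (subst q_eq) (rule lstar_sum(1)[OF fin t r])
 finally show "lstar c m p r y xi = (\<Sum>s\<in>D. mixed (fst s) (snd s) p y xi * lstar c m (taylor_term k (fst s) (snd s) y xi) r y xi)" by simp
 have "lstar c m r p y xi = 1 * lstar c m r w y xi + 1 * lstar c m r q y xi"
  by (subst p_eq) (rule lstar_linear(2)[OF w q r])
 also have "lstar c m r w y xi = 0"
  by (rule lstar_jet[OF y r w]) (rule disjI2, rule jet_zero_mono[OF jw], use N in simp)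
 also have "lstar c m r q y xi = (\<Sum>s\<in>D. mixed (fst s) (snd s) p y xi * lstar c m r (taylor_term k (fst s) (snd s) y xi) y xi)"
  by (subst q_eq) (rule lstar_sum(2)[OF fin t r])
 finally show "lstar c m r p y xi = (\<Sum>s\<in>D. mixed (fst s) (snd s) p y xi * lstar c m r (taylor_term k (fst s) (snd s) y xi) y xi)" by simp
qed

lemma star_lstar:
 assumes P: "P \<in> SY UNIV" and R: "R \<in> SY UNIV" and y: "y \<in> img c"
 shows "star UNIV P R m c y xi = lstar c m (P c) (R c) y xi"
proof -
 have e: "restrict_symbol \<A> (fst c) S = symbol_from \<A> c (S c)" if S: "S \<in> SY UNIV" for S
 proof -
  obtain k where k: "S \<in> SL k UNIV" using S by (rule symbolsE)
  show ?thesis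
  proof (rule symbol_eqI[OF c])
   show "restrict_symbol \<A> (fst c) S \<in> SY (fst c)" by (rule symbolsI[OF restrict_symbol_mem[OF open_UNIV subset_UNIV k]])
   show "symbol_from \<A> c (S c) \<in> SY (fst c)" by (rule symbol_from_symbols[OF c symbol_local[OF k c]])
   show "restrict_symbol \<A> (fst c) S c z eta = symbol_from \<A> c (S c) c z eta" if "z \<in> img c" for z eta
    using that by (simp add: restrict_symbol_def c symbol_from_chart[OF c])
  qed
 qed
 have "star UNIV P R m c y xi = restrict_symbol \<A> (fst c) (star UNIV P R m) c y xi" by (simp add: restrict_symbol_def c y)
 also have "restrict_symbol \<A> (fst c) (star UNIV P R m) = star (fst c) (restrict_symbol \<A> (fst c) P) (restrict_symbol \<A> (fst c) R) m"
  by (rule restrict_star[OF UNIV_AD fst_AD[OF c] subset_UNIV P R])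
 finally show ?thesis by (simp only: e[OF P] e[OF R] lstar_def)
qed

end

lemma star_bidifferential: "bidifferential \<A> UNIV (%P R. star UNIV P R m)"
 unfolding bidifferential_def
proof (intro allI)
 fix k l
 \<comment> \<open>A common bound for the expansion in the first and in the second argument.\<close>
 define N where "N = star_order k l + star_order l k"
 let ?D = "deg_le N :: 'n list set"
 show "\<exists>N. \<forall>c\<in>\<A>. \<exists>C. (\<forall>I J I' J'. \<exists>d. C I J I' J' \<in> LS (deg_le d) (img c)) \<and>
  (\<forall>P\<in>SL k UNIV. \<forall>R\<in>SL l UNIV. \<forall>y\<in>img c. \<forall>xi. star UNIV P R m c y xi =
   (\<Sum>I\<in>deg_le N. \<Sum>J\<in>deg_le N. \<Sum>I'\<in>deg_le N. \<Sum>J'\<in>deg_le N. C I J I' J' y xi * mixed I J (P c) y xi * mixed I' J' (R c) y xi))"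
 proof (intro exI[of _ N] ballI)
  fix c assume c: "c \<in> \<A>"
  \<comment> \<open>The coefficients of a bidifferential operator are its values on Taylor monomials
    centred at the point of evaluation.\<close>
  define C where "C I J I' J' y xi = lstar c m (taylor_term k I J y xi) (taylor_term l I' J' y xi) y xi" for I J I' J' y xi
  note o = open_image[OF c]
  show "\<exists>C. (\<forall>I J I' J'. \<exists>d. C I J I' J' \<in> LS (deg_le d) (img c)) \<and>
   (\<forall>P\<in>SL k UNIV. \<forall>R\<in>SL l UNIV. \<forall>y\<in>img c. \<forall>xi. star UNIV P R m c y xi =
    (\<Sum>I\<in>deg_le N. \<Sum>J\<in>deg_le N. \<Sum>I'\<in>deg_le N. \<Sum>J'\<in>deg_le N. C I J I' J' y xi * mixed I J (P c) y xi * mixed I' J' (R c) y xi))"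
  proof (intro exI[of _ C] conjI allI ballI)
   show "\<exists>d. C I J I' J' \<in> LS (deg_le d) (img c)" for I J I' J'
    using lstar_separated[OF c separated_taylor[OF o] separated_taylor[OF o]] unfolding C_def[abs_def] .
   fix P R y xi assume P: "P \<in> SL k UNIV" and R: "R \<in> SL l UNIV" and y: "y \<in> img c"
   have p: "P c \<in> LS (deg_le k) (img c)" by (rule symbol_local[OF P c])
   have r: "R c \<in> LS (deg_le l) (img c)" by (rule symbol_local[OF R c])
   let ?S = "?D \<times> ?D" and ?mp = "%s. mixed (fst s) (snd s) (P c) y xi" and ?mr = "%s. mixed (fst s) (snd s) (R c) y xi"
   have N1: "star_order k l <= N" "star_order l k <= N" by (auto simp: N_def)
   have "star UNIV P R m c y xi = lstar c m (P c) (R c) y xi" by (rule star_lstar[OF c symbolsI[OF P] symbolsI[OF R] y])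
   also have "... = (\<Sum>s\<in>?S. ?mp s * lstar c m (taylor_term k (fst s) (snd s) y xi) (R c) y xi)"
    by (rule lstar_taylor(1)[OF c y p r N1])
   also have "... = (\<Sum>s\<in>?S. ?mp s * (\<Sum>t\<in>?S. ?mr t * C (fst s) (snd s) (fst t) (snd t) y xi))"
    unfolding C_def by (intro sum.cong refl arg_cong2[of _ _ _ _ "(*)"] lstar_taylor(2)[OF c y r taylor_term_local[OF o] N1(2,1)])
   also have "... = (\<Sum>s\<in>?S. \<Sum>t\<in>?S. C (fst s) (snd s) (fst t) (snd t) y xi * ?mp s * ?mr t)"
    unfolding sum_distrib_left by (intro sum.cong refl) (simp add: mult_ac)
   also have "... = (\<Sum>I\<in>?D. \<Sum>J\<in>?D. \<Sum>I'\<in>?D. \<Sum>J'\<in>?D. C I J I' J' y xi * mixed I J (P c) y xi * mixed I' J' (R c) y xi)"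
   proof -
    have "(\<Sum>s\<in>?S. h s) = (\<Sum>I\<in>?D. \<Sum>J\<in>?D. h (I, J))" for h :: "'n list \<times> 'n list => complex"
     by (simp add: sum.cartesian_product split_def)
    then show ?thesis by (simp only: fst_conv snd_conv)
   qed
   finally show "star UNIV P R m c y xi = (\<Sum>I\<in>?D. \<Sum>J\<in>?D. \<Sum>I'\<in>?D. \<Sum>J'\<in>?D. C I J I' J' y xi * mixed I J (P c) y xi * mixed I' J' (R c) y xi)" .
  qed
 qed
qed

section \<open>The two directions of the equivalence\<close>

lemma poisson_gradprod: "poisson p r y xi = gradprod p r y xi - gradprod r p y xi"
 by (simp add: poisson_def gradprod_def sum_subtractf mult.commute)

lemma star_product_half:
 assumes half: "lam = 1 / 2"
 shows "star_product \<A> UNIV (star UNIV)"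
 unfolding star_product_def
proof (intro conjI ballI allI)
 show "bilinear_product \<A> UNIV (star UNIV)"
  unfolding bilinear_product_def
 proof (intro conjI ballI allI)
  fix P R T a b m assume P: "P \<in> SY UNIV" and R: "R \<in> SY UNIV" and T: "T \<in> SY UNIV"
  show "star UNIV (%c y xi. a * P c y xi + b * R c y xi) T m = (%c y xi. a * star UNIV P T m c y xi + b * star UNIV R T m c y xi)"
   by (rule fun_cong[OF star_linear(1)[OF UNIV_AD P R T]])
  show "star UNIV T (%c y xi. a * P c y xi + b * R c y xi) m = (%c y xi. a * star UNIV T P m c y xi + b * star UNIV T R m c y xi)"
   by (rule fun_cong[OF star_linear(2)[OF UNIV_AD P R T]])
 qed (rule star_mem[OF UNIV_AD])
 show "associative_product \<A> UNIV (star UNIV)"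
  unfolding associative_product_def by (intro ballI allI star_assoc[OF UNIV_AD])
 show "bidifferential \<A> UNIV (%P R. star UNIV P R m)" for m by (rule star_bidifferential)
 fix P R c y xi assume P: "P \<in> SY UNIV" and R: "R \<in> SY UNIV" and c: "c \<in> \<A>" and y: "y \<in> img c"
 obtain k where k: "P \<in> SL k UNIV" using P by (rule symbolsE)
 obtain l where l: "R \<in> SL l UNIV" using R by (rule symbolsE)
 show "star UNIV P R 0 c y xi = P c y xi * R c y xi" by (rule star_low_order(1)[OF k l c y])
 show "star UNIV P R 1 c y xi = \<i> / 2 * poisson (P c) (R c) y xi"
  using star_low_order(2)[OF k l c y, of xi] unfolding poisson_gradprod half by (simp add: field_simps)
qed

text \<open>Tested on conjugate variables: near a point, \<open>P = xi_i\<close> and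
  \<open>R = y_i\<close>, with bracket 1. The first-order term is \<open>i (1 - lam)\<close>, and a
  star-product demands \<open>i / 2\<close>. Only the germs of the two symbols matter, so cut-off
  extensions suffice.\<close>

lemma star_product_weight:
 assumes star: "star_product \<A> UNIV (star UNIV)"
 shows "lam = 1 / 2"
proof -
 obtain c where c: "c \<in> \<A>" and x: "(undefined :: 'm) \<in> fst c" by (rule chart_cover)
 define y where "y = snd c undefined"
 have y: "y \<in> img c" using c x by (simp add: y_def)
 note o = open_image[OF c]
 define i :: 'n where "i = undefined"
 let ?p = "%(_ :: real^'n) xi :: real^'n. cor (xi $ i)" and ?r = "%(y :: real^'n) (_ :: real^'n). cor (y $ i)"
 have p: "?p \<in> LS (deg_le 1) (img c)"
  using LS_monomial[OF finite_length_le[of 1], of "[i]" "img c"] by (simp add: monomial_Cons[abs_def])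
 have r: "?r \<in> LS (deg_le 0) (img c)"
  by (rule LS_fun[OF o]) (auto intro: smooth_on_of_real[OF o] smooth_on_coord[OF o])
 obtain P S where P: "P \<in> SL 1 UNIV" and S: "open S" "y \<in> S" and PS: "!!z xi. z \<in> S ==> P c z xi = ?p z xi"
  by (rule symbol_extend[OF c open_UNIV y p]) (rule that)
 obtain R S' where R: "R \<in> SL 0 UNIV" and S': "open S'" "y \<in> S'" and RS: "!!z xi. z \<in> S' ==> R c z xi = ?r z xi"
  by (rule symbol_extend[OF c open_UNIV y r]) (rule that)
 have dP: "pd j (P c y) 0 = (if j = i then 1 else 0)" for j
 proof -
  have "P c y = (%xi. cor (xi $ i))" by (rule ext) (rule PS[OF S(2)])
  then show ?thesis using pd_of_real[OF smooth_on_differentiable[OF smooth_on_coord[OF open_UNIV, of i] UNIV_I], of j 0] by simp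
 qed
 have dR: "pd j (%z. R c z 0) y = (if j = i then 1 else 0)" for j
 proof -
  have "pd j (%z. R c z 0) y = pd j (%z. cor (z $ i)) y" by (rule pd_cong[OF S' RS])
  then show ?thesis using pd_of_real[OF smooth_on_differentiable[OF smooth_on_coord[OF open_UNIV, of i] UNIV_I], of j y] by simp
 qed
 have "R c y = (%_. cor (y $ i))" by (rule ext) (rule RS[OF S'(2)])
 then have dR0: "pd j (R c y) 0 = 0" for j by simp
 have "gradprod (P c) (R c) y 0 = (\<Sum>j\<in>UNIV. if j = i then 1 else 0)"
  unfolding gradprod_def dP dR by (intro sum.cong refl) simp
 then have g1: "gradprod (P c) (R c) y 0 = 1" by simp
 have g2: "gradprod (R c) (P c) y 0 = 0" unfolding gradprod_def dR0 by simp
 have "star UNIV P R 1 c y 0 = \<i> * (1 - lam)"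
  using star_low_order(2)[OF P R c y, of 0] by (simp add: g1 g2)
 moreover have "\<forall>P\<in>SY UNIV. \<forall>R\<in>SY UNIV. \<forall>c\<in>\<A>. \<forall>y\<in>img c. \<forall>xi.
   star UNIV P R 0 c y xi = P c y xi * R c y xi \<and> star UNIV P R 1 c y xi = \<i> / 2 * poisson (P c) (R c) y xi"
  using star unfolding star_product_def by (elim conjE)
 from this[rule_format, OF symbolsI[OF P] symbolsI[OF R] c y, of 0]
 have "star UNIV P R 1 c y 0 = \<i> / 2 * poisson (P c) (R c) y 0" by (rule conjunct2)
 ultimately have "cor (1 - lam) = cor (1 / 2)"
  unfolding poisson_gradprod g1 g2 by simp
 then show ?thesis by (simp only: of_real_eq_iff)
qed

end

theorem theorem3p4:
  fixes p q :: nat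
    and g :: "real^'n^'n::finite"
    and \<A> :: "('m::{t2_space, second_countable_topology}, 'n) chart set"
    and G :: "('m, 'n) chart \<Rightarrow> real^'n \<Rightarrow> real^'n^'n"
    and lam :: real
    and Q :: "'m set \<Rightarrow> ('m, 'n) symbol \<Rightarrow> ('m, 'n) oper"
  assumes "conformally_flat_manifold p q g \<A> G"
    and "conformal_quantization g \<A> lam Q"
  shows "quantizes_product \<A> lam Q UNIV (quant_product \<A> lam Q UNIV) \<and>
         associative_product \<A> UNIV (quant_product \<A> lam Q UNIV) \<and>
         conformally_invariant g \<A> (quant_product \<A> lam Q) \<and>
         (star_product \<A> UNIV (quant_product \<A> lam Q UNIV) \<longleftrightarrow> lam = 1 / 2)"
proof -
  interpret quantization g \<A> p q lam Q
  proof unfold_locales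
    show "conformal_atlas g \<A>" and "flat_metric p q g" using assms(1) by (auto simp: conformally_flat_manifold_def)
    show "conformal_quantization g \<A> lam Q" by (rule assms(2))
  qed
  have "quantizes_product \<A> lam Q UNIV (quant_product \<A> lam Q UNIV)"
    unfolding quantizes_product_def
    by (intro ballI allI conjI ext star_mem[OF UNIV_AD] star_series[OF UNIV_AD])
  moreover have "associative_product \<A> UNIV (quant_product \<A> lam Q UNIV)"
    unfolding associative_product_def by (intro ballI allI star_assoc[OF UNIV_AD])
  ultimately show ?thesis
    using star_invariant star_product_half star_product_weight by blast
qed

end
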